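(* Let $\mathcal{C}$ be a braided locally finite abelian category and $A\in\mathcal{C}$ a commutative simple current algebra object with no fixed points which is simple as a left $A$-module. Then the induction functor $\mathcal{F}_A:\mathcal{C}\to\mathrm{Rep}A$ preserves Loewy diagrams (those associated to socle and radical filtrations).
   Context: Locally finite: abelian and $\Bbbk$-linear over a field $\Bbbk$, such that spaces of morphisms are finite dimensional and every object has finite length. Braided: a braided monoidal category with unit $\mathbf{1}$, braiding $c_{-,-}$, associativity isomorphism $a_{X,Y,Z}:X\otimes(Y\otimes Z)\to(X\otimes Y)\otimes Z$, and left unit isomorphism $\ell_X:\mathbf{1}\otimes X\to X$. Algebras and modules: an associative algebra in $\mathcal{C}$ is an object $A$ with maps $\mu:A\otimes A\to A$ and $\iota:\mathbf{1}\to A$ such that $\mu\circ(\mu\otimes\mathrm{Id}_A)\circ a_{A,A,A}=\mu\circ(\mathrm{Id}_A\otimes\mu)$ and $\mu\circ(\iota\otimes\mathrm{Id}_A)\circ\ell_A^{-1}=\mathrm{Id}_A$. It is commutative if $\mu\circ c_{A,A}=\mu$. The category $\mathrm{Rep}A$ has as objects pairs $(M,\mu_M)$ with $M\in\mathcal{C}$ and $\mu_M:A\otimes M\to M$ a morphism in $\mathcal{C}$ such that $\mu_M\circ(\mu\otimes\mathrm{Id}_M)\circ a_{A,A,M}=\mu_M\circ(\mathrm{Id}_A\otimes\mu_M)$ and $\mu_M\circ(\iota\otimes\mathrm{Id}_M)\circ\ell_M^{-1}=\mathrm{Id}_M$; morphisms $f:(M,\mu_M)\to(N,\mu_N)$ are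 $\mathcal{C}$-morphisms with $f\circ\mu_M=\mu_N\circ(\mathrm{Id}_A\otimes f)$. "Simple as a left $A$-module" means that $(A,\mu)$ is simple in $\mathrm{Rep}A$. The induction functor is $\mathcal{F}_A(M)=(A\otimes M,(\mu\otimes\mathrm{Id}_M)\circ a_{A,A,M})$, $\mathcal{F}_A(f)=\mathrm{Id}_A\otimes f$. Simple current algebras: an object $U\in\mathcal{C}$ is invertible if it is rigid (dualizable) and the morphisms $\mathrm{ev}_U:U^*\otimes U\to\mathbf{1}$ and $\mathrm{coev}_U:\mathbf{1}\to U\otimes U^*$ are isomorphisms. A family of invertible objects $\{U_i\}_{i\in\mathcal{I}}$ is closed if it is closed under tensor products and inverses (duals): for all $i,j\in\mathcal{I}$, $U_i\otimes U_j\cong U_k$ for some $k\in\mathcal{I}$ and $U_i^*\cong U_s$ for some $s\in\mathcal{I}$. A commutative simple current algebra object is a commutative algebra object of the form $A=\bigoplus_{i\in\mathcal{I}}U_i$ with $\{U_i\}_{i\in\mathcal{I}}$ a closed family of invertible objects. A fixed point of an invertible object $U$ is a nonzero object $N\in\mathcal{C}$ such that $U\otimes N\cong N$. $A$ has no fixed points if no member of the family $\{U_i\}_{i\in\mathcal{I}}$ other than the monoidal unit has a fixed point. Loewy series: a series of an object $M$ is a strictly increasing finite family of subobjects ordered by inclusion, from $0$ to $M$; its length is the number of successive quotients. A Loewy series of $M$ is a series of minimal length amongst those series which have semisimple successive quotients; the Loewy length of $M$ is this minimal length. Socle and radical filtrations: the socle $\mathrm{Soc}(M)$ is the largest semisimple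 subobject of $M$; the radical $\mathrm{Rad}(M)$ is the intersection of all maximal subobjects of $M$. Two standard examples of Loewy series are the following. The radical series (filtration) $0=\mathrm{rad}_n(M)\subset\cdots\subset\mathrm{rad}_1(M)\subset\mathrm{rad}_0(M)=M$ is defined inductively by $\mathrm{rad}_0(M)=M$ and $\mathrm{rad}_k(M)=\mathrm{Rad}(\mathrm{rad}_{k-1}(M))$. The socle series (filtration) $0=\mathrm{soc}_0(M)\subset\mathrm{soc}_1(M)\subset\cdots\subset\mathrm{soc}_n(M)=M$ is defined inductively by $\mathrm{soc}_1(M)=\mathrm{Soc}(M)$ and letting $\mathrm{soc}_k(M)$ be the unique subobject of $M$ such that $\mathrm{Soc}(M/\mathrm{soc}_{k-1}(M))\cong\mathrm{soc}_k(M)/\mathrm{soc}_{k-1}(M)$. Preserving filtrations: a functor $\mathcal{F}:\mathcal{C}\to\mathcal{D}$ preserves socle filtrations if for every $X\in\mathcal{C}$ the Loewy lengths of $X$ and $\mathcal{F}(X)$ coincide and $\mathcal{F}(\mathrm{soc}_k(X))\cong\mathrm{soc}_k(\mathcal{F}(X))$ for $k=1,\dots,n$, with $n$ the Loewy length of $X$. It preserves radical filtrations if for every $X\in\mathcal{C}$ the Loewy lengths of $X$ and $\mathcal{F}(X)$ coincide and $\mathcal{F}(\mathrm{rad}_k(X))\cong\mathrm{rad}_k(\mathcal{F}(X))$ for $k=1,\dots,n$, with $n$ the Loewy length of $X$. Loewy diagram: given a fixed Loewy series $0=M_0\subset M_1\subset\cdots\subset M_n=M$ of $M$, the associated Loewy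 diagram consists of horizontal layers, where the $k$-th layer from the bottom consists of the simple factors in $M_k/M_{k-1}$, annotated with arrows from an irreducible factor $X_k$ in layer $k$ to an irreducible factor $X_{k-1}$ in layer $k-1$ if there exists a subquotient $Z$ of $M_k/M_{k-2}$ such that there exists a non-split short exact sequence $0\to X_{k-1}\to Z\to X_k\to 0$. Preserving Loewy diagrams: $\mathcal{F}$ preserves the Loewy diagrams associated to socle (respectively radical) filtrations if it preserves socle (respectively radical) filtrations and, for every $X\in\mathcal{C}$, whenever there exists an arrow from $X_k$ in layer $k$ to $X_{k-1}$ in layer $k-1$ in the corresponding Loewy diagram of $X$, there exists an arrow from $\mathcal{F}(X_k)$ in layer $k$ to $\mathcal{F}(X_{k-1})$ in layer $k-1$ of the corresponding Loewy diagram of $\mathcal{F}(X)$. *)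

theory Defs
  imports "Jordan_Normal_Form.Missing_VectorSpace"
begin

section \<open>Categories whose morphism sets are vector spaces\<close>

text \<open>\<open>Hom X Y\<close> is the space of morphisms as a HOL-Algebra module; its ring multiplication
  and ring unit are unused fields. Morphism sets of different pairs of objects are allowed to overlap,
  so that a morphism of modules over an algebra can be literally a morphism of the underlying
  category. All conditions only concern objects in the carrier \<open>Obj\<close>.\<close>

record ('o, 'm, 'k) lin_cat =
  Obj :: "'o set"
  Hom :: "'o \<Rightarrow> 'o \<Rightarrow> ('k, 'm) module"
  Comp :: "'m \<Rightarrow> 'm \<Rightarrow> 'm"  (infixr \<open>\<cdot>\<index>\<close> 75)
  Idm :: "'o \<Rightarrow> 'm"  (\<open>\<I>\<index> _\<close> [1000] 999)

abbreviation mor :: "('o, 'm, 'k, 'z) lin_cat_scheme \<Rightarrow> 'o \<Rightarrow> 'o \<Rightarrow> 'm set"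
  where "mor C X Y \<equiv> carrier (Hom C X Y)"

locale category =
  fixes C :: "('o, 'm, 'k, 'z) lin_cat_scheme" (structure)
  assumes id_closed: "X \<in> Obj C \<Longrightarrow> \<I> X \<in> mor C X X"
    and comp_closed: "\<lbrakk>X \<in> Obj C; Y \<in> Obj C; Z \<in> Obj C; f \<in> mor C X Y; g \<in> mor C Y Z\<rbrakk>
          \<Longrightarrow> g \<cdot> f \<in> mor C X Z"
    and comp_assoc: "\<lbrakk>W \<in> Obj C; X \<in> Obj C; Y \<in> Obj C; Z \<in> Obj C;
           f \<in> mor C W X; g \<in> mor C X Y; h \<in> mor C Y Z\<rbrakk> \<Longrightarrow> (h \<cdot> g) \<cdot> f = h \<cdot> (g \<cdot> f)"
    and id_left: "\<lbrakk>X \<in> Obj C; Y \<in> Obj C; f \<in> mor C X Y\<rbrakk> \<Longrightarrow> \<I> Y \<cdot> f = f"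
    and id_right: "\<lbrakk>X \<in> Obj C; Y \<in> Obj C; f \<in> mor C X Y\<rbrakk> \<Longrightarrow> f \<cdot> \<I> X = f"

locale linear_category = category C + K: field K
  for K :: "('k, 'x) ring_scheme" and C :: "('o, 'm, 'k, 'z) lin_cat_scheme" (structure) +
  assumes hom_space: "\<lbrakk>X \<in> Obj C; Y \<in> Obj C\<rbrakk> \<Longrightarrow> vectorspace K (Hom C X Y)"
    and comp_linear_right: "\<lbrakk>X \<in> Obj C; Y \<in> Obj C; Z \<in> Obj C; g \<in> mor C Y Z\<rbrakk>
          \<Longrightarrow> linear_map K (Hom C X Y) (Hom C X Z) (\<lambda>f. g \<cdot> f)"
    and comp_linear_left: "\<lbrakk>X \<in> Obj C; Y \<in> Obj C; Z \<in> Obj C; f \<in> mor C X Y\<rbrakk>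
          \<Longrightarrow> linear_map K (Hom C Y Z) (Hom C X Z) (\<lambda>g. g \<cdot> f)"

subsection \<open>Isomorphisms, monomorphisms, kernels, direct sums\<close>

definition is_iso :: "('o, 'm, 'k, 'z) lin_cat_scheme \<Rightarrow> 'o \<Rightarrow> 'o \<Rightarrow> 'm \<Rightarrow> bool"
  where "is_iso C X Y f \<longleftrightarrow> f \<in> mor C X Y \<and> (\<exists>g \<in> mor C Y X. g \<cdot> f = \<I> X \<and> f \<cdot> g = \<I> Y)"
  for C (structure)

definition inv_mor :: "('o, 'm, 'k, 'z) lin_cat_scheme \<Rightarrow> 'o \<Rightarrow> 'o \<Rightarrow> 'm \<Rightarrow> 'm"
  where "inv_mor C X Y f = (THE g. g \<in> mor C Y X \<and> g \<cdot> f = \<I> X \<and> f \<cdot> g = \<I> Y)"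
  for C (structure)

definition isomorphic :: "('o, 'm, 'k, 'z) lin_cat_scheme \<Rightarrow> 'o \<Rightarrow> 'o \<Rightarrow> bool"
  where "isomorphic C X Y \<longleftrightarrow> (\<exists>f. is_iso C X Y f)"

definition is_mono :: "('o, 'm, 'k, 'z) lin_cat_scheme \<Rightarrow> 'o \<Rightarrow> 'o \<Rightarrow> 'm \<Rightarrow> bool"
  where "is_mono C X Y f \<longleftrightarrow> f \<in> mor C X Y \<and>
    (\<forall>W \<in> Obj C. \<forall>g \<in> mor C W X. \<forall>h \<in> mor C W X. f \<cdot> g = f \<cdot> h \<longrightarrow> g = h)"
  for C (structure)

definition is_epi :: "('o, 'm, 'k, 'z) lin_cat_scheme \<Rightarrow> 'o \<Rightarrow> 'o \<Rightarrow> 'm \<Rightarrow> bool"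
  where "is_epi C X Y f \<longleftrightarrow> f \<in> mor C X Y \<and>
    (\<forall>W \<in> Obj C. \<forall>g \<in> mor C Y W. \<forall>h \<in> mor C Y W. g \<cdot> f = h \<cdot> f \<longrightarrow> g = h)"
  for C (structure)

definition is_zero_obj :: "('o, 'm, 'k, 'z) lin_cat_scheme \<Rightarrow> 'o \<Rightarrow> bool"
  where "is_zero_obj C Z \<longleftrightarrow> Z \<in> Obj C \<and>
    (\<forall>X \<in> Obj C. (\<exists>!f. f \<in> mor C Z X) \<and> (\<exists>!f. f \<in> mor C X Z))"

text \<open>\<open>is_kernel C X Y f K k\<close>: the morphism \<open>k : K \<rightarrow> X\<close> is a kernel of \<open>f : X \<rightarrow> Y\<close>.
  Dually for \<open>is_cokernel C X Y f Q q\<close> with \<open>q : Y \<rightarrow> Q\<close>.\<close>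

definition is_kernel ::
  "('o, 'm, 'k, 'z) lin_cat_scheme \<Rightarrow> 'o \<Rightarrow> 'o \<Rightarrow> 'm \<Rightarrow> 'o \<Rightarrow> 'm \<Rightarrow> bool"
  where "is_kernel C X Y f K k \<longleftrightarrow> f \<in> mor C X Y \<and> K \<in> Obj C \<and> k \<in> mor C K X \<and>
    f \<cdot> k = \<zero>\<^bsub>Hom C K Y\<^esub> \<and>
    (\<forall>W \<in> Obj C. \<forall>g \<in> mor C W X. f \<cdot> g = \<zero>\<^bsub>Hom C W Y\<^esub> \<longrightarrow>
       (\<exists>!u. u \<in> mor C W K \<and> k \<cdot> u = g))"
  for C (structure)

definition is_cokernel ::
  "('o, 'm, 'k, 'z) lin_cat_scheme \<Rightarrow> 'o \<Rightarrow> 'o \<Rightarrow> 'm \<Rightarrow> 'o \<Rightarrow> 'm \<Rightarrow> bool"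
  where "is_cokernel C X Y f Q q \<longleftrightarrow> f \<in> mor C X Y \<and> Q \<in> Obj C \<and> q \<in> mor C Y Q \<and>
    q \<cdot> f = \<zero>\<^bsub>Hom C X Q\<^esub> \<and>
    (\<forall>W \<in> Obj C. \<forall>g \<in> mor C Y W. g \<cdot> f = \<zero>\<^bsub>Hom C X W\<^esub> \<longrightarrow>
       (\<exists>!u. u \<in> mor C Q W \<and> u \<cdot> q = g))"
  for C (structure)

text \<open>A direct sum of an arbitrary (possibly infinite or empty) family is a coproduct. For finite
  families in a linear category this is a biproduct.\<close>

definition is_direct_sum ::
  "('o, 'm, 'k, 'z) lin_cat_scheme \<Rightarrow> 'i set \<Rightarrow> ('i \<Rightarrow> 'o) \<Rightarrow> 'o \<Rightarrow> ('i \<Rightarrow> 'm) \<Rightarrow> bool"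
  where "is_direct_sum C I U A e \<longleftrightarrow> (\<forall>i \<in> I. U i \<in> Obj C) \<and> A \<in> Obj C \<and>
    (\<forall>i \<in> I. e i \<in> mor C (U i) A) \<and>
    (\<forall>X \<in> Obj C. \<forall>f. (\<forall>i \<in> I. f i \<in> mor C (U i) X) \<longrightarrow>
       (\<exists>!h. h \<in> mor C A X \<and> (\<forall>i \<in> I. h \<cdot> e i = f i)))"
  for C (structure)

subsection \<open>Subobjects, quotients and series\<close>

text \<open>A subobject of \<open>M\<close> is represented by a pair \<open>(S, s)\<close> with \<open>s : S \<rightarrow> M\<close> a
  monomorphism. Two representatives describe the same subobject iff each is \<open>sub_le\<close> the
  other.\<close>

definition subobject :: "('o, 'm, 'k, 'z) lin_cat_scheme \<Rightarrow> 'o \<Rightarrow> 'o \<times> 'm \<Rightarrow> bool"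
  where "subobject C M s \<longleftrightarrow> fst s \<in> Obj C \<and> is_mono C (fst s) M (snd s)"

definition sub_le :: "('o, 'm, 'k, 'z) lin_cat_scheme \<Rightarrow> 'o \<times> 'm \<Rightarrow> 'o \<times> 'm \<Rightarrow> bool"
  where "sub_le C s t \<longleftrightarrow> (\<exists>h \<in> mor C (fst s) (fst t). snd t \<cdot> h = snd s)"
  for C (structure)

text \<open>\<open>sub_quotient C s t Q\<close>: for subobjects \<open>s \<le> t\<close> of the same object, \<open>Q\<close> is a
  quotient \<open>t / s\<close>.\<close>

definition sub_quotient ::
  "('o, 'm, 'k, 'z) lin_cat_scheme \<Rightarrow> 'o \<times> 'm \<Rightarrow> 'o \<times> 'm \<Rightarrow> 'o \<Rightarrow> bool"
  where "sub_quotient C s t Q \<longleftrightarrow>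
    (\<exists>h \<in> mor C (fst s) (fst t). snd t \<cdot> h = snd s \<and> (\<exists>q. is_cokernel C (fst s) (fst t) h Q q))"
  for C (structure)

definition is_subquotient_of :: "('o, 'm, 'k, 'z) lin_cat_scheme \<Rightarrow> 'o \<Rightarrow> 'o \<Rightarrow> bool"
  where "is_subquotient_of C Z P \<longleftrightarrow>
    (\<exists>s t. subobject C P s \<and> subobject C P t \<and> sub_quotient C s t Z)"

definition is_simple :: "('o, 'm, 'k, 'z) lin_cat_scheme \<Rightarrow> 'o \<Rightarrow> bool"
  where "is_simple C X \<longleftrightarrow> X \<in> Obj C \<and> \<not> is_zero_obj C X \<and>
    (\<forall>s. subobject C X s \<longrightarrow> is_zero_obj C (fst s) \<or> is_iso C (fst s) X (snd s))"

text \<open>Finite direct sums are enough here: semisimplicity is only used for objects of finite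
  length. The zero object is the empty direct sum.\<close>

definition is_semisimple :: "('o, 'm, 'k, 'z) lin_cat_scheme \<Rightarrow> 'o \<Rightarrow> bool"
  where "is_semisimple C X \<longleftrightarrow>
    (\<exists>(n :: nat) U e. (\<forall>i < n. is_simple C (U i)) \<and> is_direct_sum C {..<n} U X e)"

definition is_series ::
  "('o, 'm, 'k, 'z) lin_cat_scheme \<Rightarrow> 'o \<Rightarrow> nat \<Rightarrow> (nat \<Rightarrow> 'o \<times> 'm) \<Rightarrow> bool"
  where "is_series C M n \<sigma> \<longleftrightarrow> (\<forall>k \<le> n. subobject C M (\<sigma> k)) \<and>
    is_zero_obj C (fst (\<sigma> 0)) \<and> is_iso C (fst (\<sigma> n)) M (snd (\<sigma> n)) \<and>
    (\<forall>k < n. sub_le C (\<sigma> k) (\<sigma> (Suc k)) \<and> \<not> sub_le C (\<sigma> (Suc k)) (\<sigma> k))"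

definition has_finite_length :: "('o, 'm, 'k, 'z) lin_cat_scheme \<Rightarrow> 'o \<Rightarrow> bool"
  where "has_finite_length C M \<longleftrightarrow> (\<exists>n \<sigma>. is_series C M n \<sigma> \<and>
    (\<forall>k < n. \<exists>Q. sub_quotient C (\<sigma> k) (\<sigma> (Suc k)) Q \<and> is_simple C Q))"

subsection \<open>Locally finite abelian categories\<close>

locale abelian_category = linear_category K C
  for K :: "('k, 'x) ring_scheme" and C :: "('o, 'm, 'k, 'z) lin_cat_scheme" (structure) +
  assumes ex_zero_obj: "\<exists>Z. is_zero_obj C Z"
    and ex_direct_sum: "\<lbrakk>X \<in> Obj C; Y \<in> Obj C\<rbrakk>
          \<Longrightarrow> \<exists>S e. is_direct_sum C UNIV (\<lambda>b :: bool. if b then X else Y) S e"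
    and ex_kernel: "\<lbrakk>X \<in> Obj C; Y \<in> Obj C; f \<in> mor C X Y\<rbrakk> \<Longrightarrow> \<exists>N k. is_kernel C X Y f N k"
    and ex_cokernel: "\<lbrakk>X \<in> Obj C; Y \<in> Obj C; f \<in> mor C X Y\<rbrakk> \<Longrightarrow> \<exists>Q q. is_cokernel C X Y f Q q"
    and mono_is_kernel: "\<lbrakk>X \<in> Obj C; Y \<in> Obj C; is_mono C X Y f\<rbrakk>
          \<Longrightarrow> \<exists>Z g. Z \<in> Obj C \<and> is_kernel C Y Z g X f"
    and epi_is_cokernel: "\<lbrakk>X \<in> Obj C; Y \<in> Obj C; is_epi C X Y f\<rbrakk>
          \<Longrightarrow> \<exists>Z g. Z \<in> Obj C \<and> is_cokernel C Z X g Y f"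

locale locally_finite_category = abelian_category K C
  for K :: "('k, 'x) ring_scheme" and C :: "('o, 'm, 'k, 'z) lin_cat_scheme" (structure) +
  assumes hom_fin_dim: "\<lbrakk>X \<in> Obj C; Y \<in> Obj C\<rbrakk> \<Longrightarrow> vectorspace.fin_dim K (Hom C X Y)"
    and finite_length: "X \<in> Obj C \<Longrightarrow> has_finite_length C X"

section \<open>Braided monoidal categories\<close>

record ('o, 'm, 'k) br_cat = "('o, 'm, 'k) lin_cat" +
  Tob :: "'o \<Rightarrow> 'o \<Rightarrow> 'o"  (infixr \<open>\<boxtimes>\<index>\<close> 80)
  Tmor :: "'m \<Rightarrow> 'm \<Rightarrow> 'm"  (infixr \<open>\<boxdot>\<index>\<close> 80)
  Unit :: "'o"  (\<open>\<U>\<index>\<close>)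
  Assoc :: "'o \<Rightarrow> 'o \<Rightarrow> 'o \<Rightarrow> 'm"
  Lunit :: "'o \<Rightarrow> 'm"
  Runit :: "'o \<Rightarrow> 'm"
  Braid :: "'o \<Rightarrow> 'o \<Rightarrow> 'm"

text \<open>The associativity isomorphisms are oriented as \<open>X \<boxtimes> (Y \<boxtimes> Z) \<rightarrow> (X \<boxtimes> Y) \<boxtimes> Z\<close>.\<close>

locale monoidal_category = category C
  for C :: "('o, 'm, 'k, 'z) br_cat_scheme" (structure) +
  assumes unit_closed: "\<U> \<in> Obj C"
    and tensor_closed: "\<lbrakk>X \<in> Obj C; Y \<in> Obj C\<rbrakk> \<Longrightarrow> X \<boxtimes> Y \<in> Obj C"
    and tensor_mor_closed: "\<lbrakk>X \<in> Obj C; X' \<in> Obj C; Y \<in> Obj C; Y' \<in> Obj C;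
           f \<in> mor C X Y; f' \<in> mor C X' Y'\<rbrakk> \<Longrightarrow> f \<boxdot> f' \<in> mor C (X \<boxtimes> X') (Y \<boxtimes> Y')"
    and tensor_id: "\<lbrakk>X \<in> Obj C; Y \<in> Obj C\<rbrakk> \<Longrightarrow> \<I> X \<boxdot> \<I> Y = \<I> (X \<boxtimes> Y)"
    and tensor_comp: "\<lbrakk>X \<in> Obj C; Y \<in> Obj C; Z \<in> Obj C; X' \<in> Obj C; Y' \<in> Obj C; Z' \<in> Obj C;
           f \<in> mor C X Y; g \<in> mor C Y Z; f' \<in> mor C X' Y'; g' \<in> mor C Y' Z'\<rbrakk>
          \<Longrightarrow> (g \<cdot> f) \<boxdot> (g' \<cdot> f') = (g \<boxdot> g') \<cdot> (f \<boxdot> f')"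
    and assoc_iso: "\<lbrakk>X \<in> Obj C; Y \<in> Obj C; Z \<in> Obj C\<rbrakk>
          \<Longrightarrow> is_iso C (X \<boxtimes> (Y \<boxtimes> Z)) ((X \<boxtimes> Y) \<boxtimes> Z) (Assoc C X Y Z)"
    and assoc_natural: "\<lbrakk>X \<in> Obj C; Y \<in> Obj C; Z \<in> Obj C; X' \<in> Obj C; Y' \<in> Obj C; Z' \<in> Obj C;
           f \<in> mor C X X'; g \<in> mor C Y Y'; h \<in> mor C Z Z'\<rbrakk>
          \<Longrightarrow> Assoc C X' Y' Z' \<cdot> (f \<boxdot> (g \<boxdot> h)) = ((f \<boxdot> g) \<boxdot> h) \<cdot> Assoc C X Y Z"
    and lunit_iso: "X \<in> Obj C \<Longrightarrow> is_iso C (\<U> \<boxtimes> X) X (Lunit C X)"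
    and lunit_natural: "\<lbrakk>X \<in> Obj C; Y \<in> Obj C; f \<in> mor C X Y\<rbrakk>
          \<Longrightarrow> Lunit C Y \<cdot> (\<I> \<U> \<boxdot> f) = f \<cdot> Lunit C X"
    and runit_iso: "X \<in> Obj C \<Longrightarrow> is_iso C (X \<boxtimes> \<U>) X (Runit C X)"
    and runit_natural: "\<lbrakk>X \<in> Obj C; Y \<in> Obj C; f \<in> mor C X Y\<rbrakk>
          \<Longrightarrow> Runit C Y \<cdot> (f \<boxdot> \<I> \<U>) = f \<cdot> Runit C X"
    and pentagon: "\<lbrakk>W \<in> Obj C; X \<in> Obj C; Y \<in> Obj C; Z \<in> Obj C\<rbrakk>
          \<Longrightarrow> Assoc C (W \<boxtimes> X) Y Z \<cdot> Assoc C W X (Y \<boxtimes> Z) =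
              (Assoc C W X Y \<boxdot> \<I> Z) \<cdot> Assoc C W (X \<boxtimes> Y) Z \<cdot> (\<I> W \<boxdot> Assoc C X Y Z)"
    and triangle: "\<lbrakk>X \<in> Obj C; Y \<in> Obj C\<rbrakk>
          \<Longrightarrow> (Runit C X \<boxdot> \<I> Y) \<cdot> Assoc C X \<U> Y = \<I> X \<boxdot> Lunit C Y"

locale braided_category = monoidal_category C
  for C :: "('o, 'm, 'k, 'z) br_cat_scheme" (structure) +
  assumes braid_iso: "\<lbrakk>X \<in> Obj C; Y \<in> Obj C\<rbrakk> \<Longrightarrow> is_iso C (X \<boxtimes> Y) (Y \<boxtimes> X) (Braid C X Y)"
    and braid_natural: "\<lbrakk>X \<in> Obj C; Y \<in> Obj C; X' \<in> Obj C; Y' \<in> Obj C;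
           f \<in> mor C X X'; g \<in> mor C Y Y'\<rbrakk>
          \<Longrightarrow> Braid C X' Y' \<cdot> (f \<boxdot> g) = (g \<boxdot> f) \<cdot> Braid C X Y"
    and hexagon_left: "\<lbrakk>X \<in> Obj C; Y \<in> Obj C; Z \<in> Obj C\<rbrakk>
          \<Longrightarrow> Assoc C Z X Y \<cdot> Braid C (X \<boxtimes> Y) Z \<cdot> Assoc C X Y Z =
              (Braid C X Z \<boxdot> \<I> Y) \<cdot> Assoc C X Z Y \<cdot> (\<I> X \<boxdot> Braid C Y Z)"
    and hexagon_right: "\<lbrakk>X \<in> Obj C; Y \<in> Obj C; Z \<in> Obj C\<rbrakk>
          \<Longrightarrow> inv_mor C (Y \<boxtimes> (Z \<boxtimes> X)) ((Y \<boxtimes> Z) \<boxtimes> X) (Assoc C Y Z X) \<cdot> Braid C X (Y \<boxtimes> Z) \<cdot>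
                inv_mor C (X \<boxtimes> (Y \<boxtimes> Z)) ((X \<boxtimes> Y) \<boxtimes> Z) (Assoc C X Y Z) =
              (\<I> Y \<boxdot> Braid C X Z) \<cdot>
                inv_mor C (Y \<boxtimes> (X \<boxtimes> Z)) ((Y \<boxtimes> X) \<boxtimes> Z) (Assoc C Y X Z) \<cdot>
                (Braid C X Y \<boxdot> \<I> Z)"

text \<open>As usual for a monoidal structure on a linear category, the tensor product of morphisms is
  bilinear. It is not assumed to be exact, and the unit object is not assumed to be simple.\<close>

locale braided_locally_finite_category = locally_finite_category K C + braided_category C
  for K :: "('k, 'x) ring_scheme" and C :: "('o, 'm, 'k, 'z) br_cat_scheme" (structure) +
  assumes tensor_linear_right: "\<lbrakk>X \<in> Obj C; Y \<in> Obj C; X' \<in> Obj C; Y' \<in> Obj C; f \<in> mor C X Y\<rbrakk>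
          \<Longrightarrow> linear_map K (Hom C X' Y') (Hom C (X \<boxtimes> X') (Y \<boxtimes> Y')) (\<lambda>g. f \<boxdot> g)"
    and tensor_linear_left: "\<lbrakk>X \<in> Obj C; Y \<in> Obj C; X' \<in> Obj C; Y' \<in> Obj C; g \<in> mor C X' Y'\<rbrakk>
          \<Longrightarrow> linear_map K (Hom C X Y) (Hom C (X \<boxtimes> X') (Y \<boxtimes> Y')) (\<lambda>f. f \<boxdot> g)"

section \<open>Commutative algebras and their modules\<close>

definition is_algebra :: "('o, 'm, 'k, 'z) br_cat_scheme \<Rightarrow> 'o \<Rightarrow> 'm \<Rightarrow> 'm \<Rightarrow> bool"
  where "is_algebra C A \<mu> \<iota> \<longleftrightarrow> A \<in> Obj C \<and> \<mu> \<in> mor C (A \<boxtimes> A) A \<and> \<iota> \<in> mor C \<U> A \<and>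
    \<mu> \<cdot> (\<mu> \<boxdot> \<I> A) \<cdot> Assoc C A A A = \<mu> \<cdot> (\<I> A \<boxdot> \<mu>) \<and>
    \<mu> \<cdot> (\<iota> \<boxdot> \<I> A) \<cdot> inv_mor C (\<U> \<boxtimes> A) A (Lunit C A) = \<I> A"
  for C (structure)

definition is_commutative_algebra :: "('o, 'm, 'k, 'z) br_cat_scheme \<Rightarrow> 'o \<Rightarrow> 'm \<Rightarrow> 'm \<Rightarrow> bool"
  where "is_commutative_algebra C A \<mu> \<iota> \<longleftrightarrow> is_algebra C A \<mu> \<iota> \<and> \<mu> \<cdot> Braid C A A = \<mu>"
  for C (structure)

definition Rep :: "('o, 'm, 'k, 'z) br_cat_scheme \<Rightarrow> 'o \<Rightarrow> 'm \<Rightarrow> 'm \<Rightarrow> ('o \<times> 'm, 'm, 'k) lin_cat"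
  where "Rep C A \<mu> \<iota> =
    \<lparr>Obj = {(M, \<nu>). M \<in> Obj C \<and> \<nu> \<in> mor C (A \<boxtimes> M) M \<and>
              \<nu> \<cdot> (\<mu> \<boxdot> \<I> M) \<cdot> Assoc C A A M = \<nu> \<cdot> (\<I> A \<boxdot> \<nu>) \<and>
              \<nu> \<cdot> (\<iota> \<boxdot> \<I> M) \<cdot> inv_mor C (\<U> \<boxtimes> M) M (Lunit C M) = \<I> M},
     Hom = (\<lambda>(M, \<nu>) (N, \<nu>'). (Hom C M N)
              \<lparr>carrier := {f \<in> mor C M N. f \<cdot> \<nu> = \<nu>' \<cdot> (\<I> A \<boxdot> f)}\<rparr>),
     Comp = Comp C,
     Idm = (\<lambda>(M, \<nu>). \<I> M)\<rparr>"
  for C (structure)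

record ('o, 'm, 'p, 'q) fnctr =
  omap :: "'o \<Rightarrow> 'p"
  mmap :: "'m \<Rightarrow> 'q"

definition induction_functor ::
  "('o, 'm, 'k, 'z) br_cat_scheme \<Rightarrow> 'o \<Rightarrow> 'm \<Rightarrow> ('o, 'm, 'o \<times> 'm, 'm) fnctr"
  where "induction_functor C A \<mu> =
    \<lparr>omap = (\<lambda>M. (A \<boxtimes> M, (\<mu> \<boxdot> \<I> M) \<cdot> Assoc C A A M)),
     mmap = (\<lambda>f. \<I> A \<boxdot> f)\<rparr>"
  for C (structure)

section \<open>Simple current algebras\<close>

definition is_left_dual :: "('o, 'm, 'k, 'z) br_cat_scheme \<Rightarrow> 'o \<Rightarrow> 'o \<Rightarrow> 'm \<Rightarrow> 'm \<Rightarrow> bool"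
  where "is_left_dual C U V ev coev \<longleftrightarrow> U \<in> Obj C \<and> V \<in> Obj C \<and>
    ev \<in> mor C (V \<boxtimes> U) \<U> \<and> coev \<in> mor C \<U> (U \<boxtimes> V) \<and>
    Runit C U \<cdot> (\<I> U \<boxdot> ev) \<cdot> inv_mor C (U \<boxtimes> (V \<boxtimes> U)) ((U \<boxtimes> V) \<boxtimes> U) (Assoc C U V U) \<cdot>
      (coev \<boxdot> \<I> U) \<cdot> inv_mor C (\<U> \<boxtimes> U) U (Lunit C U) = \<I> U \<and>
    Lunit C V \<cdot> (ev \<boxdot> \<I> V) \<cdot> Assoc C V U V \<cdot>
      (\<I> V \<boxdot> coev) \<cdot> inv_mor C (V \<boxtimes> \<U>) V (Runit C V) = \<I> V"
  for C (structure)

definition is_invertible :: "('o, 'm, 'k, 'z) br_cat_scheme \<Rightarrow> 'o \<Rightarrow> bool"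
  where "is_invertible C U \<longleftrightarrow> (\<exists>V ev coev. is_left_dual C U V ev coev \<and>
    is_iso C (V \<boxtimes> U) \<U> ev \<and> is_iso C \<U> (U \<boxtimes> V) coev)"
  for C (structure)

definition closed_family :: "('o, 'm, 'k, 'z) br_cat_scheme \<Rightarrow> 'i set \<Rightarrow> ('i \<Rightarrow> 'o) \<Rightarrow> bool"
  where "closed_family C I U \<longleftrightarrow>
    (\<forall>i \<in> I. \<forall>j \<in> I. \<exists>k \<in> I. isomorphic C (U i \<boxtimes> U j) (U k)) \<and>
    (\<forall>i \<in> I. \<exists>V ev coev. is_left_dual C (U i) V ev coev \<and> (\<exists>s \<in> I. isomorphic C V (U s)))"
  for C (structure)

definition is_simple_current_algebra ::
  "('o, 'm, 'k, 'z) br_cat_scheme \<Rightarrow> 'i set \<Rightarrow> ('i \<Rightarrow> 'o) \<Rightarrow> 'o \<Rightarrow> 'm \<Rightarrow> 'm \<Rightarrow> bool"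
  where "is_simple_current_algebra C I U A \<mu> \<iota> \<longleftrightarrow> is_commutative_algebra C A \<mu> \<iota> \<and>
    (\<forall>i \<in> I. is_invertible C (U i)) \<and> closed_family C I U \<and> (\<exists>e. is_direct_sum C I U A e)"

definition has_fixed_point :: "('o, 'm, 'k, 'z) br_cat_scheme \<Rightarrow> 'o \<Rightarrow> bool"
  where "has_fixed_point C U \<longleftrightarrow>
    (\<exists>N \<in> Obj C. \<not> is_zero_obj C N \<and> isomorphic C (U \<boxtimes> N) N)"
  for C (structure)

text \<open>One member \<open>i0\<close> of the family is the monoidal unit, and no member at any other index has a
  fixed point. In particular a repeated copy of the unit counts as a member with fixed points;
  this excludes, for instance, field extensions of the base field.\<close>

definition no_fixed_points :: "('o, 'm, 'k, 'z) br_cat_scheme \<Rightarrow> 'i set \<Rightarrow> ('i \<Rightarrow> 'o) \<Rightarrow> bool"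
  where "no_fixed_points C I U \<longleftrightarrow>
    (\<exists>i0 \<in> I. isomorphic C (U i0) \<U> \<and> (\<forall>i \<in> I - {i0}. \<not> has_fixed_point C (U i)))"
  for C (structure)

section \<open>Loewy series and Loewy diagrams\<close>

definition is_semisimple_series ::
  "('o, 'm, 'k, 'z) lin_cat_scheme \<Rightarrow> 'o \<Rightarrow> nat \<Rightarrow> (nat \<Rightarrow> 'o \<times> 'm) \<Rightarrow> bool"
  where "is_semisimple_series C M n \<sigma> \<longleftrightarrow> is_series C M n \<sigma> \<and>
    (\<forall>k < n. \<exists>Q. sub_quotient C (\<sigma> k) (\<sigma> (Suc k)) Q \<and> is_semisimple C Q)"

definition has_loewy_length :: "('o, 'm, 'k, 'z) lin_cat_scheme \<Rightarrow> 'o \<Rightarrow> nat \<Rightarrow> bool"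
  where "has_loewy_length C M n \<longleftrightarrow> (\<exists>\<sigma>. is_semisimple_series C M n \<sigma>) \<and>
    (\<forall>m \<sigma>. is_semisimple_series C M m \<sigma> \<longrightarrow> n \<le> m)"

definition is_socle :: "('o, 'm, 'k, 'z) lin_cat_scheme \<Rightarrow> 'o \<Rightarrow> 'o \<times> 'm \<Rightarrow> bool"
  where "is_socle C M s \<longleftrightarrow> subobject C M s \<and> is_semisimple C (fst s) \<and>
    (\<forall>t. subobject C M t \<and> is_semisimple C (fst t) \<longrightarrow> sub_le C t s)"

definition is_maximal_subobject :: "('o, 'm, 'k, 'z) lin_cat_scheme \<Rightarrow> 'o \<Rightarrow> 'o \<times> 'm \<Rightarrow> bool"
  where "is_maximal_subobject C M s \<longleftrightarrow> subobject C M s \<and> \<not> is_iso C (fst s) M (snd s) \<and>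
    (\<forall>t. subobject C M t \<and> sub_le C s t \<longrightarrow> sub_le C t s \<or> is_iso C (fst t) M (snd t))"

text \<open>The intersection of all maximal subobjects is their greatest lower bound among the
  subobjects of \<open>M\<close>.\<close>

definition is_radical :: "('o, 'm, 'k, 'z) lin_cat_scheme \<Rightarrow> 'o \<Rightarrow> 'o \<times> 'm \<Rightarrow> bool"
  where "is_radical C M r \<longleftrightarrow> subobject C M r \<and>
    (\<forall>s. is_maximal_subobject C M s \<longrightarrow> sub_le C r s) \<and>
    (\<forall>t. subobject C M t \<and> (\<forall>s. is_maximal_subobject C M s \<longrightarrow> sub_le C t s) \<longrightarrow> sub_le C t r)"

text \<open>The filtrations are indexed by all natural numbers; they become stationary at \<open>M\<close>,
  respectively at \<open>0\<close>, from the Loewy length on.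

  In the socle filtration, \<open>j\<close> is the canonical morphism
  \<open>soc\<^sub>k\<^sub>+\<^sub>1(M) / soc\<^sub>k(M) \<rightarrow> M / soc\<^sub>k(M)\<close>, and the condition says that it is the socle of
  \<open>M / soc\<^sub>k(M)\<close> as a subobject; an abstract isomorphism of objects would not determine
  \<open>soc\<^sub>k\<^sub>+\<^sub>1(M)\<close>.\<close>

definition is_socle_filtration ::
  "('o, 'm, 'k, 'z) lin_cat_scheme \<Rightarrow> 'o \<Rightarrow> (nat \<Rightarrow> 'o \<times> 'm) \<Rightarrow> bool"
  where "is_socle_filtration C M \<sigma> \<longleftrightarrow> (\<forall>k. subobject C M (\<sigma> k)) \<and> is_zero_obj C (fst (\<sigma> 0)) \<and>
    (\<forall>k. \<exists>Q q h L p j.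
       is_cokernel C (fst (\<sigma> k)) M (snd (\<sigma> k)) Q q \<and>
       h \<in> mor C (fst (\<sigma> k)) (fst (\<sigma> (Suc k))) \<and> snd (\<sigma> (Suc k)) \<cdot> h = snd (\<sigma> k) \<and>
       is_cokernel C (fst (\<sigma> k)) (fst (\<sigma> (Suc k))) h L p \<and>
       j \<in> mor C L Q \<and> j \<cdot> p = q \<cdot> snd (\<sigma> (Suc k)) \<and>
       is_socle C Q (L, j))"
  for C (structure)

definition is_radical_filtration ::
  "('o, 'm, 'k, 'z) lin_cat_scheme \<Rightarrow> 'o \<Rightarrow> (nat \<Rightarrow> 'o \<times> 'm) \<Rightarrow> bool"
  where "is_radical_filtration C M \<rho> \<longleftrightarrow> (\<forall>k. subobject C M (\<rho> k)) \<and>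
    is_iso C (fst (\<rho> 0)) M (snd (\<rho> 0)) \<and>
    (\<forall>k. \<exists>r. is_radical C (fst (\<rho> k)) (fst (\<rho> (Suc k)), r) \<and> snd (\<rho> (Suc k)) = snd (\<rho> k) \<cdot> r)"
  for C (structure)

definition is_short_exact ::
  "('o, 'm, 'k, 'z) lin_cat_scheme \<Rightarrow> 'o \<Rightarrow> 'o \<Rightarrow> 'o \<Rightarrow> 'm \<Rightarrow> 'm \<Rightarrow> bool"
  where "is_short_exact C S Z T f g \<longleftrightarrow> is_kernel C Z T g S f \<and> is_cokernel C S Z f T g"

definition is_split :: "('o, 'm, 'k, 'z) lin_cat_scheme \<Rightarrow> 'o \<Rightarrow> 'o \<Rightarrow> 'm \<Rightarrow> bool"
  where "is_split C Z T g \<longleftrightarrow> (\<exists>h \<in> mor C T Z. g \<cdot> h = \<I> T)"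
  for C (structure)

text \<open>For \<open>k \<ge> 1\<close>: \<open>T\<close> is (isomorphic to) a simple factor of \<open>M\<^sub>k / M\<^sub>k\<^sub>-\<^sub>1\<close>.\<close>

definition in_layer ::
  "('o, 'm, 'k, 'z) lin_cat_scheme \<Rightarrow> (nat \<Rightarrow> 'o \<times> 'm) \<Rightarrow> nat \<Rightarrow> 'o \<Rightarrow> bool"
  where "in_layer C \<sigma> k T \<longleftrightarrow> is_simple C T \<and>
    (\<exists>Q. sub_quotient C (\<sigma> (k - 1)) (\<sigma> k) Q \<and> is_subquotient_of C T Q)"

text \<open>For \<open>k \<ge> 2\<close>: an arrow from \<open>T\<close> in layer \<open>k\<close> to \<open>S\<close> in layer \<open>k - 1\<close>.\<close>

definition loewy_arrow ::
  "('o, 'm, 'k, 'z) lin_cat_scheme \<Rightarrow> (nat \<Rightarrow> 'o \<times> 'm) \<Rightarrow> nat \<Rightarrow> 'o \<Rightarrow> 'o \<Rightarrow> bool"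
  where "loewy_arrow C \<sigma> k T S \<longleftrightarrow> in_layer C \<sigma> k T \<and> in_layer C \<sigma> (k - 1) S \<and>
    (\<exists>P Z f g. sub_quotient C (\<sigma> (k - 2)) (\<sigma> k) P \<and> is_subquotient_of C Z P \<and>
       is_short_exact C S Z T f g \<and> \<not> is_split C Z T g)"

section \<open>Functors preserving Loewy diagrams\<close>

locale is_functor = C: category C + D: category D
  for C :: "('o, 'm, 'k, 'z) lin_cat_scheme" and D :: "('p, 'q, 'l, 'y) lin_cat_scheme"
    and F :: "('o, 'm, 'p, 'q) fnctr" +
  assumes omap_closed: "X \<in> Obj C \<Longrightarrow> omap F X \<in> Obj D"
    and mmap_closed: "\<lbrakk>X \<in> Obj C; Y \<in> Obj C; f \<in> mor C X Y\<rbrakk>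
          \<Longrightarrow> mmap F f \<in> mor D (omap F X) (omap F Y)"
    and mmap_id: "X \<in> Obj C \<Longrightarrow> mmap F (\<I>\<^bsub>C\<^esub> X) = \<I>\<^bsub>D\<^esub> (omap F X)"
    and mmap_comp: "\<lbrakk>X \<in> Obj C; Y \<in> Obj C; Z \<in> Obj C; f \<in> mor C X Y; g \<in> mor C Y Z\<rbrakk>
          \<Longrightarrow> mmap F (g \<cdot>\<^bsub>C\<^esub> f) = mmap F g \<cdot>\<^bsub>D\<^esub> mmap F f"

text \<open>Socle and radical filtrations are unique up to isomorphism of subobjects; the definitions
  below ask that they exist and quantify over all representatives.\<close>

definition preserves_socle_filtrations ::
  "('o, 'm, 'k, 'z) lin_cat_scheme \<Rightarrow> ('p, 'q, 'l, 'y) lin_cat_scheme \<Rightarrow>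
   ('o, 'm, 'p, 'q) fnctr \<Rightarrow> bool"
  where "preserves_socle_filtrations C D F \<longleftrightarrow> is_functor C D F \<and>
    (\<forall>X \<in> Obj C. \<exists>n. has_loewy_length C X n \<and> has_loewy_length D (omap F X) n \<and>
       (\<exists>\<sigma>. is_socle_filtration C X \<sigma>) \<and> (\<exists>\<tau>. is_socle_filtration D (omap F X) \<tau>) \<and>
       (\<forall>\<sigma> \<tau>. is_socle_filtration C X \<sigma> \<and> is_socle_filtration D (omap F X) \<tau> \<longrightarrow>
          (\<forall>k \<in> {1..n}. isomorphic D (omap F (fst (\<sigma> k))) (fst (\<tau> k)))))"

definition preserves_radical_filtrations ::
  "('o, 'm, 'k, 'z) lin_cat_scheme \<Rightarrow> ('p, 'q, 'l, 'y) lin_cat_scheme \<Rightarrow>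
   ('o, 'm, 'p, 'q) fnctr \<Rightarrow> bool"
  where "preserves_radical_filtrations C D F \<longleftrightarrow> is_functor C D F \<and>
    (\<forall>X \<in> Obj C. \<exists>n. has_loewy_length C X n \<and> has_loewy_length D (omap F X) n \<and>
       (\<exists>\<rho>. is_radical_filtration C X \<rho>) \<and> (\<exists>\<tau>. is_radical_filtration D (omap F X) \<tau>) \<and>
       (\<forall>\<rho> \<tau>. is_radical_filtration C X \<rho> \<and> is_radical_filtration D (omap F X) \<tau> \<longrightarrow>
          (\<forall>k \<in> {1..n}. isomorphic D (omap F (fst (\<rho> k))) (fst (\<tau> k)))))"

definition preserves_socle_loewy_diagrams ::
  "('o, 'm, 'k, 'z) lin_cat_scheme \<Rightarrow> ('p, 'q, 'l, 'y) lin_cat_scheme \<Rightarrow>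
   ('o, 'm, 'p, 'q) fnctr \<Rightarrow> bool"
  where "preserves_socle_loewy_diagrams C D F \<longleftrightarrow> preserves_socle_filtrations C D F \<and>
    (\<forall>X \<in> Obj C. \<forall>n \<sigma> \<tau>. has_loewy_length C X n \<and>
       is_socle_filtration C X \<sigma> \<and> is_socle_filtration D (omap F X) \<tau> \<longrightarrow>
       (\<forall>k \<in> {2..n}. \<forall>T S. loewy_arrow C \<sigma> k T S \<longrightarrow> loewy_arrow D \<tau> k (omap F T) (omap F S)))"

text \<open>The Loewy series of the radical filtration is \<open>M\<^sub>k = rad\<^sub>n\<^sub>-\<^sub>k(M)\<close> for \<open>0 \<le> k \<le> n\<close>.\<close>

definition preserves_radical_loewy_diagrams ::
  "('o, 'm, 'k, 'z) lin_cat_scheme \<Rightarrow> ('p, 'q, 'l, 'y) lin_cat_scheme \<Rightarrow>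
   ('o, 'm, 'p, 'q) fnctr \<Rightarrow> bool"
  where "preserves_radical_loewy_diagrams C D F \<longleftrightarrow> preserves_radical_filtrations C D F \<and>
    (\<forall>X \<in> Obj C. \<forall>n \<rho> \<tau>. has_loewy_length C X n \<and>
       is_radical_filtration C X \<rho> \<and> is_radical_filtration D (omap F X) \<tau> \<longrightarrow>
       (\<forall>k \<in> {2..n}. \<forall>T S. loewy_arrow C (\<lambda>i. \<rho> (n - i)) k T S \<longrightarrow>
          loewy_arrow D (\<lambda>i. \<tau> (n - i)) k (omap F T) (omap F S)))"

end

theory Submission
  imports Defs
begin

text \<open>The family \<open>(U\<^sub>i)\<close> is finite because \<open>A\<close> has finite length, so \<open>A \<otimes> -\<close> is a finite direct sum of
  autoequivalences of \<open>C\<close>. It is therefore exact, and \<open>Rep A\<close> inherits kernels and cokernels from \<open>C\<close>.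
  Frobenius reciprocity is \<open>Hom(F(T), N) = Hom(T, N)\<close>. Let \<open>S\<close> be simple in \<open>C\<close>. A nonzero submodule of
  \<open>F(S)\<close> contains some \<open>U\<^sub>i \<otimes> S\<close>, and \<open>F(U\<^sub>i \<otimes> S)\<close> is isomorphic to \<open>F(S)\<close> because \<open>F(U\<^sub>i) \<rightarrow> A\<close> is an
  isomorphism by simplicity of \<open>A\<close>. So there is a nonzero endomorphism of \<open>F(S)\<close> with image in the
  submodule. It is invertible, since without fixed points \<open>U\<^sub>j \<otimes> S\<close> is isomorphic to \<open>S\<close> only for the unit.
  Hence \<open>F(S)\<close> is simple. Conversely a simple module \<open>N\<close> contains a simple \<open>T\<close> in \<open>C\<close>, and \<open>F(T) \<rightarrow> N\<close> is an isomorphism.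

  A module homomorphism \<open>F(T) \<rightarrow> F(X)\<close> with \<open>T\<close> simple amounts to arrows \<open>T \<rightarrow> U\<^sub>i \<otimes> X\<close>. These land in the
  socle of \<open>U\<^sub>i \<otimes> X\<close>, which is \<open>U\<^sub>i\<close> tensored with the socle of \<open>X\<close>, so \<open>F\<close> sends socles to socles. The
  same argument for \<open>F(X) \<rightarrow> F(T)\<close> treats radicals, and exactness of \<open>F\<close> carries over the whole
  filtrations. Finally, arrows of the diagrams persist because \<open>F\<close> reflects splittings: the unit is a
  direct summand of \<open>A\<close>.\<close>

section \<open>Arrows with domain and codomain\<close>

text \<open>Exactness of the tensor product is not a hypothesis, and neither finite length nor
  general direct sums are established for modules. The target category is therefore treated only as
  one with kernels, cokernels and normal monomorphisms and epimorphisms; filtrations of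
  \<open>F X\<close> and its Loewy length are obtained by transporting those of \<open>X\<close>.
  Both Loewy lengths are read off the socle filtration, since any series with semisimple quotients
  lies below it stage by stage; this serves the radical statement too.

  The radical is an intersection over all maximal subobjects, which an exact functor need not
  respect. Finite length rewrites it as a finite intersection, built from kernels one at a time, and
  such a construction passes through the functor.

  Finite length is used through a bounded rank on subobjects: comparable subobjects of equal rank
  coincide. It supplies both chain conditions, and through them the finiteness of the family.
  Finiteness in turn lets zero tests on \<open>A \<boxtimes> X\<close> be made summand by summand,
  by additivity in the first tensor factor.\<close>

text \<open>Since morphism sets may overlap, associativity of \<open>Comp\<close> needs typing hypotheses. An arrow
  carries its domain and codomain and \<open>None\<close> is the composite of non-composable arrows, which makes
  associativity unconditional.\<close>

type_synonym ('o, 'm) arrow = "('o \<times> 'm \<times> 'o) option"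

context category
begin

definition ar :: "'o \<Rightarrow> 'm \<Rightarrow> 'o \<Rightarrow> ('o, 'm) arrow"
  where "ar X f Y = (if X \<in> Obj C \<and> Y \<in> Obj C \<and> f \<in> mor C X Y then Some (X, f, Y) else None)"

definition hom :: "('o, 'm) arrow \<Rightarrow> 'o \<Rightarrow> 'o \<Rightarrow> bool"
  where "hom a X Y \<longleftrightarrow> (\<exists>f. a = Some (X, f, Y) \<and> X \<in> Obj C \<and> Y \<in> Obj C \<and> f \<in> mor C X Y)"

text \<open>Ill-typed triples still inhabit the option type. \<open>ar\<close> never produces them
  and \<open>hom\<close> rejects them, which is why composability is tested with \<open>hom\<close>
  and not by comparing the middle objects alone.\<close>

definition cmp :: "('o, 'm) arrow \<Rightarrow> ('o, 'm) arrow \<Rightarrow> ('o, 'm) arrow"  (infixr \<open>\<bullet>\<close> 75)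
  where "cmp b a = (if \<exists>X Y Z. hom a X Y \<and> hom b Y Z
    then Some (fst (the a), fst (snd (the b)) \<cdot> fst (snd (the a)), snd (snd (the b))) else None)"

definition ide :: "'o \<Rightarrow> ('o, 'm) arrow"
  where "ide X = ar X (\<I> X) X"

lemma hom_objs: "hom a X Y \<Longrightarrow> X \<in> Obj C" "hom a X Y \<Longrightarrow> Y \<in> Obj C"
  by (auto simp: hom_def)

lemma hom_unique: "hom a X Y \<Longrightarrow> hom a X' Y' \<Longrightarrow> X' = X \<and> Y' = Y"
  by (auto simp: hom_def)

lemma hom_ar: "hom (ar X f Y) X Y \<longleftrightarrow> X \<in> Obj C \<and> Y \<in> Obj C \<and> f \<in> mor C X Y"
  by (auto simp: hom_def ar_def)

lemma hom_arE:
  assumes "hom a X Y" obtains f where "f \<in> mor C X Y" "a = ar X f Y"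
  using assms by (auto simp: hom_def ar_def)

lemma ar_inject: "hom (ar X f Y) X Y \<Longrightarrow> ar X f Y = ar X g Y \<longleftrightarrow> f = g"
  by (auto simp: hom_def ar_def)

lemma cmp_ar: "hom (ar X f Y) X Y \<Longrightarrow> hom (ar Y g Z) Y Z \<Longrightarrow> ar Y g Z \<bullet> ar X f Y = ar X (g \<cdot> f) Z"
proof -
  assume h: "hom (ar X f Y) X Y" "hom (ar Y g Z) Y Z"
  then have e: "ar X f Y = Some (X, f, Y)" "ar Y g Z = Some (Y, g, Z)" by (auto simp: ar_def hom_def split: if_splits)
  have "ar X (g \<cdot> f) Z = Some (X, g \<cdot> f, Z)"
    using h comp_closed[of X Y Z f g] by (simp add: hom_ar) (simp add: ar_def)
  moreover have "\<exists>X' Y' Z'. hom (ar X f Y) X' Y' \<and> hom (ar Y g Z) Y' Z'" using h by blast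
  ultimately show ?thesis unfolding cmp_def using e by simp
qed

lemma hom_cmp [intro]:
  assumes "hom a X Y" "hom b Y Z" shows "hom (b \<bullet> a) X Z"
proof -
  obtain f g where "a = ar X f Y" "b = ar Y g Z" using assms hom_arE by metis
  then show ?thesis using assms comp_closed[of X Y Z f g] by (simp add: cmp_ar hom_ar)
qed

lemma hom_cmpE:
  assumes "hom (b \<bullet> a) X Z" obtains Y where "hom a X Y" "hom b Y Z"
proof -
  have "\<exists>X Y Z. hom a X Y \<and> hom b Y Z" using assms by (auto simp: hom_def cmp_def split: if_splits)
  then obtain X' Y Z' where h: "hom a X' Y" "hom b Y Z'" by blast
  then have "X' = X" "Z' = Z" using assms hom_unique hom_cmp by metis+
  then show ?thesis using that h by blast
qed

lemma cmp_None: "b \<bullet> a \<noteq> None \<Longrightarrow> \<exists>X Y Z. hom a X Y \<and> hom b Y Z"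
  by (auto simp: cmp_def split: if_splits)

lemma cmp_assoc: "(c \<bullet> b) \<bullet> a = c \<bullet> (b \<bullet> a)"
proof (cases "\<exists>W X Y Z. hom a W X \<and> hom b X Y \<and> hom c Y Z")
  case True
  then obtain W X Y Z f g h where 1: "hom a W X" "hom b X Y" "hom c Y Z"
    and 2: "a = ar W f X" "b = ar X g Y" "c = ar Y h Z" by (metis hom_arE)
  have 3: "W \<in> Obj C" "X \<in> Obj C" "Y \<in> Obj C" "Z \<in> Obj C" "f \<in> mor C W X" "g \<in> mor C X Y" "h \<in> mor C Y Z"
    using 1 2 hom_ar by auto
  then show ?thesis using 1 2 comp_assoc[OF 3] by (simp add: cmp_ar hom_ar comp_closed)
next
  case False
  have "(c \<bullet> b) \<bullet> a = None"
    using False cmp_None hom_cmpE by metis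
  moreover have "c \<bullet> (b \<bullet> a) = None"
    using False cmp_None hom_cmpE by metis
  ultimately show ?thesis by simp
qed

lemma cmp_rewrite: "b \<bullet> a = c \<Longrightarrow> b \<bullet> (a \<bullet> x) = c \<bullet> x"
  by (simp flip: cmp_assoc)

lemma cmp_rewrite2: "b \<bullet> a = d \<bullet> c \<Longrightarrow> b \<bullet> (a \<bullet> x) = d \<bullet> (c \<bullet> x)"
  by (simp flip: cmp_assoc)

lemma hom_ide [intro]: "X \<in> Obj C \<Longrightarrow> hom (ide X) X X"
  by (simp add: ide_def hom_ar id_closed)

lemma ide_left: "hom a X Y \<Longrightarrow> ide Y \<bullet> a = a"
  by (metis cmp_ar hom_arE hom_ide hom_objs(2) id_left hom_ar ide_def)

lemma ide_right: "hom a X Y \<Longrightarrow> a \<bullet> ide X = a"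
  by (metis cmp_ar hom_arE hom_ide hom_objs(1) id_right hom_ar ide_def)

text \<open>The guard is needed because two arrows that do not compose with \<open>f\<close> share
  the composite \<open>None\<close>. With it, cancellation can be stated without typing
  \<open>g\<close> and \<open>h\<close>.\<close>

definition monic :: "('o, 'm) arrow \<Rightarrow> bool"
  where "monic f \<longleftrightarrow> f \<noteq> None \<and> (\<forall>g h. f \<bullet> g = f \<bullet> h \<longrightarrow> f \<bullet> g \<noteq> None \<longrightarrow> g = h)"

definition epic :: "('o, 'm) arrow \<Rightarrow> bool"
  where "epic f \<longleftrightarrow> f \<noteq> None \<and> (\<forall>g h. g \<bullet> f = h \<bullet> f \<longrightarrow> g \<bullet> f \<noteq> None \<longrightarrow> g = h)"

definition inverse_arrows :: "('o, 'm) arrow \<Rightarrow> ('o, 'm) arrow \<Rightarrow> 'o \<Rightarrow> 'o \<Rightarrow> bool"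
  where "inverse_arrows a b X Y \<longleftrightarrow> hom a X Y \<and> hom b Y X \<and> b \<bullet> a = ide X \<and> a \<bullet> b = ide Y"

definition isom :: "('o, 'm) arrow \<Rightarrow> 'o \<Rightarrow> 'o \<Rightarrow> bool"
  where "isom a X Y \<longleftrightarrow> (\<exists>b. inverse_arrows a b X Y)"

lemma hom_not_None: "hom a X Y \<Longrightarrow> a \<noteq> None" by (auto simp: hom_def)

lemma monicD: "monic f \<Longrightarrow> hom f X Y \<Longrightarrow> hom g W X \<Longrightarrow> f \<bullet> g = f \<bullet> h \<Longrightarrow> g = h"
  unfolding monic_def using hom_not_None hom_cmp by blast

lemma epicD: "epic f \<Longrightarrow> hom f X Y \<Longrightarrow> hom g Y W \<Longrightarrow> g \<bullet> f = h \<bullet> f \<Longrightarrow> g = h"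
  unfolding epic_def using hom_not_None hom_cmp by blast

lemma monicI_hom:
  assumes "hom f X Y" "\<And>W g h. hom g W X \<Longrightarrow> hom h W X \<Longrightarrow> f \<bullet> g = f \<bullet> h \<Longrightarrow> g = h"
  shows "monic f"
proof -
  have "g = h" if e: "f \<bullet> g = f \<bullet> h" "f \<bullet> g \<noteq> None" for g h
  proof -
    obtain W X' Y' where "hom g W X'" "hom f X' Y'" using cmp_None[OF e(2)] by blast
    then have g: "hom g W X" using assms(1) hom_unique by metis
    then have "hom (f \<bullet> h) W Y" using e hom_cmp assms(1) by metis
    then have "hom h W X" using hom_cmpE hom_unique assms(1) by metis
    then show ?thesis using assms(2) g e by blast
  qed
  then show ?thesis using assms(1) hom_not_None unfolding monic_def by blast
qed

lemma epicI_hom: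
  assumes "hom f X Y" "\<And>W g h. hom g Y W \<Longrightarrow> hom h Y W \<Longrightarrow> g \<bullet> f = h \<bullet> f \<Longrightarrow> g = h"
  shows "epic f"
proof -
  have "g = h" if e: "g \<bullet> f = h \<bullet> f" "g \<bullet> f \<noteq> None" for g h
  proof -
    obtain W X' Y' where "hom g Y' W" "hom f X' Y'" using cmp_None[OF e(2)] by blast
    then have g: "hom g Y W" using assms(1) hom_unique by metis
    then have "hom (h \<bullet> f) X W" using e hom_cmp assms(1) by metis
    then have "hom h Y W" using hom_cmpE hom_unique assms(1) by metis
    then show ?thesis using assms(2) g e by blast
  qed
  then show ?thesis using assms(1) hom_not_None unfolding epic_def by blast
qed

lemma monic_cmp: "monic f \<Longrightarrow> monic g \<Longrightarrow> g \<bullet> f \<noteq> None \<Longrightarrow> monic (g \<bullet> f)"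
  unfolding monic_def by (metis cmp_assoc cmp_None hom_cmpE hom_not_None)

lemma epic_cmp: "epic f \<Longrightarrow> epic g \<Longrightarrow> g \<bullet> f \<noteq> None \<Longrightarrow> epic (g \<bullet> f)"
  unfolding epic_def by (metis cmp_assoc cmp_None hom_cmpE hom_not_None)

lemma monic_cancel: "monic (g \<bullet> f) \<Longrightarrow> monic f"
proof -
  assume m: "monic (g \<bullet> f)"
  then obtain X Y Z where h: "hom f X Y" "hom g Y Z" using cmp_None unfolding monic_def by blast
  show ?thesis
  proof (rule monicI_hom[OF h(1)])
    fix W u v assume "hom u W X" "hom v W X" "f \<bullet> u = f \<bullet> v"
    then show "u = v" using monicD[OF m hom_cmp[OF h], of u W v] by (simp add: cmp_assoc)
  qed
qed

lemma epic_cancel: "epic (g \<bullet> f) \<Longrightarrow> epic g"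
proof -
  assume m: "epic (g \<bullet> f)"
  then obtain X Y Z where h: "hom f X Y" "hom g Y Z" using cmp_None unfolding epic_def by blast
  show ?thesis
  proof (rule epicI_hom[OF h(2)])
    fix W u v assume "hom u Z W" "hom v Z W" "u \<bullet> g = v \<bullet> g"
    then show "u = v" using epicD[OF m hom_cmp[OF h], of u W v] by (simp flip: cmp_assoc)
  qed
qed

lemma monic_ide: "X \<in> Obj C \<Longrightarrow> monic (ide X)"
  by (metis hom_ide ide_left monicI_hom)

lemma epic_ide: "X \<in> Obj C \<Longrightarrow> epic (ide X)"
  by (metis hom_ide ide_right epicI_hom)

lemma isom_hom: "isom a X Y \<Longrightarrow> hom a X Y"
  by (auto simp: isom_def inverse_arrows_def)

lemma isomI: "hom a X Y \<Longrightarrow> hom b Y X \<Longrightarrow> b \<bullet> a = ide X \<Longrightarrow> a \<bullet> b = ide Y \<Longrightarrow> isom a X Y"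
  by (auto simp: isom_def inverse_arrows_def)

lemma isomE:
  assumes "isom a X Y" obtains b where "isom b Y X" "hom b Y X" "b \<bullet> a = ide X" "a \<bullet> b = ide Y"
  using assms by (auto simp: isom_def inverse_arrows_def)

lemma isom_monic: "isom a X Y \<Longrightarrow> monic a"
  by (metis isomE monic_cancel monic_ide hom_objs isom_hom)

lemma isom_epic: "isom a X Y \<Longrightarrow> epic a"
  by (metis isomE epic_cancel epic_ide hom_objs isom_hom)

lemma isom_ide: "X \<in> Obj C \<Longrightarrow> isom (ide X) X X"
  by (metis hom_ide ide_left isomI)

lemma isom_cmp: "isom a X Y \<Longrightarrow> isom b Y Z \<Longrightarrow> isom (b \<bullet> a) X Z"
proof -
  assume "isom a X Y" "isom b Y Z"
  then obtain a' b' where h: "hom a X Y" "hom a' Y X" "a' \<bullet> a = ide X" "a \<bullet> a' = ide Y"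
    "hom b Y Z" "hom b' Z Y" "b' \<bullet> b = ide Y" "b \<bullet> b' = ide Z"
    by (auto simp: isom_def inverse_arrows_def)
  show ?thesis
  proof (rule isomI)
    show "hom (b \<bullet> a) X Z" "hom (a' \<bullet> b') Z X" using h by blast+
    show "(a' \<bullet> b') \<bullet> (b \<bullet> a) = ide X" "(b \<bullet> a) \<bullet> (a' \<bullet> b') = ide Z"
      using h by (simp_all add: cmp_assoc cmp_rewrite[OF h(7)] cmp_rewrite[OF h(4)] ide_left)
  qed
qed

lemma monic_section_isom:
  assumes "monic f" "hom f X Y" "f \<bullet> g = ide Y" shows "isom f X Y"
proof -
  have o: "X \<in> Obj C" "Y \<in> Obj C" using assms(2) hom_objs by auto
  have g: "hom g Y X" using assms hom_cmpE hom_unique hom_ide o by metis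
  have "f \<bullet> (g \<bullet> f) = f \<bullet> ide X" using assms ide_left ide_right cmp_rewrite by metis
  then have "g \<bullet> f = ide X" using monicD assms g hom_cmp by metis
  then show ?thesis using isomI assms g by blast
qed

lemma epic_retract_isom:
  assumes "epic f" "hom f X Y" "g \<bullet> f = ide X" shows "isom f X Y"
proof -
  have o: "X \<in> Obj C" "Y \<in> Obj C" using assms(2) hom_objs by auto
  have g: "hom g Y X" using assms hom_cmpE hom_unique hom_ide o by metis
  have "(f \<bullet> g) \<bullet> f = ide Y \<bullet> f" using assms ide_left ide_right cmp_assoc by metis
  then have "f \<bullet> g = ide Y" using epicD assms g hom_cmp by metis
  then show ?thesis using isomI assms g by blast
qed

text \<open>The inverse of the composite yields a section of \<open>f\<close>, and a monomorphism
  with a section is invertible.\<close>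

lemma monic_isom_cancel:
  assumes "monic f" "hom f X Y" "isom (f \<bullet> g) W Y" shows "isom f X Y"
proof -
  obtain k where "(f \<bullet> g) \<bullet> k = ide Y" using assms(3) isomE by blast
  then show ?thesis using monic_section_isom assms cmp_assoc by metis
qed

lemma isom_cancel_right:
  assumes "isom f X Y" "hom g Y Z" "isom (g \<bullet> f) X Z" shows "isom g Y Z"
proof -
  obtain f' where f': "isom f' Y X" "f \<bullet> f' = ide Y" using isomE[OF assms(1)] by blast
  have "(g \<bullet> f) \<bullet> f' = g" using f' assms by (simp add: cmp_assoc ide_right)
  then show ?thesis using isom_cmp[OF f'(1) assms(3)] by simp
qed

lemma isom_cancel_left:
  assumes "isom g Y Z" "hom f X Y" "isom (g \<bullet> f) X Z" shows "isom f X Y"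
proof -
  obtain g' where g': "isom g' Z Y" "g' \<bullet> g = ide Y" using isomE[OF assms(1)] by blast
  have "g' \<bullet> (g \<bullet> f) = f" using g' assms by (simp add: cmp_rewrite ide_left)
  then show ?thesis using isom_cmp[OF assms(3) g'(1)] by simp
qed

section \<open>Dictionary between the given notions and arrows\<close>

lemma is_mono_iff:
  assumes "X \<in> Obj C" "Y \<in> Obj C" shows "is_mono C X Y f \<longleftrightarrow> hom (ar X f Y) X Y \<and> monic (ar X f Y)"
proof
  assume m: "is_mono C X Y f"
  then have h: "hom (ar X f Y) X Y" using assms by (simp add: hom_ar is_mono_def)
  moreover have "monic (ar X f Y)"
  proof (rule monicI_hom[OF h])
    fix W g' h' assume gh: "hom g' W X" "hom h' W X" and e: "ar X f Y \<bullet> g' = ar X f Y \<bullet> h'"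
    then obtain g k where gk: "g \<in> mor C W X" "k \<in> mor C W X" "g' = ar W g X" "h' = ar W k X"
      by (metis hom_arE)
    then have "ar W (f \<cdot> g) Y = ar W (f \<cdot> k) Y" using e h gh cmp_ar by metis
    then have "f \<cdot> g = f \<cdot> k" using ar_inject cmp_ar hom_cmp gh gk h by metis
    then show "g' = h'" using m gk hom_objs gh unfolding is_mono_def by blast
  qed
  ultimately show "hom (ar X f Y) X Y \<and> monic (ar X f Y)" by blast
next
  assume m: "hom (ar X f Y) X Y \<and> monic (ar X f Y)"
  have "g = h" if "W \<in> Obj C" "g \<in> mor C W X" "h \<in> mor C W X" "f \<cdot> g = f \<cdot> h" for W g h
  proof -
    have 1: "hom (ar W g X) W X" "hom (ar W h X) W X" using that assms hom_ar by auto
    then have "ar X f Y \<bullet> ar W g X = ar X f Y \<bullet> ar W h X" using m that cmp_ar by metis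
    then show ?thesis using monicD 1 m ar_inject by metis
  qed
  then show "is_mono C X Y f" using m by (auto simp: is_mono_def hom_ar)
qed

lemma is_epi_iff:
  assumes "X \<in> Obj C" "Y \<in> Obj C" shows "is_epi C X Y f \<longleftrightarrow> hom (ar X f Y) X Y \<and> epic (ar X f Y)"
proof
  assume m: "is_epi C X Y f"
  then have h: "hom (ar X f Y) X Y" using assms by (simp add: hom_ar is_epi_def)
  moreover have "epic (ar X f Y)"
  proof (rule epicI_hom[OF h])
    fix W g' h' assume gh: "hom g' Y W" "hom h' Y W" and e: "g' \<bullet> ar X f Y = h' \<bullet> ar X f Y"
    then obtain g k where gk: "g \<in> mor C Y W" "k \<in> mor C Y W" "g' = ar Y g W" "h' = ar Y k W"
      by (metis hom_arE)
    then have "ar X (g \<cdot> f) W = ar X (k \<cdot> f) W" using e h gh cmp_ar by metis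
    then have "g \<cdot> f = k \<cdot> f" using ar_inject cmp_ar hom_cmp gh gk h by metis
    then show "g' = h'" using m gk hom_objs gh unfolding is_epi_def by blast
  qed
  ultimately show "hom (ar X f Y) X Y \<and> epic (ar X f Y)" by blast
next
  assume m: "hom (ar X f Y) X Y \<and> epic (ar X f Y)"
  have "g = h" if "W \<in> Obj C" "g \<in> mor C Y W" "h \<in> mor C Y W" "g \<cdot> f = h \<cdot> f" for W g h
  proof -
    have 1: "hom (ar Y g W) Y W" "hom (ar Y h W) Y W" using that assms hom_ar by auto
    then have "ar Y g W \<bullet> ar X f Y = ar Y h W \<bullet> ar X f Y" using m that cmp_ar by metis
    then show ?thesis using epicD 1 m ar_inject by metis
  qed
  then show "is_epi C X Y f" using m by (auto simp: is_epi_def hom_ar)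
qed

lemma cmp_ide_iff:
  assumes "hom (ar X f Y) X Y" "hom (ar Y g X) Y X"
  shows "ar Y g X \<bullet> ar X f Y = ide X \<longleftrightarrow> g \<cdot> f = \<I> X"
  using assms by (metis ar_inject cmp_ar hom_cmp ide_def)

lemma is_iso_iff:
  assumes "X \<in> Obj C" "Y \<in> Obj C" shows "is_iso C X Y f \<longleftrightarrow> isom (ar X f Y) X Y"
proof
  assume "is_iso C X Y f"
  then obtain g where "f \<in> mor C X Y" "g \<in> mor C Y X" "g \<cdot> f = \<I> X" "f \<cdot> g = \<I> Y"
    unfolding is_iso_def by blast
  then show "isom (ar X f Y) X Y"
    using assms cmp_ide_iff[of X f Y g] cmp_ide_iff[of Y g X f] by (intro isomI[of _ _ _ "ar Y g X"]) (auto simp: hom_ar)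
next
  assume i: "isom (ar X f Y) X Y"
  then obtain b where b: "hom b Y X" "b \<bullet> ar X f Y = ide X" "ar X f Y \<bullet> b = ide Y" using isomE by metis
  then obtain g where g: "g \<in> mor C Y X" "b = ar Y g X" using hom_arE by blast
  then show "is_iso C X Y f"
    using b isom_hom[OF i] cmp_ide_iff[of X f Y g] cmp_ide_iff[of Y g X f] hom_ar
    unfolding is_iso_def by auto
qed

text \<open>An arrow determines its endpoints, so its inverse can be named without mentioning
  objects; the existential only restores the typing.\<close>

definition inv_arrow :: "('o, 'm) arrow \<Rightarrow> ('o, 'm) arrow"
  where "inv_arrow a = (THE b. \<exists>X Y. inverse_arrows a b X Y)"

lemma inv_arrow:
  assumes "isom a X Y"
  shows "isom (inv_arrow a) Y X" "hom (inv_arrow a) Y X" "inv_arrow a \<bullet> a = ide X" "a \<bullet> inv_arrow a = ide Y"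
proof -
  obtain b where b: "isom b Y X" "inverse_arrows a b X Y"
    using isomE[OF assms] isom_hom[OF assms] inverse_arrows_def by metis
  have "c = b" if "inverse_arrows a c X' Y'" for c X' Y'
  proof -
    have "X' = X" "Y' = Y" using that b hom_unique unfolding inverse_arrows_def by metis+
    then show ?thesis using that b monicD[OF isom_monic[OF assms]] unfolding inverse_arrows_def by metis
  qed
  then have "inv_arrow a = b" unfolding inv_arrow_def using b by blast
  then show "isom (inv_arrow a) Y X" "hom (inv_arrow a) Y X" "inv_arrow a \<bullet> a = ide X" "a \<bullet> inv_arrow a = ide Y"
    using b isom_hom unfolding inverse_arrows_def by auto
qed

lemma ar_inv_mor:
  assumes "isom (ar X f Y) X Y" shows "ar Y (inv_mor C X Y f) X = inv_arrow (ar X f Y)"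
proof -
  note i = inv_arrow[OF assms] and f = isom_hom[OF assms]
  obtain g where g: "g \<in> mor C Y X" "inv_arrow (ar X f Y) = ar Y g X" using i(2) hom_arE by blast
  have "inv_mor C X Y f = g"
    unfolding inv_mor_def
  proof (rule the_equality)
    show "g \<in> mor C Y X \<and> g \<cdot> f = \<I> X \<and> f \<cdot> g = \<I> Y"
      using g i f cmp_ide_iff[of X f Y g] cmp_ide_iff[of Y g X f] by metis
  next
    fix h assume h: "h \<in> mor C Y X \<and> h \<cdot> f = \<I> X \<and> f \<cdot> h = \<I> Y"
    then have hh: "hom (ar Y h X) Y X" using f hom_ar by blast
    then have "ar X f Y \<bullet> ar Y h X = ar X f Y \<bullet> ar Y g X"
      using h f g i(4) cmp_ide_iff[of Y h X f] by metis
    then show "h = g" using monicD[OF isom_monic[OF assms] f hh] ar_inject[OF hh] by metis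
  qed
  then show ?thesis using g by simp
qed

definition zob :: "'o \<Rightarrow> bool" where "zob Z \<longleftrightarrow> is_zero_obj C Z"

lemma zob_obj: "zob Z \<Longrightarrow> Z \<in> Obj C"
  by (simp add: zob_def is_zero_obj_def)

lemma to_zob_eq: "zob Z \<Longrightarrow> hom f X Z \<Longrightarrow> hom g X Z \<Longrightarrow> f = g"
  by (auto simp: zob_def is_zero_obj_def hom_def)

lemma from_zob_eq: "zob Z \<Longrightarrow> hom f Z X \<Longrightarrow> hom g Z X \<Longrightarrow> f = g"
  by (auto simp: zob_def is_zero_obj_def hom_def)

lemma isomorphic_iff: "X \<in> Obj C \<Longrightarrow> Y \<in> Obj C \<Longrightarrow> isomorphic C X Y \<longleftrightarrow> (\<exists>f. isom f X Y)"
  by (metis hom_arE isom_hom isomorphic_def is_iso_iff)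

lemma isomorphic_refl: "X \<in> Obj C \<Longrightarrow> isomorphic C X X"
  using isomorphic_iff isom_ide by blast

lemma isomorphic_sym: "X \<in> Obj C \<Longrightarrow> Y \<in> Obj C \<Longrightarrow> isomorphic C X Y \<Longrightarrow> isomorphic C Y X"
  by (metis isomorphic_iff isomE)

lemma isomorphic_trans:
  "X \<in> Obj C \<Longrightarrow> Y \<in> Obj C \<Longrightarrow> Z \<in> Obj C \<Longrightarrow> isomorphic C X Y \<Longrightarrow> isomorphic C Y Z
    \<Longrightarrow> isomorphic C X Z"
  by (meson isomorphic_iff isom_cmp)

lemma subobject_iff:
  "M \<in> Obj C \<Longrightarrow> subobject C M s \<longleftrightarrow> hom (ar (fst s) (snd s) M) (fst s) M \<and> monic (ar (fst s) (snd s) M)"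
  unfolding subobject_def by (metis hom_ar is_mono_iff)

lemma cmp_ar_eq_iff:
  assumes "hom (ar X f Y) X Y" "hom (ar Y g Z) Y Z"
  shows "ar Y g Z \<bullet> ar X f Y = ar X h Z \<longleftrightarrow> g \<cdot> f = h"
  using assms by (metis ar_inject cmp_ar hom_cmp)

text \<open>Inclusion of subobjects becomes factorisation; the endpoints of \<open>h\<close> are
  forced because the composite is defined. Inclusion is used in this form from here on.\<close>

lemma sub_le_iff:
  assumes "hom (ar (fst s) (snd s) M) (fst s) M" "hom (ar (fst t) (snd t) M) (fst t) M"
  shows "sub_le C s t \<longleftrightarrow> (\<exists>h. ar (fst s) (snd s) M = ar (fst t) (snd t) M \<bullet> h)"
proof
  assume "sub_le C s t"
  then obtain h where h: "h \<in> mor C (fst s) (fst t)" "snd t \<cdot> h = snd s" by (auto simp: sub_le_def)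
  then have "hom (ar (fst s) h (fst t)) (fst s) (fst t)" using assms hom_ar by auto
  then show "\<exists>h. ar (fst s) (snd s) M = ar (fst t) (snd t) M \<bullet> h" using h assms cmp_ar by metis
next
  assume "\<exists>h. ar (fst s) (snd s) M = ar (fst t) (snd t) M \<bullet> h"
  then obtain h where h: "ar (fst s) (snd s) M = ar (fst t) (snd t) M \<bullet> h" by blast
  then have hh: "hom h (fst s) (fst t)" using assms hom_cmpE hom_unique by metis
  then obtain k where "k \<in> mor C (fst s) (fst t)" "h = ar (fst s) k (fst t)" using hom_arE by blast
  then show "sub_le C s t" using h hh assms cmp_ar_eq_iff unfolding sub_le_def by metis
qed

end

section \<open>Zero arrows, kernels, direct sums\<close>

context linear_category
begin

definition zer :: "'o \<Rightarrow> 'o \<Rightarrow> ('o, 'm) arrow"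
  where "zer X Y = ar X \<zero>\<^bsub>Hom C X Y\<^esub> Y"

text \<open>A predicate without objects that fails on \<open>None\<close>. Hence
  \<open>zro (b \<bullet> a)\<close> already asserts that the composite is defined, and the
  endpoints of an unknown factor can be recovered from it.\<close>

definition zro :: "('o, 'm) arrow \<Rightarrow> bool"
  where "zro a \<longleftrightarrow> (\<exists>X Y. hom a X Y \<and> a = zer X Y)"

text \<open>The endpoints are taken from the first summand and those of the second are ignored, so
  the rules for sums assume parallel arrows.\<close>

definition pls :: "('o, 'm) arrow \<Rightarrow> ('o, 'm) arrow \<Rightarrow> ('o, 'm) arrow"
  where "pls a b = (case (a, b) of (Some (X, f, Y), Some (_, g, _)) \<Rightarrow> ar X (f \<oplus>\<^bsub>Hom C X Y\<^esub> g) Y | _ \<Rightarrow> None)"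

lemma hom_module: "X \<in> Obj C \<Longrightarrow> Y \<in> Obj C \<Longrightarrow> module K (Hom C X Y)"
  using hom_space by (simp add: vectorspace_def)

lemma hom_abelian: "X \<in> Obj C \<Longrightarrow> Y \<in> Obj C \<Longrightarrow> abelian_group (Hom C X Y)"
  using hom_module by (simp add: module_def)

lemma hom_zer [intro]: "X \<in> Obj C \<Longrightarrow> Y \<in> Obj C \<Longrightarrow> hom (zer X Y) X Y"
  unfolding zer_def hom_ar using abelian_group.axioms(1)[OF hom_abelian] abelian_monoid.zero_closed by auto

lemma pls_ar: "hom (ar X f Y) X Y \<Longrightarrow> hom (ar X g Y) X Y \<Longrightarrow> pls (ar X f Y) (ar X g Y) = ar X (f \<oplus>\<^bsub>Hom C X Y\<^esub> g) Y"
  by (auto simp: pls_def hom_def ar_def)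

lemma hom_pls [intro]: assumes "hom a X Y" "hom b X Y" shows "hom (pls a b) X Y"
proof -
  interpret H: abelian_group "Hom C X Y" using hom_abelian assms hom_objs by blast
  show ?thesis using assms by (metis hom_arE pls_ar hom_ar H.a_closed)
qed

lemma cmp_linear_right: "X \<in> Obj C \<Longrightarrow> hom (ar Y g Z) Y Z \<Longrightarrow> mod_hom K (Hom C X Y) (Hom C X Z) (\<lambda>f. g \<cdot> f)"
  using comp_linear_right[of X Y Z g] by (simp add: linear_map_def hom_ar)

lemma cmp_linear_left: "Z \<in> Obj C \<Longrightarrow> hom (ar X f Y) X Y \<Longrightarrow> mod_hom K (Hom C Y Z) (Hom C X Z) (\<lambda>g. g \<cdot> f)"
  using comp_linear_left[of X Y Z f] by (simp add: linear_map_def hom_ar)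

lemma cmp_zer: assumes "X \<in> Obj C" "hom a Y Z" shows "a \<bullet> zer X Y = zer X Z"
proof -
  obtain g where g: "a = ar Y g Z" using assms hom_arE by blast
  show ?thesis
    using mod_hom.f0_is_0[OF cmp_linear_right[OF assms(1), of Y g Z]] assms hom_zer[of X Y] hom_objs[OF assms(2)] g
    by (simp add: zer_def cmp_ar)
qed

lemma zer_cmp: assumes "Z \<in> Obj C" "hom a X Y" shows "zer Y Z \<bullet> a = zer X Z"
proof -
  obtain g where g: "a = ar X g Y" using assms hom_arE by blast
  show ?thesis
    using mod_hom.f0_is_0[OF cmp_linear_left[OF assms(1), of X g Y]] assms hom_zer[of Y Z] hom_objs[OF assms(2)] g
    by (simp add: zer_def cmp_ar)
qed

lemma cmp_pls: assumes "hom a X Y" "hom b X Y" "hom c Y Z" shows "c \<bullet> pls a b = pls (c \<bullet> a) (c \<bullet> b)"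
proof -
  obtain f g h where g: "a = ar X f Y" "b = ar X g Y" "c = ar Y h Z" using assms hom_arE by metis
  have o: "X \<in> Obj C" using assms hom_objs by blast
  show ?thesis
    using module_hom_add[OF mod_hom.f_hom[OF cmp_linear_right[OF o, of Y h Z]]] assms hom_cmp[OF assms(1,3)] hom_cmp[OF assms(2,3)]
      hom_pls[OF assms(1,2)] g
    by (simp add: cmp_ar pls_ar hom_ar)
qed

lemma pls_cmp: assumes "hom a X Y" "hom b Y Z" "hom c Y Z" shows "pls b c \<bullet> a = pls (b \<bullet> a) (c \<bullet> a)"
proof -
  obtain f g h where g: "a = ar X f Y" "b = ar Y g Z" "c = ar Y h Z" using assms hom_arE by metis
  have o: "Z \<in> Obj C" using assms hom_objs by blast
  show ?thesis
    using module_hom_add[OF mod_hom.f_hom[OF cmp_linear_left[OF o, of X f Y]]] assms hom_cmp[OF assms(1,2)] hom_cmp[OF assms(1,3)]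
      hom_pls[OF assms(2,3)] g
    by (simp add: cmp_ar pls_ar hom_ar)
qed

lemma pls_zer:
  assumes "hom a X Y" shows "pls a (zer X Y) = a" "pls (zer X Y) a = a"
proof -
  interpret H: abelian_group "Hom C X Y" using hom_abelian assms hom_objs by blast
  obtain f where f: "a = ar X f Y" "f \<in> mor C X Y" using assms hom_arE by blast
  show "pls a (zer X Y) = a" "pls (zer X Y) a = a"
    using f assms hom_zer[of X Y] hom_objs[OF assms] by (simp_all add: zer_def pls_ar)
qed

text \<open>Subtraction is offered only as solvability of \<open>pls d b = a\<close>; that suffices
  to reduce left and right cancellation to arrows whose composite with \<open>f\<close> is
  zero.\<close>

lemma difference_arrow:
  assumes "hom a X Y" "hom b X Y"
  obtains d where "hom d X Y" "pls d b = a"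
proof -
  interpret H: abelian_group "Hom C X Y" using hom_abelian assms hom_objs by blast
  obtain f g where g: "a = ar X f Y" "b = ar X g Y" "f \<in> mor C X Y" "g \<in> mor C X Y" using assms hom_arE by metis
  have h: "f \<ominus>\<^bsub>Hom C X Y\<^esub> g \<in> mor C X Y" using g by simp
  have e: "(f \<ominus>\<^bsub>Hom C X Y\<^esub> g) \<oplus>\<^bsub>Hom C X Y\<^esub> g = f" using g by (simp add: H.minus_eq H.a_assoc H.l_neg)
  have "hom (ar X (f \<ominus>\<^bsub>Hom C X Y\<^esub> g) Y) X Y" using h assms hom_ar hom_objs by blast
  then show ?thesis using that e g assms by (metis pls_ar)
qed

lemma pls_cancel:
  assumes "hom d X Y" "hom b X Y" "pls d b = b" shows "d = zer X Y"
proof -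
  interpret H: abelian_group "Hom C X Y" using hom_abelian assms hom_objs by blast
  obtain f g where g: "d = ar X f Y" "b = ar X g Y" "f \<in> mor C X Y" "g \<in> mor C X Y" using assms hom_arE by metis
  then have "f \<oplus>\<^bsub>Hom C X Y\<^esub> g = g" using assms pls_ar ar_inject by metis
  then have "f = \<zero>\<^bsub>Hom C X Y\<^esub>" using g H.add.r_cancel_one by blast
  then show ?thesis using g zer_def by simp
qed

lemma zro_hom: "zro a \<Longrightarrow> hom a X Y \<Longrightarrow> a = zer X Y"
  unfolding zro_def using hom_unique by blast

lemma zro_zer: "X \<in> Obj C \<Longrightarrow> Y \<in> Obj C \<Longrightarrow> zro (zer X Y)"
  unfolding zro_def by blast

lemma zroI: "hom a X Y \<Longrightarrow> a = zer X Y \<Longrightarrow> zro a"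
  unfolding zro_def by blast

lemma zro_cmp_left: "zro b \<Longrightarrow> b \<bullet> a \<noteq> None \<Longrightarrow> zro (b \<bullet> a)"
  using zro_zer zro_hom zer_cmp cmp_None hom_objs by metis

lemma zro_cmp_right: "zro a \<Longrightarrow> b \<bullet> a \<noteq> None \<Longrightarrow> zro (b \<bullet> a)"
  using zro_zer zro_hom cmp_zer cmp_None hom_objs by metis

lemma zro_cmp_hom: "hom a X Y \<Longrightarrow> hom b Y Z \<Longrightarrow> zro a \<or> zro b \<Longrightarrow> zro (b \<bullet> a)"
  using zro_cmp_left zro_cmp_right hom_cmp hom_not_None by metis

lemma zro_cmp_dom:
  assumes "zro (f \<bullet> w)" "hom f X Y" obtains W where "hom w W X"
  using assms hom_cmpE hom_unique unfolding zro_def by metis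

lemma zro_cmp_cod:
  assumes "zro (w \<bullet> f)" "hom f X Y" obtains W where "hom w Y W"
  using assms hom_cmpE hom_unique unfolding zro_def by metis

lemma zro_parallel: "zro a \<Longrightarrow> zro b \<Longrightarrow> hom a X Y \<Longrightarrow> hom b X Y \<Longrightarrow> a = b"
  using zro_hom by metis

lemma monicI:
  assumes f: "hom f X Y" and z: "\<And>W w. hom w W X \<Longrightarrow> zro (f \<bullet> w) \<Longrightarrow> zro w" shows "monic f"
proof (rule monicI_hom[OF f])
  fix W g h assume gh: "hom g W X" "hom h W X" "f \<bullet> g = f \<bullet> h"
  obtain d where d: "hom d W X" "pls d h = g" using difference_arrow[OF gh(1,2)] .
  have "pls (f \<bullet> d) (f \<bullet> h) = f \<bullet> h" using cmp_pls[OF d(1) gh(2) f] d gh by simp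
  then have "f \<bullet> d = zer W Y" using pls_cancel hom_cmp d gh f by metis
  then have "zro d" using z d f zroI hom_cmp by metis
  then have "d = zer W X" using zro_hom d by blast
  then show "g = h" using d gh pls_zer by metis
qed

lemma epicI:
  assumes f: "hom f X Y" and z: "\<And>W w. hom w Y W \<Longrightarrow> zro (w \<bullet> f) \<Longrightarrow> zro w" shows "epic f"
proof (rule epicI_hom[OF f])
  fix W g h assume gh: "hom g Y W" "hom h Y W" "g \<bullet> f = h \<bullet> f"
  obtain d where d: "hom d Y W" "pls d h = g" using difference_arrow[OF gh(1,2)] .
  have "pls (d \<bullet> f) (h \<bullet> f) = h \<bullet> f" using pls_cmp[OF f d(1) gh(2)] d gh by simp
  then have "d \<bullet> f = zer X W" using pls_cancel hom_cmp d gh f by metis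
  then have "zro d" using z d f zroI hom_cmp by metis
  then have "d = zer Y W" using zro_hom d by blast
  then show "g = h" using d gh pls_zer by metis
qed

lemma monic_zro: "monic f \<Longrightarrow> zro (f \<bullet> w) \<Longrightarrow> zro w"
proof -
  assume f: "monic f" "zro (f \<bullet> w)"
  then obtain X Y W where h: "hom w W X" "hom f X Y" using cmp_None hom_not_None zro_def by metis
  then have "f \<bullet> w = f \<bullet> zer W X" using f zro_hom cmp_zer hom_cmp hom_objs by metis
  then show "zro w" using monicD f h zroI by metis
qed

lemma epic_zro: "epic f \<Longrightarrow> zro (w \<bullet> f) \<Longrightarrow> zro w"
proof -
  assume f: "epic f" "zro (w \<bullet> f)"
  then obtain X Y W where h: "hom w Y W" "hom f X Y" using cmp_None hom_not_None zro_def by metis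
  then have "w \<bullet> f = zer Y W \<bullet> f" using f zro_hom zer_cmp hom_cmp hom_objs by metis
  then show "zro w" using epicD f h zroI by metis
qed

lemma zob_iff: "Z \<in> Obj C \<Longrightarrow> zob Z \<longleftrightarrow> zro (ide Z)"
proof
  assume "Z \<in> Obj C" "zob Z" then show "zro (ide Z)" using to_zob_eq hom_ide hom_zer zroI by metis
next
  assume Z: "Z \<in> Obj C" and e: "zro (ide Z)"
  have 1: "f = zer Z X" if "hom f Z X" for f X
    using that e ide_right cmp_zer hom_objs zro_hom hom_ide by metis
  have 2: "f = zer X Z" if "hom f X Z" for f X
    using that e ide_left zer_cmp hom_objs zro_hom hom_ide by metis
  have "\<exists>!f. f \<in> mor C Z X" "\<exists>!f. f \<in> mor C X Z" if X: "X \<in> Obj C" for X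
  proof -
    show "\<exists>!f. f \<in> mor C Z X"
      using 1[of _ X] hom_zer[OF Z X] hom_ar[of Z _ X] Z X unfolding zer_def by (metis ar_inject)
    show "\<exists>!f. f \<in> mor C X Z"
      using 2[of _ X] hom_zer[OF X Z] hom_ar[of X _ Z] Z X unfolding zer_def by (metis ar_inject)
  qed
  then show "zob Z" unfolding zob_def is_zero_obj_def using Z by blast
qed

lemma to_zob: "zob Z \<Longrightarrow> hom f X Z \<Longrightarrow> zro f"
  using to_zob_eq hom_zer hom_objs zroI by metis

lemma from_zob: "zob Z \<Longrightarrow> hom f Z X \<Longrightarrow> zro f"
  using from_zob_eq hom_zer hom_objs zroI by metis

lemma zob_monic: "monic f \<Longrightarrow> hom f X Y \<Longrightarrow> zro f \<Longrightarrow> zob X"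
  by (metis hom_objs(1) ide_right monic_zro zob_iff)

lemma zob_epic: "epic f \<Longrightarrow> hom f X Y \<Longrightarrow> zro f \<Longrightarrow> zob Y"
  by (metis hom_objs(2) ide_left epic_zro zob_iff)

lemma zob_isom: "isom f X Y \<Longrightarrow> zob X \<longleftrightarrow> zob Y"
  by (metis from_zob isom_epic isom_hom isom_monic to_zob zob_epic zob_monic)

text \<open>Objects are left implicit: uniqueness of the factorisation is replaced by
  \<open>monic k\<close>, and since \<open>zro\<close> fails on \<open>None\<close> the test arrows
  \<open>w\<close> are automatically composable with \<open>f\<close>.\<close>

definition kern :: "('o, 'm) arrow \<Rightarrow> ('o, 'm) arrow \<Rightarrow> bool"
  where "kern f k \<longleftrightarrow> monic k \<and> zro (f \<bullet> k) \<and> (\<forall>w. zro (f \<bullet> w) \<longrightarrow> (\<exists>u. w = k \<bullet> u))"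

definition coker :: "('o, 'm) arrow \<Rightarrow> ('o, 'm) arrow \<Rightarrow> bool"
  where "coker f q \<longleftrightarrow> epic q \<and> zro (q \<bullet> f) \<and> (\<forall>w. zro (w \<bullet> f) \<longrightarrow> (\<exists>u. w = u \<bullet> q))"

lemma zro_cmp_ar:
  assumes "hom (ar X f Y) X Y" "hom (ar Y g Z) Y Z"
  shows "zro (ar Y g Z \<bullet> ar X f Y) \<longleftrightarrow> g \<cdot> f = \<zero>\<^bsub>Hom C X Z\<^esub>"
proof -
  have "zro (ar Y g Z \<bullet> ar X f Y) \<longleftrightarrow> ar Y g Z \<bullet> ar X f Y = ar X \<zero>\<^bsub>Hom C X Z\<^esub> Z"
    using zro_hom[OF _ hom_cmp[OF assms]] zroI[OF hom_cmp[OF assms]] unfolding zer_def by blast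
  then show ?thesis using cmp_ar_eq_iff[OF assms] by simp
qed

text \<open>The point is that unique factorisation makes \<open>k\<close> monic:
  \<open>k \<bullet> g\<close> is killed by \<open>f\<close> for every composable \<open>g\<close>,
  so two arrows with the same composite are both its unique factor.\<close>

lemma is_kernel_iff:
  assumes "X \<in> Obj C" "Y \<in> Obj C"
  shows "is_kernel C X Y f N k \<longleftrightarrow> hom (ar X f Y) X Y \<and> hom (ar N k X) N X \<and> kern (ar X f Y) (ar N k X)"
proof
  assume a: "is_kernel C X Y f N k"
  have hs: "hom (ar X f Y) X Y" "hom (ar N k X) N X" "N \<in> Obj C"
    using a assms unfolding is_kernel_def by (auto simp: hom_ar)
  have z: "zro (ar X f Y \<bullet> ar N k X)" using a hs zro_cmp_ar unfolding is_kernel_def by blast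
  have ex1: "\<exists>!u. hom u W N \<and> ar N k X \<bullet> u = w" if w: "hom w W X" "zro (ar X f Y \<bullet> w)" for W w
  proof -
    obtain g where g: "g \<in> mor C W X" "w = ar W g X" using w hom_arE by blast
    have W: "W \<in> Obj C" using w hom_objs by blast
    have "f \<cdot> g = \<zero>\<^bsub>Hom C W Y\<^esub>" using w g zro_cmp_ar hs by blast
    then obtain u where u: "u \<in> mor C W N" "k \<cdot> u = g" and un: "\<And>u'. u' \<in> mor C W N \<Longrightarrow> k \<cdot> u' = g \<Longrightarrow> u' = u"
      using a g W unfolding is_kernel_def by metis
    have "hom (ar W u N) W N \<and> ar N k X \<bullet> ar W u N = w"
      using u g W hs by (simp add: hom_ar cmp_ar)
    moreover have "v = ar W u N" if "hom v W N" "ar N k X \<bullet> v = w" for v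
      using that un g hs cmp_ar_eq_iff hom_arE by metis
    ultimately show ?thesis by metis
  qed
  have "monic (ar N k X)"
  proof (rule monicI_hom[OF hs(2)])
    fix W g h assume gh: "hom g W N" "hom h W N" "ar N k X \<bullet> g = ar N k X \<bullet> h"
    have "zro (ar X f Y \<bullet> (ar N k X \<bullet> g))"
      using zro_cmp_hom[OF gh(1) hom_cmp[OF hs(2,1)]] z by (simp add: cmp_assoc)
    then show "g = h" using ex1[OF hom_cmp[OF gh(1) hs(2)]] gh by metis
  qed
  moreover have "\<exists>u. w = ar N k X \<bullet> u" if z0: "zro (ar X f Y \<bullet> w)" for w
  proof -
    obtain W where "hom w W X" using zro_cmp_dom[OF z0 hs(1)] .
    then show ?thesis using ex1[OF _ z0] by blast
  qed
  ultimately show "hom (ar X f Y) X Y \<and> hom (ar N k X) N X \<and> kern (ar X f Y) (ar N k X)"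
    unfolding kern_def using hs z by blast
next
  assume a: "hom (ar X f Y) X Y \<and> hom (ar N k X) N X \<and> kern (ar X f Y) (ar N k X)"
  then have hs: "hom (ar X f Y) X Y" "hom (ar N k X) N X" "monic (ar N k X)" "zro (ar X f Y \<bullet> ar N k X)"
    unfolding kern_def by auto
  have "\<exists>!u. u \<in> mor C W N \<and> k \<cdot> u = g" if g: "W \<in> Obj C" "g \<in> mor C W X" "f \<cdot> g = \<zero>\<^bsub>Hom C W Y\<^esub>" for W g
  proof -
    have h: "hom (ar W g X) W X" using g assms hom_ar by blast
    then have "zro (ar X f Y \<bullet> ar W g X)" using g zro_cmp_ar hs by blast
    then obtain u where u: "ar W g X = ar N k X \<bullet> u" using a kern_def by blast
    then have uh: "hom u W N" using h hs hom_cmpE hom_unique by metis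
    then obtain v where v: "v \<in> mor C W N" "u = ar W v N" using hom_arE by blast
    then have kv: "k \<cdot> v = g" using u uh hs cmp_ar_eq_iff by metis
    have "v' = v" if "v' \<in> mor C W N" "k \<cdot> v' = g" for v'
    proof -
      have h': "hom (ar W v' N) W N" using that g hs hom_ar by blast
      then have "ar N k X \<bullet> ar W v' N = ar N k X \<bullet> u" using that u hs cmp_ar by metis
      then show ?thesis using monicD hs h' v ar_inject by metis
    qed
    then show ?thesis using v kv by blast
  qed
  then show "is_kernel C X Y f N k"
    unfolding is_kernel_def using hs zro_cmp_ar hom_ar by auto
qed

lemma is_cokernel_iff:
  assumes "X \<in> Obj C" "Y \<in> Obj C"
  shows "is_cokernel C X Y f Q q \<longleftrightarrow> hom (ar X f Y) X Y \<and> hom (ar Y q Q) Y Q \<and> coker (ar X f Y) (ar Y q Q)"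
proof
  assume a: "is_cokernel C X Y f Q q"
  have hs: "hom (ar X f Y) X Y" "hom (ar Y q Q) Y Q" "Q \<in> Obj C"
    using a assms unfolding is_cokernel_def by (auto simp: hom_ar)
  have z: "zro (ar Y q Q \<bullet> ar X f Y)" using a hs zro_cmp_ar unfolding is_cokernel_def by blast
  have ex1: "\<exists>!u. hom u Q W \<and> u \<bullet> ar Y q Q = w" if w: "hom w Y W" "zro (w \<bullet> ar X f Y)" for W w
  proof -
    obtain g where g: "g \<in> mor C Y W" "w = ar Y g W" using w hom_arE by blast
    have W: "W \<in> Obj C" using w hom_objs by blast
    have "g \<cdot> f = \<zero>\<^bsub>Hom C X W\<^esub>" using w g zro_cmp_ar hs by blast
    then obtain u where u: "u \<in> mor C Q W" "u \<cdot> q = g" and un: "\<And>u'. u' \<in> mor C Q W \<Longrightarrow> u' \<cdot> q = g \<Longrightarrow> u' = u"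
      using a g W unfolding is_cokernel_def by metis
    have "hom (ar Q u W) Q W \<and> ar Q u W \<bullet> ar Y q Q = w"
      using u g W hs by (simp add: hom_ar cmp_ar)
    moreover have "v = ar Q u W" if "hom v Q W" "v \<bullet> ar Y q Q = w" for v
      using that un g hs cmp_ar_eq_iff hom_arE by metis
    ultimately show ?thesis by metis
  qed
  have "epic (ar Y q Q)"
  proof (rule epicI_hom[OF hs(2)])
    fix W g h assume gh: "hom g Q W" "hom h Q W" "g \<bullet> ar Y q Q = h \<bullet> ar Y q Q"
    have "zro ((g \<bullet> ar Y q Q) \<bullet> ar X f Y)"
      using zro_cmp_hom[OF hom_cmp[OF hs(1,2)] gh(1)] z by (simp add: cmp_assoc)
    then show "g = h" using ex1[OF hom_cmp[OF hs(2) gh(1)]] gh by metis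
  qed
  moreover have "\<exists>u. w = u \<bullet> ar Y q Q" if z0: "zro (w \<bullet> ar X f Y)" for w
  proof -
    obtain W where "hom w Y W" using zro_cmp_cod[OF z0 hs(1)] .
    then show ?thesis using ex1[OF _ z0] by blast
  qed
  ultimately show "hom (ar X f Y) X Y \<and> hom (ar Y q Q) Y Q \<and> coker (ar X f Y) (ar Y q Q)"
    unfolding coker_def using hs z by blast
next
  assume a: "hom (ar X f Y) X Y \<and> hom (ar Y q Q) Y Q \<and> coker (ar X f Y) (ar Y q Q)"
  then have hs: "hom (ar X f Y) X Y" "hom (ar Y q Q) Y Q" "epic (ar Y q Q)" "zro (ar Y q Q \<bullet> ar X f Y)"
    unfolding coker_def by auto
  have "\<exists>!u. u \<in> mor C Q W \<and> u \<cdot> q = g" if g: "W \<in> Obj C" "g \<in> mor C Y W" "g \<cdot> f = \<zero>\<^bsub>Hom C X W\<^esub>" for W g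
  proof -
    have h: "hom (ar Y g W) Y W" using g assms hom_ar by blast
    then have "zro (ar Y g W \<bullet> ar X f Y)" using g zro_cmp_ar hs by blast
    then obtain u where u: "ar Y g W = u \<bullet> ar Y q Q" using a coker_def by blast
    then have uh: "hom u Q W" using h hs hom_cmpE hom_unique by metis
    then obtain v where v: "v \<in> mor C Q W" "u = ar Q v W" using hom_arE by blast
    then have kv: "v \<cdot> q = g" using u uh hs cmp_ar_eq_iff by metis
    have "v' = v" if "v' \<in> mor C Q W" "v' \<cdot> q = g" for v'
    proof -
      have h': "hom (ar Q v' W) Q W" using that g hs hom_ar by blast
      then have "ar Q v' W \<bullet> ar Y q Q = u \<bullet> ar Y q Q" using that u hs cmp_ar by metis
      then show ?thesis using epicD hs h' v ar_inject by metis
    qed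
    then show ?thesis using v kv by blast
  qed
  then show "is_cokernel C X Y f Q q"
    unfolding is_cokernel_def using hs zro_cmp_ar hom_ar by auto
qed

end

context linear_category
begin

section \<open>Calculus of kernels, cokernels and direct sums\<close>

lemma kernD:
  assumes "kern f k" "hom f X Y"
  shows "monic k" "\<exists>N. hom k N X" "zro (f \<bullet> k)" "zro (f \<bullet> w) \<Longrightarrow> \<exists>u. w = k \<bullet> u"
  using assms hom_cmpE hom_unique unfolding kern_def zro_def by metis+

lemma cokerD:
  assumes "coker f q" "hom f X Y"
  shows "epic q" "\<exists>Q. hom q Y Q" "zro (q \<bullet> f)" "zro (w \<bullet> f) \<Longrightarrow> \<exists>u. w = u \<bullet> q"
  using assms hom_cmpE hom_unique unfolding coker_def zro_def by metis+

lemma coker_pre_isom: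
  assumes "coker f q" "hom f X Y" "isom u X' X" shows "coker (f \<bullet> u) q"
  unfolding coker_def
proof (intro conjI allI impI)
  show "epic q" using assms coker_def by blast
  obtain Q where q: "hom q Y Q" using cokerD(2)[OF assms(1,2)] by blast
  have "zro (q \<bullet> f)" using assms coker_def by blast
  then show "zro (q \<bullet> (f \<bullet> u))"
    using zro_cmp_hom[OF isom_hom[OF assms(3)] hom_cmp[OF assms(2) q]] by (simp add: cmp_assoc)
  fix w assume w: "zro (w \<bullet> (f \<bullet> u))"
  then have "zro ((w \<bullet> f) \<bullet> u)" by (simp add: cmp_assoc)
  then have "zro (w \<bullet> f)" using epic_zro isom_epic assms by blast
  then show "\<exists>v. w = v \<bullet> q" using assms coker_def by blast
qed

text \<open>Replaces both ends of \<open>h\<close> by isomorphic objects. This is needed because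
  subobjects agree only up to isomorphism, whereas \<open>sub_quotient\<close> speaks about chosen
  representatives.\<close>

lemma coker_isom_source:
  assumes "coker h q" "hom h S T" "isom a S' S" "isom b T T'" "b' \<bullet> b = ide T" "b \<bullet> b' = ide T'"
  shows "coker (b \<bullet> (h \<bullet> a)) (q \<bullet> b')"
proof -
  have b': "hom b' T' T" using assms isom_hom hom_cmpE hom_unique hom_ide hom_objs by metis
  have ib': "isom b' T' T" using isomI assms isom_hom b' by metis
  obtain Q where q: "hom q T Q" using cokerD(2)[OF assms(1,2)] by blast
  have c: "coker (h \<bullet> a) q" using coker_pre_isom assms by blast
  have ha: "hom (h \<bullet> a) S' T" using assms isom_hom by blast
  show ?thesis
    unfolding coker_def
  proof (intro conjI allI impI)
    show "epic (q \<bullet> b')" using epic_cmp isom_epic[OF ib'] c b' q hom_cmp hom_not_None unfolding coker_def by metis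
    have e: "(q \<bullet> b') \<bullet> (b \<bullet> (h \<bullet> a)) = q \<bullet> (h \<bullet> a)"
      using assms ha by (simp add: cmp_assoc cmp_rewrite[OF assms(5)] ide_left)
    then show "zro ((q \<bullet> b') \<bullet> (b \<bullet> (h \<bullet> a)))" using c coker_def by metis
    fix w assume "zro (w \<bullet> (b \<bullet> (h \<bullet> a)))"
    then have z: "zro ((w \<bullet> b) \<bullet> (h \<bullet> a))" by (simp add: cmp_assoc)
    then obtain W where "hom (w \<bullet> b) T W" using zro_cmp_cod ha by blast
    then have wh: "hom w T' W" using isom_hom[OF assms(4)] hom_cmpE hom_unique by metis
    obtain u where "w \<bullet> b = u \<bullet> q" using c z coker_def by blast
    then have "(w \<bullet> b) \<bullet> b' = u \<bullet> (q \<bullet> b')" by (simp add: cmp_assoc)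
    then show "\<exists>u. w = u \<bullet> (q \<bullet> b')" using assms wh by (metis cmp_assoc ide_right)
  qed
qed

text \<open>Existence and uniqueness of the mediating arrow are split; the last clause says that the
  injections are jointly epic and can be applied on its own.\<close>

definition dsum :: "'i set \<Rightarrow> ('i \<Rightarrow> 'o) \<Rightarrow> 'o \<Rightarrow> ('i \<Rightarrow> ('o, 'm) arrow) \<Rightarrow> bool"
  where "dsum I U A e \<longleftrightarrow> A \<in> Obj C \<and> (\<forall>i\<in>I. hom (e i) (U i) A) \<and>
    (\<forall>X f. X \<in> Obj C \<longrightarrow> (\<forall>i\<in>I. hom (f i) (U i) X) \<longrightarrow> (\<exists>h. hom h A X \<and> (\<forall>i\<in>I. h \<bullet> e i = f i))) \<and>
    (\<forall>X g h. hom g A X \<longrightarrow> hom h A X \<longrightarrow> (\<forall>i\<in>I. g \<bullet> e i = h \<bullet> e i) \<longrightarrow> g = h)"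

lemma dsumD:
  assumes "dsum I U A e"
  shows "A \<in> Obj C" "\<And>i. i \<in> I \<Longrightarrow> hom (e i) (U i) A" "\<And>i. i \<in> I \<Longrightarrow> U i \<in> Obj C"
    "\<And>X g h. hom g A X \<Longrightarrow> hom h A X \<Longrightarrow> (\<And>i. i \<in> I \<Longrightarrow> g \<bullet> e i = h \<bullet> e i) \<Longrightarrow> g = h"
  using assms hom_objs unfolding dsum_def by blast+

lemma dsum_exists:
  assumes "dsum I U A e" "X \<in> Obj C" "\<And>i. i \<in> I \<Longrightarrow> hom (f i) (U i) X"
  shows "\<exists>h. hom h A X \<and> (\<forall>i\<in>I. h \<bullet> e i = f i)"
proof -
  have "\<forall>i\<in>I. hom (f i) (U i) X" using assms(3) by blast
  then show ?thesis using assms(1,2) unfolding dsum_def by blast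
qed

lemma dsum_ex:
  assumes "dsum I U A e" "X \<in> Obj C" "\<And>i. i \<in> I \<Longrightarrow> hom (f i) (U i) X"
  obtains h where "hom h A X" "\<And>i. i \<in> I \<Longrightarrow> h \<bullet> e i = f i"
  using dsum_exists[OF assms] by blast

lemma is_direct_sum_iff: "is_direct_sum C I U A e \<longleftrightarrow> dsum I U A (\<lambda>i. ar (U i) (e i) A)"
proof
  assume a: "is_direct_sum C I U A e"
  have e: "\<And>i. i \<in> I \<Longrightarrow> hom (ar (U i) (e i) A) (U i) A" and A: "A \<in> Obj C"
    using a unfolding is_direct_sum_def by (auto simp: hom_ar)
  have ex1: "\<exists>!h. h \<in> mor C A X \<and> (\<forall>i\<in>I. h \<cdot> e i = f i)" if "X \<in> Obj C" "\<forall>i\<in>I. f i \<in> mor C (U i) X" for X f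
    using a that unfolding is_direct_sum_def by blast
  show "dsum I U A (\<lambda>i. ar (U i) (e i) A)"
    unfolding dsum_def
  proof (intro conjI allI impI ballI)
    fix X f assume X: "X \<in> Obj C" and f: "\<forall>i\<in>I. hom (f i) (U i) X"
    have "\<forall>i\<in>I. \<exists>g. g \<in> mor C (U i) X \<and> f i = ar (U i) g X"
      using f hom_arE by blast
    then obtain f' where f': "\<And>i. i \<in> I \<Longrightarrow> f' i \<in> mor C (U i) X \<and> f i = ar (U i) (f' i) X"
      using bchoice[of I "\<lambda>i g. g \<in> mor C (U i) X \<and> f i = ar (U i) g X"] by blast
    then obtain h where h: "h \<in> mor C A X" "\<And>i. i \<in> I \<Longrightarrow> h \<cdot> e i = f' i" using ex1[OF X, of f'] by blast
    have hh: "hom (ar A h X) A X" using h A X hom_ar by blast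
    have "\<And>i. i \<in> I \<Longrightarrow> ar A h X \<bullet> ar (U i) (e i) A = f i" using h f' e hh cmp_ar by metis
    then show "\<exists>h. hom h A X \<and> (\<forall>i\<in>I. h \<bullet> ar (U i) (e i) A = f i)" using hh by blast
  next
    fix X g h assume gh: "hom g A X" "hom h A X" "\<forall>i\<in>I. g \<bullet> ar (U i) (e i) A = h \<bullet> ar (U i) (e i) A"
    then obtain g' h' where g': "g = ar A g' X" "h = ar A h' X" "g' \<in> mor C A X" "h' \<in> mor C A X" by (metis hom_arE)
    have i: "g' \<cdot> e i = h' \<cdot> e i" if "i \<in> I" for i
      using gh g' e that cmp_ar_eq_iff[OF e[OF that], of g' X] cmp_ar[OF e[OF that], of h' X] by metis
    have "\<exists>!k. k \<in> mor C A X \<and> (\<forall>i\<in>I. k \<cdot> e i = h' \<cdot> e i)"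
    proof (rule ex1)
      show "X \<in> Obj C" using gh hom_objs by blast
      show "\<forall>i\<in>I. h' \<cdot> e i \<in> mor C (U i) X"
        using e g' gh hom_objs comp_closed by (metis hom_ar)
    qed
    then have "g' = h'" using g' i by blast
    then show "g = h" using g' by simp
  qed (use e A in auto)
next
  assume a: "dsum I U A (\<lambda>i. ar (U i) (e i) A)"
  note e = dsumD(2)[OF a] and A = dsumD(1)[OF a]
  show "is_direct_sum C I U A e"
    unfolding is_direct_sum_def
  proof (intro conjI allI impI ballI)
    show "A \<in> Obj C" by (rule A)
    show "U i \<in> Obj C" "e i \<in> mor C (U i) A" if "i \<in> I" for i using e[OF that] hom_ar by auto
    fix X f assume X: "X \<in> Obj C" and f: "\<forall>i\<in>I. f i \<in> mor C (U i) X"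
    have f': "\<And>i. i \<in> I \<Longrightarrow> hom (ar (U i) (f i) X) (U i) X" using f X e hom_ar by auto
    obtain h where h: "hom h A X" "\<And>i. i \<in> I \<Longrightarrow> h \<bullet> ar (U i) (e i) A = ar (U i) (f i) X"
      using dsum_ex[OF a X, of "\<lambda>i. ar (U i) (f i) X"] f' by blast
    obtain h' where h': "h = ar A h' X" "h' \<in> mor C A X" using h hom_arE by blast
    show "\<exists>!h. h \<in> mor C A X \<and> (\<forall>i\<in>I. h \<cdot> e i = f i)"
    proof (rule ex1I[of _ h'])
      show "h' \<in> mor C A X \<and> (\<forall>i\<in>I. h' \<cdot> e i = f i)" using h h' e cmp_ar_eq_iff by metis
      fix k assume k: "k \<in> mor C A X \<and> (\<forall>i\<in>I. k \<cdot> e i = f i)"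
      then have kh: "hom (ar A k X) A X" using A X hom_ar by blast
      have "ar A k X \<bullet> ar (U i) (e i) A = h \<bullet> ar (U i) (e i) A" if "i \<in> I" for i
        using k h(2)[OF that] cmp_ar[OF e[OF that] kh] that by simp
      then have "ar A k X = h" using dsumD(4)[OF a kh h(1)] by blast
      then show "k = h'" using h' kh ar_inject by metis
    qed
  qed
qed

lemma dsum_is_direct_sum:
  assumes "dsum I U A e" obtains e' where "is_direct_sum C I U A e'"
proof -
  have "\<forall>i\<in>I. \<exists>g. e i = ar (U i) g A" using dsumD(2)[OF assms] hom_arE by blast
  then obtain e' where "\<And>i. i \<in> I \<Longrightarrow> e i = ar (U i) (e' i) A" using bchoice[of I "\<lambda>i g. e i = ar (U i) g A"] by blast
  then have "dsum I U A (\<lambda>i. ar (U i) (e' i) A)"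
    using assms unfolding dsum_def by simp
  then show ?thesis using that is_direct_sum_iff by blast
qed

text \<open>The universal property is applied to the Kronecker family, identity on the diagonal and
  zero elsewhere. It covers infinite families, which matters because the finiteness of the family of
  invertible objects is itself proved with these projections.\<close>

lemma dsum_projections:
  assumes "dsum I U A e"
  obtains p where "\<And>i. i \<in> I \<Longrightarrow> hom (p i) A (U i)" "\<And>i. i \<in> I \<Longrightarrow> p i \<bullet> e i = ide (U i)"
    "\<And>i j. i \<in> I \<Longrightarrow> j \<in> I \<Longrightarrow> i \<noteq> j \<Longrightarrow> p i \<bullet> e j = zer (U j) (U i)"
proof -
  have "\<exists>p. hom p A (U i) \<and> (\<forall>j\<in>I. p \<bullet> e j = (if j = i then ide (U i) else zer (U j) (U i)))"
    if "i \<in> I" for i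
  proof -
    have "hom (if j = i then ide (U i) else zer (U j) (U i)) (U j) (U i)" if "j \<in> I" for j
      using that dsumD(3)[OF assms] \<open>i \<in> I\<close> by auto
    then show ?thesis
      using dsum_ex[OF assms dsumD(3)[OF assms that], of "\<lambda>j. if j = i then ide (U i) else zer (U j) (U i)"]
      by metis
  qed
  then obtain p where "\<And>i. i \<in> I \<Longrightarrow> hom (p i) A (U i) \<and>
      (\<forall>j\<in>I. p i \<bullet> e j = (if j = i then ide (U i) else zer (U j) (U i)))" by metis
  then show ?thesis using that[of p] by (metis (full_types))
qed

text \<open>The identity of a finite direct sum is the sum of the idempotents \<open>e i \<bullet> p i\<close>; this is
  phrased as an induction principle over additively closed sets of endomorphisms.\<close>

lemma dsum_ide_induct:
  assumes A: "dsum I U A e" and fin: "finite I"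
    and p: "\<And>i. i \<in> I \<Longrightarrow> hom (p i) A (U i)" "\<And>i. i \<in> I \<Longrightarrow> p i \<bullet> e i = ide (U i)"
      "\<And>i j. i \<in> I \<Longrightarrow> j \<in> I \<Longrightarrow> i \<noteq> j \<Longrightarrow> p i \<bullet> e j = zer (U j) (U i)"
    and zero: "P (zer A A)" and idem: "\<And>i. i \<in> I \<Longrightarrow> P (e i \<bullet> p i)"
    and add: "\<And>f g. hom f A A \<Longrightarrow> hom g A A \<Longrightarrow> P f \<Longrightarrow> P g \<Longrightarrow> P (pls f g)"
  shows "P (ide A)"
proof -
  note e = dsumD(2)[OF A] and oA = dsumD(1)[OF A]
  \<comment> \<open>The partial sum over \<open>F\<close> of the idempotents is the identity on the
    summands in \<open>F\<close> and zero on the others; for \<open>F = I\<close> joint epicness of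
    the injections makes it the identity of \<open>A\<close>.\<close>
  have "\<exists>g. hom g A A \<and> P g \<and> (\<forall>i\<in>I. g \<bullet> e i = (if i \<in> F then e i else zer (U i) A))"
    if "finite F" "F \<subseteq> I" for F
    using that
  proof (induction F)
    case empty
    show ?case using zero oA zer_cmp e by (intro exI[of _ "zer A A"]) auto
  next
    case (insert j F)
    then obtain g where g: "hom g A A" "P g"
      "\<And>i. i \<in> I \<Longrightarrow> g \<bullet> e i = (if i \<in> F then e i else zer (U i) A)" by auto
    have j: "j \<in> I" using insert by simp
    let ?h = "pls g (e j \<bullet> p j)"
    have ep: "hom (e j \<bullet> p j) A A" using e p j by blast
    have "?h \<bullet> e i = (if i \<in> insert j F then e i else zer (U i) A)" if i: "i \<in> I" for i
    proof -
      have 1: "?h \<bullet> e i = pls (g \<bullet> e i) (e j \<bullet> (p j \<bullet> e i))"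
        using pls_cmp[OF e[OF i] g(1) ep] by (simp add: cmp_assoc)
      show ?thesis
      proof (cases "i = j")
        case True
        then have "i \<notin> F" using insert by blast
        then show ?thesis using 1 g(3)[OF i] True p(2)[OF j] ide_right[OF e[OF j]] pls_zer[OF e[OF j]] by simp
      next
        case False
        then have "e j \<bullet> (p j \<bullet> e i) = zer (U i) A"
          using p(3)[OF j i] cmp_zer[OF hom_objs(1)[OF e[OF i]] e[OF j]] by simp
        then show ?thesis using 1 g(3)[OF i] False pls_zer[OF hom_cmp[OF e[OF i] g(1)]]
          by auto
      qed
    qed
    then show ?case using add[OF g(1) ep g(2) idem[OF j]] hom_pls[OF g(1) ep] by blast
  qed
  then obtain g where g: "hom g A A" "P g" "\<And>i. i \<in> I \<Longrightarrow> g \<bullet> e i = e i"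
    using fin by (metis order_refl)
  have "g = ide A" by (rule dsumD(4)[OF A g(1) hom_ide[OF oA]]) (use g e ide_left in metis)
  then show ?thesis using g by simp
qed

section \<open>Simple and semisimple objects, socles and radicals\<close>

text \<open>For a monic \<open>s\<close> the alternative \<open>zro s\<close> is equivalent to its
  source being a zero object, and it combines better with zero tests.\<close>

definition simple :: "'o \<Rightarrow> bool"
  where "simple X \<longleftrightarrow> X \<in> Obj C \<and> \<not> zob X \<and> (\<forall>s S. hom s S X \<longrightarrow> monic s \<longrightarrow> zro s \<or> isom s S X)"

lemma subobject_ar: "hom s S M \<Longrightarrow> monic s \<Longrightarrow> \<exists>f. s = ar S f M \<and> subobject C M (S, f)"
  using hom_arE hom_objs subobject_iff by (metis fst_conv snd_conv)

lemma is_simple_iff: "is_simple C X \<longleftrightarrow> simple X"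
proof
  assume a: "is_simple C X"
  show "simple X"
    unfolding simple_def
  proof (intro conjI allI impI)
    show X: "X \<in> Obj C" "\<not> zob X" using a unfolding is_simple_def zob_def by auto
    fix s S assume s: "hom s S X" "monic s"
    obtain f where f: "s = ar S f X" "subobject C X (S, f)" using subobject_ar[OF s] by blast
    then have "is_zero_obj C S \<or> is_iso C S X f" using a unfolding is_simple_def by force
    then show "zro s \<or> isom s S X"
      using f s from_zob is_iso_iff hom_objs unfolding zob_def by metis
  qed
next
  assume a: "simple X"
  then have X: "X \<in> Obj C" "\<not> is_zero_obj C X" unfolding simple_def zob_def by auto
  moreover have "is_zero_obj C (fst s) \<or> is_iso C (fst s) X (snd s)" if "subobject C X s" for s
  proof -
    have s: "hom (ar (fst s) (snd s) X) (fst s) X" "monic (ar (fst s) (snd s) X)"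
      using that X subobject_iff by auto
    then have "zro (ar (fst s) (snd s) X) \<or> isom (ar (fst s) (snd s) X) (fst s) X" using a simple_def by blast
    then show ?thesis using s zob_monic is_iso_iff hom_objs unfolding zob_def by metis
  qed
  ultimately show "is_simple C X" unfolding is_simple_def by blast
qed

definition semisimple :: "'o \<Rightarrow> bool"
  where "semisimple X \<longleftrightarrow> (\<exists>(n :: nat) U e. (\<forall>i<n. simple (U i)) \<and> dsum {..<n} U X e)"

lemma is_semisimple_iff: "is_semisimple C X \<longleftrightarrow> semisimple X"
  unfolding is_semisimple_def semisimple_def is_simple_iff
  using is_direct_sum_iff dsum_is_direct_sum by metis

lemma simple_obj: "simple X \<Longrightarrow> X \<in> Obj C"
  by (simp add: simple_def)

lemma simple_semisimple: assumes "simple X" shows "semisimple X"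
proof -
  have "dsum {..<1::nat} (\<lambda>_. X) X (\<lambda>_. ide X)"
    unfolding dsum_def
  proof (intro conjI allI impI ballI)
    show "X \<in> Obj C" "hom (ide X) X X" using assms simple_obj by auto
    fix Y f assume "Y \<in> Obj C" "\<forall>i\<in>{..<1::nat}. hom (f i) X Y"
    then show "\<exists>h. hom h X Y \<and> (\<forall>i\<in>{..<1::nat}. h \<bullet> ide X = f i)"
      using ide_right by (intro exI[of _ "f 0"]) auto
  next
    fix Y g h assume "hom g X Y" "hom h X Y" "\<forall>i\<in>{..<1::nat}. g \<bullet> ide X = h \<bullet> ide X"
    moreover have "g \<bullet> ide X = h \<bullet> ide X" using calculation(3) by simp
    ultimately show "g = h" using ide_right by metis
  qed
  then show ?thesis unfolding semisimple_def using assms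
    by (intro exI[of _ "1::nat"] exI[of _ "\<lambda>_. X"] exI[of _ "\<lambda>_. ide X"]) simp
qed

lemma zob_semisimple: assumes "zob X" shows "semisimple X"
proof -
  have "dsum {..<0::nat} (\<lambda>_. X) X (\<lambda>_. ide X)"
    unfolding dsum_def using assms zob_obj from_zob_eq by auto
  then show ?thesis unfolding semisimple_def by blast
qed

lemma simple_isom:
  assumes "simple X" "isom f X Y" shows "simple Y"
  unfolding simple_def
proof (intro conjI allI impI)
  show "Y \<in> Obj C" "\<not> zob Y" using assms isom_hom hom_objs zob_isom simple_def by metis+
  fix s S assume s: "hom s S Y" "monic s"
  obtain g where g: "isom g Y X" using isomE assms by blast
  have gs: "hom (g \<bullet> s) S X" "monic (g \<bullet> s)"
    using s g isom_hom isom_monic monic_cmp hom_cmp hom_not_None by metis+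
  then have "zro (g \<bullet> s) \<or> isom (g \<bullet> s) S X" using assms simple_def by blast
  then show "zro s \<or> isom s S Y" using isom_cancel_left[OF g s(1)] monic_zro isom_monic[OF g] by blast
qed

definition socle :: "'o \<Rightarrow> ('o, 'm) arrow \<Rightarrow> bool"
  where "socle M s \<longleftrightarrow> monic s \<and> (\<exists>S. hom s S M \<and> semisimple S) \<and>
    (\<forall>t T. hom t T M \<longrightarrow> monic t \<longrightarrow> semisimple T \<longrightarrow> (\<exists>h. t = s \<bullet> h))"

definition maximal_sub :: "'o \<Rightarrow> ('o, 'm) arrow \<Rightarrow> bool"
  where "maximal_sub M s \<longleftrightarrow> monic s \<and> (\<exists>S. hom s S M \<and> \<not> isom s S M) \<and>
    (\<forall>t T. hom t T M \<longrightarrow> monic t \<longrightarrow> (\<exists>h. s = t \<bullet> h) \<longrightarrow> (\<exists>h. t = s \<bullet> h) \<or> isom t T M)"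

definition radical :: "'o \<Rightarrow> ('o, 'm) arrow \<Rightarrow> bool"
  where "radical M r \<longleftrightarrow> monic r \<and> (\<exists>R. hom r R M) \<and>
    (\<forall>s. maximal_sub M s \<longrightarrow> (\<exists>h. r = s \<bullet> h)) \<and>
    (\<forall>t T. hom t T M \<longrightarrow> monic t \<longrightarrow> (\<forall>s. maximal_sub M s \<longrightarrow> (\<exists>h. t = s \<bullet> h)) \<longrightarrow> (\<exists>h. t = r \<bullet> h))"

abbreviation sub_ar :: "'o \<Rightarrow> 'o \<times> 'm \<Rightarrow> ('o, 'm) arrow"
  where "sub_ar M s \<equiv> ar (fst s) (snd s) M"

section \<open>Dictionary for socles, maximal subobjects, radicals, filtrations and
  subquotients\<close>

lemma is_socle_iff:
  assumes M: "M \<in> Obj C"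
  shows "is_socle C M s \<longleftrightarrow> hom (sub_ar M s) (fst s) M \<and> socle M (sub_ar M s)"
proof
  assume a: "is_socle C M s"
  then have s: "hom (sub_ar M s) (fst s) M" "monic (sub_ar M s)" "semisimple (fst s)"
    using subobject_iff[OF M] is_semisimple_iff unfolding is_socle_def by auto
  moreover have "\<exists>h. t = sub_ar M s \<bullet> h" if t: "hom t T M" "monic t" "semisimple T" for t T
  proof -
    obtain f where f: "t = ar T f M" "subobject C M (T, f)" using subobject_ar t by blast
    then have "sub_le C (T, f) s" using a t is_semisimple_iff unfolding is_socle_def by force
    then show ?thesis using sub_le_iff[of "(T, f)" M s] f t s by simp
  qed
  ultimately show "hom (sub_ar M s) (fst s) M \<and> socle M (sub_ar M s)" unfolding socle_def by blast
next
  assume a: "hom (sub_ar M s) (fst s) M \<and> socle M (sub_ar M s)"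
  have ss: "semisimple (fst s)" using a hom_unique unfolding socle_def by metis
  have "sub_le C t s" if t: "subobject C M t" "is_semisimple C (fst t)" for t
  proof -
    have h: "hom (sub_ar M t) (fst t) M" "monic (sub_ar M t)" using t M subobject_iff by auto
    then have "\<exists>h. sub_ar M t = sub_ar M s \<bullet> h" using a t is_semisimple_iff unfolding socle_def by blast
    then show ?thesis using sub_le_iff h a by blast
  qed
  then show "is_socle C M s"
    using a ss subobject_iff[OF M] is_semisimple_iff unfolding is_socle_def socle_def by blast
qed

lemma is_maximal_subobject_iff:
  assumes M: "M \<in> Obj C"
  shows "is_maximal_subobject C M s \<longleftrightarrow> hom (sub_ar M s) (fst s) M \<and> maximal_sub M (sub_ar M s)"
proof
  assume a: "is_maximal_subobject C M s"
  then have s: "hom (sub_ar M s) (fst s) M" "monic (sub_ar M s)"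
    using subobject_iff[OF M] unfolding is_maximal_subobject_def by auto
  then have "\<not> isom (sub_ar M s) (fst s) M"
    using a M is_iso_iff hom_objs unfolding is_maximal_subobject_def by blast
  moreover have "(\<exists>h. t = sub_ar M s \<bullet> h) \<or> isom t T M"
    if t: "hom t T M" "monic t" "\<exists>h. sub_ar M s = t \<bullet> h" for t T
  proof -
    obtain f where f: "t = ar T f M" "subobject C M (T, f)" using subobject_ar t by blast
    then have "sub_le C s (T, f)" using sub_le_iff[of s M "(T, f)"] t s by simp
    then have "sub_le C (T, f) s \<or> is_iso C T M f"
      using a f unfolding is_maximal_subobject_def by force
    then show ?thesis using sub_le_iff[of "(T, f)" M s] f t s M is_iso_iff hom_objs by (metis fst_conv snd_conv)
  qed
  ultimately show "hom (sub_ar M s) (fst s) M \<and> maximal_sub M (sub_ar M s)"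
    using s unfolding maximal_sub_def by blast
next
  assume a: "hom (sub_ar M s) (fst s) M \<and> maximal_sub M (sub_ar M s)"
  have ni: "\<not> isom (sub_ar M s) (fst s) M" using a hom_unique unfolding maximal_sub_def by metis
  have "sub_le C t s \<or> is_iso C (fst t) M (snd t)" if t: "subobject C M t" "sub_le C s t" for t
  proof -
    have h: "hom (sub_ar M t) (fst t) M" "monic (sub_ar M t)" using t M subobject_iff by auto
    then have "\<exists>h. sub_ar M s = sub_ar M t \<bullet> h" using sub_le_iff t a by blast
    then have "(\<exists>h. sub_ar M t = sub_ar M s \<bullet> h) \<or> isom (sub_ar M t) (fst t) M"
      using a h unfolding maximal_sub_def by blast
    then show ?thesis using sub_le_iff h a is_iso_iff hom_objs by meson
  qed
  then show "is_maximal_subobject C M s"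
    using a ni subobject_iff[OF M] is_iso_iff hom_objs unfolding is_maximal_subobject_def maximal_sub_def by meson
qed

lemma is_radical_iff:
  assumes M: "M \<in> Obj C"
  shows "is_radical C M r \<longleftrightarrow> hom (sub_ar M r) (fst r) M \<and> radical M (sub_ar M r)"
proof -
  have max: "(\<forall>s. is_maximal_subobject C M s \<longrightarrow> sub_le C t s) \<longleftrightarrow>
      (\<forall>s. maximal_sub M s \<longrightarrow> (\<exists>h. sub_ar M t = s \<bullet> h))" (is "?L t \<longleftrightarrow> ?R t")
    if t: "hom (sub_ar M t) (fst t) M" for t
  proof
    assume l: "?L t"
    show "?R t"
    proof (intro allI impI)
      fix s assume s: "maximal_sub M s"
      then obtain S where S: "hom s S M" "monic s" unfolding maximal_sub_def by blast
      obtain f where f: "s = ar S f M" "subobject C M (S, f)" using subobject_ar S by blast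
      then have "sub_le C t (S, f)" using l s is_maximal_subobject_iff[OF M, of "(S, f)"] S by simp
      then show "\<exists>h. sub_ar M t = s \<bullet> h" using sub_le_iff[of t M "(S, f)"] f S t by simp
    qed
  next
    assume r: "?R t"
    then show "?L t" using is_maximal_subobject_iff[OF M] sub_le_iff t by blast
  qed
  show ?thesis
  proof
    assume a: "is_radical C M r"
    then have r: "hom (sub_ar M r) (fst r) M" "monic (sub_ar M r)" "?R r"
      using subobject_iff[OF M] max unfolding is_radical_def by blast+
    moreover have "\<exists>h. t = sub_ar M r \<bullet> h"
      if t: "hom t T M" "monic t" "\<forall>s. maximal_sub M s \<longrightarrow> (\<exists>h. t = s \<bullet> h)" for t T
    proof -
      obtain f where f: "t = ar T f M" "subobject C M (T, f)" using subobject_ar t by blast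
      then have "?L (T, f)" using max[of "(T, f)"] t by simp
      then have "sub_le C (T, f) r" using a f unfolding is_radical_def by blast
      then show ?thesis using sub_le_iff[of "(T, f)" M r] f t r by simp
    qed
    ultimately show "hom (sub_ar M r) (fst r) M \<and> radical M (sub_ar M r)" unfolding radical_def by blast
  next
    assume a: "hom (sub_ar M r) (fst r) M \<and> radical M (sub_ar M r)"
    have "sub_le C t r" if t: "subobject C M t" "?L t" for t
    proof -
      have h: "hom (sub_ar M t) (fst t) M" "monic (sub_ar M t)" using t M subobject_iff by auto
      then have "?R t" using max t by blast
      then have "\<exists>h. sub_ar M t = sub_ar M r \<bullet> h" using a h unfolding radical_def by blast
      then show ?thesis using sub_le_iff h a by blast
    qed
    then show "is_radical C M r"
      using a subobject_iff[OF M] max unfolding is_radical_def radical_def by blast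
  qed
qed

text \<open>\<open>zro (\<sigma> 0)\<close> says that the bottom term is the zero subobject, because
  \<open>\<sigma> 0\<close> is monic. The arrow \<open>j\<close> is the inclusion of the layer above
  \<open>\<sigma> k\<close> into the quotient \<open>Q\<close>; that it is monic is part of
  \<open>socle Q j\<close>.\<close>

definition socle_filtration :: "'o \<Rightarrow> (nat \<Rightarrow> ('o, 'm) arrow) \<Rightarrow> bool"
  where "socle_filtration M \<sigma> \<longleftrightarrow> (\<forall>k. monic (\<sigma> k) \<and> (\<exists>S. hom (\<sigma> k) S M)) \<and> zro (\<sigma> 0) \<and>
    (\<forall>k. \<exists>q h p j Q. coker (\<sigma> k) q \<and> \<sigma> k = \<sigma> (Suc k) \<bullet> h \<and> coker h p \<and>
      j \<bullet> p = q \<bullet> \<sigma> (Suc k) \<and> hom q M Q \<and> socle Q j)"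

lemma is_socle_filtration_iff:
  assumes M: "M \<in> Obj C"
  shows "is_socle_filtration C M \<sigma> \<longleftrightarrow>
    (\<forall>k. hom (sub_ar M (\<sigma> k)) (fst (\<sigma> k)) M) \<and> socle_filtration M (\<lambda>k. sub_ar M (\<sigma> k))"
proof
  assume a: "is_socle_filtration C M \<sigma>"
  have s: "\<And>k. hom (sub_ar M (\<sigma> k)) (fst (\<sigma> k)) M" "\<And>k. monic (sub_ar M (\<sigma> k))"
    using a subobject_iff[OF M] unfolding is_socle_filtration_def by auto
  have "zro (sub_ar M (\<sigma> 0))" using a s from_zob unfolding is_socle_filtration_def zob_def by blast
  moreover have "\<exists>q h p j Q. coker (sub_ar M (\<sigma> k)) q \<and> sub_ar M (\<sigma> k) = sub_ar M (\<sigma> (Suc k)) \<bullet> h \<and>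
      coker h p \<and> j \<bullet> p = q \<bullet> sub_ar M (\<sigma> (Suc k)) \<and> hom q M Q \<and> socle Q j" for k
  proof -
    obtain Q q h L p j where f: "is_cokernel C (fst (\<sigma> k)) M (snd (\<sigma> k)) Q q"
       "h \<in> mor C (fst (\<sigma> k)) (fst (\<sigma> (Suc k)))" "snd (\<sigma> (Suc k)) \<cdot> h = snd (\<sigma> k)"
       "is_cokernel C (fst (\<sigma> k)) (fst (\<sigma> (Suc k))) h L p"
       "j \<in> mor C L Q" "j \<cdot> p = q \<cdot> snd (\<sigma> (Suc k))" "is_socle C Q (L, j)"
      using a unfolding is_socle_filtration_def by blast
    have o: "fst (\<sigma> k) \<in> Obj C" "fst (\<sigma> (Suc k)) \<in> Obj C" using s(1) hom_objs by blast+
    have 1: "hom (ar M q Q) M Q" "coker (sub_ar M (\<sigma> k)) (ar M q Q)"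
      using f(1) is_cokernel_iff o M by auto
    have 2: "hom (ar (fst (\<sigma> k)) h (fst (\<sigma> (Suc k)))) (fst (\<sigma> k)) (fst (\<sigma> (Suc k)))"
      using f(2) o hom_ar by blast
    have 3: "hom (ar (fst (\<sigma> (Suc k))) p L) (fst (\<sigma> (Suc k))) L"
        "coker (ar (fst (\<sigma> k)) h (fst (\<sigma> (Suc k)))) (ar (fst (\<sigma> (Suc k))) p L)"
      using f(4) is_cokernel_iff o by auto
    have 4: "hom (ar L j Q) L Q" using f(5) 1 3 hom_ar by blast
    have "sub_ar M (\<sigma> k) = sub_ar M (\<sigma> (Suc k)) \<bullet> ar (fst (\<sigma> k)) h (fst (\<sigma> (Suc k)))"
      using cmp_ar[OF 2 s(1)] f(3) by simp
    moreover have "ar L j Q \<bullet> ar (fst (\<sigma> (Suc k))) p L = ar M q Q \<bullet> sub_ar M (\<sigma> (Suc k))"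
      using cmp_ar[OF 3(1) 4] cmp_ar[OF s(1) 1(1)] f(6) by simp
    moreover have "socle Q (ar L j Q)" using is_socle_iff[of Q "(L, j)"] f(7) hom_objs(2)[OF 1(1)] by simp
    ultimately show ?thesis using 1 3 by blast
  qed
  ultimately show "(\<forall>k. hom (sub_ar M (\<sigma> k)) (fst (\<sigma> k)) M) \<and> socle_filtration M (\<lambda>k. sub_ar M (\<sigma> k))"
    unfolding socle_filtration_def using s by blast
next
  assume a: "(\<forall>k. hom (sub_ar M (\<sigma> k)) (fst (\<sigma> k)) M) \<and> socle_filtration M (\<lambda>k. sub_ar M (\<sigma> k))"
  have s: "\<And>k. hom (sub_ar M (\<sigma> k)) (fst (\<sigma> k)) M" "\<And>k. monic (sub_ar M (\<sigma> k))"
    using a unfolding socle_filtration_def by blast+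
  have o: "fst (\<sigma> k) \<in> Obj C" for k using s(1) hom_objs by blast
  have "\<exists>Q q h L p j.
       is_cokernel C (fst (\<sigma> k)) M (snd (\<sigma> k)) Q q \<and>
       h \<in> mor C (fst (\<sigma> k)) (fst (\<sigma> (Suc k))) \<and> snd (\<sigma> (Suc k)) \<cdot> h = snd (\<sigma> k) \<and>
       is_cokernel C (fst (\<sigma> k)) (fst (\<sigma> (Suc k))) h L p \<and>
       j \<in> mor C L Q \<and> j \<cdot> p = q \<cdot> snd (\<sigma> (Suc k)) \<and>
       is_socle C Q (L, j)" for k
  proof -
    obtain q h p j Q where f: "coker (sub_ar M (\<sigma> k)) q" "sub_ar M (\<sigma> k) = sub_ar M (\<sigma> (Suc k)) \<bullet> h"
      "coker h p" "j \<bullet> p = q \<bullet> sub_ar M (\<sigma> (Suc k))" "hom q M Q" "socle Q j"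
      using a unfolding socle_filtration_def by blast
    have h: "hom h (fst (\<sigma> k)) (fst (\<sigma> (Suc k)))" using f(2) s hom_cmpE hom_unique by metis
    obtain L where p: "hom p (fst (\<sigma> (Suc k))) L" using cokerD(2)[OF f(3) h] by blast
    have j: "hom j L Q" using f(4) hom_cmp[OF s(1) f(5)] p hom_cmpE hom_unique by metis
    obtain q' h' p' j' where r: "q = ar M q' Q" "h = ar (fst (\<sigma> k)) h' (fst (\<sigma> (Suc k)))"
      "p = ar (fst (\<sigma> (Suc k))) p' L" "j = ar L j' Q" using f(5) h p j hom_arE by metis
    have "is_cokernel C (fst (\<sigma> k)) M (snd (\<sigma> k)) Q q'"
      using is_cokernel_iff[OF o M] s f r by blast
    moreover have "h' \<in> mor C (fst (\<sigma> k)) (fst (\<sigma> (Suc k)))" using h r hom_ar by blast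
    moreover have "snd (\<sigma> (Suc k)) \<cdot> h' = snd (\<sigma> k)" using f(2) r h s cmp_ar_eq_iff by metis
    moreover have "is_cokernel C (fst (\<sigma> k)) (fst (\<sigma> (Suc k))) h' L p'"
      using is_cokernel_iff[OF o o] h p f(3) r by blast
    moreover have "j' \<in> mor C L Q" using j r hom_ar by blast
    moreover have "j' \<cdot> p' = q' \<cdot> snd (\<sigma> (Suc k))"
      using f(4,5) r j p s cmp_ar_eq_iff cmp_ar by metis
    moreover have "is_socle C Q (L, j')" using is_socle_iff[of Q "(L, j')"] hom_objs(2)[OF f(5)] f(6) j r by simp
    ultimately show ?thesis by blast
  qed
  moreover have "is_zero_obj C (fst (\<sigma> 0))"
    using a zob_monic[OF s(2) s(1)] unfolding socle_filtration_def zob_def by blast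
  ultimately show "is_socle_filtration C M \<sigma>"
    unfolding is_socle_filtration_def using s subobject_iff[OF M] by blast
qed

definition radical_filtration :: "'o \<Rightarrow> (nat \<Rightarrow> ('o, 'm) arrow) \<Rightarrow> bool"
  where "radical_filtration M \<rho> \<longleftrightarrow> (\<forall>k. monic (\<rho> k)) \<and> (\<exists>R. isom (\<rho> 0) R M) \<and>
    (\<forall>k. \<exists>r R. hom (\<rho> k) R M \<and> radical R r \<and> \<rho> (Suc k) = \<rho> k \<bullet> r)"

lemma is_radical_filtration_iff:
  assumes M: "M \<in> Obj C"
  shows "is_radical_filtration C M \<rho> \<longleftrightarrow>
    (\<forall>k. hom (sub_ar M (\<rho> k)) (fst (\<rho> k)) M) \<and> radical_filtration M (\<lambda>k. sub_ar M (\<rho> k))"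
proof
  assume a: "is_radical_filtration C M \<rho>"
  have s: "\<And>k. hom (sub_ar M (\<rho> k)) (fst (\<rho> k)) M" "\<And>k. monic (sub_ar M (\<rho> k))"
    using a subobject_iff[OF M] unfolding is_radical_filtration_def by auto
  have o: "fst (\<rho> k) \<in> Obj C" for k using s(1) hom_objs by blast
  have "isom (sub_ar M (\<rho> 0)) (fst (\<rho> 0)) M"
    using a is_iso_iff[OF o M] unfolding is_radical_filtration_def by blast
  moreover have "\<exists>r. radical (fst (\<rho> k)) r \<and> sub_ar M (\<rho> (Suc k)) = sub_ar M (\<rho> k) \<bullet> r" for k
  proof -
    obtain r where r: "is_radical C (fst (\<rho> k)) (fst (\<rho> (Suc k)), r)" "snd (\<rho> (Suc k)) = snd (\<rho> k) \<cdot> r"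
      using a unfolding is_radical_filtration_def by blast
    have 1: "hom (ar (fst (\<rho> (Suc k))) r (fst (\<rho> k))) (fst (\<rho> (Suc k))) (fst (\<rho> k))"
      "radical (fst (\<rho> k)) (ar (fst (\<rho> (Suc k))) r (fst (\<rho> k)))"
      using r is_radical_iff[OF o, of k "(fst (\<rho> (Suc k)), r)"] by auto
    then show ?thesis using cmp_ar[OF 1(1) s(1)] r by auto
  qed
  ultimately show "(\<forall>k. hom (sub_ar M (\<rho> k)) (fst (\<rho> k)) M) \<and> radical_filtration M (\<lambda>k. sub_ar M (\<rho> k))"
    unfolding radical_filtration_def using s by blast
next
  assume a: "(\<forall>k. hom (sub_ar M (\<rho> k)) (fst (\<rho> k)) M) \<and> radical_filtration M (\<lambda>k. sub_ar M (\<rho> k))"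
  have s: "\<And>k. hom (sub_ar M (\<rho> k)) (fst (\<rho> k)) M" "\<And>k. monic (sub_ar M (\<rho> k))"
    using a unfolding radical_filtration_def by blast+
  have o: "fst (\<rho> k) \<in> Obj C" for k using s(1) hom_objs by blast
  have "is_iso C (fst (\<rho> 0)) M (snd (\<rho> 0))"
    using a is_iso_iff[OF o M] isom_hom hom_unique unfolding radical_filtration_def by metis
  moreover have "\<exists>r. is_radical C (fst (\<rho> k)) (fst (\<rho> (Suc k)), r) \<and> snd (\<rho> (Suc k)) = snd (\<rho> k) \<cdot> r" for k
  proof -
    obtain r R where r: "hom (sub_ar M (\<rho> k)) R M" "radical R r" "sub_ar M (\<rho> (Suc k)) = sub_ar M (\<rho> k) \<bullet> r"
      using a unfolding radical_filtration_def by blast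
    then have R: "R = fst (\<rho> k)" using s hom_unique by metis
    have rh: "hom r (fst (\<rho> (Suc k))) (fst (\<rho> k))" using r(3) s hom_cmpE hom_unique by metis
    then obtain r' where r': "r = ar (fst (\<rho> (Suc k))) r' (fst (\<rho> k))" using hom_arE by metis
    have "snd (\<rho> (Suc k)) = snd (\<rho> k) \<cdot> r'" using r(3) r' rh s cmp_ar_eq_iff by metis
    moreover have "is_radical C (fst (\<rho> k)) (fst (\<rho> (Suc k)), r')"
      using is_radical_iff[OF o, of k "(fst (\<rho> (Suc k)), r')"] r R rh r' by simp
    ultimately show ?thesis by blast
  qed
  ultimately show "is_radical_filtration C M \<rho>"
    unfolding is_radical_filtration_def using s subobject_iff[OF M] by blast
qed

lemma sub_quotient_iff:
  assumes s: "hom (sub_ar M s) (fst s) M" and t: "hom (sub_ar M t) (fst t) M"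
  shows "sub_quotient C s t Q \<longleftrightarrow> (\<exists>h p. sub_ar M s = sub_ar M t \<bullet> h \<and> coker h p \<and> hom p (fst t) Q)"
proof
  assume "sub_quotient C s t Q"
  then obtain h q where h: "h \<in> mor C (fst s) (fst t)" "snd t \<cdot> h = snd s" "is_cokernel C (fst s) (fst t) h Q q"
    unfolding sub_quotient_def by blast
  have o: "fst s \<in> Obj C" "fst t \<in> Obj C" using s t hom_objs by auto
  have hh: "hom (ar (fst s) h (fst t)) (fst s) (fst t)" using h o hom_ar by blast
  then have "sub_ar M s = sub_ar M t \<bullet> ar (fst s) h (fst t)" using h t cmp_ar by metis
  then show "\<exists>h p. sub_ar M s = sub_ar M t \<bullet> h \<and> coker h p \<and> hom p (fst t) Q"
    using h is_cokernel_iff[OF o] by blast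
next
  assume "\<exists>h p. sub_ar M s = sub_ar M t \<bullet> h \<and> coker h p \<and> hom p (fst t) Q"
  then obtain h p where h: "sub_ar M s = sub_ar M t \<bullet> h" "coker h p" "hom p (fst t) Q" by blast
  have hh: "hom h (fst s) (fst t)" using h s t hom_cmpE hom_unique by metis
  have o: "fst s \<in> Obj C" "fst t \<in> Obj C" using s t hom_objs by auto
  obtain h' p' where h': "h = ar (fst s) h' (fst t)" "h' \<in> mor C (fst s) (fst t)" "p = ar (fst t) p' Q"
    using hh h hom_arE by metis
  have "snd t \<cdot> h' = snd s" using h h' hh t cmp_ar_eq_iff by metis
  moreover have "is_cokernel C (fst s) (fst t) h' Q p'" using is_cokernel_iff[OF o] h h' hh by blast
  ultimately show "sub_quotient C s t Q" unfolding sub_quotient_def using h' by blast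
qed

end

section \<open>Categories with kernels, cokernels and normal monomorphisms and epimorphisms\<close>

text \<open>An abelian category without the existence of direct sums: this is all that is needed of the
  category of modules over the algebra.\<close>

locale normal_category = linear_category K C
  for K :: "('k, 'x) ring_scheme" and C :: "('o, 'm, 'k, 'z) lin_cat_scheme" (structure) +
  assumes ex_kern: "hom f X Y \<Longrightarrow> \<exists>k. kern f k"
    and ex_coker: "hom f X Y \<Longrightarrow> \<exists>q. coker f q"
    and monic_kern: "hom f X Y \<Longrightarrow> monic f \<Longrightarrow> \<exists>g. kern g f"
    and epic_coker: "hom f X Y \<Longrightarrow> epic f \<Longrightarrow> \<exists>g. coker g f"

sublocale abelian_category \<subseteq> normal_category
proof
  show "\<exists>k. kern f k" if h: "hom f X Y" for f X Y
  proof -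
    obtain f' where f: "f = ar X f' Y" "f' \<in> mor C X Y" using h hom_arE by blast
    then show ?thesis using ex_kernel[of X Y f'] is_kernel_iff[of X Y f'] hom_objs[OF h] by blast
  qed
  show "\<exists>q. coker f q" if h: "hom f X Y" for f X Y
  proof -
    obtain f' where f: "f = ar X f' Y" "f' \<in> mor C X Y" using h hom_arE by blast
    then show ?thesis using ex_cokernel[of X Y f'] is_cokernel_iff[of X Y f'] hom_objs[OF h] by blast
  qed
  show "\<exists>g. kern g f" if h: "hom f X Y" "monic f" for f X Y
  proof -
    obtain f' where f: "f = ar X f' Y" using h hom_arE by blast
    have o: "X \<in> Obj C" "Y \<in> Obj C" using h hom_objs by auto
    then have "is_mono C X Y f'" using h f is_mono_iff by blast
    then obtain Z g where "Z \<in> Obj C" "is_kernel C Y Z g X f'" using mono_is_kernel o by blast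
    then show ?thesis using is_kernel_iff[of Y Z g X f'] o f by blast
  qed
  show "\<exists>g. coker g f" if h: "hom f X Y" "epic f" for f X Y
  proof -
    obtain f' where f: "f = ar X f' Y" using h hom_arE by blast
    have o: "X \<in> Obj C" "Y \<in> Obj C" using h hom_objs by auto
    then have "is_epi C X Y f'" using h f is_epi_iff by blast
    then obtain Z g where "Z \<in> Obj C" "is_cokernel C Z X g Y f'" using epi_is_cokernel o by blast
    then show ?thesis using is_cokernel_iff[of Z X g Y f'] o f by blast
  qed
qed

context normal_category
begin

text \<open>Some \<open>g\<close> has kernel \<open>f\<close> by normality. As \<open>g\<close>
  kills \<open>f\<close>, it factors through the cokernel \<open>q\<close>; so whatever
  \<open>q\<close> kills is killed by \<open>g\<close> and factors through \<open>f\<close>.\<close>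

lemma kern_of_coker:
  assumes "monic f" "hom f X Y" "coker f q" shows "kern q f"
proof -
  obtain g where g: "kern g f" using monic_kern assms by blast
  then have "zro (g \<bullet> f)" using kern_def by blast
  then obtain u where u: "g = u \<bullet> q" using assms(3) coker_def by blast
  have "\<exists>v. w = f \<bullet> v" if w: "zro (q \<bullet> w)" for w
  proof -
    have "u \<bullet> (q \<bullet> f) \<noteq> None" using \<open>zro (g \<bullet> f)\<close> u unfolding zro_def by (auto simp: cmp_assoc hom_def)
    then obtain Y' Q Z where uq: "hom q Y' Q" "hom u Q Z" by (metis cmp_None hom_cmpE)
    obtain W where "hom w W Y'" using zro_cmp_dom[OF w uq(1)] .
    then have "zro (u \<bullet> (q \<bullet> w))" using zro_cmp_hom[OF hom_cmp uq(2)] uq w by blast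
    then have "zro (g \<bullet> w)" using u by (simp add: cmp_assoc)
    then show ?thesis using g kern_def by blast
  qed
  then show ?thesis using assms unfolding kern_def coker_def by blast
qed

lemma coker_of_kern:
  assumes "epic f" "hom f X Y" "kern f k" shows "coker k f"
proof -
  obtain g where g: "coker g f" using epic_coker assms by blast
  then have "zro (f \<bullet> g)" using coker_def by blast
  then obtain u where u: "g = k \<bullet> u" using assms(3) kern_def by blast
  have "\<exists>v. w = v \<bullet> f" if w: "zro (w \<bullet> k)" for w
  proof -
    have "f \<bullet> (k \<bullet> u) \<noteq> None" using \<open>zro (f \<bullet> g)\<close> u unfolding zro_def by (auto simp: cmp_assoc hom_def)
    then obtain Y' Q Z where uq: "hom k Y' Q" "hom u Z Y'" by (metis cmp_None hom_cmpE)
    obtain W where "hom w Q W" using zro_cmp_cod[OF w uq(1)] .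
    then have "zro ((w \<bullet> k) \<bullet> u)" using zro_cmp_hom[OF uq(2) hom_cmp] uq w by blast
    then have "zro (w \<bullet> g)" using u by (simp add: cmp_assoc)
    then show ?thesis using g coker_def by blast
  qed
  then show ?thesis using assms unfolding kern_def coker_def by blast
qed

lemma epic_of_zro_coker:
  assumes "hom f X Y" "coker f q" "zro q" shows "epic f"
proof (rule epicI[OF assms(1)])
  fix W w assume w: "hom w Y W" "zro (w \<bullet> f)"
  then obtain u where u: "w = u \<bullet> q" using assms coker_def by blast
  then show "zro w" using zro_cmp_right[OF assms(3)] w hom_not_None by metis
qed

lemma monic_of_zro_kern:
  assumes "hom f X Y" "kern f k" "zro k" shows "monic f"
proof (rule monicI[OF assms(1)])
  fix W w assume w: "hom w W X" "zro (f \<bullet> w)"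
  then obtain u where u: "w = k \<bullet> u" using assms kern_def by blast
  then show "zro w" using zro_cmp_left[OF assms(3)] w hom_not_None by metis
qed

text \<open>The cokernel of an epimorphism is zero, so it kills \<open>ide Y\<close>; as
  \<open>f\<close> is the kernel of its cokernel, \<open>ide Y\<close> factors through
  \<open>f\<close>.\<close>

lemma monic_epic_isom:
  assumes "monic f" "epic f" "hom f X Y" shows "isom f X Y"
proof -
  obtain q where q: "coker f q" using ex_coker assms by blast
  then have z: "zro q" using epic_zro assms coker_def by blast
  obtain Q where "hom q Y Q" using cokerD(2)[OF q assms(3)] by blast
  then have "q \<bullet> ide Y = q" using ide_right by blast
  then have "zro (q \<bullet> ide Y)" using z by simp
  then obtain u where "ide Y = f \<bullet> u" using kern_of_coker[OF assms(1,3) q] kern_def by blast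
  then show ?thesis using monic_section_isom assms by metis
qed

text \<open>The image \<open>m\<close> is the kernel of the cokernel of \<open>f\<close>. To see
  that \<open>e\<close> is epic, let \<open>k\<close> be the kernel of the cokernel of
  \<open>e\<close>, so that \<open>f\<close> factors through the smaller subobject
  \<open>m \<bullet> k\<close>. The cokernel of \<open>m \<bullet> k\<close> kills \<open>f\<close>,
  hence also \<open>m\<close>; so \<open>m\<close> factors through \<open>m \<bullet> k\<close> and
  \<open>k\<close> is a split epimorphism.\<close>

lemma image_factorization:
  assumes f: "hom f X Y"
  obtains J e m where "hom e X J" "epic e" "hom m J Y" "monic m" "f = m \<bullet> e"
proof -
  obtain c where c: "coker f c" using ex_coker f by blast
  obtain Q where cQ: "hom c Y Q" using cokerD(2)[OF c f] by blast
  obtain m where m: "kern c m" using ex_kern cQ by blast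
  obtain J where mJ: "hom m J Y" "monic m" using kernD[OF m cQ] by blast
  have "zro (c \<bullet> f)" using c coker_def by blast
  then obtain e where e: "f = m \<bullet> e" using m kern_def by blast
  then have eJ: "hom e X J" using f mJ hom_cmpE hom_unique by metis
  obtain d where d: "coker e d" using ex_coker eJ by blast
  obtain D where dD: "hom d J D" using cokerD(2)[OF d eJ] by blast
  obtain k where k: "kern d k" using ex_kern dD by blast
  obtain L where kL: "hom k L J" "monic k" using kernD[OF k dD] by blast
  have "zro (d \<bullet> e)" using d coker_def by blast
  then obtain e' where e': "e = k \<bullet> e'" using k kern_def by blast
  have mk: "hom (m \<bullet> k) L Y" "monic (m \<bullet> k)" using mJ kL monic_cmp hom_cmp hom_not_None by metis+
  obtain c' where c': "coker (m \<bullet> k) c'" using ex_coker mk by blast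
  obtain Q' where cQ': "hom c' Y Q'" using cokerD(2)[OF c' mk(1)] by blast
  have e'L: "hom e' X L" using e' eJ kL hom_cmpE hom_unique by metis
  have "zro (c' \<bullet> ((m \<bullet> k) \<bullet> e'))"
    using zro_cmp_hom[OF e'L hom_cmp[OF mk(1) cQ']] c' unfolding coker_def by (simp add: cmp_assoc)
  then have "zro (c' \<bullet> f)" using e e' by (simp add: cmp_assoc)
  then obtain z where z: "c' = z \<bullet> c" using c coker_def by blast
  then have zQ: "hom z Q Q'" using cQ cQ' hom_cmpE hom_unique by metis
  have "zro (z \<bullet> (c \<bullet> m))" using zro_cmp_hom[OF hom_cmp[OF mJ(1) cQ] zQ] m kern_def by blast
  then have "zro (c' \<bullet> m)" using z by (simp add: cmp_assoc)
  then obtain w where w: "m = (m \<bullet> k) \<bullet> w" using kern_of_coker[OF mk(2,1) c'] kern_def by blast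
  have J: "J \<in> Obj C" using mJ hom_objs by blast
  have kw: "hom (k \<bullet> w) J J" using w mJ hom_cmpE hom_unique cmp_assoc by metis
  have "m \<bullet> (k \<bullet> w) = m \<bullet> ide J" using w mJ ide_right cmp_assoc by metis
  then have "k \<bullet> w = ide J" using monicD[OF mJ(2,1) kw] by blast
  then have ke: "epic k" using epic_cancel epic_ide J by metis
  have "zro (d \<bullet> k)" using k kern_def by blast
  then have "zro d" using epic_zro ke by blast
  then have "epic e" using epic_of_zro_coker eJ d by blast
  then show ?thesis using that eJ mJ e by blast
qed

text \<open>The standard comparison of two extensions: \<open>S\<close> contains the kernel of
  \<open>y\<close> and has the same image under \<open>y\<close> as \<open>S'\<close>. The cokernel
  \<open>r\<close> of \<open>i\<close> kills the kernel of \<open>y\<close>, so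
  \<open>r = r' \<bullet> y\<close>; then \<open>r'\<close> kills the epic
  \<open>y \<bullet> i\<close> and vanishes.\<close>

lemma epic_of_same_extension:
  assumes i: "hom i S S'" and y: "hom y S' L" and e: "epic (y \<bullet> i)" and k: "kern y k" "k = i \<bullet> h"
  shows "epic i"
proof -
  obtain r where r: "coker i r" using ex_coker i by blast
  obtain R where rR: "hom r S' R" "zro (r \<bullet> i)" using cokerD[OF r i] by blast
  have ye: "epic y" using epic_cancel e by blast
  have ck: "coker k y" using coker_of_kern[OF ye y k(1)] .
  obtain N where N: "hom k N S'" using kernD(2)[OF k(1) y] by blast
  then have h: "hom h N S" using k(2) i hom_cmpE hom_unique by metis
  have "zro ((r \<bullet> i) \<bullet> h)" using zro_cmp_hom[OF h hom_cmp[OF i rR(1)]] rR by blast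
  then have "zro (r \<bullet> k)" using k by (simp add: cmp_assoc)
  then obtain r' where r': "r = r' \<bullet> y" using ck coker_def by blast
  have "zro (r' \<bullet> (y \<bullet> i))" using rR r' by (simp add: cmp_assoc)
  then have r'z: "zro r'" using epic_zro e by blast
  have "zro r" using zro_cmp_left[OF r'z] r' rR(1) hom_not_None by metis
  then show ?thesis using epic_of_zro_coker i r by blast
qed

lemma zro_if_factors:
  assumes "kern f k" "hom f X Y" "w = k \<bullet> u" "w \<noteq> None" shows "zro (f \<bullet> w)"
proof -
  obtain N where N: "hom k N X" "zro (f \<bullet> k)" using kernD[OF assms(1,2)] by blast
  obtain W where "hom u W N" using assms N cmp_None hom_unique by metis
  then show ?thesis using zro_cmp_hom[OF _ hom_cmp[OF N(1) assms(2)]] N assms(3) by (simp add: cmp_assoc)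
qed

text \<open>The kernel of the composite of \<open>s\<close> with the cokernel of \<open>t\<close>;
  no pullbacks are constructed separately.\<close>

lemma intersection:
  assumes s: "hom s S M" "monic s" and t: "hom t T M" "monic t"
  obtains p P a where "hom p P M" "monic p" "p = s \<bullet> a" "hom a P S" "monic a" "\<exists>b. p = t \<bullet> b"
    "\<And>w u v. w \<noteq> None \<Longrightarrow> w = s \<bullet> u \<Longrightarrow> w = t \<bullet> v \<Longrightarrow> \<exists>z. w = p \<bullet> z"
proof -
  obtain q where q: "coker t q" using ex_coker t by blast
  obtain Q where qQ: "hom q M Q" using cokerD(2)[OF q t(1)] by blast
  have kt: "kern q t" using kern_of_coker[OF t(2,1) q] .
  obtain k where k: "kern (q \<bullet> s) k" using ex_kern[OF hom_cmp[OF s(1) qQ]] by blast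
  obtain P where kP: "hom k P S" "monic k" "zro ((q \<bullet> s) \<bullet> k)" using kernD[OF k hom_cmp[OF s(1) qQ]] by blast
  show ?thesis
  proof (rule that[of "s \<bullet> k" P k])
    show "hom (s \<bullet> k) P M" using s kP by blast
    then show "monic (s \<bullet> k)" using monic_cmp s kP hom_not_None by blast
    show "\<exists>b. s \<bullet> k = t \<bullet> b" using kP(3) kt unfolding kern_def by (simp add: cmp_assoc)
    fix w u v assume w: "w \<noteq> None" "w = s \<bullet> u" "w = t \<bullet> v"
    have "zro (q \<bullet> w)" using zro_if_factors[OF kt qQ w(3,1)] .
    then have "zro ((q \<bullet> s) \<bullet> u)" using w by (simp add: cmp_assoc)
    then obtain z where "u = k \<bullet> z" using k kern_def by blast
    then show "\<exists>z. w = (s \<bullet> k) \<bullet> z" using w by (auto simp: cmp_assoc)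
  qed (use kP in auto)
qed

section \<open>Schur's lemma, maximal subobjects and radicals\<close>

lemma simple_epic:
  assumes "simple T" "hom f X T" "\<not> zro f" shows "epic f"
proof -
  obtain J e m where 1: "hom e X J" "epic e" "hom m J T" "monic m" "f = m \<bullet> e"
    using image_factorization[OF assms(2)] .
  have "\<not> zro m" using 1 zro_cmp_left assms hom_not_None by metis
  then have "isom m J T" using 1 assms simple_def by blast
  then show ?thesis using 1 epic_cmp isom_epic assms hom_not_None by metis
qed

lemma simple_monic:
  assumes "simple T" "hom f T Y" "\<not> zro f" shows "monic f"
proof -
  obtain k where k: "kern f k" using ex_kern assms by blast
  obtain N where kN: "hom k N T" "monic k" "zro (f \<bullet> k)" using kernD[OF k assms(2)] by blast
  have "\<not> isom k N T" using epic_zro isom_epic kN assms(3) by blast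
  then have "zro k" using kN assms(1) simple_def by blast
  then show ?thesis using monic_of_zro_kern assms k by blast
qed

lemma simple_isom_of_nonzero:
  assumes "simple S" "simple T" "hom f S T" "\<not> zro f" shows "isom f S T"
  using simple_epic[OF assms(2,3,4)] simple_monic[OF assms(1,3,4)] monic_epic_isom assms by blast

lemma isom_of_epic_to_simple:
  assumes "simple S" "\<not> zob T" "hom f S T" "epic f" shows "isom f S T"
  using simple_monic[OF assms(1,3)] zob_epic assms monic_epic_isom by blast

text \<open>A subobject containing the kernel of \<open>q\<close> either is killed by
  \<open>q\<close>, hence equals the kernel, or maps onto the simple \<open>T\<close>, hence is
  everything by \<open>epic_of_same_extension\<close>.\<close>

lemma maximal_sub_kern:
  assumes q: "hom q M T" "epic q" and T: "simple T" and s: "kern q s"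
  shows "maximal_sub M s"
  unfolding maximal_sub_def
proof (intro conjI allI impI)
  obtain S where S: "hom s S M" "monic s" "zro (q \<bullet> s)" using kernD[OF s q(1)] by blast
  show "monic s" by fact
  have "\<not> isom s S M" using S isom_epic epic_zro zob_epic q T simple_def by metis
  then show "\<exists>S. hom s S M \<and> \<not> isom s S M" using S by blast
  fix t T' assume t: "hom t T' M" "monic t" "\<exists>h. s = t \<bullet> h"
  show "(\<exists>h. t = s \<bullet> h) \<or> isom t T' M"
  proof (cases "zro (q \<bullet> t)")
    case True then show ?thesis using s kern_def by blast
  next
    case False
    then have "epic (q \<bullet> t)" using simple_epic T hom_cmp t q by blast
    then have "epic t" using epic_of_same_extension t q s by blast
    then show ?thesis using monic_epic_isom t by blast
  qed
qed

text \<open>Subobjects of the quotient are compared with their preimages in \<open>M\<close>: the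
  preimage of \<open>j\<close> is \<open>k\<close>, the kernel of \<open>c \<bullet> q\<close>. It
  contains \<open>s\<close>, so maximality leaves two cases.\<close>

lemma maximal_sub_simple_coker:
  assumes s: "maximal_sub M s" and q: "coker s q" "hom q M Q"
  shows "simple Q"
  unfolding simple_def
proof (intro conjI allI impI)
  obtain S where S: "hom s S M" "monic s" "\<not> isom s S M" using s maximal_sub_def by blast
  show Q: "Q \<in> Obj C" using q hom_objs by blast
  have qe: "epic q" using q coker_def by blast
  show "\<not> zob Q"
  proof
    assume "zob Q"
    then have "zro q" using to_zob q by blast
    then show False using epic_of_zro_coker[OF S(1) q(1)] monic_epic_isom S by blast
  qed
  fix j J assume j: "hom j J Q" "monic j"
  obtain c where c: "coker j c" using ex_coker j by blast
  obtain R where cR: "hom c Q R" "epic c" "zro (c \<bullet> j)" using cokerD[OF c j(1)] by blast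
  have kj: "kern c j" using kern_of_coker[OF j(2,1) c] .
  have cq: "hom (c \<bullet> q) M R" "epic (c \<bullet> q)" using epic_cmp cR q qe hom_cmp hom_not_None by metis+
  obtain k where k: "kern (c \<bullet> q) k" using ex_kern cq by blast
  obtain P where kP: "hom k P M" "monic k" "zro ((c \<bullet> q) \<bullet> k)" using kernD[OF k cq(1)] by blast
  have qs: "zro (q \<bullet> s)" using q coker_def by blast
  have "zro ((c \<bullet> q) \<bullet> s)" using zro_cmp_hom[OF hom_cmp[OF S(1) q(2)] cR(1)] qs by (simp add: cmp_assoc)
  then have "\<exists>h. s = k \<bullet> h" using k kern_def by blast
  then consider "isom k P M" | "\<exists>h. k = s \<bullet> h" using s kP unfolding maximal_sub_def by blast
  then show "zro j \<or> isom j J Q"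
  proof cases
    case 1
    \<comment> \<open>The preimage is all of \<open>M\<close>: the cokernel of \<open>j\<close>
      vanishes and \<open>j\<close> is everything.\<close>
    then have "zro (c \<bullet> q)" using kP epic_zro isom_epic by blast
    then have "zro c" using epic_zro qe by blast
    then show ?thesis using epic_of_zro_coker[OF j(1) c] monic_epic_isom j by blast
  next
    case 2
    \<comment> \<open>The preimage is \<open>s\<close>: then \<open>q\<close> factors through
      \<open>c \<bullet> q\<close>, so \<open>c\<close> is a split monomorphism, and as it kills
      \<open>j\<close> this forces \<open>j\<close> to vanish.\<close>
    then obtain h where h: "k = s \<bullet> h" by blast
    have "zro (q \<bullet> k)"
      using zro_if_factors[OF kern_of_coker[OF S(2,1) q(1)] q(2) h] kP hom_not_None by blast
    then obtain z where z: "q = z \<bullet> (c \<bullet> q)" using coker_of_kern[OF cq(2,1) k] coker_def by blast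
    have zh: "hom z R Q" using z q cq hom_cmpE hom_unique by metis
    have "(z \<bullet> c) \<bullet> q = ide Q \<bullet> q" using z q ide_left by (metis cmp_assoc)
    then have "z \<bullet> c = ide Q" using epicD[OF qe q(2) hom_cmp[OF cR(1) zh]] by blast
    then have "monic c" using monic_cancel monic_ide Q by metis
    then show ?thesis using monic_zro cR by blast
  qed
qed

text \<open>A nonzero arrow to a simple object is epic with maximal kernel, and the radical lies in
  that kernel.\<close>

lemma radical_zro:
  assumes "radical M r" "hom f M T" "simple T" shows "zro (f \<bullet> r)"
proof (cases "zro f")
  case True
  obtain R where "hom r R M" using assms(1) radical_def by blast
  then show ?thesis using True zro_cmp_hom assms by blast
next
  case False
  then have e: "epic f" using simple_epic assms by blast
  obtain k where k: "kern f k" using ex_kern assms by blast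
  then have "maximal_sub M k" using maximal_sub_kern assms e by blast
  then obtain h where h: "r = k \<bullet> h" using assms(1) radical_def by blast
  then show ?thesis using zro_if_factors[OF k assms(2) h] assms(1) hom_not_None unfolding radical_def by blast
qed

text \<open>Composition with \<open>f\<close> and with its inverse matches the maximal subobjects of
  \<open>M\<close> with those of \<open>M'\<close>. Both directions occur: one for being a lower
  bound, the other for being the greatest.\<close>

lemma radical_isom:
  assumes r: "radical M r" and f: "isom f M M'" shows "radical M' (f \<bullet> r)"
proof -
  obtain g where g: "isom g M' M" "g \<bullet> f = ide M" "f \<bullet> g = ide M'" using isomE f by metis
  have trans: "maximal_sub M (g \<bullet> s)" if s: "maximal_sub M' s" for s
    unfolding maximal_sub_def
  proof (intro conjI allI impI)
    obtain S where S: "hom s S M'" "monic s" "\<not> isom s S M'" using s maximal_sub_def by blast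
    have gs: "hom (g \<bullet> s) S M" using S g isom_hom by blast
    then show "monic (g \<bullet> s)" using monic_cmp S isom_monic g hom_not_None by blast
    show "\<exists>S. hom (g \<bullet> s) S M \<and> \<not> isom (g \<bullet> s) S M"
      using gs S isom_cancel_left[OF g(1) S(1)] by blast
    fix t T assume t: "hom t T M" "monic t" "\<exists>h. g \<bullet> s = t \<bullet> h"
    have ft: "hom (f \<bullet> t) T M'" "monic (f \<bullet> t)"
      using t f isom_hom isom_monic monic_cmp hom_cmp hom_not_None by metis+
    have gft: "g \<bullet> (f \<bullet> t) = t" using cmp_rewrite[OF g(2)] ide_left t by metis
    have "\<exists>h. s = (f \<bullet> t) \<bullet> h"
    proof -
      obtain h where h: "g \<bullet> s = t \<bullet> h" using t by blast
      have "f \<bullet> (g \<bullet> s) = s" using cmp_rewrite[OF g(3)] ide_left S by metis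
      then show ?thesis using h cmp_assoc by metis
    qed
    then have "(\<exists>h. f \<bullet> t = s \<bullet> h) \<or> isom (f \<bullet> t) T M'" using s ft unfolding maximal_sub_def by blast
    then show "(\<exists>h. t = (g \<bullet> s) \<bullet> h) \<or> isom t T M"
      using gft isom_cancel_left[OF f t(1)] cmp_assoc by metis
  qed
  obtain R where R: "hom r R M" "monic r" using r radical_def by blast
  show ?thesis
    unfolding radical_def
  proof (intro conjI allI impI)
    show fr: "\<exists>R. hom (f \<bullet> r) R M'" using R f isom_hom by blast
    then show "monic (f \<bullet> r)" using monic_cmp R isom_monic f hom_not_None by blast
    show "\<exists>h. f \<bullet> r = s \<bullet> h" if s: "maximal_sub M' s" for s
    proof -
      obtain S where S: "hom s S M'" using s maximal_sub_def by blast
      obtain h where "r = (g \<bullet> s) \<bullet> h" using r trans[OF s] radical_def by blast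
      then have "f \<bullet> r = f \<bullet> (g \<bullet> (s \<bullet> h))" by (simp add: cmp_assoc)
      also have "\<dots> = (f \<bullet> (g \<bullet> s)) \<bullet> h" by (simp add: cmp_assoc)
      also have "f \<bullet> (g \<bullet> s) = s" using cmp_rewrite[OF g(3)] ide_left S by metis
      finally show ?thesis by blast
    qed
    fix t T assume t: "hom t T M'" "monic t" "\<forall>s. maximal_sub M' s \<longrightarrow> (\<exists>h. t = s \<bullet> h)"
    have trans': "maximal_sub M' (f \<bullet> s)" if s: "maximal_sub M s" for s
      unfolding maximal_sub_def
    proof (intro conjI allI impI)
      obtain S where S: "hom s S M" "monic s" "\<not> isom s S M" using s maximal_sub_def by blast
      have gs: "hom (f \<bullet> s) S M'" using S f isom_hom by blast
      then show "monic (f \<bullet> s)" using monic_cmp S isom_monic f hom_not_None by blast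
      show "\<exists>S. hom (f \<bullet> s) S M' \<and> \<not> isom (f \<bullet> s) S M'"
        using gs S isom_cancel_left[OF f S(1)] by blast
      fix t T assume t: "hom t T M'" "monic t" "\<exists>h. f \<bullet> s = t \<bullet> h"
      have ft: "hom (g \<bullet> t) T M" "monic (g \<bullet> t)"
        using t g isom_hom isom_monic monic_cmp hom_cmp hom_not_None by metis+
      have gft: "f \<bullet> (g \<bullet> t) = t" using cmp_rewrite[OF g(3)] ide_left t by metis
      have "\<exists>h. s = (g \<bullet> t) \<bullet> h"
      proof -
        obtain h where h: "f \<bullet> s = t \<bullet> h" using t by blast
        have "g \<bullet> (f \<bullet> s) = s" using cmp_rewrite[OF g(2)] ide_left S by metis
        then show ?thesis using h cmp_assoc by metis
      qed
      then have "(\<exists>h. g \<bullet> t = s \<bullet> h) \<or> isom (g \<bullet> t) T M" using s ft unfolding maximal_sub_def by blast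
      then show "(\<exists>h. t = (f \<bullet> s) \<bullet> h) \<or> isom t T M'"
        using gft isom_cancel_left[OF g(1) t(1)] cmp_assoc by metis
    qed
    have gt: "hom (g \<bullet> t) T M" "monic (g \<bullet> t)"
      using t g isom_hom isom_monic monic_cmp hom_cmp hom_not_None by metis+
    have "\<exists>h. g \<bullet> t = s \<bullet> h" if s: "maximal_sub M s" for s
    proof -
      obtain S where S: "hom s S M" using s maximal_sub_def by blast
      obtain h where "t = (f \<bullet> s) \<bullet> h" using t trans'[OF s] by blast
      then have "g \<bullet> t = (g \<bullet> (f \<bullet> s)) \<bullet> h" by (simp add: cmp_assoc)
      also have "g \<bullet> (f \<bullet> s) = s" using cmp_rewrite[OF g(2)] ide_left S by metis
      finally show ?thesis by blast
    qed
    then obtain h where "g \<bullet> t = r \<bullet> h" using r gt unfolding radical_def by blast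
    then have "f \<bullet> (g \<bullet> t) = (f \<bullet> r) \<bullet> h" by (simp add: cmp_assoc)
    then show "\<exists>h. t = (f \<bullet> r) \<bullet> h" using cmp_rewrite[OF g(3)] ide_left t by metis
  qed
qed

section \<open>Equality of subobjects, uniqueness of the filtrations, and Loewy length\<close>

definition same_sub :: "('o, 'm) arrow \<Rightarrow> ('o, 'm) arrow \<Rightarrow> bool"
  where "same_sub s t \<longleftrightarrow> (\<exists>h. s = t \<bullet> h) \<and> (\<exists>h. t = s \<bullet> h)"

lemma same_sub_isom:
  assumes s: "monic s" "hom s S M" and t: "monic t" "hom t T M" and e: "same_sub s t"
  shows "\<exists>a b. isom a S T \<and> hom b T S \<and> b \<bullet> a = ide S \<and> a \<bullet> b = ide T \<and> s = t \<bullet> a \<and> t = s \<bullet> b"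
proof -
  obtain a b where ab: "s = t \<bullet> a" "t = s \<bullet> b" using e same_sub_def by metis
  have h: "hom a S T" "hom b T S" using ab s t hom_cmpE hom_unique by metis+
  have o: "S \<in> Obj C" "T \<in> Obj C" using h hom_objs by auto
  have "s \<bullet> (b \<bullet> a) = s \<bullet> ide S" using ab s ide_right by (metis cmp_assoc)
  then have 1: "b \<bullet> a = ide S" using monicD[OF s hom_cmp[OF h]] by blast
  have "t \<bullet> (a \<bullet> b) = t \<bullet> ide T" using ab t ide_right by (metis cmp_assoc)
  then have 2: "a \<bullet> b = ide T" using monicD[OF t hom_cmp[OF h(2,1)]] by blast
  show ?thesis using isomI[OF h 1 2] h 1 2 ab by blast
qed

text \<open>Equal stages are related by an isomorphism \<open>a\<close>, and
  \<open>radical_isom\<close> carries the radical of one to a radical of the other; two greatest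
  lower bounds contain each other.\<close>

lemma radical_filtration_unique:
  assumes \<rho>: "radical_filtration M \<rho>" and \<tau>: "radical_filtration M \<tau>"
  shows "same_sub (\<rho> k) (\<tau> k)"
proof (induction k)
  case 0
  obtain R T where i: "isom (\<rho> 0) R M" "isom (\<tau> 0) T M" using \<rho> \<tau> unfolding radical_filtration_def by blast
  obtain a b where ab: "\<rho> 0 \<bullet> a = ide M" "\<tau> 0 \<bullet> b = ide M" using isomE i by metis
  have "\<rho> 0 = \<tau> 0 \<bullet> (b \<bullet> \<rho> 0)" "\<tau> 0 = \<rho> 0 \<bullet> (a \<bullet> \<tau> 0)"
    using cmp_rewrite[OF ab(1)] cmp_rewrite[OF ab(2)] ide_left isom_hom[OF i(1)] isom_hom[OF i(2)] by metis+
  then show ?case unfolding same_sub_def by blast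
next
  case (Suc k)
  obtain R r where r: "hom (\<rho> k) R M" "radical R r" "\<rho> (Suc k) = \<rho> k \<bullet> r"
    using \<rho> unfolding radical_filtration_def by blast
  obtain T t where t: "hom (\<tau> k) T M" "radical T t" "\<tau> (Suc k) = \<tau> k \<bullet> t"
    using \<tau> unfolding radical_filtration_def by blast
  have m: "monic (\<rho> k)" "monic (\<tau> k)" using \<rho> \<tau> unfolding radical_filtration_def by auto
  obtain a where a: "isom a R T" "\<rho> k = \<tau> k \<bullet> a"
    using same_sub_isom[OF m(1) r(1) m(2) t(1) Suc] by blast
  have ar: "radical T (a \<bullet> r)" using radical_isom r a by blast
  obtain h h' where "a \<bullet> r = t \<bullet> h" "t = (a \<bullet> r) \<bullet> h'"
    using ar t(2) unfolding radical_def by metis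
  then have "\<rho> (Suc k) = \<tau> (Suc k) \<bullet> h" "\<tau> (Suc k) = \<rho> (Suc k) \<bullet> h'"
    using r t a by (metis cmp_assoc)+
  then show ?case unfolding same_sub_def by blast
qed

text \<open>The simple summands are themselves simple objects mapping into \<open>P\<close>, and
  their injections are jointly epic. This is the test by which semisimple sources are
  handled.\<close>

lemma semisimple_zro:
  assumes "semisimple P" "hom f P X" "\<And>t T. simple T \<Longrightarrow> hom t T P \<Longrightarrow> zro (f \<bullet> t)"
  shows "zro f"
proof -
  obtain n U e where u: "\<forall>i<(n::nat). simple (U i)" "dsum {..<n} U P e" using assms(1) semisimple_def by blast
  have X: "X \<in> Obj C" "P \<in> Obj C" using assms(2) hom_objs by auto
  have "f \<bullet> e i = zer P X \<bullet> e i" if i: "i \<in> {..<n}" for i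
  proof -
    have e: "hom (e i) (U i) P" using dsumD(2)[OF u(2) i] .
    then have "zro (f \<bullet> e i)" using assms(3) u i by blast
    then show ?thesis using zro_hom[OF _ hom_cmp[OF e assms(2)]] zer_cmp[OF X(1) e] by simp
  qed
  then have "f = zer P X" using dsumD(4)[OF u(2) assms(2) hom_zer[OF X(2,1)]] by blast
  then show ?thesis using zroI assms by blast
qed

lemma simple_into_socle:
  assumes "socle Q j" "simple T" "hom f T Q" shows "\<exists>g. f = j \<bullet> g"
proof (cases "zro f")
  case True
  obtain L where j: "hom j L Q" using assms socle_def by blast
  have o: "T \<in> Obj C" "L \<in> Obj C" using j assms hom_objs by auto
  have "j \<bullet> zer T L = f" using cmp_zer[OF o(1) j] zro_hom[OF True assms(3)] by simp
  then show ?thesis by metis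
next
  case False
  then show ?thesis using simple_monic simple_semisimple assms unfolding socle_def by blast
qed

text \<open>The definition of the socle speaks only of monomorphisms. For arbitrary \<open>f\<close>
  the question is whether the cokernel \<open>c\<close> of \<open>j\<close> kills \<open>f\<close>;
  this is tested on simple sources, where an arrow is zero or monic.\<close>

lemma semisimple_into_socle:
  assumes j: "socle Q j" and P: "semisimple P" "hom f P Q" shows "\<exists>g. f = j \<bullet> g"
proof -
  obtain L where jL: "hom j L Q" "monic j" using j socle_def by blast
  obtain c where c: "coker j c" using ex_coker jL by blast
  obtain R where cR: "hom c Q R" using cokerD(2)[OF c jL(1)] by blast
  have k: "kern c j" using kern_of_coker[OF jL(2,1) c] .
  have "zro (c \<bullet> f)"
  proof (rule semisimple_zro[OF P(1) hom_cmp[OF P(2) cR]])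
    fix t T assume t: "simple T" "hom t T P"
    then obtain g where g: "f \<bullet> t = j \<bullet> g" using simple_into_socle[OF j] P by blast
    then show "zro ((c \<bullet> f) \<bullet> t)"
      using zro_if_factors[OF k cR g] hom_cmp[OF t(2) P(2)] hom_not_None by (simp add: cmp_assoc)
  qed
  then show ?thesis using k kern_def by blast
qed

text \<open>Says that \<open>s'\<close> is the full preimage of the layer \<open>j\<close> under
  \<open>q\<close>, which the filtration does not state outright. The true preimage \<open>k\<close>
  contains \<open>s'\<close> and maps to the layer by \<open>y\<close> with kernel \<open>s\<close>,
  while already \<open>s'\<close> maps onto the layer; \<open>epic_of_same_extension\<close> then
  gives equality.\<close>

lemma socle_filtration_step:
  assumes s: "hom s S M" "monic s" and q: "coker s q" "hom q M Q"
    and s': "hom s' S' M" "monic s'" and h: "s = s' \<bullet> h" and p: "coker h p" and j: "j \<bullet> p = q \<bullet> s'" "monic j"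
    and w: "hom w W M"
  shows "(\<exists>u. w = s' \<bullet> u) \<longleftrightarrow> (\<exists>v. q \<bullet> w = j \<bullet> v)"
proof
  assume "\<exists>u. w = s' \<bullet> u"
  then obtain u where u: "w = s' \<bullet> u" by blast
  then have "q \<bullet> w = (j \<bullet> p) \<bullet> u" using j by (simp add: cmp_assoc)
  then show "\<exists>v. q \<bullet> w = j \<bullet> v" by (auto simp: cmp_assoc)
next
  assume "\<exists>v. q \<bullet> w = j \<bullet> v"
  then obtain v where v: "q \<bullet> w = j \<bullet> v" by blast
  have hh: "hom h S S'" using h s s' hom_cmpE hom_unique by metis
  obtain L where pL: "hom p S' L" "epic p" using cokerD[OF p hh] by blast
  have jL: "hom j L Q" using j(1) hom_cmp[OF s'(1) q(2)] pL hom_cmpE hom_unique by metis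
  obtain c where c: "coker j c" using ex_coker jL by blast
  obtain R where cR: "hom c Q R" using cokerD(2)[OF c jL] by blast
  have kc: "kern c j" using kern_of_coker[OF j(2) jL c] .
  have kq: "kern q s" using kern_of_coker[OF s(2,1) q(1)] .
  have cq: "hom (c \<bullet> q) M R" using q cR by blast
  obtain k where k: "kern (c \<bullet> q) k" using ex_kern cq by blast
  obtain P where kP: "hom k P M" "monic k" "zro ((c \<bullet> q) \<bullet> k)" using kernD[OF k cq] by blast
  have "zro (c \<bullet> (j \<bullet> p))" using zro_if_factors[OF kc cR refl hom_not_None[OF hom_cmp[OF pL(1) jL]]] .
  then have "zro ((c \<bullet> q) \<bullet> s')" using j by (simp add: cmp_assoc)
  then obtain i where i: "s' = k \<bullet> i" using k kern_def by blast
  have ih: "hom i S' P" using i s' kP hom_cmpE hom_unique by metis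
  have "zro (c \<bullet> (q \<bullet> k))" using kP by (simp add: cmp_assoc)
  then obtain y where y: "q \<bullet> k = j \<bullet> y" using kc kern_def by blast
  have yh: "hom y P L" using y hom_cmp[OF kP(1) q(2)] jL hom_cmpE hom_unique by metis
  have "j \<bullet> (y \<bullet> i) = (q \<bullet> k) \<bullet> i" using y by (simp add: cmp_assoc)
  also have "\<dots> = j \<bullet> p" using i j by (simp add: cmp_assoc)
  finally have yi: "y \<bullet> i = p" using monicD[OF j(2) jL hom_cmp[OF ih yh]] by blast
  have ky: "kern y (i \<bullet> h)"
    unfolding kern_def
  proof (intro conjI allI impI)
    have e: "k \<bullet> (i \<bullet> h) = s" using i h by (simp add: cmp_assoc)
    then show "monic (i \<bullet> h)" using s monic_cancel by metis
    have "zro (q \<bullet> s)" using q coker_def by blast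
    then have "zro (j \<bullet> (y \<bullet> (i \<bullet> h)))" using e y by (metis cmp_assoc)
    then show "zro (y \<bullet> (i \<bullet> h))" using monic_zro j by blast
    fix x assume x: "zro (y \<bullet> x)"
    obtain X where xX: "hom x X P" using zro_cmp_dom[OF x yh] .
    have "zro (j \<bullet> (y \<bullet> x))" using zro_cmp_hom[OF hom_cmp[OF xX yh] jL] x by blast
    then have "zro (q \<bullet> (k \<bullet> x))" using y by (metis cmp_assoc)
    then obtain z where z: "k \<bullet> x = s \<bullet> z" using kq kern_def by blast
    then have "k \<bullet> x = k \<bullet> ((i \<bullet> h) \<bullet> z)" using e by (metis cmp_assoc)
    then show "\<exists>u. x = (i \<bullet> h) \<bullet> u" using monicD[OF kP(2,1) xX] by blast
  qed
  have "epic (y \<bullet> i)" using yi pL by simp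
  then have "epic i" using epic_of_same_extension[OF ih yh _ ky] by blast
  moreover have "monic i" using monic_cancel i s' by metis
  ultimately obtain i' where i': "i \<bullet> i' = ide P" using monic_epic_isom ih isomE by metis
  have "zro (c \<bullet> (j \<bullet> v))"
    using zro_if_factors[OF kc cR refl] v hom_cmp[OF w q(2)] hom_not_None by metis
  then have "zro ((c \<bullet> q) \<bullet> w)" using v by (simp add: cmp_assoc)
  then obtain x where x: "w = k \<bullet> x" using k kern_def by blast
  then have xh: "hom x W P" using w kP hom_cmpE hom_unique by metis
  then have "w = s' \<bullet> (i' \<bullet> x)" using x i cmp_rewrite[OF i'] ide_left by (metis cmp_assoc)
  then show "\<exists>u. w = s' \<bullet> u" by blast
qed

text \<open>The working form of the recursion: lying in the next stage is a condition on the image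
  in the quotient by the current stage.\<close>

lemma socle_filtration_suc:
  assumes "socle_filtration M \<sigma>"
  obtains q Q j where "coker (\<sigma> k) q" "hom q M Q" "socle Q j"
    "\<And>w W. hom w W M \<Longrightarrow> (\<exists>u. w = \<sigma> (Suc k) \<bullet> u) \<longleftrightarrow> (\<exists>v. q \<bullet> w = j \<bullet> v)"
proof -
  obtain q h p j Q where f: "coker (\<sigma> k) q" "\<sigma> k = \<sigma> (Suc k) \<bullet> h" "coker h p"
      "j \<bullet> p = q \<bullet> \<sigma> (Suc k)" "hom q M Q" "socle Q j"
    using assms unfolding socle_filtration_def by blast
  obtain S S' where s: "hom (\<sigma> k) S M" "hom (\<sigma> (Suc k)) S' M" "monic (\<sigma> k)" "monic (\<sigma> (Suc k))"
    using assms unfolding socle_filtration_def by blast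
  show ?thesis
    using that[OF f(1,5,6)] socle_filtration_step[OF s(1,3) f(1,5) s(2,4) f(2,3,4)] f(6) unfolding socle_def by blast
qed

text \<open>Modulo \<open>\<sigma> k\<close> the arrow \<open>t'\<close> factors through the
  semisimple quotient \<open>L\<close>, hence lands in the socle. This one inclusion yields both the
  uniqueness of the socle filtration and the minimality of its length.\<close>

lemma semisimple_step_le_socle:
  assumes \<sigma>: "socle_filtration M \<sigma>" and t: "hom t T M" "monic t" and t': "hom t' T' M" "monic t'"
    and h: "t = t' \<bullet> h" "coker h p" "hom p T' L" "semisimple L"
    and le: "\<exists>u. t = \<sigma> k \<bullet> u"
  shows "\<exists>u. t' = \<sigma> (Suc k) \<bullet> u"
proof -
  obtain q Q j where f: "coker (\<sigma> k) q" "hom q M Q" "socle Q j"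
    "\<And>w W. hom w W M \<Longrightarrow> (\<exists>u. w = \<sigma> (Suc k) \<bullet> u) \<longleftrightarrow> (\<exists>v. q \<bullet> w = j \<bullet> v)"
    using socle_filtration_suc[OF \<sigma>] by blast
  obtain S where s: "hom (\<sigma> k) S M" "monic (\<sigma> k)" using \<sigma> unfolding socle_filtration_def by blast
  obtain u where u: "t = \<sigma> k \<bullet> u" using le by blast
  have "zro (q \<bullet> t)" using zro_if_factors[OF kern_of_coker[OF s(2,1) f(1)] f(2) u] t hom_not_None by blast
  then have "zro ((q \<bullet> t') \<bullet> h)" using h by (simp add: cmp_assoc)
  then obtain g where g: "q \<bullet> t' = g \<bullet> p" using h(2) coker_def by blast
  have gh: "hom g L Q" using g hom_cmp[OF t'(1) f(2)] h(3) hom_cmpE hom_unique by metis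
  obtain v where "g = j \<bullet> v" using semisimple_into_socle[OF f(3) h(4) gh] by blast
  then have "q \<bullet> t' = j \<bullet> (v \<bullet> p)" using g by (simp add: cmp_assoc)
  then show ?thesis using f(4)[OF t'(1)] by blast
qed

lemma socle_filtration_semisimple_step:
  assumes "socle_filtration M \<sigma>" "hom (\<sigma> (Suc k)) S' M"
  shows "\<exists>h p L. \<sigma> k = \<sigma> (Suc k) \<bullet> h \<and> coker h p \<and> hom p S' L \<and> semisimple L"
proof -
  obtain q h p j Q where f: "coker (\<sigma> k) q" "\<sigma> k = \<sigma> (Suc k) \<bullet> h" "coker h p"
      "j \<bullet> p = q \<bullet> \<sigma> (Suc k)" "hom q M Q" "socle Q j"
    using assms unfolding socle_filtration_def by blast
  obtain S where s: "hom (\<sigma> k) S M" using assms(1) unfolding socle_filtration_def by blast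
  have h: "hom h S S'" using f(2) s assms(2) hom_cmpE hom_unique by metis
  obtain L where p: "hom p S' L" using cokerD(2)[OF f(3) h] by blast
  obtain L' where j: "hom j L' Q" "semisimple L'" using f(6) socle_def by blast
  have "L' = L" using f(4) hom_cmp[OF assms(2) f(5)] p j hom_cmpE hom_unique by metis
  then show ?thesis using f h p j by blast
qed

lemma socle_filtration_mono_step:
  assumes \<sigma>: "socle_filtration M \<sigma>" and \<tau>: "socle_filtration M \<tau>" and le: "\<exists>u. \<tau> l = \<sigma> k \<bullet> u"
  shows "\<exists>u. \<tau> (Suc l) = \<sigma> (Suc k) \<bullet> u"
proof -
  obtain T T' where t: "hom (\<tau> l) T M" "hom (\<tau> (Suc l)) T' M" "monic (\<tau> l)" "monic (\<tau> (Suc l))"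
    using \<tau> unfolding socle_filtration_def by blast
  then show ?thesis
    using socle_filtration_semisimple_step[OF \<tau> t(2)] semisimple_step_le_socle[OF \<sigma> t(1,3,2,4) _ _ _ _ le] by blast
qed

lemma socle_filtration_unique:
  assumes \<sigma>: "socle_filtration M \<sigma>" and \<tau>: "socle_filtration M \<tau>"
  shows "same_sub (\<sigma> k) (\<tau> k)"
proof (induction k)
  case 0
  obtain S T where s: "hom (\<sigma> 0) S M" "hom (\<tau> 0) T M" using \<sigma> \<tau> unfolding socle_filtration_def by blast
  have z: "zro (\<sigma> 0)" "zro (\<tau> 0)" using \<sigma> \<tau> unfolding socle_filtration_def by auto
  have o: "S \<in> Obj C" "T \<in> Obj C" using s hom_objs by auto
  have "\<sigma> 0 = \<tau> 0 \<bullet> zer S T" "\<tau> 0 = \<sigma> 0 \<bullet> zer T S"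
    using cmp_zer[OF o(1) s(2)] cmp_zer[OF o(2) s(1)] zro_hom z s by metis+
  then show ?case unfolding same_sub_def by blast
next
  case (Suc k)
  then show ?case using socle_filtration_mono_step \<sigma> \<tau> unfolding same_sub_def by blast
qed

text \<open>\<open>socle_filtration_mono_step\<close> also compares a filtration with itself at
  shifted indices, so one repetition propagates to all later stages.\<close>

lemma socle_filtration_stationary:
  assumes \<sigma>: "socle_filtration M \<sigma>" and le: "\<exists>u. \<sigma> (Suc k) = \<sigma> k \<bullet> u"
  shows "\<exists>u. \<sigma> (k + n) = \<sigma> k \<bullet> u"
proof (induction n)
  case 0
  obtain S where "hom (\<sigma> k) S M" using \<sigma> unfolding socle_filtration_def by blast
  then show ?case using ide_right by (metis add_0_right)
next
  case (Suc n)
  obtain u v where u: "\<sigma> (Suc (k + n)) = \<sigma> (Suc k) \<bullet> u" "\<sigma> (Suc k) = \<sigma> k \<bullet> v"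
    using socle_filtration_mono_step[OF \<sigma> \<sigma> Suc] le by blast
  then have "\<sigma> (k + Suc n) = \<sigma> k \<bullet> (v \<bullet> u)" by (simp add: cmp_assoc)
  then show ?case by blast
qed

text \<open>Below the first stage that exhausts \<open>M\<close> the socle filtration is strict,
  since a repeated stage would persist up to \<open>n\<close>. Any competing series stays below it
  stage by stage, so it cannot reach \<open>M\<close> earlier.\<close>

lemma has_loewy_lengthI:
  assumes \<sigma>: "socle_filtration M \<sigma>" and n: "\<exists>S. isom (\<sigma> n) S M" and least: "\<And>k S. k < n \<Longrightarrow> \<not> isom (\<sigma> k) S M"
  shows "has_loewy_length C M n"
proof -
  have s: "\<And>k. monic (\<sigma> k)" "\<And>k. \<exists>S. hom (\<sigma> k) S M" "zro (\<sigma> 0)"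
    using \<sigma> unfolding socle_filtration_def by auto
  have M: "M \<in> Obj C" using s hom_objs by blast
  have "\<forall>k. \<exists>s. \<sigma> k = sub_ar M s \<and> hom (sub_ar M s) (fst s) M"
    using s(2) hom_arE by (metis fst_conv snd_conv)
  then obtain \<sigma>' where \<sigma>': "\<And>k. \<sigma> k = sub_ar M (\<sigma>' k)" "\<And>k. hom (sub_ar M (\<sigma>' k)) (fst (\<sigma>' k)) M" by metis
  have strict: "\<not> (\<exists>u. \<sigma> (Suc k) = \<sigma> k \<bullet> u)" if k: "k < n" for k
  proof
    assume "\<exists>u. \<sigma> (Suc k) = \<sigma> k \<bullet> u"
    then obtain u where "\<sigma> n = \<sigma> k \<bullet> u"
      using socle_filtration_stationary[OF \<sigma>, of k "n - k"] k by auto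
    moreover obtain S T where "isom (\<sigma> n) S M" "hom (\<sigma> k) T M" using n s by blast
    ultimately show False using monic_isom_cancel[OF s(1)] least[OF k] by metis
  qed
  have "is_semisimple_series C M n \<sigma>'"
    unfolding is_semisimple_series_def is_series_def
  proof (intro conjI allI impI)
    show "subobject C M (\<sigma>' k)" for k using subobject_iff[OF M] s \<sigma>' by metis
    show "is_zero_obj C (fst (\<sigma>' 0))" using zob_monic s \<sigma>' zob_def by metis
    show "is_iso C (fst (\<sigma>' n)) M (snd (\<sigma>' n))"
      using n \<sigma>' is_iso_iff[OF hom_objs(1)[OF \<sigma>'(2)] M] isom_hom hom_unique by metis
    fix k assume k: "k < n"
    have 1: "\<exists>h p L. \<sigma> k = \<sigma> (Suc k) \<bullet> h \<and> coker h p \<and> hom p (fst (\<sigma>' (Suc k))) L \<and> semisimple L"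
      using socle_filtration_semisimple_step[OF \<sigma>] \<sigma>' by metis
    then show "sub_le C (\<sigma>' k) (\<sigma>' (Suc k))" using sub_le_iff[OF \<sigma>'(2) \<sigma>'(2)] \<sigma>'(1) by metis
    show "\<not> sub_le C (\<sigma>' (Suc k)) (\<sigma>' k)" using sub_le_iff[OF \<sigma>'(2) \<sigma>'(2)] \<sigma>'(1) strict[OF k] by metis
    show "\<exists>Q. sub_quotient C (\<sigma>' k) (\<sigma>' (Suc k)) Q \<and> is_semisimple C Q"
      using 1 sub_quotient_iff[OF \<sigma>'(2) \<sigma>'(2)] \<sigma>'(1) is_semisimple_iff by metis
  qed
  moreover have "n \<le> m" if \<tau>: "is_semisimple_series C M m \<tau>" for m \<tau>
  proof (rule ccontr)
    assume "\<not> n \<le> m"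
    have t: "hom (sub_ar M (\<tau> k)) (fst (\<tau> k)) M" "monic (sub_ar M (\<tau> k))" if "k \<le> m" for k
      using \<tau> that subobject_iff[OF M] unfolding is_semisimple_series_def is_series_def by auto
    have "\<exists>u. sub_ar M (\<tau> k) = \<sigma> k \<bullet> u" if "k \<le> m" for k
      using that
    proof (induction k)
      case 0
      have "zob (fst (\<tau> 0))" using \<tau> unfolding is_semisimple_series_def is_series_def zob_def by blast
      then have z: "zro (sub_ar M (\<tau> 0))" using from_zob t by blast
      obtain S where S: "hom (\<sigma> 0) S M" using s by blast
      have o: "fst (\<tau> 0) \<in> Obj C" using hom_objs(1)[OF t(1)] by simp
      then have "\<sigma> 0 \<bullet> zer (fst (\<tau> 0)) S = sub_ar M (\<tau> 0)" using cmp_zer[OF o S] zro_hom[OF z t(1)] by simp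
      then show ?case by metis
    next
      case (Suc k)
      obtain Q where Q: "sub_quotient C (\<tau> k) (\<tau> (Suc k)) Q" "is_semisimple C Q"
        using \<tau> Suc unfolding is_semisimple_series_def by (metis Suc_le_lessD)
      have k: "k \<le> m" using Suc by simp
      have "\<exists>h p. sub_ar M (\<tau> k) = sub_ar M (\<tau> (Suc k)) \<bullet> h \<and> coker h p \<and> hom p (fst (\<tau> (Suc k))) Q"
        using sub_quotient_iff[OF t(1)[OF k] t(1)[OF Suc.prems]] Q by blast
      then obtain h p where hp: "sub_ar M (\<tau> k) = sub_ar M (\<tau> (Suc k)) \<bullet> h" "coker h p" "hom p (fst (\<tau> (Suc k))) Q"
        by blast
      show ?case
        using semisimple_step_le_socle[OF \<sigma> t[OF k] t[OF Suc.prems] hp _ Suc.IH[OF k]] Q is_semisimple_iff by blast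
    qed
    then obtain u where u: "sub_ar M (\<tau> m) = \<sigma> m \<bullet> u" by blast
    have "isom (sub_ar M (\<tau> m)) (fst (\<tau> m)) M"
      using \<tau> is_iso_iff[OF hom_objs(1)[OF t(1)] M] unfolding is_semisimple_series_def is_series_def by blast
    then obtain S where "isom (\<sigma> m) S M" using monic_isom_cancel[OF s(1)] s(2) u by metis
    then show False using least \<open>\<not> n \<le> m\<close> by (meson not_le)
  qed
  ultimately show ?thesis unfolding has_loewy_length_def by blast
qed

end

section \<open>Objects of finite length\<close>

context linear_category
begin

text \<open>The equation \<open>g \<bullet> w = g \<bullet> w'\<close> holds for each idempotent
  \<open>e i \<bullet> p i\<close> and is additive in \<open>g\<close>, so it holds for the
  identity: the projections are jointly monic.\<close>

lemma dsum_projections_ext: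
  assumes A: "dsum I U A e" and fin: "finite I"
    and p: "\<And>i. i \<in> I \<Longrightarrow> hom (p i) A (U i)" "\<And>i. i \<in> I \<Longrightarrow> p i \<bullet> e i = ide (U i)"
      "\<And>i j. i \<in> I \<Longrightarrow> j \<in> I \<Longrightarrow> i \<noteq> j \<Longrightarrow> p i \<bullet> e j = zer (U j) (U i)"
    and w: "hom w W A" "hom w' W A" and eq: "\<And>i. i \<in> I \<Longrightarrow> p i \<bullet> w = p i \<bullet> w'"
  shows "w = w'"
proof -
  have "ide A \<bullet> w = ide A \<bullet> w'"
  proof (rule dsum_ide_induct[OF A fin p, where P = "\<lambda>g. g \<bullet> w = g \<bullet> w'"])
    show "zer A A \<bullet> w = zer A A \<bullet> w'" using zer_cmp dsumD(1)[OF A] w by metis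
    show "(e i \<bullet> p i) \<bullet> w = (e i \<bullet> p i) \<bullet> w'" if "i \<in> I" for i
      using eq[OF that] by (simp add: cmp_assoc)
    show "pls f g \<bullet> w = pls f g \<bullet> w'" if "hom f A A" "hom g A A" "f \<bullet> w = f \<bullet> w'" "g \<bullet> w = g \<bullet> w'" for f g
      using pls_cmp[OF w(1) that(1,2)] pls_cmp[OF w(2) that(1,2)] that by simp
  qed
  then show ?thesis using ide_left w by metis
qed

text \<open>Keeps the index set in the form \<open>{..<n}\<close> that \<open>semisimple\<close>
  demands when one simple summand is added.\<close>

lemma dsum_extend:
  assumes S: "dsum {..<n::nat} U S e" and F: "dsum UNIV (\<lambda>b. if b then S else T) F i"
  shows "dsum {..<Suc n} (U(n := T)) F (\<lambda>k. if k < n then i True \<bullet> e k else i False)"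
proof -
  have i: "hom (i True) S F" "hom (i False) T F" using dsumD(2)[OF F, of True] dsumD(2)[OF F, of False] by auto
  have e: "\<And>k. k < n \<Longrightarrow> hom (e k) (U k) S" using dsumD(2)[OF S] by auto
  show ?thesis
    unfolding dsum_def
  proof (intro conjI allI impI ballI)
    show "F \<in> Obj C" using dsumD(1)[OF F] .
    show "hom (if k < n then i True \<bullet> e k else i False) ((U(n := T)) k) F" if "k \<in> {..<Suc n}" for k
      using that i e by (cases "k < n") auto
    fix X f assume X: "X \<in> Obj C" and f: "\<forall>k\<in>{..<Suc n}. hom (f k) ((U(n := T)) k) X"
    have f1: "hom (f k) (U k) X" if "k \<in> {..<n}" for k using f[rule_format, of k] that by simp
    have f2: "hom (f n) T X" using f[rule_format, of n] by simp
    obtain g where g: "hom g S X" "\<And>k. k \<in> {..<n} \<Longrightarrow> g \<bullet> e k = f k" using dsum_ex[OF S X, of f] f1 by blast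
    obtain h where h: "hom h F X" "\<And>b. h \<bullet> i b = (if b then g else f n)"
    proof -
      have "hom (if b then g else f n) (if b then S else T) X" for b using g f2 by (cases b) auto
      then show ?thesis using dsum_exists[OF F X, of "\<lambda>b. if b then g else f n"] that by blast
    qed
    have "h \<bullet> (if k < n then i True \<bullet> e k else i False) = f k" if "k \<in> {..<Suc n}" for k
    proof (cases "k < n")
      case True
      then show ?thesis using cmp_rewrite[OF h(2)[of True]] g(2) by simp
    next
      case False
      then have "k = n" using that by simp
      then show ?thesis using h(2)[of False] by simp
    qed
    then show "\<exists>h. hom h F X \<and> (\<forall>k\<in>{..<Suc n}. h \<bullet> (if k < n then i True \<bullet> e k else i False) = f k)"
      using h by blast
  next
    fix X g h assume gh: "hom g F X" "hom h F X"
      and eq: "\<forall>k\<in>{..<Suc n}. g \<bullet> (if k < n then i True \<bullet> e k else i False) = h \<bullet> (if k < n then i True \<bullet> e k else i False)"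
    have "(g \<bullet> i True) \<bullet> e k = (h \<bullet> i True) \<bullet> e k" if "k \<in> {..<n}" for k
      using eq[rule_format, of k] that by (simp add: cmp_assoc)
    then have 1: "g \<bullet> i True = h \<bullet> i True"
      using dsumD(4)[OF S hom_cmp[OF i(1) gh(1)] hom_cmp[OF i(1) gh(2)]] by blast
    have 2: "g \<bullet> i False = h \<bullet> i False" using eq[rule_format, of n] by simp
    have "g \<bullet> i b = h \<bullet> i b" for b using 1 2 by (cases b) auto
    then show "g = h" using dsumD(4)[OF F gh] by blast
  qed
qed

end

context normal_category
begin

text \<open>Finite intersections of maximal subobjects: \<open>r \<bullet> k\<close> is the
  intersection of \<open>r\<close> with \<open>s\<close>, obtained as the kernel of
  \<open>q \<bullet> r\<close>. A construction by kernels is what an exact functor preserves, unlike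
  the arbitrary intersection that defines the radical.\<close>

inductive finite_meet :: "'o \<Rightarrow> ('o, 'm) arrow \<Rightarrow> bool" for M
  where top: "M \<in> Obj C \<Longrightarrow> finite_meet M (ide M)"
  | meet: "finite_meet M r \<Longrightarrow> maximal_sub M s \<Longrightarrow> coker s q \<Longrightarrow> kern (q \<bullet> r) k \<Longrightarrow> finite_meet M (r \<bullet> k)"

lemma maximal_coker_hom:
  assumes "maximal_sub M s" "coker s q" obtains Q where "hom q M Q" "kern q s" "simple Q"
proof -
  obtain S where S: "hom s S M" "monic s" using assms maximal_sub_def by blast
  obtain Q where Q: "hom q M Q" using cokerD(2)[OF assms(2) S(1)] by blast
  then show ?thesis using that kern_of_coker[OF S(2,1) assms(2)] maximal_sub_simple_coker[OF assms] by blast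
qed

lemma finite_meet_hom: "finite_meet M r \<Longrightarrow> monic r \<and> (\<exists>R. hom r R M)"
proof (induction rule: finite_meet.induct)
  case top then show ?case using monic_ide by blast
next
  case (meet r s q k)
  obtain R where R: "hom r R M" "monic r" using meet by blast
  obtain Q where "hom q M Q" using maximal_coker_hom meet by blast
  then obtain N where "hom k N R" "monic k" using kernD[OF meet(4) hom_cmp[OF R(1)]] by blast
  then show ?case using R monic_cmp hom_cmp hom_not_None by metis
qed

lemma finite_meet_greatest:
  assumes "finite_meet M r" "hom t T M" "\<And>s. maximal_sub M s \<Longrightarrow> \<exists>h. t = s \<bullet> h"
  shows "\<exists>h. t = r \<bullet> h"
  using assms(1)
proof (induction rule: finite_meet.induct)
  case top then show ?case using ide_left assms(2) by metis
next
  case (meet r s q k)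
  obtain h h' where h: "t = r \<bullet> h" "t = s \<bullet> h'" using meet.IH assms(3)[OF meet(2)] by blast
  obtain Q where Q: "hom q M Q" "kern q s" using maximal_coker_hom meet by blast
  have "zro (q \<bullet> t)" using zro_if_factors[OF Q(2,1) h(2)] assms hom_not_None by blast
  then have "zro ((q \<bullet> r) \<bullet> h)" using h by (simp add: cmp_assoc)
  then obtain z where "h = k \<bullet> z" using meet(4) kern_def by blast
  then show ?case using h by (auto simp: cmp_assoc)
qed

end

context locally_finite_category
begin

section \<open>Composition series, chain conditions, and existence of socles and radicals\<close>

definition composition_series :: "'o \<Rightarrow> nat \<Rightarrow> (nat \<Rightarrow> ('o, 'm) arrow) \<Rightarrow> bool"
  where "composition_series M n c \<longleftrightarrow> (\<forall>k\<le>n. monic (c k) \<and> (\<exists>S. hom (c k) S M)) \<and> zro (c 0) \<and>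
    (\<exists>S. isom (c n) S M) \<and>
    (\<forall>k<n. \<exists>h p T Q. c k = c (Suc k) \<bullet> h \<and> coker h p \<and> hom (c (Suc k)) T M \<and> hom p T Q \<and> simple Q)"

lemma composition_seriesD:
  assumes "composition_series M n c"
  shows "\<And>k. k \<le> n \<Longrightarrow> monic (c k)" "\<And>k. k \<le> n \<Longrightarrow> \<exists>S. hom (c k) S M" "zro (c 0)" "\<exists>S. isom (c n) S M"
    "\<And>k. k < n \<Longrightarrow> \<exists>h p T Q. c k = c (Suc k) \<bullet> h \<and> coker h p \<and> hom (c (Suc k)) T M \<and> hom p T Q \<and> simple Q"
  using assms unfolding composition_series_def by blast+

lemma ex_composition_series:
  assumes M: "M \<in> Obj C" shows "\<exists>n c. composition_series M n c"
proof -
  obtain n \<sigma> where s: "is_series C M n \<sigma>" "\<And>k. k < n \<Longrightarrow> \<exists>Q. sub_quotient C (\<sigma> k) (\<sigma> (Suc k)) Q \<and> is_simple C Q"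
    using finite_length[OF M] unfolding has_finite_length_def by blast
  have h: "hom (sub_ar M (\<sigma> k)) (fst (\<sigma> k)) M" "monic (sub_ar M (\<sigma> k))" if "k \<le> n" for k
    using s(1) that subobject_iff[OF M] unfolding is_series_def by auto
  have "composition_series M n (\<lambda>k. sub_ar M (\<sigma> k))"
    unfolding composition_series_def
  proof (intro conjI allI impI)
    show "monic (sub_ar M (\<sigma> k))" "\<exists>S. hom (sub_ar M (\<sigma> k)) S M" if "k \<le> n" for k
      using h[OF that] by blast+
    have "zob (fst (\<sigma> 0))" using s(1) unfolding is_series_def zob_def by blast
    then show "zro (sub_ar M (\<sigma> 0))" using from_zob h(1)[of 0] by blast
    have "isom (sub_ar M (\<sigma> n)) (fst (\<sigma> n)) M"
      using s(1) is_iso_iff[OF hom_objs(1)[OF h(1)] M] unfolding is_series_def by blast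
    then show "\<exists>S. isom (sub_ar M (\<sigma> n)) S M" by blast
    fix k assume k: "k < n"
    then obtain Q where Q: "sub_quotient C (\<sigma> k) (\<sigma> (Suc k)) Q" "simple Q" using s(2) is_simple_iff by blast
    have k': "k \<le> n" "Suc k \<le> n" using k by auto
    show "\<exists>h p T Q. sub_ar M (\<sigma> k) = sub_ar M (\<sigma> (Suc k)) \<bullet> h \<and> coker h p \<and> hom (sub_ar M (\<sigma> (Suc k))) T M \<and> hom p T Q \<and> simple Q"
      using Q sub_quotient_iff[OF h(1)[OF k'(1)] h(1)[OF k'(2)]] h(1)[OF k'(2)] by blast
  qed
  then show ?thesis by blast
qed

text \<open>The bottom term of a composition series is zero, so the term above it is isomorphic to
  its simple quotient.\<close>

lemma ex_simple_sub:
  assumes M: "M \<in> Obj C" "\<not> zob M"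
  obtains t T where "hom t T M" "monic t" "simple T"
proof -
  obtain n c where cs: "composition_series M n c" using ex_composition_series[OF M(1)] by blast
  note c = composition_seriesD[OF cs]
  have "n \<noteq> 0"
  proof
    assume "n = 0"
    then obtain S where S: "isom (c 0) S M" using c(4) by blast
    then show False using zob_epic[OF isom_epic isom_hom] c(3) M by blast
  qed
  then obtain h p T Q where h: "c 0 = c (Suc 0) \<bullet> h" "coker h p" "hom (c (Suc 0)) T M" "hom p T Q" "simple Q"
    using c(5)[of 0] by blast
  have m: "monic (c (Suc 0))" using c(1) \<open>n \<noteq> 0\<close> by simp
  then have z: "zro h" using monic_zro h(1) c(3) by metis
  obtain S where S: "hom (c 0) S M" using c(2)[of 0] by blast
  have hS: "hom h S T" using h S hom_cmpE hom_unique by metis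
  have o: "T \<in> Obj C" using hS hom_objs by blast
  have "zro (ide T \<bullet> h)" using z ide_left[OF hS] by simp
  then obtain u where "ide T = u \<bullet> p" using h(2) coker_def by blast
  then have "isom p T Q" using epic_retract_isom h coker_def by metis
  then have "simple T" using simple_isom isomE h(5) by metis
  then show ?thesis using that h m by blast
qed

text \<open>The rank of \<open>s\<close> counts the composition factors of \<open>M\<close> that are met by \<open>s\<close>.\<close>

lemma rank_function:
  assumes M: "M \<in> Obj C"
  obtains r :: "('o, 'm) arrow \<Rightarrow> nat" and n where "\<And>s. r s \<le> n"
    "\<And>s S t T. hom s S M \<Longrightarrow> monic s \<Longrightarrow> hom t T M \<Longrightarrow> monic t \<Longrightarrow> \<exists>h. s = t \<bullet> h \<Longrightarrow> r t \<le> r s \<Longrightarrow> \<exists>h. t = s \<bullet> h"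
proof -
  obtain n c where cs: "composition_series M n c" using ex_composition_series[OF M] by blast
  note c = composition_seriesD[OF cs]
  \<comment> \<open>The index \<open>k\<close> is recorded when the intersection of \<open>s\<close>
    with \<open>c (Suc k)\<close> is not contained in \<open>c k\<close>; arrows \<open>w\<close>
    that factor through both stand in for the intersection.\<close>
  define met where "met s = {k. k < n \<and> (\<exists>w u v. w \<noteq> None \<and> w = s \<bullet> u \<and> w = c (Suc k) \<bullet> v \<and> \<not> (\<exists>x. w = c k \<bullet> x))}" for s
  have fin: "finite (met s)" "card (met s) \<le> n" for s
  proof -
    have "met s \<subseteq> {..<n}" unfolding met_def by blast
    then show "finite (met s)" "card (met s) \<le> n" using finite_subset card_mono[of "{..<n}" "met s"] by auto
  qed
  show ?thesis
  proof (rule that[of "\<lambda>s. card (met s)" n])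
    show "card (met s) \<le> n" for s using fin by blast
    fix s S t T assume s: "hom s S M" "monic s" and t: "hom t T M" "monic t" and le: "\<exists>h. s = t \<bullet> h"
      and card: "card (met t) \<le> card (met s)"
    obtain h0 where h0: "s = t \<bullet> h0" using le by blast
    have "met s \<subseteq> met t"
    proof
      fix k assume "k \<in> met s"
      then obtain w u v where w: "k < n" "w \<noteq> None" "w = s \<bullet> u" "w = c (Suc k) \<bullet> v" "\<not> (\<exists>x. w = c k \<bullet> x)"
        unfolding met_def by blast
      have "w = t \<bullet> (h0 \<bullet> u)" using w(3) h0 by (simp add: cmp_assoc)
      then show "k \<in> met t" unfolding met_def using w by blast
    qed
    then have eq: "met s = met t" using card card_seteq fin by blast
    \<comment> \<open>The intersection of \<open>t\<close> with \<open>c k\<close> lies in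
      \<open>s\<close>; at \<open>k = n\<close> this is \<open>t\<close> itself.\<close>
    have main: "\<forall>w u v. w \<noteq> None \<longrightarrow> w = t \<bullet> u \<longrightarrow> w = c k \<bullet> v \<longrightarrow> (\<exists>x. w = s \<bullet> x)" if "k \<le> n" for k
      using that
    proof (induction k)
      case 0
      show ?case
      proof (intro allI impI)
        fix w u v assume w: "w \<noteq> None" "w = t \<bullet> u" "w = c 0 \<bullet> v"
        then have z: "zro w" using zro_cmp_left c(3) by metis
        obtain W where W: "hom w W M" using w t(1) cmp_None hom_cmp hom_unique by metis
        have o: "W \<in> Obj C" using W hom_objs by blast
        have "w = s \<bullet> zer W S" using cmp_zer[OF o s(1)] zro_hom[OF z W] by simp
        then show "\<exists>x. w = s \<bullet> x" by blast
      qed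
    next
      case (Suc k)
      have k: "k < n" using Suc by simp
      obtain h p C' Q where h: "c k = c (Suc k) \<bullet> h" "coker h p" "hom (c (Suc k)) C' M" "hom p C' Q" "simple Q"
        using c(5)[OF k] by blast
      have mc: "monic (c (Suc k))" "monic (c k)" using c(1) Suc.prems by auto
      obtain Ck where Ck: "hom (c k) Ck M" using c(2)[of k] k by auto
      have hh: "hom h Ck C'" using h(1) Ck h(3) hom_cmpE hom_unique by metis
      have kh: "kern p h" using kern_of_coker[OF monic_cancel hh h(2)] h(1) mc by metis
      show ?case
      proof (cases "k \<in> met t")
        case False
        show ?thesis
        proof (intro allI impI)
          fix w u v assume w: "w \<noteq> None" "w = t \<bullet> u" "w = c (Suc k) \<bullet> v"
          then obtain x where "w = c k \<bullet> x" using False k unfolding met_def by blast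
          then show "\<exists>x. w = s \<bullet> x" using Suc.IH[OF less_imp_le[OF k]] w(1,2) by blast
        qed
      next
        case True
        then obtain w0 u0 v0 where w0: "w0 \<noteq> None" "w0 = s \<bullet> u0" "w0 = c (Suc k) \<bullet> v0" "\<not> (\<exists>x. w0 = c k \<bullet> x)"
        proof -
          have "k \<in> met s" using True eq by simp
          then show ?thesis using that unfolding met_def by blast
        qed
        \<comment> \<open>\<open>ps\<close> and \<open>pt\<close> are the intersections of
          \<open>s\<close> and \<open>t\<close> with \<open>c (Suc k)\<close>. Both map onto the
          simple factor \<open>Q\<close>, and the kernel of the map from \<open>pt\<close> lies in
          \<open>s\<close> by the induction hypothesis, so \<open>epic_of_same_extension\<close>
          identifies the two.\<close>
        obtain ps Ps as where ps: "hom ps Ps M" "monic ps" "ps = s \<bullet> as" "\<exists>b. ps = c (Suc k) \<bullet> b"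
          "\<And>w u v. w \<noteq> None \<Longrightarrow> w = s \<bullet> u \<Longrightarrow> w = c (Suc k) \<bullet> v \<Longrightarrow> \<exists>z. w = ps \<bullet> z"
          using intersection[OF s h(3) mc(1)] by metis
        obtain pt Pt at where pt: "hom pt Pt M" "monic pt" "pt = t \<bullet> at" "\<exists>b. pt = c (Suc k) \<bullet> b"
          "\<And>w u v. w \<noteq> None \<Longrightarrow> w = t \<bullet> u \<Longrightarrow> w = c (Suc k) \<bullet> v \<Longrightarrow> \<exists>z. w = pt \<bullet> z"
          using intersection[OF t h(3) mc(1)] by metis
        obtain bs bt where b: "ps = c (Suc k) \<bullet> bs" "pt = c (Suc k) \<bullet> bt" using ps(4) pt(4) by blast
        have bh: "hom bs Ps C'" "hom bt Pt C'" using b ps(1) pt(1) h(3) hom_cmpE hom_unique by metis+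
        have "ps = t \<bullet> (h0 \<bullet> as)" using ps(3) h0 by (simp add: cmp_assoc)
        then obtain i where i: "ps = pt \<bullet> i" using pt(5)[OF hom_not_None[OF ps(1)] _ b(1)] by blast
        have ih: "hom i Ps Pt" using i ps(1) pt(1) hom_cmpE hom_unique by metis
        have "c (Suc k) \<bullet> (bt \<bullet> i) = c (Suc k) \<bullet> bs" using i b by (metis cmp_assoc)
        then have bti: "bt \<bullet> i = bs" using monicD[OF mc(1) h(3) hom_cmp[OF ih bh(2)]] by blast
        have nz: "\<not> zro (p \<bullet> bs)"
        proof
          assume "zro (p \<bullet> bs)"
          then obtain x where "bs = h \<bullet> x" using kh kern_def by blast
          then have "ps = c k \<bullet> x" using b h(1) by (simp add: cmp_assoc)
          moreover obtain z where "w0 = ps \<bullet> z" using ps(5) w0 by blast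
          ultimately have "w0 = c k \<bullet> (x \<bullet> z)" by (simp add: cmp_assoc)
          then show False using w0 by blast
        qed
        let ?y = "p \<bullet> bt"
        have y: "hom ?y Pt Q" using bh h(4) by blast
        have yi: "epic (?y \<bullet> i)"
          using simple_epic[OF h(5) hom_cmp[OF bh(1) h(4)] nz] bti by (simp add: cmp_assoc)
        obtain k0 where k0: "kern ?y k0" using ex_kern y by blast
        obtain N where N: "hom k0 N Pt" "monic k0" "zro (?y \<bullet> k0)" using kernD[OF k0 y] by blast
        have "zro (p \<bullet> (bt \<bullet> k0))" using N by (simp add: cmp_assoc)
        then obtain x where "bt \<bullet> k0 = h \<bullet> x" using kh kern_def by blast
        then have 1: "pt \<bullet> k0 = c k \<bullet> x" using b h(1) by (simp add: cmp_assoc)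
        have 2: "pt \<bullet> k0 = t \<bullet> (at \<bullet> k0)" using pt(3) by (simp add: cmp_assoc)
        have ne: "pt \<bullet> k0 \<noteq> None" using hom_not_None hom_cmp[OF N(1) pt(1)] by blast
        obtain x' where 3: "pt \<bullet> k0 = s \<bullet> x'" using Suc.IH k ne 1 2 by (metis less_imp_le)
        have 4: "pt \<bullet> k0 = c (Suc k) \<bullet> (bt \<bullet> k0)" using b by (simp add: cmp_assoc)
        obtain z where "pt \<bullet> k0 = ps \<bullet> z" using ps(5)[OF ne 3 4] by blast
        then have "pt \<bullet> k0 = pt \<bullet> (i \<bullet> z)" using i by (simp add: cmp_assoc)
        then have "k0 = i \<bullet> z" using monicD[OF pt(2,1) N(1)] by blast
        then have "epic i" using epic_of_same_extension[OF ih y yi k0] by blast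
        moreover have "monic i" using monic_cancel i ps by metis
        ultimately obtain i' where i': "i \<bullet> i' = ide Pt" using monic_epic_isom ih isomE by metis
        have "pt = ps \<bullet> i'" using i i' pt(1) ide_right by (metis cmp_assoc)
        then have pts: "pt = s \<bullet> (as \<bullet> i')" using ps(3) by (simp add: cmp_assoc)
        show ?thesis
        proof (intro allI impI)
          fix w u v assume w: "w \<noteq> None" "w = t \<bullet> u" "w = c (Suc k) \<bullet> v"
          then obtain z where "w = pt \<bullet> z" using pt(5) by blast
          then have "w = s \<bullet> ((as \<bullet> i') \<bullet> z)" using pts by (simp add: cmp_assoc)
          then show "\<exists>x. w = s \<bullet> x" by blast
        qed
      qed
    qed
    obtain N where N: "isom (c n) N M" using c(4) by blast
    then obtain c' where "c n \<bullet> c' = ide M" using isomE by metis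
    then have "t = c n \<bullet> (c' \<bullet> t)" using cmp_rewrite ide_left t by metis
    moreover have "t = t \<bullet> ide T" using ide_right t by metis
    ultimately show "\<exists>h. t = s \<bullet> h" using main[of n] hom_not_None[OF t(1)] by blast
  qed
qed

text \<open>The ascending chain condition. A member of largest rank is maximal, because any member
  above it has no larger rank and therefore coincides with it.\<close>

lemma maximal_sub_ex:
  assumes M: "M \<in> Obj C" and P: "P s0" and sub: "\<And>s. P s \<Longrightarrow> monic s \<and> (\<exists>S. hom s S M)"
  obtains s where "P s" "\<And>t. P t \<Longrightarrow> \<exists>h. s = t \<bullet> h \<Longrightarrow> \<exists>h. t = s \<bullet> h"
proof -
  obtain r :: "('o, 'm) arrow \<Rightarrow> nat" and n where r: "\<And>s. r s \<le> n"
    "\<And>s S t T. hom s S M \<Longrightarrow> monic s \<Longrightarrow> hom t T M \<Longrightarrow> monic t \<Longrightarrow> \<exists>h. s = t \<bullet> h \<Longrightarrow> r t \<le> r s \<Longrightarrow> \<exists>h. t = s \<bullet> h"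
    using rank_function[OF M] by blast
  \<comment> \<open>\<open>ex_has_greatest_nat\<close> is supplied with a strict bound, hence
    \<open>Suc n\<close>.\<close>
  obtain s where s: "P s" "\<forall>t. P t \<longrightarrow> r t \<le> r s"
    using ex_has_greatest_nat[of P s0 r "Suc n"] P r(1) by (metis le_imp_less_Suc)
  show ?thesis using that[OF s(1)] s r(2) sub by metis
qed

lemma minimal_sub_ex:
  assumes M: "M \<in> Obj C" and P: "P s0" and sub: "\<And>s. P s \<Longrightarrow> monic s \<and> (\<exists>S. hom s S M)"
  obtains s where "P s" "\<And>t. P t \<Longrightarrow> \<exists>h. t = s \<bullet> h \<Longrightarrow> \<exists>h. s = t \<bullet> h"
proof -
  obtain r :: "('o, 'm) arrow \<Rightarrow> nat" and n where r: "\<And>s. r s \<le> n"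
    "\<And>s S t T. hom s S M \<Longrightarrow> monic s \<Longrightarrow> hom t T M \<Longrightarrow> monic t \<Longrightarrow> \<exists>h. s = t \<bullet> h \<Longrightarrow> r t \<le> r s \<Longrightarrow> \<exists>h. t = s \<bullet> h"
    using rank_function[OF M] by blast
  obtain s where s: "P s" "\<forall>t. P t \<longrightarrow> r s \<le> r t"
    using ex_has_least_nat[of P s0 r] P by blast
  show ?thesis using that[OF s(1)] s r(2) sub by metis
qed

text \<open>The sum of \<open>s\<close> and a simple object not mapping into it is direct. The
  composite \<open>q \<bullet> f\<close> sees only the second component, through the monic
  \<open>q \<bullet> x\<close>; so whatever \<open>f\<close> kills has zero second component, and
  then \<open>s\<close> being monic disposes of the first.\<close>

lemma semisimple_join:
  assumes s: "hom s S M" "monic s" "semisimple S" and x: "hom x T M" "simple T"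
    and q: "coker s q" "\<not> zro (q \<bullet> x)"
  obtains f F where "hom f F M" "monic f" "semisimple F" "\<exists>a. s = f \<bullet> a" "\<exists>b. x = f \<bullet> b"
proof -
  have o: "S \<in> Obj C" "T \<in> Obj C" "M \<in> Obj C" using s x hom_objs by auto
  obtain F e' where "is_direct_sum C UNIV (\<lambda>b :: bool. if b then S else T) F e'" using ex_direct_sum[OF o(1,2)] by blast
  then obtain e where e: "dsum UNIV (\<lambda>b :: bool. if b then S else T) F e" using is_direct_sum_iff by blast
  have eh: "hom (e True) S F" "hom (e False) T F" using dsumD(2)[OF e, of True] dsumD(2)[OF e, of False] by auto
  obtain f where f: "hom f F M" "\<And>b. f \<bullet> e b = (if b then s else x)"
  proof -
    have "hom (if b then s else x) (if b then S else T) M" for b using s x by (cases b) auto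
    then show ?thesis using dsum_exists[OF e o(3), of "\<lambda>b. if b then s else x"] that by blast
  qed
  obtain p where p: "\<And>b. hom (p b) F (if b then S else T)" "\<And>b. p b \<bullet> e b = ide (if b then S else T)"
    "\<And>b b'. b \<noteq> b' \<Longrightarrow> p b \<bullet> e b' = zer (if b' then S else T) (if b then S else T)"
    using dsum_projections[OF e] by (metis UNIV_I)
  have pT: "hom (p True) F S" "p True \<bullet> e True = ide S" "p True \<bullet> e False = zer T S"
    and pF: "hom (p False) F T" "p False \<bullet> e False = ide T" "p False \<bullet> e True = zer S T"
    using p(1)[of True] p(1)[of False] p(2)[of True] p(2)[of False] p(3)[of True False] p(3)[of False True] by auto
  obtain Q where Q: "hom q M Q" "zro (q \<bullet> s)" using cokerD[OF q(1) s(1)] by blast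
  have qx: "monic (q \<bullet> x)" "hom (q \<bullet> x) T Q" using simple_monic[OF x(2) hom_cmp[OF x(1) Q(1)] q(2)] x Q by auto
  have qf: "q \<bullet> f = (q \<bullet> x) \<bullet> p False"
  proof (rule dsumD(4)[OF e hom_cmp[OF f(1) Q(1)] hom_cmp[OF pF(1) qx(2)]])
    fix b :: bool
    have Qo: "Q \<in> Obj C" using Q hom_objs by blast
    show "(q \<bullet> f) \<bullet> e b = ((q \<bullet> x) \<bullet> p False) \<bullet> e b"
    proof (cases b)
      case True
      have "q \<bullet> s = zer S Q" using zro_hom Q s hom_cmp by metis
      moreover have "(q \<bullet> x) \<bullet> zer S T = zer S Q" using cmp_zer[OF o(1) qx(2)] .
      ultimately show ?thesis using f(2)[of True] pF True by (simp add: cmp_assoc)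
    next
      case False
      then show ?thesis using f(2)[of False] pF ide_right[OF x(1)] by (simp add: cmp_assoc)
    qed
  qed
  have "monic f"
  proof (rule monicI[OF f(1)])
    fix W w assume w: "hom w W F" "zro (f \<bullet> w)"
    have W: "W \<in> Obj C" using w hom_objs by blast
    have "zro (q \<bullet> (f \<bullet> w))" using zro_cmp_hom[OF hom_cmp[OF w(1) f(1)] Q(1)] w by blast
    then have "zro ((q \<bullet> x) \<bullet> (p False \<bullet> w))" using qf by (metis cmp_assoc)
    then have z: "p False \<bullet> w = zer W T" using monic_zro qx zro_hom hom_cmp w pF by metis
    have pw: "hom (p True \<bullet> w) W S" using w pT by blast
    have w2: "w = e True \<bullet> (p True \<bullet> w)"
    proof (rule dsum_projections_ext[OF e finite_UNIV])
      show "hom (p b) F (if b then S else T)" "p b \<bullet> e b = ide (if b then S else T)" for b using p by auto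
      show "p b \<bullet> e b' = zer (if b' then S else T) (if b then S else T)" if "b \<noteq> b'" for b b' using p that by auto
      show "hom w W F" "hom (e True \<bullet> (p True \<bullet> w)) W F" using w eh pw by auto
      show "p b \<bullet> w = p b \<bullet> (e True \<bullet> (p True \<bullet> w))" for b
        using cmp_rewrite[OF pT(2)] cmp_rewrite[OF pF(3)] ide_left[OF pw] zer_cmp[OF o(2) pw] z
        by (cases b) simp_all
    qed
    have "f \<bullet> w = (f \<bullet> e True) \<bullet> (p True \<bullet> w)" using w2 by (metis cmp_assoc)
    then have "zro (s \<bullet> (p True \<bullet> w))" using w f(2)[of True] by simp
    then have "zro (p True \<bullet> w)" using monic_zro s by blast
    then show "zro w" using zro_cmp_hom[OF pw eh(1)] w2 by simp
  qed
  moreover have "semisimple F"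
  proof -
    obtain n U e1 where u: "\<forall>i<(n::nat). simple (U i)" "dsum {..<n} U S e1" using s(3) semisimple_def by blast
    have "dsum {..<Suc n} (U(n := T)) F (\<lambda>k. if k < n then e True \<bullet> e1 k else e False)"
      using dsum_extend[OF u(2) e] .
    moreover have "\<forall>i<Suc n. simple ((U(n := T)) i)" using u x by (auto simp: less_Suc_eq)
    ultimately show ?thesis unfolding semisimple_def by blast
  qed
  ultimately show ?thesis using that[OF f(1)] f(2)[of True] f(2)[of False] by metis
qed

text \<open>A maximal semisimple subobject exists by the rank. It contains every semisimple
  \<open>t\<close>: otherwise some simple object mapping to \<open>t\<close> does not land in
  \<open>s\<close>, and \<open>semisimple_join\<close> enlarges \<open>s\<close>.\<close>

lemma ex_socle:
  assumes M: "M \<in> Obj C" shows "\<exists>s. socle M s"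
proof -
  let ?P = "\<lambda>s. monic s \<and> (\<exists>S. hom s S M \<and> semisimple S)"
  obtain Z where Z: "zob Z" using ex_zero_obj zob_def by blast
  have zh: "hom (zer Z M) Z M" using Z zob_obj M by blast
  have "monic (zer Z M)" by (rule monicI_hom[OF zh]) (metis Z to_zob_eq)
  then have "?P (zer Z M)" using zh zob_semisimple Z by blast
  then obtain s where s: "?P s" "\<And>t. ?P t \<Longrightarrow> \<exists>h. s = t \<bullet> h \<Longrightarrow> \<exists>h. t = s \<bullet> h"
    using maximal_sub_ex[OF M, of ?P "zer Z M"] by blast
  obtain S where S: "hom s S M" "semisimple S" "monic s" using s by blast
  obtain q where q: "coker s q" using ex_coker S by blast
  obtain Q where Q: "hom q M Q" using cokerD(2)[OF q S(1)] by blast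
  have k: "kern q s" using kern_of_coker[OF S(3,1) q] .
  have "\<exists>h. t = s \<bullet> h" if t: "hom t T M" "monic t" "semisimple T" for t T
  proof -
    have "zro (q \<bullet> t)"
    proof (rule semisimple_zro[OF t(3) hom_cmp[OF t(1) Q]])
      fix x X assume x: "simple X" "hom x X T"
      have tx: "hom (t \<bullet> x) X M" using x t by blast
      show "zro ((q \<bullet> t) \<bullet> x)"
      proof (rule ccontr)
        assume "\<not> zro ((q \<bullet> t) \<bullet> x)"
        then have nz: "\<not> zro (q \<bullet> (t \<bullet> x))" by (simp add: cmp_assoc)
        obtain f F where f: "hom f F M" "monic f" "semisimple F" "\<exists>a. s = f \<bullet> a" "\<exists>b. t \<bullet> x = f \<bullet> b"
          using semisimple_join[OF S(1,3,2) tx x(1) q nz] .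
        then obtain h b where "f = s \<bullet> h" "t \<bullet> x = f \<bullet> b" using s(2)[of f] by blast
        then have "t \<bullet> x = s \<bullet> (h \<bullet> b)" by (simp add: cmp_assoc)
        then show False using nz zro_if_factors[OF k Q _ hom_not_None[OF tx]] by blast
      qed
    qed
    then show ?thesis using k kern_def by blast
  qed
  then show ?thesis unfolding socle_def using S by blast
qed

text \<open>A nonzero object of finite length has a simple subobject, which the socle contains. This
  is what forces the socle filtration to exhaust its object.\<close>

lemma socle_nonzero:
  assumes "socle M s" "M \<in> Obj C" "\<not> zob M" shows "\<not> zro s"
proof
  assume z: "zro s"
  obtain t T where t: "hom t T M" "monic t" "simple T" using ex_simple_sub[OF assms(2,3)] .
  then obtain h where h: "t = s \<bullet> h" using assms(1) simple_semisimple unfolding socle_def by blast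
  then have "zro t" using zro_cmp_left z hom_not_None t by metis
  then show False using zob_monic t simple_def by blast
qed

text \<open>\<open>s'\<close> is the preimage of the socle of \<open>M\<close> modulo
  \<open>s\<close>. What has to be checked is that \<open>p\<close> presents the socle as the
  quotient of \<open>s'\<close> by \<open>s\<close>, that is, that \<open>p\<close> is epic with
  kernel \<open>h\<close>.\<close>

lemma ex_socle_filtration_step:
  assumes s: "hom s S M" "monic s"
  shows "\<exists>s'. (monic s' \<and> (\<exists>S'. hom s' S' M)) \<and> (\<exists>q h p j Q. coker s q \<and> s = s' \<bullet> h \<and> coker h p \<and>
      j \<bullet> p = q \<bullet> s' \<and> hom q M Q \<and> socle Q j)"
proof -
  obtain q where q: "coker s q" using ex_coker s by blast
  obtain Q where Q: "hom q M Q" "epic q" "zro (q \<bullet> s)" using cokerD[OF q s(1)] by blast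
  have kq: "kern q s" using kern_of_coker[OF s(2,1) q] .
  obtain j where j: "socle Q j" using ex_socle Q hom_objs by blast
  obtain L where L: "hom j L Q" "monic j" using j socle_def by blast
  obtain c where c: "coker j c" using ex_coker L by blast
  obtain R where R: "hom c Q R" "epic c" "zro (c \<bullet> j)" using cokerD[OF c L(1)] by blast
  have kc: "kern c j" using kern_of_coker[OF L(2,1) c] .
  have cq: "hom (c \<bullet> q) M R" "epic (c \<bullet> q)" using epic_cmp R Q hom_cmp hom_not_None by metis+
  obtain s' where s': "kern (c \<bullet> q) s'" using ex_kern cq by blast
  obtain S' where S': "hom s' S' M" "monic s'" "zro ((c \<bullet> q) \<bullet> s')" using kernD[OF s' cq(1)] by blast
  have "zro (c \<bullet> (q \<bullet> s'))" using S' by (simp add: cmp_assoc)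
  then obtain p where p: "q \<bullet> s' = j \<bullet> p" using kc kern_def by blast
  have ph: "hom p S' L" using p hom_cmp[OF S'(1) Q(1)] L hom_cmpE hom_unique by metis
  have "zro (c \<bullet> (q \<bullet> s))" using zro_cmp_hom[OF hom_cmp[OF s(1) Q(1)] R(1)] Q by blast
  then have "zro ((c \<bullet> q) \<bullet> s)" by (simp add: cmp_assoc)
  then obtain h where h: "s = s' \<bullet> h" using s' kern_def by blast
  have hh: "hom h S S'" using h s S' hom_cmpE hom_unique by metis
  \<comment> \<open>With \<open>m\<close> the image of \<open>p\<close>, the cokernel
    \<open>d\<close> of \<open>j \<bullet> m\<close> kills \<open>q \<bullet> s'\<close>, so it
    factors through \<open>c\<close> and kills \<open>j\<close>. Hence \<open>j\<close> factors
    through \<open>j \<bullet> m\<close>, and \<open>m\<close> is a split epimorphism.\<close>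
  have pe: "epic p"
  proof -
    obtain J e m where m: "hom e S' J" "epic e" "hom m J L" "monic m" "p = m \<bullet> e"
      using image_factorization[OF ph] .
    have jm: "hom (j \<bullet> m) J Q" "monic (j \<bullet> m)" using monic_cmp m L hom_cmp hom_not_None by metis+
    obtain d where d: "coker (j \<bullet> m) d" using ex_coker jm by blast
    obtain D where D: "hom d Q D" "zro (d \<bullet> (j \<bullet> m))" using cokerD[OF d jm(1)] by blast
    have "zro ((d \<bullet> (j \<bullet> m)) \<bullet> e)" using zro_cmp_hom[OF m(1) hom_cmp[OF jm(1) D(1)]] D by blast
    then have "zro ((d \<bullet> q) \<bullet> s')" using m(5) p by (simp add: cmp_assoc)
    then obtain z where z: "d \<bullet> q = z \<bullet> (c \<bullet> q)"
      using coker_of_kern[OF cq(2,1) s'] coker_def by blast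
    then have "d \<bullet> q = (z \<bullet> c) \<bullet> q" by (simp add: cmp_assoc)
    then have dz: "d = z \<bullet> c" using epicD[OF Q(2,1) D(1)] by blast
    have zh: "hom z R D" using dz D R hom_cmpE hom_unique by metis
    have "zro (d \<bullet> j)" using zro_cmp_hom[OF hom_cmp[OF L(1) R(1)] zh] R dz by (simp add: cmp_assoc)
    then obtain v where v: "j = (j \<bullet> m) \<bullet> v" using kern_of_coker[OF jm(2,1) d] kern_def by blast
    have "m \<bullet> v = ide L"
    proof -
      have 1: "j \<bullet> (m \<bullet> v) = j \<bullet> ide L" using v ide_right[OF L(1)] by (simp add: cmp_assoc)
      have "hom (j \<bullet> (m \<bullet> v)) L Q" using v L by (simp add: cmp_assoc)
      then have "hom (m \<bullet> v) L L" using L(1) hom_cmpE hom_unique by metis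
      then show ?thesis using monicD[OF L(2,1)] 1 by blast
    qed
    then have "epic m" using epic_cancel epic_ide hom_objs L by metis
    then show ?thesis using epic_cmp m ph hom_not_None by metis
  qed
  have "kern p h"
    unfolding kern_def
  proof (intro conjI allI impI)
    show mh: "monic h" using monic_cancel h s by metis
    have "zro (j \<bullet> (p \<bullet> h))" using p h Q by (metis cmp_assoc)
    then show "zro (p \<bullet> h)" using monic_zro L by blast
    fix w assume w: "zro (p \<bullet> w)"
    obtain W where W: "hom w W S'" using zro_cmp_dom[OF w ph] .
    have "zro (j \<bullet> (p \<bullet> w))" using zro_cmp_hom[OF hom_cmp[OF W ph] L(1)] w by blast
    then have "zro (q \<bullet> (s' \<bullet> w))" using p by (metis cmp_assoc)
    then obtain x where "s' \<bullet> w = s \<bullet> x" using kq kern_def by blast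
    then have "s' \<bullet> w = s' \<bullet> (h \<bullet> x)" using h by (simp add: cmp_assoc)
    then show "\<exists>u. w = h \<bullet> u" using monicD[OF S'(2,1) W] by blast
  qed
  then have "coker h p" using coker_of_kern[OF pe ph] by blast
  then show ?thesis using S' q h p Q j by metis
qed

lemma ex_socle_filtration:
  assumes M: "M \<in> Obj C" shows "\<exists>\<sigma>. socle_filtration M \<sigma>"
proof -
  obtain Z where Z: "zob Z" using ex_zero_obj zob_def by blast
  have zh: "hom (zer Z M) Z M" "zro (zer Z M)" using Z zob_obj M zro_zer by auto
  have zm: "monic (zer Z M)" by (rule monicI_hom[OF zh(1)]) (metis Z to_zob_eq)
  \<comment> \<open>The implication guarded by \<open>k = 0\<close> carries the initial condition
    through dependent choice, whose conclusion prescribes no starting value.\<close>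
  have "\<exists>\<sigma>. \<forall>k. (monic (\<sigma> k) \<and> (\<exists>S. hom (\<sigma> k) S M) \<and> (k = 0 \<longrightarrow> zro (\<sigma> k))) \<and>
      (\<exists>q h p j Q. coker (\<sigma> k) q \<and> \<sigma> k = \<sigma> (Suc k) \<bullet> h \<and> coker h p \<and>
      j \<bullet> p = q \<bullet> \<sigma> (Suc k) \<and> hom q M Q \<and> socle Q j)"
  proof (rule dependent_nat_choice)
    show "\<exists>s. monic s \<and> (\<exists>S. hom s S M) \<and> (0 = (0::nat) \<longrightarrow> zro s)" using zh zm by blast
    fix s k assume "monic s \<and> (\<exists>S. hom s S M) \<and> (k = (0::nat) \<longrightarrow> zro s)"
    then obtain S where "hom s S M" "monic s" by blast
    then show "\<exists>s'. (monic s' \<and> (\<exists>S. hom s' S M) \<and> (Suc k = 0 \<longrightarrow> zro s')) \<and>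
      (\<exists>q h p j Q. coker s q \<and> s = s' \<bullet> h \<and> coker h p \<and> j \<bullet> p = q \<bullet> s' \<and> hom q M Q \<and> socle Q j)"
      using ex_socle_filtration_step by fastforce
  qed
  then show ?thesis unfolding socle_filtration_def by (elim ex_forward, intro conjI allI) blast+
qed

text \<open>The ascending chain condition gives a stage equal to the next one. There the quotient
  has zero socle, so it is zero by \<open>socle_nonzero\<close>.\<close>

lemma socle_filtration_terminates:
  assumes M: "M \<in> Obj C" and \<sigma>: "socle_filtration M \<sigma>" shows "\<exists>n S. isom (\<sigma> n) S M"
proof -
  let ?P = "\<lambda>s. \<exists>k. s = \<sigma> k"
  have sub: "monic s \<and> (\<exists>S. hom s S M)" if "?P s" for s using that \<sigma> unfolding socle_filtration_def by blast
  obtain s where s: "?P s" "\<And>t. ?P t \<Longrightarrow> \<exists>h. s = t \<bullet> h \<Longrightarrow> \<exists>h. t = s \<bullet> h"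
    using maximal_sub_ex[OF M, of ?P "\<sigma> 0"] sub by blast
  obtain k where k: "s = \<sigma> k" using s by blast
  obtain q h p j Q where f: "coker (\<sigma> k) q" "\<sigma> k = \<sigma> (Suc k) \<bullet> h" "coker h p"
      "j \<bullet> p = q \<bullet> \<sigma> (Suc k)" "hom q M Q" "socle Q j"
    using \<sigma> unfolding socle_filtration_def by blast
  obtain S where S: "hom (\<sigma> k) S M" "monic (\<sigma> k)" using sub by blast
  obtain S' where S': "hom (\<sigma> (Suc k)) S' M" using sub by blast
  obtain u where u: "\<sigma> (Suc k) = \<sigma> k \<bullet> u" using s(2)[of "\<sigma> (Suc k)"] f(2) k by blast
  have "zro (q \<bullet> \<sigma> (Suc k))"
    using zro_if_factors[OF kern_of_coker[OF S(2,1) f(1)] f(5) u] S' hom_not_None by blast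
  then have "zro (j \<bullet> p)" using f by simp
  then have "zro j" using epic_zro f(3) coker_def by blast
  moreover have Q: "Q \<in> Obj C" using f hom_objs by blast
  ultimately have "zob Q" using socle_nonzero f by blast
  then have "zro q" using to_zob f by blast
  then have "epic (\<sigma> k)" using epic_of_zro_coker S f by blast
  then show ?thesis using monic_epic_isom S by blast
qed

text \<open>A minimal finite meet lies below each maximal subobject, since intersecting it once more
  with that subobject gives nothing smaller.\<close>

lemma ex_radical:
  assumes M: "M \<in> Obj C" shows "\<exists>r. radical M r \<and> finite_meet M r"
proof -
  obtain r where r: "finite_meet M r" "\<And>t. finite_meet M t \<Longrightarrow> \<exists>h. t = r \<bullet> h \<Longrightarrow> \<exists>h. r = t \<bullet> h"
    using minimal_sub_ex[OF M, of "finite_meet M" "ide M"] finite_meet.top[OF M] finite_meet_hom by blast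
  obtain R where R: "hom r R M" "monic r" using finite_meet_hom r by blast
  have "\<exists>h. r = s \<bullet> h" if s: "maximal_sub M s" for s
  proof -
    obtain S where S: "hom s S M" using s maximal_sub_def by blast
    obtain q where q: "coker s q" using ex_coker S by blast
    obtain Q where Q: "hom q M Q" "kern q s" using maximal_coker_hom[OF s q] by blast
    obtain k where k: "kern (q \<bullet> r) k" using ex_kern hom_cmp[OF R(1) Q(1)] by blast
    obtain h where h: "r = (r \<bullet> k) \<bullet> h" using r(2)[OF finite_meet.meet[OF r(1) s q k]] by blast
    have "zro ((q \<bullet> r) \<bullet> k)" using k kern_def by blast
    then have "zro (q \<bullet> (r \<bullet> k))" by (simp add: cmp_assoc)
    then obtain x where "r \<bullet> k = s \<bullet> x" using Q kern_def by blast
    then have "r = s \<bullet> (x \<bullet> h)" using h by (metis cmp_assoc)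
    then show ?thesis by blast
  qed
  moreover have "\<exists>h. t = r \<bullet> h" if "hom t T M" "\<forall>s. maximal_sub M s \<longrightarrow> (\<exists>h. t = s \<bullet> h)" for t T
    using finite_meet_greatest[OF r(1) that(1)] that(2) by blast
  ultimately have "radical M r" unfolding radical_def using R by blast
  then show ?thesis using r by blast
qed

text \<open>Each step keeps its \<open>finite_meet\<close> witness, because the image of a radical
  under the functor is computed from it.\<close>

lemma ex_radical_filtration:
  assumes M: "M \<in> Obj C"
  shows "\<exists>\<rho>. \<rho> 0 = ide M \<and> (\<forall>k. monic (\<rho> k) \<and> (\<exists>r R. hom (\<rho> k) R M \<and> radical R r \<and> finite_meet R r \<and> \<rho> (Suc k) = \<rho> k \<bullet> r))"
proof -
  have "\<exists>\<rho>. \<forall>k. (monic (\<rho> k) \<and> (\<exists>R. hom (\<rho> k) R M) \<and> (k = 0 \<longrightarrow> \<rho> k = ide M)) \<and>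
      (\<exists>r R. hom (\<rho> k) R M \<and> radical R r \<and> finite_meet R r \<and> \<rho> (Suc k) = \<rho> k \<bullet> r)"
  proof (rule dependent_nat_choice)
    show "\<exists>s. monic s \<and> (\<exists>S. hom s S M) \<and> (0 = (0::nat) \<longrightarrow> s = ide M)" using monic_ide M by blast
    fix s k assume "monic s \<and> (\<exists>S. hom s S M) \<and> (k = (0::nat) \<longrightarrow> s = ide M)"
    then obtain S where S: "hom s S M" "monic s" by blast
    then obtain r where r: "radical S r" "finite_meet S r" using ex_radical hom_objs by blast
    then obtain R where R: "hom r R S" "monic r" unfolding radical_def by blast
    then have "hom (s \<bullet> r) R M" "monic (s \<bullet> r)" using S monic_cmp hom_cmp hom_not_None by metis+
    then show "\<exists>s'. (monic s' \<and> (\<exists>S. hom s' S M) \<and> (Suc k = 0 \<longrightarrow> s' = ide M)) \<and>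
      (\<exists>r R. hom s R M \<and> radical R r \<and> finite_meet R r \<and> s' = s \<bullet> r)"
      using S r by blast
  qed
  then show ?thesis by blast
qed

end

section \<open>Functors preserving Loewy diagrams\<close>

context is_functor
begin

definition fa :: "('o, 'm) arrow \<Rightarrow> ('p, 'q) arrow"
  where "fa a = map_option (\<lambda>(X, f, Y). (omap F X, mmap F f, omap F Y)) a"

lemma fa_ar: "C.hom (C.ar X f Y) X Y \<Longrightarrow> fa (C.ar X f Y) = D.ar (omap F X) (mmap F f) (omap F Y)"
  using omap_closed mmap_closed by (auto simp: fa_def C.ar_def D.ar_def C.hom_def)

lemma hom_fa: "C.hom a X Y \<Longrightarrow> D.hom (fa a) (omap F X) (omap F Y)"
  using omap_closed mmap_closed by (auto simp: fa_def C.hom_def D.hom_def)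

lemma fa_ide: "X \<in> Obj C \<Longrightarrow> fa (C.ide X) = D.ide (omap F X)"
  using fa_ar C.hom_ide unfolding C.ide_def D.ide_def by (simp add: mmap_id)

lemma fa_cmp:
  assumes "C.hom a X Y" "C.hom b Y Z" shows "fa (C.cmp b a) = D.cmp (fa b) (fa a)"
proof -
  obtain f g where e: "a = C.ar X f Y" "b = C.ar Y g Z" and m: "f \<in> mor C X Y" "g \<in> mor C Y Z"
    using assms C.hom_arE by metis
  have o: "X \<in> Obj C" "Y \<in> Obj C" "Z \<in> Obj C" using assms C.hom_objs by auto
  have "fa (C.cmp b a) = fa (C.ar X (Comp C g f) Z)" using C.cmp_ar assms e by simp
  also have "\<dots> = D.ar (omap F X) (mmap F (Comp C g f)) (omap F Z)"
    using fa_ar C.hom_cmp[OF assms] C.cmp_ar assms e by simp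
  also have "mmap F (Comp C g f) = Comp D (mmap F g) (mmap F f)" using mmap_comp[OF o m] .
  also have "D.ar (omap F X) (Comp D (mmap F g) (mmap F f)) (omap F Z) = D.cmp (fa b) (fa a)"
    using D.cmp_ar[of "omap F X" "mmap F f" "omap F Y" "mmap F g" "omap F Z"] hom_fa[OF assms(1)] hom_fa[OF assms(2)]
      fa_ar[of X f Y] fa_ar[of Y g Z] assms unfolding e by simp
  finally show ?thesis .
qed

lemma fa_isom: "C.isom a X Y \<Longrightarrow> D.isom (fa a) (omap F X) (omap F Y)"
proof -
  assume a: "C.isom a X Y"
  obtain b where b: "C.hom b Y X" "C.cmp b a = C.ide X" "C.cmp a b = C.ide Y" using C.isomE[OF a] by metis
  have ah: "C.hom a X Y" using C.isom_hom a by blast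
  show ?thesis
    by (rule D.isomI[OF hom_fa[OF ah] hom_fa[OF b(1)]])
      (use fa_cmp[OF ah b(1)] fa_cmp[OF b(1) ah] b ah fa_ide C.hom_objs in metis)+
qed

end

text \<open>By \<open>fa_socle_zro\<close>, arrows from \<open>F T\<close> with \<open>T\<close> simple to \<open>F X\<close> factor through the image of the
  socle of \<open>X\<close>; by \<open>fa_radical_zro\<close>, arrows from \<open>F X\<close> to \<open>F T\<close> vanish on the image of the radical.\<close>

locale loewy_functor = C: locally_finite_category K C + D: normal_category L D + is_functor C D F
  for K :: "('k, 'x) ring_scheme" and C :: "('o, 'm, 'k, 'z) lin_cat_scheme"
    and L :: "('l, 'w) ring_scheme" and D :: "('p, 'q, 'l, 'y) lin_cat_scheme"
    and F :: "('o, 'm, 'p, 'q) fnctr" +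
  assumes fa_kern: "C.hom f X Y \<Longrightarrow> C.kern f k \<Longrightarrow> D.kern (fa f) (fa k)"
    and fa_coker: "C.hom f X Y \<Longrightarrow> C.coker f q \<Longrightarrow> D.coker (fa f) (fa q)"
    and fa_dsum: "C.dsum (J :: nat set) U A e \<Longrightarrow> D.dsum J (\<lambda>i. omap F (U i)) (omap F A) (\<lambda>i. fa (e i))"
    and omap_simple: "C.simple T \<Longrightarrow> D.simple (omap F T)"
    and simple_image: "D.simple N \<Longrightarrow> \<exists>T f. C.simple T \<and> D.isom f (omap F T) N"
    and fa_socle_zro: "\<lbrakk>C.simple T; C.hom q X Y; \<And>t T'. C.simple T' \<Longrightarrow> C.hom t T' X \<Longrightarrow> C.zro (C.cmp q t);
       D.hom d (omap F T) (omap F X)\<rbrakk> \<Longrightarrow> D.zro (D.cmp (fa q) d)"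
    and fa_radical_zro: "\<lbrakk>C.simple T; C.hom k W X; \<And>t T'. C.simple T' \<Longrightarrow> C.hom t X T' \<Longrightarrow> C.zro (C.cmp t k);
       D.hom d (omap F X) (omap F T)\<rbrakk> \<Longrightarrow> D.zro (D.cmp d (fa k))"
    and omap_zob: "X \<in> Obj C \<Longrightarrow> D.zob (omap F X) \<Longrightarrow> C.zob X"
    and fa_section: "\<lbrakk>C.hom g Z T; D.hom h (omap F T) (omap F Z); D.cmp (fa g) h = D.ide (omap F T)\<rbrakk>
       \<Longrightarrow> \<exists>s. C.cmp g s = C.ide T"
begin

section \<open>Images of socles, radicals and their filtrations\<close>

lemma fa_monic: assumes "C.hom f X Y" "C.monic f" shows "D.monic (fa f)"
proof -
  obtain q where q: "C.coker f q" using C.ex_coker assms by blast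
  obtain Q where "C.hom q Y Q" using C.cokerD(2)[OF q assms(1)] by blast
  then have "D.kern (fa q) (fa f)" using fa_kern C.kern_of_coker[OF assms(2,1) q] by blast
  then show ?thesis using D.kern_def by blast
qed

text \<open>Additivity of the functor is not among the locale assumptions. Instead, a zero arrow has
  the identity as its kernel, and kernels are preserved.\<close>

lemma fa_zro: assumes "C.hom f X Y" "C.zro f" shows "D.zro (fa f)"
proof -
  have o: "Y \<in> Obj C" using assms C.hom_objs by blast
  have "C.kern f (C.ide X)"
    unfolding C.kern_def
  proof (intro conjI allI impI)
    show "C.monic (C.ide X)" using C.monic_ide C.hom_objs assms by blast
    show "C.zro (C.cmp f (C.ide X))" using C.ide_right assms by metis
    fix w assume w: "C.zro (C.cmp f w)"
    obtain W where "C.hom w W X" using C.zro_cmp_dom[OF w assms(1)] .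
    then have "w = C.cmp (C.ide X) w" using C.ide_left by simp
    then show "\<exists>u. w = C.cmp (C.ide X) u" by blast
  qed
  then have "D.zro (D.cmp (fa f) (fa (C.ide X)))" using fa_kern assms D.kern_def by blast
  then show ?thesis using fa_ide D.ide_right hom_fa[OF assms(1)] C.hom_objs assms by metis
qed

lemma omap_semisimple: "C.semisimple X \<Longrightarrow> D.semisimple (omap F X)"
proof -
  assume "C.semisimple X"
  then obtain n U e where u: "\<forall>i<(n::nat). C.simple (U i)" "C.dsum {..<n} U X e" using C.semisimple_def by blast
  then have "\<forall>i<n. D.simple (omap F (U i))" using omap_simple by blast
  moreover have "D.dsum {..<n} (\<lambda>i. omap F (U i)) (omap F X) (\<lambda>i. fa (e i))" using fa_dsum u by blast
  ultimately show ?thesis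
    unfolding D.semisimple_def by (intro exI[of _ n] exI[of _ "\<lambda>i. omap F (U i)"] exI[of _ "\<lambda>i. fa (e i)"]) simp
qed

text \<open>The cokernel of \<open>s\<close> is sent to a zero object, and \<open>omap_zob\<close>
  reflects this; so \<open>s\<close> is epic as well as monic. The equality of Loewy lengths rests
  on it.\<close>

lemma fa_isom_reflect:
  assumes "C.hom s S X" "C.monic s" "D.isom (fa s) S' X'" shows "C.isom s S X"
proof -
  obtain q where q: "C.coker s q" using C.ex_coker assms by blast
  obtain Q where Q: "C.hom q X Q" using C.cokerD(2)[OF q assms(1)] by blast
  have c: "D.coker (fa s) (fa q)" using fa_coker assms q by blast
  then have z: "D.zro (fa q)" using D.epic_zro D.isom_epic assms(3) D.coker_def by blast
  then have "D.zob (omap F Q)" using D.zob_epic hom_fa[OF Q] c D.coker_def by blast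
  then have "C.zob Q" using omap_zob Q C.hom_objs by blast
  then have "C.zro q" using C.to_zob Q by blast
  then show ?thesis using C.epic_of_zro_coker[OF assms(1) q] C.monic_epic_isom assms by blast
qed

text \<open>A semisimple object over the image of \<open>Q\<close> is tested on the simple objects
  mapping to it. Each of these is the image of a simple \<open>T\<close>, and
  \<open>fa_socle_zro\<close> says that the image of the cokernel of \<open>j\<close> kills
  it.\<close>

lemma fa_socle:
  assumes j: "C.socle Q j" shows "D.socle (omap F Q) (fa j)"
proof -
  obtain S where S: "C.hom j S Q" "C.monic j" "C.semisimple S" using j C.socle_def by blast
  obtain c where c: "C.coker j c" using C.ex_coker S by blast
  obtain R where R: "C.hom c Q R" using C.cokerD(2)[OF c S(1)] by blast
  have k: "C.kern c j" using C.kern_of_coker[OF S(2,1) c] .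
  have kD: "D.kern (fa c) (fa j)" using fa_kern R k by blast
  have kill: "C.zro (C.cmp c t)" if t: "C.simple T'" "C.hom t T' Q" for t T'
  proof -
    obtain g where g: "t = C.cmp j g" using C.simple_into_socle[OF j t] by blast
    show ?thesis using C.zro_if_factors[OF k R g] C.hom_not_None t by blast
  qed
  have "\<exists>h. t = D.cmp (fa j) h" if t: "D.hom t N (omap F Q)" "D.semisimple N" for t N
  proof -
    have "D.zro (D.cmp (fa c) t)"
    proof (rule D.semisimple_zro[OF t(2) D.hom_cmp[OF t(1) hom_fa[OF R]]])
      fix x N' assume x: "D.simple N'" "D.hom x N' N"
      obtain T f where f: "C.simple T" "D.isom f (omap F T) N'" using simple_image x by blast
      have "D.hom (D.cmp t (D.cmp x f)) (omap F T) (omap F Q)" using t x D.isom_hom[OF f(2)] by blast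
      then have "D.zro (D.cmp (fa c) (D.cmp t (D.cmp x f)))" using fa_socle_zro[OF f(1) R] kill by blast
      then have "D.zro (D.cmp (D.cmp (D.cmp (fa c) t) x) f)" by (simp add: D.cmp_assoc)
      then show "D.zro (D.cmp (D.cmp (fa c) t) x)" using D.epic_zro D.isom_epic f by blast
    qed
    then show ?thesis using kD D.kern_def by blast
  qed
  then show ?thesis
    unfolding D.socle_def using fa_monic S hom_fa omap_semisimple by blast
qed

lemma fa_socle_filtration:
  assumes \<sigma>: "C.socle_filtration M \<sigma>" shows "D.socle_filtration (omap F M) (\<lambda>k. fa (\<sigma> k))"
  unfolding D.socle_filtration_def
proof (intro conjI allI)
  have s: "C.monic (\<sigma> k)" "\<exists>S. C.hom (\<sigma> k) S M" for k using \<sigma> unfolding C.socle_filtration_def by auto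
  show "D.monic (fa (\<sigma> k))" for k using fa_monic s by blast
  show "\<exists>S. D.hom (fa (\<sigma> k)) S (omap F M)" for k using hom_fa s by blast
  show "D.zro (fa (\<sigma> 0))" using fa_zro s \<sigma> unfolding C.socle_filtration_def by blast
  fix k
  obtain q h p j Q where f: "C.coker (\<sigma> k) q" "\<sigma> k = C.cmp (\<sigma> (Suc k)) h" "C.coker h p"
      "C.cmp j p = C.cmp q (\<sigma> (Suc k))" "C.hom q M Q" "C.socle Q j"
    using \<sigma> unfolding C.socle_filtration_def by blast
  obtain S S' where S: "C.hom (\<sigma> k) S M" "C.hom (\<sigma> (Suc k)) S' M" using s by blast
  have h: "C.hom h S S'" using f(2) S C.hom_cmpE C.hom_unique by metis
  obtain P where p: "C.hom p S' P" using C.cokerD(2)[OF f(3) h] by blast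
  have j: "C.hom j P Q" using f(4) C.hom_cmp[OF S(2) f(5)] p C.hom_cmpE C.hom_unique by metis
  have "D.coker (fa (\<sigma> k)) (fa q)" using fa_coker S f by blast
  moreover have "fa (\<sigma> k) = D.cmp (fa (\<sigma> (Suc k))) (fa h)" using fa_cmp[OF h S(2)] f(2) by simp
  moreover have "D.coker (fa h) (fa p)" using fa_coker h f by blast
  moreover have "D.cmp (fa j) (fa p) = D.cmp (fa q) (fa (\<sigma> (Suc k)))"
    using fa_cmp[OF p j] fa_cmp[OF S(2) f(5)] f(4) by simp
  ultimately show "\<exists>q h p j Q. D.coker (fa (\<sigma> k)) q \<and> fa (\<sigma> k) = D.cmp (fa (\<sigma> (Suc k))) h \<and> D.coker h p \<and>
      D.cmp j p = D.cmp q (fa (\<sigma> (Suc k))) \<and> D.hom q (omap F M) Q \<and> D.socle Q j"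
    using hom_fa[OF f(5)] fa_socle[OF f(6)] by blast
qed

lemma fa_maximal_sub:
  assumes s: "C.maximal_sub X s" shows "D.maximal_sub (omap F X) (fa s)"
proof -
  obtain S where S: "C.hom s S X" using s C.maximal_sub_def by blast
  obtain q where q: "C.coker s q" using C.ex_coker S by blast
  obtain Q where Q: "C.hom q X Q" "C.kern q s" "C.simple Q" using C.maximal_coker_hom[OF s q] .
  show ?thesis
    using D.maximal_sub_kern[OF hom_fa[OF Q(1)] _ omap_simple[OF Q(3)] fa_kern[OF Q(1,2)]] fa_coker[OF S q]
    unfolding D.coker_def by blast
qed

text \<open>Images of maximal subobjects are maximal, and every meet is taken by a kernel, which the
  functor preserves; so the bound is pushed through one kernel at a time.\<close>

lemma fa_finite_meet:
  assumes "C.finite_meet X r" "D.hom t T (omap F X)" "\<And>s. D.maximal_sub (omap F X) s \<Longrightarrow> \<exists>h. t = D.cmp s h"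
  shows "\<exists>h. t = D.cmp (fa r) h"
  using assms(1)
proof (induction rule: C.finite_meet.induct)
  case top
  then show ?case using fa_ide D.ide_left assms(2) by metis
next
  case (meet r s q k)
  obtain R where R: "C.hom r R X" using C.finite_meet_hom meet by blast
  obtain Q where Q: "C.hom q X Q" "C.kern q s" using C.maximal_coker_hom meet by blast
  obtain P where P: "C.hom k P R" using C.kernD(2)[OF meet(4) C.hom_cmp[OF R Q(1)]] by blast
  obtain h h' where h: "t = D.cmp (fa r) h" "t = D.cmp (fa s) h'"
    using meet.IH assms(3)[OF fa_maximal_sub[OF meet(2)]] by blast
  have "D.zro (D.cmp (fa q) t)"
    using D.zro_if_factors[OF fa_kern[OF Q] hom_fa[OF Q(1)] h(2)] assms(2) D.hom_not_None by blast
  then have z: "D.zro (D.cmp (fa (C.cmp q r)) h)" using h fa_cmp[OF R Q(1)] by (simp add: D.cmp_assoc)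
  have "D.kern (fa (C.cmp q r)) (fa k)" using fa_kern[OF C.hom_cmp[OF R Q(1)] meet(4)] .
  then obtain z where "h = D.cmp (fa k) z" using z D.kern_def by blast
  then show ?case using h fa_cmp[OF P R] by (auto simp: D.cmp_assoc)
qed

text \<open>Two opposite inclusions. The image of \<open>r\<close> lies in each maximal subobject,
  because the simple quotient is the image of a simple object and \<open>fa_radical_zro\<close>
  applies. It is the greatest such, because the maximal subobjects coming from \<open>X\<close>
  already cut it out.\<close>

lemma fa_radical:
  assumes r: "C.radical X r" "C.finite_meet X r" shows "D.radical (omap F X) (fa r)"
  unfolding D.radical_def
proof (intro conjI allI impI)
  obtain R where R: "C.hom r R X" "C.monic r" using r C.radical_def by blast
  show "D.monic (fa r)" using fa_monic R by blast
  show "\<exists>R. D.hom (fa r) R (omap F X)" using hom_fa R by blast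
  fix s assume s: "D.maximal_sub (omap F X) s"
  obtain S where S: "D.hom s S (omap F X)" using s D.maximal_sub_def by blast
  obtain q where q: "D.coker s q" using D.ex_coker S by blast
  obtain Q where Q: "D.hom q (omap F X) Q" "D.kern q s" "D.simple Q" using D.maximal_coker_hom[OF s q] .
  obtain T f where f: "C.simple T" "D.isom f (omap F T) Q" using simple_image Q by blast
  obtain g where g: "D.isom g Q (omap F T)" using D.isomE f by blast
  have gq: "D.hom (D.cmp g q) (omap F X) (omap F T)" using Q D.isom_hom g by blast
  have "D.zro (D.cmp (D.cmp g q) (fa r))"
    using fa_radical_zro[OF f(1) R(1) _ gq] C.radical_zro[OF r(1)] by blast
  then have "D.zro (D.cmp g (D.cmp q (fa r)))" by (simp add: D.cmp_assoc)
  then have "D.zro (D.cmp q (fa r))" using D.monic_zro D.isom_monic g by blast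
  then show "\<exists>h. fa r = D.cmp s h" using Q D.kern_def by blast
next
  fix t T assume "D.hom t T (omap F X)" "\<forall>s. D.maximal_sub (omap F X) s \<longrightarrow> (\<exists>h. t = D.cmp s h)"
  then show "\<exists>h. t = D.cmp (fa r) h" using fa_finite_meet r by blast
qed

lemma fa_same_sub:
  assumes "C.hom s S M" "C.hom t T M" "C.same_sub s t" shows "D.same_sub (fa s) (fa t)"
proof -
  obtain a b where ab: "s = C.cmp t a" "t = C.cmp s b" using assms C.same_sub_def by metis
  then have "C.hom a S T" "C.hom b T S" using assms C.hom_cmpE C.hom_unique by metis+
  then have "fa s = D.cmp (fa t) (fa a)" "fa t = D.cmp (fa s) (fa b)" using ab fa_cmp assms by metis+
  then show ?thesis unfolding D.same_sub_def by blast
qed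

lemma fa_socle_filtration_same:
  assumes X: "X \<in> Obj C" and \<sigma>: "is_socle_filtration C X \<sigma>" and \<tau>: "is_socle_filtration D (omap F X) \<tau>"
  shows "C.hom (C.sub_ar X (\<sigma> k)) (fst (\<sigma> k)) X" "C.monic (C.sub_ar X (\<sigma> k))"
    "D.hom (D.sub_ar (omap F X) (\<tau> k)) (fst (\<tau> k)) (omap F X)" "D.monic (D.sub_ar (omap F X) (\<tau> k))"
    "D.same_sub (fa (C.sub_ar X (\<sigma> k))) (D.sub_ar (omap F X) (\<tau> k))"
proof -
  have s: "\<forall>k. C.hom (C.sub_ar X (\<sigma> k)) (fst (\<sigma> k)) X" "C.socle_filtration X (\<lambda>k. C.sub_ar X (\<sigma> k))"
    using C.is_socle_filtration_iff[OF X] \<sigma> by auto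
  have t: "\<forall>k. D.hom (D.sub_ar (omap F X) (\<tau> k)) (fst (\<tau> k)) (omap F X)"
      "D.socle_filtration (omap F X) (\<lambda>k. D.sub_ar (omap F X) (\<tau> k))"
    using D.is_socle_filtration_iff[OF omap_closed[OF X]] \<tau> by auto
  show "C.hom (C.sub_ar X (\<sigma> k)) (fst (\<sigma> k)) X" "C.monic (C.sub_ar X (\<sigma> k))"
    using s unfolding C.socle_filtration_def by blast+
  show "D.hom (D.sub_ar (omap F X) (\<tau> k)) (fst (\<tau> k)) (omap F X)" "D.monic (D.sub_ar (omap F X) (\<tau> k))"
    using t unfolding D.socle_filtration_def by blast+
  show "D.same_sub (fa (C.sub_ar X (\<sigma> k))) (D.sub_ar (omap F X) (\<tau> k))"
    using D.socle_filtration_unique[OF fa_socle_filtration[OF s(2)] t(2)] .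
qed

lemma fa_radical_filtration:
  assumes X: "X \<in> Obj C"
  obtains \<rho> where "C.radical_filtration X \<rho>" "D.radical_filtration (omap F X) (\<lambda>k. fa (\<rho> k))"
proof -
  obtain \<rho> where \<rho>: "\<rho> 0 = C.ide X" "\<And>k. C.monic (\<rho> k)"
    "\<And>k. \<exists>r R. C.hom (\<rho> k) R X \<and> C.radical R r \<and> C.finite_meet R r \<and> \<rho> (Suc k) = C.cmp (\<rho> k) r"
    using C.ex_radical_filtration[OF X] by blast
  have "C.radical_filtration X \<rho>"
    unfolding C.radical_filtration_def using \<rho> C.isom_ide[OF X] by metis
  moreover have "D.radical_filtration (omap F X) (\<lambda>k. fa (\<rho> k))"
    unfolding D.radical_filtration_def
  proof (intro conjI allI)
    show "D.monic (fa (\<rho> k))" for k using fa_monic \<rho> by blast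
    show "\<exists>R. D.isom (fa (\<rho> 0)) R (omap F X)" using \<rho>(1) C.isom_ide[OF X] fa_isom by metis
    fix k
    obtain r R where r: "C.hom (\<rho> k) R X" "C.radical R r" "C.finite_meet R r" "\<rho> (Suc k) = C.cmp (\<rho> k) r"
      using \<rho>(3) by blast
    obtain R' where "C.hom r R' R" using r(2) C.radical_def by blast
    then have "fa (\<rho> (Suc k)) = D.cmp (fa (\<rho> k)) (fa r)" using fa_cmp r by simp
    then show "\<exists>r R. D.hom (fa (\<rho> k)) R (omap F X) \<and> D.radical R r \<and> fa (\<rho> (Suc k)) = D.cmp (fa (\<rho> k)) r"
      using hom_fa[OF r(1)] fa_radical[OF r(2,3)] by blast
  qed
  ultimately show ?thesis using that by blast
qed

lemma fa_radical_filtration_same: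
  assumes X: "X \<in> Obj C" and \<sigma>: "is_radical_filtration C X \<sigma>" and \<tau>: "is_radical_filtration D (omap F X) \<tau>"
  shows "C.hom (C.sub_ar X (\<sigma> k)) (fst (\<sigma> k)) X" "C.monic (C.sub_ar X (\<sigma> k))"
    "D.hom (D.sub_ar (omap F X) (\<tau> k)) (fst (\<tau> k)) (omap F X)" "D.monic (D.sub_ar (omap F X) (\<tau> k))"
    "D.same_sub (fa (C.sub_ar X (\<sigma> k))) (D.sub_ar (omap F X) (\<tau> k))"
proof -
  have s: "\<forall>k. C.hom (C.sub_ar X (\<sigma> k)) (fst (\<sigma> k)) X" "C.radical_filtration X (\<lambda>k. C.sub_ar X (\<sigma> k))"
    using C.is_radical_filtration_iff[OF X] \<sigma> by auto
  have t: "\<forall>k. D.hom (D.sub_ar (omap F X) (\<tau> k)) (fst (\<tau> k)) (omap F X)"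
      "D.radical_filtration (omap F X) (\<lambda>k. D.sub_ar (omap F X) (\<tau> k))"
    using D.is_radical_filtration_iff[OF omap_closed[OF X]] \<tau> by auto
  show sk: "C.hom (C.sub_ar X (\<sigma> k)) (fst (\<sigma> k)) X" "C.monic (C.sub_ar X (\<sigma> k))"
    using s unfolding C.radical_filtration_def by blast+
  show "D.hom (D.sub_ar (omap F X) (\<tau> k)) (fst (\<tau> k)) (omap F X)" "D.monic (D.sub_ar (omap F X) (\<tau> k))"
    using t unfolding D.radical_filtration_def by blast+
  \<comment> \<open>The given \<open>\<sigma>\<close> carries no \<open>finite_meet\<close>
    witnesses, so it is compared with a filtration built with them, and uniqueness is applied on
    both sides.\<close>
  obtain \<rho> where \<rho>: "C.radical_filtration X \<rho>" "D.radical_filtration (omap F X) (\<lambda>k. fa (\<rho> k))"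
    using fa_radical_filtration[OF X] .
  obtain R where R: "C.hom (\<rho> k) R X" using \<rho>(1) unfolding C.radical_filtration_def by blast
  have 1: "D.same_sub (fa (C.sub_ar X (\<sigma> k))) (fa (\<rho> k))"
    using fa_same_sub[OF sk(1) R] C.radical_filtration_unique[OF s(2) \<rho>(1)] by blast
  have 2: "D.same_sub (fa (\<rho> k)) (D.sub_ar (omap F X) (\<tau> k))"
    using D.radical_filtration_unique[OF \<rho>(2) t(2)] .
  show "D.same_sub (fa (C.sub_ar X (\<sigma> k))) (D.sub_ar (omap F X) (\<tau> k))"
    using 1 2 unfolding D.same_sub_def by (metis D.cmp_assoc)
qed

section \<open>Transport of subquotients, arrows of diagrams and Loewy lengths\<close>

lemma omap_sub_quotient:
  assumes X: "X \<in> Obj C"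
    and s: "C.hom (C.sub_ar X s) (fst s) X" "C.monic (C.sub_ar X s)"
    and t: "C.hom (C.sub_ar X t) (fst t) X" "C.monic (C.sub_ar X t)"
    and s': "D.hom (D.sub_ar (omap F X) s') (fst s') (omap F X)" "D.monic (D.sub_ar (omap F X) s')"
    and t': "D.hom (D.sub_ar (omap F X) t') (fst t') (omap F X)" "D.monic (D.sub_ar (omap F X) t')"
    and same: "D.same_sub (fa (C.sub_ar X s)) (D.sub_ar (omap F X) s')"
      "D.same_sub (fa (C.sub_ar X t)) (D.sub_ar (omap F X) t')"
    and Q: "sub_quotient C s t Q"
  shows "sub_quotient D s' t' (omap F Q)" "Q \<in> Obj C"
proof -
  obtain h p where h: "C.sub_ar X s = C.cmp (C.sub_ar X t) h" "C.coker h p" "C.hom p (fst t) Q"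
    using C.sub_quotient_iff[OF s(1) t(1)] Q by blast
  show "Q \<in> Obj C" using h C.hom_objs by blast
  have hh: "C.hom h (fst s) (fst t)" using h(1) s t C.hom_cmpE C.hom_unique by metis
  obtain a where a: "D.isom a (fst s') (omap F (fst s))" "D.sub_ar (omap F X) s' = D.cmp (fa (C.sub_ar X s)) a"
  proof -
    have "D.same_sub (D.sub_ar (omap F X) s') (fa (C.sub_ar X s))" using same(1) unfolding D.same_sub_def by blast
    then show ?thesis using D.same_sub_isom[OF s'(2,1) fa_monic[OF s] hom_fa[OF s(1)]] that by blast
  qed
  obtain b b' where b: "D.isom b (omap F (fst t)) (fst t')" "D.cmp b' b = D.ide (omap F (fst t))"
      "D.cmp b b' = D.ide (fst t')" "fa (C.sub_ar X t) = D.cmp (D.sub_ar (omap F X) t') b" "D.hom b' (fst t') (omap F (fst t))"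
    using D.same_sub_isom[OF fa_monic[OF t] hom_fa[OF t(1)] t'(2,1) same(2)] by blast
  have 1: "D.sub_ar (omap F X) s' = D.cmp (D.sub_ar (omap F X) t') (D.cmp b (D.cmp (fa h) a))"
    using a(2) b(4) h(1) fa_cmp[OF hh t(1)] by (simp add: D.cmp_assoc)
  have 2: "D.coker (D.cmp b (D.cmp (fa h) a)) (D.cmp (fa p) b')"
    using D.coker_isom_source[OF fa_coker[OF hh h(2)] hom_fa[OF hh] a(1) b(1,2,3)] .
  have "D.hom (D.cmp (fa p) b') (fst t') (omap F Q)" using b(5) hom_fa[OF h(3)] by blast
  then show "sub_quotient D s' t' (omap F Q)" using D.sub_quotient_iff[OF s'(1) t'(1)] 1 2 by blast
qed

lemma omap_subquotient_of:
  assumes P: "P \<in> Obj C" and Z: "is_subquotient_of C Z P"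
  shows "is_subquotient_of D (omap F Z) (omap F P)" "Z \<in> Obj C"
proof -
  obtain s t where st: "subobject C P s" "subobject C P t" "sub_quotient C s t Z"
    using Z unfolding is_subquotient_of_def by blast
  have s: "C.hom (C.sub_ar P s) (fst s) P" "C.monic (C.sub_ar P s)"
    and t: "C.hom (C.sub_ar P t) (fst t) P" "C.monic (C.sub_ar P t)"
    using st C.subobject_iff[OF P] by auto
  let ?i = "\<lambda>s. (omap F (fst s), mmap F (snd s))"
  have i: "D.sub_ar (omap F P) (?i s) = fa (C.sub_ar P s)" "D.sub_ar (omap F P) (?i t) = fa (C.sub_ar P t)"
    using fa_ar s t by auto
  have s': "D.hom (D.sub_ar (omap F P) (?i s)) (fst (?i s)) (omap F P)" "D.monic (D.sub_ar (omap F P) (?i s))"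
    and t': "D.hom (D.sub_ar (omap F P) (?i t)) (fst (?i t)) (omap F P)" "D.monic (D.sub_ar (omap F P) (?i t))"
    unfolding i using s t hom_fa fa_monic by auto
  have same: "D.same_sub (fa (C.sub_ar P s)) (D.sub_ar (omap F P) (?i s))" "D.same_sub (fa (C.sub_ar P t)) (D.sub_ar (omap F P) (?i t))"
    unfolding i D.same_sub_def using D.ide_right hom_fa s t by metis+
  have "subobject D (omap F P) (?i s)" "subobject D (omap F P) (?i t)"
    using D.subobject_iff[OF omap_closed[OF P]] s' t' by auto
  then show "is_subquotient_of D (omap F Z) (omap F P)" "Z \<in> Obj C"
    using omap_sub_quotient[OF P s t s' t' same st(3)] unfolding is_subquotient_of_def by blast+
qed

text \<open>Stated for any two families that match stage by stage, so that it serves both the socle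
  filtration and the radical filtration read backwards. Non-splitness passes by contraposition: a
  section of the image of \<open>g\<close> gives one of \<open>g\<close> by
  \<open>fa_section\<close>.\<close>

lemma omap_loewy_arrow:
  assumes X: "X \<in> Obj C"
    and s: "\<And>i. C.hom (C.sub_ar X (\<sigma> i)) (fst (\<sigma> i)) X" "\<And>i. C.monic (C.sub_ar X (\<sigma> i))"
    and t: "\<And>i. D.hom (D.sub_ar (omap F X) (\<tau> i)) (fst (\<tau> i)) (omap F X)" "\<And>i. D.monic (D.sub_ar (omap F X) (\<tau> i))"
    and same: "\<And>i. D.same_sub (fa (C.sub_ar X (\<sigma> i))) (D.sub_ar (omap F X) (\<tau> i))"
    and arrow: "loewy_arrow C \<sigma> k T S"
  shows "loewy_arrow D \<tau> k (omap F T) (omap F S)"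
proof -
  note sq = omap_sub_quotient[OF X s s t t same same]
  have layer: "in_layer D \<tau> i (omap F V)" if v: "in_layer C \<sigma> i V" for i V
  proof -
    obtain Q where Q: "C.simple V" "sub_quotient C (\<sigma> (i - 1)) (\<sigma> i) Q" "is_subquotient_of C V Q"
      using v C.is_simple_iff unfolding in_layer_def by blast
    have "is_simple D (omap F V)" using omap_simple[OF Q(1)] D.is_simple_iff by blast
    then show ?thesis
      using sq(1)[OF Q(2)] omap_subquotient_of(1)[OF sq(2)[OF Q(2)] Q(3)]
      unfolding in_layer_def by blast
  qed
  obtain P Z f g where P: "sub_quotient C (\<sigma> (k - 2)) (\<sigma> k) P" "is_subquotient_of C Z P"
    and ex: "is_short_exact C S Z T f g" "\<not> is_split C Z T g"
    using arrow unfolding loewy_arrow_def by blast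
  have o: "Z \<in> Obj C" "S \<in> Obj C" "T \<in> Obj C"
    using omap_subquotient_of(2)[OF sq(2)[OF P(1)] P(2)] arrow C.simple_obj C.is_simple_iff
    unfolding loewy_arrow_def in_layer_def by auto
  have fg: "C.hom (C.ar S f Z) S Z" "C.hom (C.ar Z g T) Z T"
      "C.kern (C.ar Z g T) (C.ar S f Z)" "C.coker (C.ar S f Z) (C.ar Z g T)"
    using ex(1) C.is_kernel_iff[OF o(1,3)] C.is_cokernel_iff[OF o(2,1)] unfolding is_short_exact_def by auto
  have "is_short_exact D (omap F S) (omap F Z) (omap F T) (mmap F f) (mmap F g)"
    using D.is_kernel_iff[OF omap_closed omap_closed] D.is_cokernel_iff[OF omap_closed omap_closed] o
      hom_fa[OF fg(1)] hom_fa[OF fg(2)] fa_kern[OF fg(2,3)] fa_coker[OF fg(1,4)] fa_ar[OF fg(1)] fa_ar[OF fg(2)]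
    unfolding is_short_exact_def by simp
  moreover have "\<not> is_split D (omap F Z) (omap F T) (mmap F g)"
  proof
    assume "is_split D (omap F Z) (omap F T) (mmap F g)"
    then obtain h where h: "h \<in> mor D (omap F T) (omap F Z)" "Comp D (mmap F g) h = Idm D (omap F T)"
      unfolding is_split_def by blast
    have hh: "D.hom (D.ar (omap F T) h (omap F Z)) (omap F T) (omap F Z)" using h o omap_closed D.hom_ar by blast
    have "D.cmp (fa (C.ar Z g T)) (D.ar (omap F T) h (omap F Z)) = D.ide (omap F T)"
      using D.cmp_ar[OF hh, of "mmap F g" "omap F T"] hom_fa[OF fg(2)] h fa_ar[OF fg(2)] unfolding D.ide_def by simp
    then obtain u where u: "C.cmp (C.ar Z g T) u = C.ide T" using fa_section[OF fg(2) hh] by blast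
    then have "C.hom u T Z" using fg(2) C.hom_cmpE C.hom_unique C.hom_ide o by metis
    then obtain v where v: "v \<in> mor C T Z" "u = C.ar T v Z" "C.hom (C.ar T v Z) T Z" by (metis C.hom_arE)
    then have "Comp C g v = Idm C T" using u C.cmp_ar_eq_iff[OF v(3) fg(2)] unfolding C.ide_def by blast
    then show False using ex(2) v unfolding is_split_def by blast
  qed
  ultimately show ?thesis
    using arrow layer sq(1)[OF P(1)] omap_subquotient_of(1)[OF sq(2)[OF P(1)] P(2)]
    unfolding loewy_arrow_def by blast
qed

lemma same_sub_isomorphic:
  assumes X: "X \<in> Obj C"
    and s: "C.hom (C.sub_ar X s) (fst s) X" "C.monic (C.sub_ar X s)"
    and t: "D.hom (D.sub_ar (omap F X) t) (fst t) (omap F X)" "D.monic (D.sub_ar (omap F X) t)"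
    and same: "D.same_sub (fa (C.sub_ar X s)) (D.sub_ar (omap F X) t)"
  shows "isomorphic D (omap F (fst s)) (fst t)"
proof -
  obtain a where "D.isom a (omap F (fst s)) (fst t)"
    using D.same_sub_isom[OF fa_monic[OF s] hom_fa[OF s(1)] t(2,1) same] by blast
  then show ?thesis using D.isomorphic_iff D.isom_hom D.hom_objs by metis
qed

text \<open>The image of a socle filtration of \<open>X\<close> is a socle filtration of
  \<open>omap F X\<close>, and a stage is everything on one side exactly when it is on the
  other.\<close>

lemma loewy_length:
  assumes X: "X \<in> Obj C"
  shows "\<exists>n. has_loewy_length C X n \<and> has_loewy_length D (omap F X) n"
proof -
  obtain \<sigma> where \<sigma>: "C.socle_filtration X \<sigma>" using C.ex_socle_filtration[OF X] by blast
  have s: "C.monic (\<sigma> k)" "\<exists>S. C.hom (\<sigma> k) S X" for k using \<sigma> unfolding C.socle_filtration_def by auto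
  define n where "n = (LEAST n. \<exists>S. C.isom (\<sigma> n) S X)"
  have n: "\<exists>S. C.isom (\<sigma> n) S X" unfolding n_def using C.socle_filtration_terminates[OF X \<sigma>] by (rule LeastI_ex)
  have least: "\<not> C.isom (\<sigma> k) S X" if "k < n" for k S using not_less_Least[OF that[unfolded n_def]] by blast
  have "has_loewy_length C X n" using C.has_loewy_lengthI[OF \<sigma> n] least by blast
  moreover have "has_loewy_length D (omap F X) n"
  proof (rule D.has_loewy_lengthI[OF fa_socle_filtration[OF \<sigma>]])
    show "\<exists>S. D.isom (fa (\<sigma> n)) S (omap F X)" using fa_isom n by blast
    show "\<not> D.isom (fa (\<sigma> k)) S (omap F X)" if "k < n" for k S
      using least[OF that] s fa_isom_reflect by blast
  qed
  ultimately show ?thesis by blast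
qed

lemma (in linear_category) hom_sub_ar:
  assumes "hom a S M" shows "\<exists>s. a = sub_ar M s \<and> hom (sub_ar M s) (fst s) M"
proof -
  obtain f where "a = ar S f M" using assms hom_arE by blast
  then show ?thesis using assms by (intro exI[of _ "(S, f)"]) simp
qed

lemma (in normal_category) ex_is_socle_filtration:
  assumes M: "M \<in> Obj C" and \<sigma>: "socle_filtration M \<sigma>" shows "\<exists>\<sigma>. is_socle_filtration C M \<sigma>"
proof -
  have "\<forall>k. \<exists>s. \<sigma> k = sub_ar M s \<and> hom (sub_ar M s) (fst s) M"
    using \<sigma> hom_sub_ar unfolding socle_filtration_def by blast
  from choice[OF this] obtain s where s: "\<And>k. \<sigma> k = sub_ar M (s k)" "\<And>k. hom (sub_ar M (s k)) (fst (s k)) M"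
    by blast
  then have "\<sigma> = (\<lambda>k. sub_ar M (s k))" by blast
  then show ?thesis using is_socle_filtration_iff[OF M, of s] s(2) \<sigma> by auto
qed

lemma (in normal_category) ex_is_radical_filtration:
  assumes M: "M \<in> Obj C" and \<sigma>: "radical_filtration M \<sigma>" shows "\<exists>\<sigma>. is_radical_filtration C M \<sigma>"
proof -
  have "\<forall>k. \<exists>s. \<sigma> k = sub_ar M s \<and> hom (sub_ar M s) (fst s) M"
    using \<sigma> hom_sub_ar unfolding radical_filtration_def by blast
  from choice[OF this] obtain s where s: "\<And>k. \<sigma> k = sub_ar M (s k)" "\<And>k. hom (sub_ar M (s k)) (fst (s k)) M"
    by blast
  then have "\<sigma> = (\<lambda>k. sub_ar M (s k))" by blast
  then show ?thesis using is_radical_filtration_iff[OF M, of s] s(2) \<sigma> by auto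
qed

theorem preserves_socle: "preserves_socle_loewy_diagrams C D F"
proof -
  have "\<exists>n. has_loewy_length C X n \<and> has_loewy_length D (omap F X) n \<and>
       (\<exists>\<sigma>. is_socle_filtration C X \<sigma>) \<and> (\<exists>\<tau>. is_socle_filtration D (omap F X) \<tau>) \<and>
       (\<forall>\<sigma> \<tau>. is_socle_filtration C X \<sigma> \<and> is_socle_filtration D (omap F X) \<tau> \<longrightarrow>
          (\<forall>k \<in> {1..n}. isomorphic D (omap F (fst (\<sigma> k))) (fst (\<tau> k))))" if X: "X \<in> Obj C" for X
  proof -
    obtain \<sigma> where \<sigma>: "C.socle_filtration X \<sigma>" using C.ex_socle_filtration[OF X] by blast
    have 1: "\<exists>\<sigma>. is_socle_filtration C X \<sigma>" using C.ex_is_socle_filtration[OF X \<sigma>] .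
    have 2: "\<exists>\<tau>. is_socle_filtration D (omap F X) \<tau>"
      using D.ex_is_socle_filtration[OF omap_closed[OF X] fa_socle_filtration[OF \<sigma>]] .
    have 3: "isomorphic D (omap F (fst (\<sigma> k))) (fst (\<tau> k))"
      if "is_socle_filtration C X \<sigma>" "is_socle_filtration D (omap F X) \<tau>" for \<sigma> \<tau> k
      using same_sub_isomorphic[OF X fa_socle_filtration_same[OF X that]] .
    show ?thesis using loewy_length[OF X] 1 2 3 by blast
  qed
  moreover have "loewy_arrow D \<tau> k (omap F T) (omap F S)"
    if X: "X \<in> Obj C" and st: "is_socle_filtration C X \<sigma>" "is_socle_filtration D (omap F X) \<tau>"
      and a: "loewy_arrow C \<sigma> k T S" for X \<sigma> \<tau> k T S
    using omap_loewy_arrow[OF X fa_socle_filtration_same[OF X st] a] .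
  ultimately show ?thesis
    unfolding preserves_socle_loewy_diagrams_def preserves_socle_filtrations_def
    using is_functor_axioms by blast
qed

theorem preserves_radical: "preserves_radical_loewy_diagrams C D F"
proof -
  have "\<exists>n. has_loewy_length C X n \<and> has_loewy_length D (omap F X) n \<and>
       (\<exists>\<sigma>. is_radical_filtration C X \<sigma>) \<and> (\<exists>\<tau>. is_radical_filtration D (omap F X) \<tau>) \<and>
       (\<forall>\<sigma> \<tau>. is_radical_filtration C X \<sigma> \<and> is_radical_filtration D (omap F X) \<tau> \<longrightarrow>
          (\<forall>k \<in> {1..n}. isomorphic D (omap F (fst (\<sigma> k))) (fst (\<tau> k))))" if X: "X \<in> Obj C" for X
  proof -
    obtain \<rho> where \<rho>: "C.radical_filtration X \<rho>" "D.radical_filtration (omap F X) (\<lambda>k. fa (\<rho> k))"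
      using fa_radical_filtration[OF X] .
    have 1: "\<exists>\<sigma>. is_radical_filtration C X \<sigma>" using C.ex_is_radical_filtration[OF X \<rho>(1)] .
    have 2: "\<exists>\<tau>. is_radical_filtration D (omap F X) \<tau>"
      using D.ex_is_radical_filtration[OF omap_closed[OF X] \<rho>(2)] .
    have 3: "isomorphic D (omap F (fst (\<sigma> k))) (fst (\<tau> k))"
      if "is_radical_filtration C X \<sigma>" "is_radical_filtration D (omap F X) \<tau>" for \<sigma> \<tau> k
      using same_sub_isomorphic[OF X fa_radical_filtration_same[OF X that]] .
    show ?thesis using loewy_length[OF X] 1 2 3 by blast
  qed
  \<comment> \<open>The reversal by \<open>n - i\<close> is harmless: the stages agree at every
    index, so also where the subtraction is truncated.\<close>
  moreover have "loewy_arrow D (\<lambda>i. \<tau> (n - i)) k (omap F T) (omap F S)"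
    if X: "X \<in> Obj C" and st: "is_radical_filtration C X \<sigma>" "is_radical_filtration D (omap F X) \<tau>"
      and a: "loewy_arrow C (\<lambda>i. \<sigma> (n - i)) k T S" for X \<sigma> \<tau> k T S n
    using omap_loewy_arrow[OF X fa_radical_filtration_same[OF X st] a] .
  ultimately show ?thesis
    unfolding preserves_radical_loewy_diagrams_def preserves_radical_filtrations_def
    using is_functor_axioms by blast
qed

end

section \<open>Coherence in monoidal and braided categories\<close>

context monoidal_category
begin

definition ten :: "('o, 'm) arrow \<Rightarrow> ('o, 'm) arrow \<Rightarrow> ('o, 'm) arrow"  (infixr \<open>\<star>\<close> 80)
  where "ten a b = (case (a, b) of (Some (X, f, Y), Some (X', f', Y')) \<Rightarrow> Some (X \<boxtimes> X', f \<boxdot> f', Y \<boxtimes> Y') | _ \<Rightarrow> None)"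

definition asc :: "'o \<Rightarrow> 'o \<Rightarrow> 'o \<Rightarrow> ('o, 'm) arrow"
  where "asc X Y Z = ar (X \<boxtimes> (Y \<boxtimes> Z)) (Assoc C X Y Z) ((X \<boxtimes> Y) \<boxtimes> Z)"

definition lun :: "'o \<Rightarrow> ('o, 'm) arrow"
  where "lun X = ar (\<U> \<boxtimes> X) (Lunit C X) X"

definition run :: "'o \<Rightarrow> ('o, 'm) arrow"
  where "run X = ar (X \<boxtimes> \<U>) (Runit C X) X"

lemma ten_ar:
  assumes "hom (ar X f Y) X Y" "hom (ar X' f' Y') X' Y'"
  shows "ar X f Y \<star> ar X' f' Y' = ar (X \<boxtimes> X') (f \<boxdot> f') (Y \<boxtimes> Y')"
proof -
  have "ar X f Y = Some (X, f, Y)" "ar X' f' Y' = Some (X', f', Y')"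
    using assms unfolding hom_ar by (auto simp: ar_def)
  moreover have "ar (X \<boxtimes> X') (f \<boxdot> f') (Y \<boxtimes> Y') = Some (X \<boxtimes> X', f \<boxdot> f', Y \<boxtimes> Y')"
    using assms tensor_closed tensor_mor_closed[of X X' Y Y' f f'] unfolding hom_ar by (simp add: ar_def)
  ultimately show ?thesis by (simp add: ten_def)
qed

lemma hom_ten [intro]:
  assumes "hom a X Y" "hom b X' Y'" shows "hom (a \<star> b) (X \<boxtimes> X') (Y \<boxtimes> Y')"
proof -
  obtain f g where "a = ar X f Y" "b = ar X' g Y'" using assms hom_arE by metis
  then show ?thesis
    using assms ten_ar tensor_closed tensor_mor_closed[of X X' Y Y' f g] by (simp add: hom_ar)
qed

lemma ten_ide: "X \<in> Obj C \<Longrightarrow> Y \<in> Obj C \<Longrightarrow> ide X \<star> ide Y = ide (X \<boxtimes> Y)"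
  using ten_ar hom_ide tensor_id unfolding ide_def by metis

lemma ten_cmp:
  assumes "hom a X Y" "hom b Y Z" "hom a' X' Y'" "hom b' Y' Z'"
  shows "(b \<bullet> a) \<star> (b' \<bullet> a') = (b \<star> b') \<bullet> (a \<star> a')"
proof -
  obtain f g f' g' where e: "a = ar X f Y" "b = ar Y g Z" "a' = ar X' f' Y'" "b' = ar Y' g' Z'"
    using assms hom_arE by metis
  have m: "X \<in> Obj C" "Y \<in> Obj C" "Z \<in> Obj C" "X' \<in> Obj C" "Y' \<in> Obj C" "Z' \<in> Obj C"
    "f \<in> mor C X Y" "g \<in> mor C Y Z" "f' \<in> mor C X' Y'" "g' \<in> mor C Y' Z'"
    using assms hom_ar unfolding e by auto
  have "(b \<bullet> a) \<star> (b' \<bullet> a') = ar (X \<boxtimes> X') ((g \<cdot> f) \<boxdot> (g' \<cdot> f')) (Z \<boxtimes> Z')"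
    using assms hom_cmp[OF assms(1,2)] hom_cmp[OF assms(3,4)] unfolding e by (simp add: cmp_ar ten_ar)
  also have "\<dots> = ar (X \<boxtimes> X') ((g \<boxdot> g') \<cdot> (f \<boxdot> f')) (Z \<boxtimes> Z')" using tensor_comp[OF m] by simp
  also have "\<dots> = (b \<star> b') \<bullet> (a \<star> a')"
    using assms hom_ten[OF assms(1,3)] hom_ten[OF assms(2,4)] unfolding e by (simp add: cmp_ar ten_ar)
  finally show ?thesis .
qed

lemma ide_ten_cmp: "X \<in> Obj C \<Longrightarrow> hom a Y Z \<Longrightarrow> hom b Z W \<Longrightarrow> ide X \<star> (b \<bullet> a) = (ide X \<star> b) \<bullet> (ide X \<star> a)"
  using ten_cmp[of "ide X" X X "ide X" X a Y Z b W] ide_left[of "ide X" X X] by auto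

lemma ten_ide_cmp: "X \<in> Obj C \<Longrightarrow> hom a Y Z \<Longrightarrow> hom b Z W \<Longrightarrow> (b \<bullet> a) \<star> ide X = (b \<star> ide X) \<bullet> (a \<star> ide X)"
  using ten_cmp[of a Y Z b W "ide X" X X "ide X" X] ide_left[of "ide X" X X] by auto

lemma ten_split1: "hom a X Y \<Longrightarrow> hom b X' Y' \<Longrightarrow> (a \<star> ide Y') \<bullet> (ide X \<star> b) = a \<star> b"
  using ten_cmp[of "ide X" X X a Y b X' Y' "ide Y'" Y'] hom_objs ide_left ide_right hom_ide by metis

lemma ten_split2: "hom a X Y \<Longrightarrow> hom b X' Y' \<Longrightarrow> (ide Y \<star> b) \<bullet> (a \<star> ide X') = a \<star> b"
  using ten_cmp[of a X Y "ide Y" Y "ide X'" X' X' b Y'] hom_objs ide_left ide_right hom_ide by metis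

lemma ten_isom: assumes "isom a X Y" "isom b X' Y'" shows "isom (a \<star> b) (X \<boxtimes> X') (Y \<boxtimes> Y')"
proof -
  obtain a' b' where i: "hom a' Y X" "a' \<bullet> a = ide X" "a \<bullet> a' = ide Y" "hom b' Y' X'" "b' \<bullet> b = ide X'" "b \<bullet> b' = ide Y'"
    using isomE assms by metis
  have h: "hom a X Y" "hom b X' Y'" using assms isom_hom by auto
  have "(a' \<star> b') \<bullet> (a \<star> b) = ide (X \<boxtimes> X')"
    using ten_cmp[OF h(1) i(1) h(2) i(4)] i ten_ide hom_objs h by metis
  moreover have "(a \<star> b) \<bullet> (a' \<star> b') = ide (Y \<boxtimes> Y')"
    using ten_cmp[OF i(1) h(1) i(4) h(2)] i ten_ide hom_objs h by metis
  ultimately show ?thesis using isomI h i by (meson hom_ten)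
qed

lemma asc_isom: "X \<in> Obj C \<Longrightarrow> Y \<in> Obj C \<Longrightarrow> Z \<in> Obj C \<Longrightarrow> isom (asc X Y Z) (X \<boxtimes> (Y \<boxtimes> Z)) ((X \<boxtimes> Y) \<boxtimes> Z)"
  using is_iso_iff assoc_iso tensor_closed unfolding asc_def by metis

lemma asc_hom [intro]: "X \<in> Obj C \<Longrightarrow> Y \<in> Obj C \<Longrightarrow> Z \<in> Obj C \<Longrightarrow> hom (asc X Y Z) (X \<boxtimes> (Y \<boxtimes> Z)) ((X \<boxtimes> Y) \<boxtimes> Z)"
  using asc_isom isom_hom by blast

lemma lun_isom: "X \<in> Obj C \<Longrightarrow> isom (lun X) (\<U> \<boxtimes> X) X"
  using is_iso_iff lunit_iso tensor_closed unit_closed unfolding lun_def by metis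

lemma lun_hom [intro]: "X \<in> Obj C \<Longrightarrow> hom (lun X) (\<U> \<boxtimes> X) X"
  using lun_isom isom_hom by blast

lemma run_isom: "X \<in> Obj C \<Longrightarrow> isom (run X) (X \<boxtimes> \<U>) X"
  using is_iso_iff runit_iso tensor_closed unit_closed unfolding run_def by metis

lemma run_hom [intro]: "X \<in> Obj C \<Longrightarrow> hom (run X) (X \<boxtimes> \<U>) X"
  using run_isom isom_hom by blast

lemma asc_natural:
  assumes "hom a X X'" "hom b Y Y'" "hom c Z Z'"
  shows "asc X' Y' Z' \<bullet> (a \<star> (b \<star> c)) = ((a \<star> b) \<star> c) \<bullet> asc X Y Z"
proof -
  obtain f g h where e: "a = ar X f X'" "b = ar Y g Y'" "c = ar Z h Z'" using assms hom_arE by metis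
  have m: "X \<in> Obj C" "Y \<in> Obj C" "Z \<in> Obj C" "X' \<in> Obj C" "Y' \<in> Obj C" "Z' \<in> Obj C"
    "f \<in> mor C X X'" "g \<in> mor C Y Y'" "h \<in> mor C Z Z'"
    using assms hom_ar unfolding e by auto
  have h1: "hom (b \<star> c) (Y \<boxtimes> Z) (Y' \<boxtimes> Z')" "hom (a \<star> b) (X \<boxtimes> Y) (X' \<boxtimes> Y')" using assms by auto
  have h2: "hom (a \<star> (b \<star> c)) (X \<boxtimes> (Y \<boxtimes> Z)) (X' \<boxtimes> (Y' \<boxtimes> Z'))" "hom ((a \<star> b) \<star> c) ((X \<boxtimes> Y) \<boxtimes> Z) ((X' \<boxtimes> Y') \<boxtimes> Z')"
    using assms h1 by auto
  have e1: "b \<star> c = ar (Y \<boxtimes> Z) (g \<boxdot> h) (Y' \<boxtimes> Z')" "a \<star> b = ar (X \<boxtimes> Y) (f \<boxdot> g) (X' \<boxtimes> Y')"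
    using ten_ar assms unfolding e by auto
  have e2: "a \<star> (b \<star> c) = ar (X \<boxtimes> (Y \<boxtimes> Z)) (f \<boxdot> (g \<boxdot> h)) (X' \<boxtimes> (Y' \<boxtimes> Z'))"
    "(a \<star> b) \<star> c = ar ((X \<boxtimes> Y) \<boxtimes> Z) ((f \<boxdot> g) \<boxdot> h) ((X' \<boxtimes> Y') \<boxtimes> Z')"
    using ten_ar assms h1 e e1 by simp_all
  show ?thesis
    unfolding e2 asc_def
    using cmp_ar[OF h2(1)[unfolded e2] asc_hom[OF m(4,5,6), unfolded asc_def]]
      cmp_ar[OF asc_hom[OF m(1,2,3), unfolded asc_def] h2(2)[unfolded e2]] assoc_natural[OF m] by simp
qed

lemma lun_natural: assumes "hom a X Y" shows "lun Y \<bullet> (ide \<U> \<star> a) = a \<bullet> lun X"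
proof -
  obtain f where e: "a = ar X f Y" "f \<in> mor C X Y" using assms hom_arE by metis
  have o: "X \<in> Obj C" "Y \<in> Obj C" using assms hom_objs by auto
  have i: "hom (ide \<U>) \<U> \<U>" using unit_closed by auto
  have t: "ide \<U> \<star> a = ar (\<U> \<boxtimes> X) (\<I> \<U> \<boxdot> f) (\<U> \<boxtimes> Y)"
    using ten_ar i assms unfolding e ide_def by blast
  show ?thesis
    using cmp_ar[OF hom_ten[OF i assms, unfolded t] lun_hom[OF o(2), unfolded lun_def]]
      cmp_ar[OF lun_hom[OF o(1), unfolded lun_def] assms[unfolded e(1)]] lunit_natural[OF o e(2)] t e
    by (simp add: lun_def)
qed

lemma run_natural: assumes "hom a X Y" shows "run Y \<bullet> (a \<star> ide \<U>) = a \<bullet> run X"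
proof -
  obtain f where e: "a = ar X f Y" "f \<in> mor C X Y" using assms hom_arE by metis
  have o: "X \<in> Obj C" "Y \<in> Obj C" using assms hom_objs by auto
  have i: "hom (ide \<U>) \<U> \<U>" using unit_closed by auto
  have t: "a \<star> ide \<U> = ar (X \<boxtimes> \<U>) (f \<boxdot> \<I> \<U>) (Y \<boxtimes> \<U>)"
    using ten_ar i assms unfolding e ide_def by blast
  show ?thesis
    using cmp_ar[OF hom_ten[OF assms i, unfolded t] run_hom[OF o(2), unfolded run_def]]
      cmp_ar[OF run_hom[OF o(1), unfolded run_def] assms[unfolded e(1)]] runit_natural[OF o e(2)] t e
    by (simp add: run_def)
qed

lemma pentagon_arrow:
  assumes o: "W \<in> Obj C" "X \<in> Obj C" "Y \<in> Obj C" "Z \<in> Obj C"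
  shows "asc (W \<boxtimes> X) Y Z \<bullet> asc W X (Y \<boxtimes> Z) = (asc W X Y \<star> ide Z) \<bullet> (asc W (X \<boxtimes> Y) Z \<bullet> (ide W \<star> asc X Y Z))"
proof -
  note t = tensor_closed
  have h: "hom (asc W X (Y \<boxtimes> Z)) (W \<boxtimes> (X \<boxtimes> (Y \<boxtimes> Z))) ((W \<boxtimes> X) \<boxtimes> (Y \<boxtimes> Z))"
    "hom (asc (W \<boxtimes> X) Y Z) ((W \<boxtimes> X) \<boxtimes> (Y \<boxtimes> Z)) (((W \<boxtimes> X) \<boxtimes> Y) \<boxtimes> Z)"
    "hom (ide W \<star> asc X Y Z) (W \<boxtimes> (X \<boxtimes> (Y \<boxtimes> Z))) (W \<boxtimes> ((X \<boxtimes> Y) \<boxtimes> Z))"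
    "hom (asc W (X \<boxtimes> Y) Z) (W \<boxtimes> ((X \<boxtimes> Y) \<boxtimes> Z)) ((W \<boxtimes> (X \<boxtimes> Y)) \<boxtimes> Z)"
    "hom (asc W X Y \<star> ide Z) ((W \<boxtimes> (X \<boxtimes> Y)) \<boxtimes> Z) (((W \<boxtimes> X) \<boxtimes> Y) \<boxtimes> Z)"
    using o t by auto
  have e: "ide W \<star> asc X Y Z = ar (W \<boxtimes> (X \<boxtimes> (Y \<boxtimes> Z))) (\<I> W \<boxdot> Assoc C X Y Z) (W \<boxtimes> ((X \<boxtimes> Y) \<boxtimes> Z))"
    "asc W X Y \<star> ide Z = ar ((W \<boxtimes> (X \<boxtimes> Y)) \<boxtimes> Z) (Assoc C W X Y \<boxdot> \<I> Z) (((W \<boxtimes> X) \<boxtimes> Y) \<boxtimes> Z)"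
    unfolding asc_def ide_def
    using ten_ar[OF hom_ide[OF o(1), unfolded ide_def] asc_hom[OF o(2,3,4), unfolded asc_def]]
      ten_ar[OF asc_hom[OF o(1,2,3), unfolded asc_def] hom_ide[OF o(4), unfolded ide_def]] by auto
  note h' = h[unfolded e, unfolded asc_def]
  show ?thesis
    unfolding e unfolding asc_def
    using cmp_ar[OF h'(1,2)] cmp_ar[OF h'(3,4)] cmp_ar[OF hom_cmp[OF h'(3,4), unfolded cmp_ar[OF h'(3,4)]] h'(5)]
      pentagon[OF o] by simp
qed

lemma triangle_arrow:
  assumes o: "X \<in> Obj C" "Y \<in> Obj C"
  shows "(run X \<star> ide Y) \<bullet> asc X \<U> Y = ide X \<star> lun Y"
proof -
  have h: "hom (asc X \<U> Y) (X \<boxtimes> (\<U> \<boxtimes> Y)) ((X \<boxtimes> \<U>) \<boxtimes> Y)" "hom (run X \<star> ide Y) ((X \<boxtimes> \<U>) \<boxtimes> Y) (X \<boxtimes> Y)"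
    using o unit_closed by auto
  have e: "run X \<star> ide Y = ar ((X \<boxtimes> \<U>) \<boxtimes> Y) (Runit C X \<boxdot> \<I> Y) (X \<boxtimes> Y)"
    "ide X \<star> lun Y = ar (X \<boxtimes> (\<U> \<boxtimes> Y)) (\<I> X \<boxdot> Lunit C Y) (X \<boxtimes> Y)"
    unfolding run_def lun_def ide_def
    using ten_ar[OF run_hom[OF o(1), unfolded run_def] hom_ide[OF o(2), unfolded ide_def]]
      ten_ar[OF hom_ide[OF o(1), unfolded ide_def] lun_hom[OF o(2), unfolded lun_def]] by auto
  show ?thesis
    unfolding e unfolding asc_def
    using cmp_ar[OF h(1)[unfolded asc_def] h(2)[unfolded e]] triangle[OF o] by simp
qed

text \<open>Naturality of \<open>lun\<close> makes tensoring with the unit isomorphic to the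
  identity functor. Coherence equations can therefore be proved after tensoring with the
  unit.\<close>

lemma unit_ten_faithful:
  assumes "hom f X Y" "hom g X Y" "ide \<U> \<star> f = ide \<U> \<star> g" shows "f = g"
proof -
  have "f \<bullet> lun X = g \<bullet> lun X" using lun_natural assms by metis
  moreover have "X \<in> Obj C" using assms hom_objs by blast
  ultimately show ?thesis using epicD[OF isom_epic[OF lun_isom] lun_hom assms(1)] by blast
qed

lemma ten_unit_faithful:
  assumes "hom f X Y" "hom g X Y" "f \<star> ide \<U> = g \<star> ide \<U>" shows "f = g"
proof -
  have "f \<bullet> run X = g \<bullet> run X" using run_natural assms by metis
  moreover have "X \<in> Obj C" using assms hom_objs by blast
  ultimately show ?thesis using epicD[OF isom_epic[OF run_isom] run_hom assms(1)] by blast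
qed

text \<open>Kelly's coherence consequence of pentagon and triangle. The pentagon at
  \<open>\<U>\<close>, \<open>\<U>\<close>, \<open>Y\<close>, \<open>Z\<close> gives the equation
  tensored with the unit and followed by an associator, and both can be cancelled.\<close>

lemma lun_ten:
  assumes o: "Y \<in> Obj C" "Z \<in> Obj C"
  shows "(lun Y \<star> ide Z) \<bullet> asc \<U> Y Z = lun (Y \<boxtimes> Z)"
proof -
  note t = tensor_closed and u = unit_closed
  have i: "hom (ide \<U>) \<U> \<U>" "hom (ide Z) Z Z" "hom (ide Y) Y Y" using o u by auto
  have YZ: "Y \<boxtimes> Z \<in> Obj C" "\<U> \<boxtimes> Y \<in> Obj C" using o t u by auto
  have h: "hom (lun Y \<star> ide Z) ((\<U> \<boxtimes> Y) \<boxtimes> Z) (Y \<boxtimes> Z)" "hom (asc \<U> Y Z) (\<U> \<boxtimes> (Y \<boxtimes> Z)) ((\<U> \<boxtimes> Y) \<boxtimes> Z)"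
    using o u by auto
  have A: "asc \<U> Y Z \<bullet> (ide \<U> \<star> (lun Y \<star> ide Z)) = ((ide \<U> \<star> lun Y) \<star> ide Z) \<bullet> asc \<U> (\<U> \<boxtimes> Y) Z"
    using asc_natural[OF i(1) lun_hom[OF o(1)] i(2)] .
  have B: "ide \<U> \<star> lun Y = (run \<U> \<star> ide Y) \<bullet> asc \<U> \<U> Y" using triangle_arrow[OF u o(1)] by simp
  have C': "(ide \<U> \<star> lun Y) \<star> ide Z = ((run \<U> \<star> ide Y) \<star> ide Z) \<bullet> (asc \<U> \<U> Y \<star> ide Z)"
    unfolding B using ten_ide_cmp[OF o(2) asc_hom[OF u u o(1)] hom_ten[OF run_hom[OF u] i(3)]] .
  have D: "asc \<U> Y Z \<bullet> (run \<U> \<star> (ide Y \<star> ide Z)) = ((run \<U> \<star> ide Y) \<star> ide Z) \<bullet> asc (\<U> \<boxtimes> \<U>) Y Z"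
    using asc_natural[OF run_hom[OF u] i(3,2)] .
  have "asc \<U> Y Z \<bullet> (ide \<U> \<star> ((lun Y \<star> ide Z) \<bullet> asc \<U> Y Z))
      = asc \<U> Y Z \<bullet> ((ide \<U> \<star> (lun Y \<star> ide Z)) \<bullet> (ide \<U> \<star> asc \<U> Y Z))"
    using ide_ten_cmp[OF u h(2,1)] by simp
  also have "\<dots> = ((run \<U> \<star> ide Y) \<star> ide Z) \<bullet> ((asc \<U> \<U> Y \<star> ide Z) \<bullet> (asc \<U> (\<U> \<boxtimes> Y) Z \<bullet> (ide \<U> \<star> asc \<U> Y Z)))"
    using cmp_rewrite2[OF A] C' by (simp add: cmp_assoc)
  also have "\<dots> = ((run \<U> \<star> ide Y) \<star> ide Z) \<bullet> (asc (\<U> \<boxtimes> \<U>) Y Z \<bullet> asc \<U> \<U> (Y \<boxtimes> Z))"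
    using pentagon_arrow[OF u u o] by simp
  also have "\<dots> = asc \<U> Y Z \<bullet> ((run \<U> \<star> ide (Y \<boxtimes> Z)) \<bullet> asc \<U> \<U> (Y \<boxtimes> Z))"
    using cmp_rewrite2[OF D] ten_ide[OF o] by simp
  also have "\<dots> = asc \<U> Y Z \<bullet> (ide \<U> \<star> lun (Y \<boxtimes> Z))"
    using triangle_arrow[OF u YZ(1)] by simp
  finally have e: "asc \<U> Y Z \<bullet> (ide \<U> \<star> ((lun Y \<star> ide Z) \<bullet> asc \<U> Y Z)) = asc \<U> Y Z \<bullet> (ide \<U> \<star> lun (Y \<boxtimes> Z))" .
  have "ide \<U> \<star> ((lun Y \<star> ide Z) \<bullet> asc \<U> Y Z) = ide \<U> \<star> lun (Y \<boxtimes> Z)"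
    using monicD[OF isom_monic[OF asc_isom[OF u o]] h(2) _ e] i(1) h by blast
  then show ?thesis using unit_ten_faithful[OF hom_cmp[OF h(2,1)] lun_hom[OF YZ(1)]] by blast
qed

text \<open>The mirror image of \<open>lun_ten\<close>: the pentagon at \<open>X\<close>,
  \<open>Y\<close>, \<open>\<U>\<close>, \<open>\<U>\<close>, with the extra unit now tensored on
  the right.\<close>

lemma run_ten:
  assumes o: "X \<in> Obj C" "Y \<in> Obj C"
  shows "run (X \<boxtimes> Y) \<bullet> asc X Y \<U> = ide X \<star> run Y"
proof -
  note t = tensor_closed and u = unit_closed
  have i: "hom (ide \<U>) \<U> \<U>" "hom (ide X) X X" "hom (ide Y) Y Y" using o u by auto
  have ob: "X \<boxtimes> Y \<in> Obj C" "Y \<boxtimes> \<U> \<in> Obj C" "\<U> \<boxtimes> \<U> \<in> Obj C" using o t u by auto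
  have h: "hom (asc X Y \<U>) (X \<boxtimes> (Y \<boxtimes> \<U>)) ((X \<boxtimes> Y) \<boxtimes> \<U>)" "hom (run (X \<boxtimes> Y)) ((X \<boxtimes> Y) \<boxtimes> \<U>) (X \<boxtimes> Y)"
    "hom (ide X \<star> run Y) (X \<boxtimes> (Y \<boxtimes> \<U>)) (X \<boxtimes> Y)" "hom (run (X \<boxtimes> Y) \<bullet> asc X Y \<U>) (X \<boxtimes> (Y \<boxtimes> \<U>)) (X \<boxtimes> Y)"
    using o u ob by (auto intro!: hom_cmp)
  let ?w = "asc X (Y \<boxtimes> \<U>) \<U> \<bullet> (ide X \<star> asc Y \<U> \<U>)"
  have w: "isom ?w (X \<boxtimes> (Y \<boxtimes> (\<U> \<boxtimes> \<U>))) ((X \<boxtimes> (Y \<boxtimes> \<U>)) \<boxtimes> \<U>)"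
    using isom_cmp[OF ten_isom[OF isom_ide[OF o(1)] asc_isom[OF o(2) u u]] asc_isom[OF o(1) ob(2) u]] .
  have A: "((run (X \<boxtimes> Y) \<bullet> asc X Y \<U>) \<star> ide \<U>) \<bullet> ?w = asc X Y \<U> \<bullet> (ide X \<star> (ide Y \<star> lun \<U>))"
  proof -
    have "((run (X \<boxtimes> Y) \<bullet> asc X Y \<U>) \<star> ide \<U>) \<bullet> ?w
        = (run (X \<boxtimes> Y) \<star> ide \<U>) \<bullet> ((asc X Y \<U> \<star> ide \<U>) \<bullet> ?w)"
      using ten_ide_cmp[OF u h(1,2)] by (simp add: cmp_assoc)
    also have "\<dots> = (run (X \<boxtimes> Y) \<star> ide \<U>) \<bullet> (asc (X \<boxtimes> Y) \<U> \<U> \<bullet> asc X Y (\<U> \<boxtimes> \<U>))"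
      using pentagon_arrow[OF o u u] by simp
    also have "\<dots> = (ide (X \<boxtimes> Y) \<star> lun \<U>) \<bullet> asc X Y (\<U> \<boxtimes> \<U>)"
      using cmp_rewrite[OF triangle_arrow[OF ob(1) u]] by simp
    also have "\<dots> = ((ide X \<star> ide Y) \<star> lun \<U>) \<bullet> asc X Y (\<U> \<boxtimes> \<U>)" using ten_ide[OF o] by simp
    also have "\<dots> = asc X Y \<U> \<bullet> (ide X \<star> (ide Y \<star> lun \<U>))"
      using asc_natural[OF i(2,3) lun_hom[OF u]] by simp
    finally show ?thesis .
  qed
  have B: "((ide X \<star> run Y) \<star> ide \<U>) \<bullet> ?w = asc X Y \<U> \<bullet> (ide X \<star> (ide Y \<star> lun \<U>))"
  proof -
    have "((ide X \<star> run Y) \<star> ide \<U>) \<bullet> ?w = asc X Y \<U> \<bullet> ((ide X \<star> (run Y \<star> ide \<U>)) \<bullet> (ide X \<star> asc Y \<U> \<U>))"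
      using cmp_rewrite2[OF asc_natural[OF i(2) run_hom[OF o(2)] i(1), symmetric]] .
    also have "(ide X \<star> (run Y \<star> ide \<U>)) \<bullet> (ide X \<star> asc Y \<U> \<U>) = ide X \<star> ((run Y \<star> ide \<U>) \<bullet> asc Y \<U> \<U>)"
      using ide_ten_cmp[OF o(1) asc_hom[OF o(2) u u] hom_ten[OF run_hom[OF o(2)] i(1)]] by simp
    also have "(run Y \<star> ide \<U>) \<bullet> asc Y \<U> \<U> = ide Y \<star> lun \<U>" using triangle_arrow[OF o(2) u] .
    finally show ?thesis .
  qed
  have "(run (X \<boxtimes> Y) \<bullet> asc X Y \<U>) \<star> ide \<U> = (ide X \<star> run Y) \<star> ide \<U>"
    using epicD[OF isom_epic[OF w] isom_hom[OF w] hom_ten[OF h(4) i(1)]] A B by simp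
  then show ?thesis using ten_unit_faithful[OF h(4,3)] by blast
qed

end

context braided_category
begin

definition brd :: "'o \<Rightarrow> 'o \<Rightarrow> ('o, 'm) arrow"
  where "brd X Y = ar (X \<boxtimes> Y) (Braid C X Y) (Y \<boxtimes> X)"

lemma brd_isom: "X \<in> Obj C \<Longrightarrow> Y \<in> Obj C \<Longrightarrow> isom (brd X Y) (X \<boxtimes> Y) (Y \<boxtimes> X)"
  using is_iso_iff braid_iso tensor_closed unfolding brd_def by metis

lemma brd_hom [intro]: "X \<in> Obj C \<Longrightarrow> Y \<in> Obj C \<Longrightarrow> hom (brd X Y) (X \<boxtimes> Y) (Y \<boxtimes> X)"
  using brd_isom isom_hom by blast

lemma brd_natural:
  assumes "hom a X X'" "hom b Y Y'" shows "brd X' Y' \<bullet> (a \<star> b) = (b \<star> a) \<bullet> brd X Y"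
proof -
  obtain f g where e: "a = ar X f X'" "b = ar Y g Y'" using assms hom_arE by metis
  have m: "X \<in> Obj C" "Y \<in> Obj C" "X' \<in> Obj C" "Y' \<in> Obj C" "f \<in> mor C X X'" "g \<in> mor C Y Y'"
    using assms hom_ar unfolding e by auto
  have t: "a \<star> b = ar (X \<boxtimes> Y) (f \<boxdot> g) (X' \<boxtimes> Y')" "b \<star> a = ar (Y \<boxtimes> X) (g \<boxdot> f) (Y' \<boxtimes> X')"
    using ten_ar assms unfolding e by auto
  show ?thesis
    unfolding t unfolding brd_def
    using cmp_ar[OF hom_ten[OF assms, unfolded t] brd_hom[OF m(3,4), unfolded brd_def]]
      cmp_ar[OF brd_hom[OF m(1,2), unfolded brd_def] hom_ten[OF assms(2,1), unfolded t]] braid_natural[OF m] by simp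
qed

lemma hexagon_right_arrow:
  assumes o: "X \<in> Obj C" "Y \<in> Obj C" "Z \<in> Obj C"
  shows "inv_arrow (asc Y Z X) \<bullet> (brd X (Y \<boxtimes> Z) \<bullet> inv_arrow (asc X Y Z)) =
    (ide Y \<star> brd X Z) \<bullet> (inv_arrow (asc Y X Z) \<bullet> (brd X Y \<star> ide Z))"
proof -
  note t = tensor_closed
  let ?a = "\<lambda>X Y Z. inv_mor C (X \<boxtimes> (Y \<boxtimes> Z)) ((X \<boxtimes> Y) \<boxtimes> Z) (Assoc C X Y Z)"
  have inv: "inv_arrow (asc X Y Z) = ar ((X \<boxtimes> Y) \<boxtimes> Z) (?a X Y Z) (X \<boxtimes> (Y \<boxtimes> Z))"
    "hom (ar ((X \<boxtimes> Y) \<boxtimes> Z) (?a X Y Z) (X \<boxtimes> (Y \<boxtimes> Z))) ((X \<boxtimes> Y) \<boxtimes> Z) (X \<boxtimes> (Y \<boxtimes> Z))"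
    if "X \<in> Obj C" "Y \<in> Obj C" "Z \<in> Obj C" for X Y Z
    using asc_isom[OF that] ar_inv_mor[OF asc_isom[OF that, unfolded asc_def]] inv_arrow(2)[OF asc_isom[OF that]]
    unfolding asc_def by auto
  have e: "ide Y \<star> brd X Z = ar (Y \<boxtimes> (X \<boxtimes> Z)) (\<I> Y \<boxdot> Braid C X Z) (Y \<boxtimes> (Z \<boxtimes> X))"
    "brd X Y \<star> ide Z = ar ((X \<boxtimes> Y) \<boxtimes> Z) (Braid C X Y \<boxdot> \<I> Z) ((Y \<boxtimes> X) \<boxtimes> Z)"
    unfolding brd_def ide_def
    using ten_ar[OF hom_ide[OF o(2), unfolded ide_def] brd_hom[OF o(1,3), unfolded brd_def]]
      ten_ar[OF brd_hom[OF o(1,2), unfolded brd_def] hom_ide[OF o(3), unfolded ide_def]] by auto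
  have YZ: "Y \<boxtimes> Z \<in> Obj C" using o t by blast
  have h1: "hom (ar (X \<boxtimes> (Y \<boxtimes> Z)) (Braid C X (Y \<boxtimes> Z)) ((Y \<boxtimes> Z) \<boxtimes> X)) (X \<boxtimes> (Y \<boxtimes> Z)) ((Y \<boxtimes> Z) \<boxtimes> X)"
    using brd_hom[OF o(1) YZ] unfolding brd_def .
  have h2: "hom (ide Y \<star> brd X Z) (Y \<boxtimes> (X \<boxtimes> Z)) (Y \<boxtimes> (Z \<boxtimes> X))" "hom (brd X Y \<star> ide Z) ((X \<boxtimes> Y) \<boxtimes> Z) ((Y \<boxtimes> X) \<boxtimes> Z)"
    using o by auto
  note h2' = h2[unfolded e]
  have l: "inv_arrow (asc Y Z X) \<bullet> (brd X (Y \<boxtimes> Z) \<bullet> inv_arrow (asc X Y Z))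
      = ar ((X \<boxtimes> Y) \<boxtimes> Z) (?a Y Z X \<cdot> (Braid C X (Y \<boxtimes> Z) \<cdot> ?a X Y Z)) (Y \<boxtimes> (Z \<boxtimes> X))"
    unfolding inv(1)[OF o] inv(1)[OF o(2,3,1)] unfolding brd_def
    using cmp_ar[OF inv(2)[OF o] h1] cmp_ar[OF hom_cmp[OF inv(2)[OF o] h1, unfolded cmp_ar[OF inv(2)[OF o] h1]] inv(2)[OF o(2,3,1)]]
    by simp
  have r: "(ide Y \<star> brd X Z) \<bullet> (inv_arrow (asc Y X Z) \<bullet> (brd X Y \<star> ide Z))
      = ar ((X \<boxtimes> Y) \<boxtimes> Z) ((\<I> Y \<boxdot> Braid C X Z) \<cdot> (?a Y X Z \<cdot> (Braid C X Y \<boxdot> \<I> Z))) (Y \<boxtimes> (Z \<boxtimes> X))"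
    unfolding inv(1)[OF o(2,1,3)] e
    using cmp_ar[OF h2'(2) inv(2)[OF o(2,1,3)]]
      cmp_ar[OF hom_cmp[OF h2'(2) inv(2)[OF o(2,1,3)], unfolded cmp_ar[OF h2'(2) inv(2)[OF o(2,1,3)]]] h2'(1)]
    by simp
  show ?thesis unfolding l r using hexagon_right[OF o] by simp
qed

text \<open>Compatibility of the braiding with the units is derived from the hexagon with two unit
  factors, by cancelling the invertible \<open>brd X \<U> \<star> ide \<U>\<close>. It turns the
  left unit law of a commutative algebra into the right one.\<close>

lemma lun_brd_unit:
  assumes X: "X \<in> Obj C" shows "lun X \<bullet> brd X \<U> = run X"
proof -
  note t = tensor_closed and u = unit_closed
  have UX: "\<U> \<boxtimes> X \<in> Obj C" "X \<boxtimes> \<U> \<in> Obj C" "\<U> \<boxtimes> \<U> \<in> Obj C" using t u X by auto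
  note a1 = inv_arrow[OF asc_isom[OF u u X]] and a2 = inv_arrow[OF asc_isom[OF X u u]] and a3 = inv_arrow[OF asc_isom[OF u X u]]
  have i: "hom (ide X) X X" "hom (ide \<U>) \<U> \<U>" using X u by auto
  have T: "(ide \<U> \<star> lun X) \<bullet> inv_arrow (asc \<U> \<U> X) = run \<U> \<star> ide X"
    using triangle_arrow[OF u X] a1(4) ide_right[OF hom_ten[OF run_hom[OF u] i(1)]] by (metis cmp_assoc)
  have K: "(ide X \<star> run \<U>) \<bullet> inv_arrow (asc X \<U> \<U>) = run (X \<boxtimes> \<U>)"
    using run_ten[OF X u] a2(4) ide_right[OF run_hom[OF UX(2)]] by (metis cmp_assoc)
  have K': "(ide \<U> \<star> run X) \<bullet> inv_arrow (asc \<U> X \<U>) = run (\<U> \<boxtimes> X)"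
    using run_ten[OF u X] a3(4) ide_right[OF run_hom[OF UX(1)]] by (metis cmp_assoc)
  have B: "(run \<U> \<star> ide X) \<bullet> brd X (\<U> \<boxtimes> \<U>) = brd X \<U> \<bullet> (ide X \<star> run \<U>)"
    using brd_natural[OF i(1) run_hom[OF u]] by simp
  have R: "brd X \<U> \<bullet> run (X \<boxtimes> \<U>) = run (\<U> \<boxtimes> X) \<bullet> (brd X \<U> \<star> ide \<U>)"
    using run_natural[OF brd_hom[OF X u]] by simp
  have b: "isom (brd X \<U> \<star> ide \<U>) ((X \<boxtimes> \<U>) \<boxtimes> \<U>) ((\<U> \<boxtimes> X) \<boxtimes> \<U>)"
    using ten_isom[OF brd_isom[OF X u] isom_ide[OF u]] .
  have "run (\<U> \<boxtimes> X) \<bullet> (brd X \<U> \<star> ide \<U>) = (ide \<U> \<star> lun X) \<bullet> (inv_arrow (asc \<U> \<U> X) \<bullet> (brd X (\<U> \<boxtimes> \<U>) \<bullet> inv_arrow (asc X \<U> \<U>)))"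
    using cmp_rewrite[OF T] cmp_rewrite2[OF B] K R by metis
  also have "\<dots> = (ide \<U> \<star> lun X) \<bullet> ((ide \<U> \<star> brd X \<U>) \<bullet> (inv_arrow (asc \<U> X \<U>) \<bullet> (brd X \<U> \<star> ide \<U>)))"
    using hexagon_right_arrow[OF X u u] by simp
  also have "\<dots> = ((ide \<U> \<star> (lun X \<bullet> brd X \<U>)) \<bullet> inv_arrow (asc \<U> X \<U>)) \<bullet> (brd X \<U> \<star> ide \<U>)"
    using ide_ten_cmp[OF u brd_hom[OF X u] lun_hom[OF X]] by (simp add: cmp_assoc)
  finally have "run (\<U> \<boxtimes> X) \<bullet> (brd X \<U> \<star> ide \<U>) = ((ide \<U> \<star> (lun X \<bullet> brd X \<U>)) \<bullet> inv_arrow (asc \<U> X \<U>)) \<bullet> (brd X \<U> \<star> ide \<U>)" .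
  then have "run (\<U> \<boxtimes> X) = (ide \<U> \<star> (lun X \<bullet> brd X \<U>)) \<bullet> inv_arrow (asc \<U> X \<U>)"
    using epicD[OF isom_epic[OF b] isom_hom[OF b] run_hom[OF UX(1)]] by blast
  then have e: "(ide \<U> \<star> run X) \<bullet> inv_arrow (asc \<U> X \<U>) = (ide \<U> \<star> (lun X \<bullet> brd X \<U>)) \<bullet> inv_arrow (asc \<U> X \<U>)"
    using K' by simp
  have h: "hom (lun X \<bullet> brd X \<U>) (X \<boxtimes> \<U>) X" using X u by blast
  have "ide \<U> \<star> run X = ide \<U> \<star> (lun X \<bullet> brd X \<U>)"
    using epicD[OF isom_epic[OF a3(1)] a3(2) hom_ten[OF i(2) run_hom[OF X]] e] .
  then show ?thesis using unit_ten_faithful[OF run_hom[OF X] h] by simp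
qed

end

section \<open>Invertible objects\<close>

context braided_locally_finite_category
begin

lemma ten_zro_right:
  assumes "hom f X Y" "hom g X' Y'" "zro g" shows "zro (f \<star> g)"
proof -
  obtain f' where f: "f = ar X f' Y" "f' \<in> mor C X Y" using assms hom_arE by blast
  have o: "X \<in> Obj C" "Y \<in> Obj C" "X' \<in> Obj C" "Y' \<in> Obj C" using assms hom_objs by auto
  have g: "g = ar X' \<zero>\<^bsub>Hom C X' Y'\<^esub> Y'" using zro_hom assms zer_def by metis
  have "mod_hom K (Hom C X' Y') (Hom C (X \<boxtimes> X') (Y \<boxtimes> Y')) (\<lambda>g. f' \<boxdot> g)"
    using tensor_linear_right[OF o f(2)] by (simp add: linear_map_def)
  then have "f' \<boxdot> \<zero>\<^bsub>Hom C X' Y'\<^esub> = \<zero>\<^bsub>Hom C (X \<boxtimes> X') (Y \<boxtimes> Y')\<^esub>" by (rule mod_hom.f0_is_0)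
  then have "f \<star> g = zer (X \<boxtimes> X') (Y \<boxtimes> Y')" using ten_ar assms f g unfolding zer_def by metis
  then show ?thesis using zroI hom_ten[OF assms(1,2)] by blast
qed

lemma ten_zro_left:
  assumes "hom f X Y" "hom g X' Y'" "zro f" shows "zro (f \<star> g)"
proof -
  obtain g' where g: "g = ar X' g' Y'" "g' \<in> mor C X' Y'" using assms hom_arE by blast
  have o: "X \<in> Obj C" "Y \<in> Obj C" "X' \<in> Obj C" "Y' \<in> Obj C" using assms hom_objs by auto
  have f: "f = ar X \<zero>\<^bsub>Hom C X Y\<^esub> Y" using zro_hom assms zer_def by metis
  have "mod_hom K (Hom C X Y) (Hom C (X \<boxtimes> X') (Y \<boxtimes> Y')) (\<lambda>f. f \<boxdot> g')"
    using tensor_linear_left[OF o g(2)] by (simp add: linear_map_def)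
  then have "\<zero>\<^bsub>Hom C X Y\<^esub> \<boxdot> g' = \<zero>\<^bsub>Hom C (X \<boxtimes> X') (Y \<boxtimes> Y')\<^esub>" by (rule mod_hom.f0_is_0)
  then have "f \<star> g = zer (X \<boxtimes> X') (Y \<boxtimes> Y')" using ten_ar assms f g unfolding zer_def by metis
  then show ?thesis using zroI hom_ten[OF assms(1,2)] by blast
qed

lemma pls_ten:
  assumes "hom f X Y" "hom f' X Y" "hom g X' Y'"
  shows "pls f f' \<star> g = pls (f \<star> g) (f' \<star> g)"
proof -
  obtain a b c where e: "f = ar X a Y" "f' = ar X b Y" "g = ar X' c Y'" using assms hom_arE by metis
  have o: "X \<in> Obj C" "Y \<in> Obj C" "X' \<in> Obj C" "Y' \<in> Obj C" "c \<in> mor C X' Y'" "a \<in> mor C X Y" "b \<in> mor C X Y"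
    using assms hom_ar unfolding e by auto
  have "mod_hom K (Hom C X Y) (Hom C (X \<boxtimes> X') (Y \<boxtimes> Y')) (\<lambda>f. f \<boxdot> c)"
    using tensor_linear_left[OF o(1-5)] by (simp add: linear_map_def)
  from module_hom_add[OF mod_hom.f_hom[OF this] o(6,7)]
  have l: "(a \<oplus>\<^bsub>Hom C X Y\<^esub> b) \<boxdot> c = (a \<boxdot> c) \<oplus>\<^bsub>Hom C (X \<boxtimes> X') (Y \<boxtimes> Y')\<^esub> (b \<boxdot> c)" .
  have h: "hom (ar X (a \<oplus>\<^bsub>Hom C X Y\<^esub> b) Y) X Y" using hom_pls[OF assms(1,2)] pls_ar[OF assms(1,2)[unfolded e]] unfolding e by simp
  show ?thesis
    using ten_ar[OF h assms(3)[unfolded e]] ten_ar[OF assms(1,3)[unfolded e]] ten_ar[OF assms(2,3)[unfolded e]]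
      hom_ten[OF assms(1,3)] hom_ten[OF assms(2,3)] pls_ar[OF assms(1,2)[unfolded e]] l
    unfolding e by (simp add: pls_ar)
qed

text \<open>Of invertibility only the existence of isomorphisms is kept, without the duality
  identities. The relation becomes symmetric and still makes tensoring with \<open>U\<close> an
  equivalence.\<close>

definition inverse_objects :: "'o \<Rightarrow> 'o \<Rightarrow> bool"
  where "inverse_objects U V \<longleftrightarrow> U \<in> Obj C \<and> V \<in> Obj C \<and> isomorphic C (V \<boxtimes> U) \<U> \<and> isomorphic C (U \<boxtimes> V) \<U>"

lemma inverse_objects_sym: "inverse_objects U V \<Longrightarrow> inverse_objects V U"
  by (auto simp: inverse_objects_def)

lemma is_invertible_inverse: "is_invertible C U \<Longrightarrow> \<exists>V. inverse_objects U V"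
proof -
  assume "is_invertible C U"
  then obtain V ev co where d: "is_left_dual C U V ev co" "is_iso C (V \<boxtimes> U) \<U> ev" "is_iso C \<U> (U \<boxtimes> V) co"
    unfolding is_invertible_def by blast
  then have o: "U \<in> Obj C" "V \<in> Obj C" unfolding is_left_dual_def by auto
  have "isomorphic C \<U> (U \<boxtimes> V)" "isomorphic C (V \<boxtimes> U) \<U>" using d unfolding isomorphic_def by auto
  then have "inverse_objects U V"
    unfolding inverse_objects_def using o isomorphic_sym unit_closed tensor_closed by blast
  then show ?thesis by blast
qed

text \<open>The isomorphism from \<open>V \<boxtimes> U\<close> to the unit, transported by the
  associator and the left unitor. Its naturality is the source of faithfulness and fullness of
  tensoring with \<open>U\<close>.\<close>

lemma inverse_natural:
  assumes "inverse_objects U V"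
  obtains n where "\<And>X. X \<in> Obj C \<Longrightarrow> isom (n X) (V \<boxtimes> (U \<boxtimes> X)) X"
    "\<And>f X Y. hom f X Y \<Longrightarrow> n Y \<bullet> (ide V \<star> (ide U \<star> f)) = f \<bullet> n X"
proof -
  have o: "U \<in> Obj C" "V \<in> Obj C" and u: "\<U> \<in> Obj C" using assms unit_closed unfolding inverse_objects_def by auto
  obtain \<phi> where \<phi>: "isom \<phi> (V \<boxtimes> U) \<U>"
    using assms isomorphic_iff tensor_closed unit_closed unfolding inverse_objects_def by blast
  let ?n = "\<lambda>X. lun X \<bullet> ((\<phi> \<star> ide X) \<bullet> asc V U X)"
  show ?thesis
  proof (rule that[of ?n])
    fix X assume X: "X \<in> Obj C"
    show "isom (?n X) (V \<boxtimes> (U \<boxtimes> X)) X"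
      using isom_cmp[OF isom_cmp[OF asc_isom[OF o(2,1) X] ten_isom[OF \<phi> isom_ide[OF X]]] lun_isom[OF X]] .
  next
    fix f X Y assume f: "hom f X Y"
    have XY: "X \<in> Obj C" "Y \<in> Obj C" using f hom_objs by auto
    have p: "hom \<phi> (V \<boxtimes> U) \<U>" using \<phi> isom_hom by blast
    have i: "hom (ide V) V V" "hom (ide U) U U" using o by auto
    have 1: "asc V U Y \<bullet> (ide V \<star> (ide U \<star> f)) = (ide (V \<boxtimes> U) \<star> f) \<bullet> asc V U X"
      using asc_natural[OF i f] ten_ide o by simp
    have 2: "(\<phi> \<star> ide Y) \<bullet> (ide (V \<boxtimes> U) \<star> f) = (ide \<U> \<star> f) \<bullet> (\<phi> \<star> ide X)"
      using ten_split1[OF p f] ten_split2[OF p f] by simp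
    show "?n Y \<bullet> (ide V \<star> (ide U \<star> f)) = f \<bullet> ?n X"
      by (simp add: cmp_assoc 1 cmp_rewrite2[OF 2] cmp_rewrite2[OF lun_natural[OF f]])
  qed
qed

lemma inverse_faithful:
  assumes "inverse_objects U V" "hom f X Y" "hom g X Y" "ide U \<star> f = ide U \<star> g" shows "f = g"
proof -
  obtain n where n: "\<And>X. X \<in> Obj C \<Longrightarrow> isom (n X) (V \<boxtimes> (U \<boxtimes> X)) X"
    "\<And>f X Y. hom f X Y \<Longrightarrow> n Y \<bullet> (ide V \<star> (ide U \<star> f)) = f \<bullet> n X"
    using inverse_natural[OF assms(1)] by blast
  have X: "X \<in> Obj C" using assms hom_objs by blast
  have "f \<bullet> n X = g \<bullet> n X" using n(2)[OF assms(2)] n(2)[OF assms(3)] assms(4) by simp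
  then show ?thesis using epicD[OF isom_epic[OF n(1)[OF X]] isom_hom[OF n(1)[OF X]] assms(2)] by blast
qed

text \<open>The candidate is \<open>ide V \<star> w\<close> conjugated by the natural isomorphism.
  That it maps to \<open>w\<close> is checked after tensoring with \<open>V\<close>, which is
  faithful by symmetry.\<close>

lemma inverse_full:
  assumes i: "inverse_objects U V" and X: "X \<in> Obj C" "Y \<in> Obj C" and w: "hom w (U \<boxtimes> X) (U \<boxtimes> Y)"
  shows "\<exists>f. hom f X Y \<and> w = ide U \<star> f"
proof -
  obtain n where n: "\<And>X. X \<in> Obj C \<Longrightarrow> isom (n X) (V \<boxtimes> (U \<boxtimes> X)) X"
    "\<And>f X Y. hom f X Y \<Longrightarrow> n Y \<bullet> (ide V \<star> (ide U \<star> f)) = f \<bullet> n X"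
    using inverse_natural[OF i] by blast
  have o: "U \<in> Obj C" "V \<in> Obj C" using i unfolding inverse_objects_def by auto
  obtain m where m: "hom m X (V \<boxtimes> (U \<boxtimes> X))" "m \<bullet> n X = ide (V \<boxtimes> (U \<boxtimes> X))" using isomE[OF n(1)[OF X(1)]] by metis
  let ?f = "n Y \<bullet> ((ide V \<star> w) \<bullet> m)"
  have vw: "hom (ide V \<star> w) (V \<boxtimes> (U \<boxtimes> X)) (V \<boxtimes> (U \<boxtimes> Y))" using w o by blast
  have f: "hom ?f X Y" using hom_cmp[OF hom_cmp[OF m(1) vw] isom_hom[OF n(1)[OF X(2)]]] .
  have "n Y \<bullet> (ide V \<star> (ide U \<star> ?f)) = ?f \<bullet> n X" using n(2)[OF f] .
  also have "\<dots> = n Y \<bullet> (ide V \<star> w)" using m ide_right[OF vw] by (simp add: cmp_assoc)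
  finally have "ide V \<star> (ide U \<star> ?f) = ide V \<star> w"
    using monicD[OF isom_monic[OF n(1)[OF X(2)]] isom_hom[OF n(1)[OF X(2)]]] f o by blast
  then have "ide U \<star> ?f = w"
    using inverse_faithful[OF inverse_objects_sym[OF i]] w f o by blast
  then show ?thesis using f by metis
qed

lemma inverse_surj:
  assumes i: "inverse_objects U V" and W: "W \<in> Obj C"
  shows "\<exists>w. isom w (U \<boxtimes> (V \<boxtimes> W)) W"
  using inverse_natural[OF inverse_objects_sym[OF i]] W by metis

text \<open>Tensoring with an invertible object is an autoequivalence, so it preserves kernels, cokernels
  and simplicity.\<close>

lemma inverse_lift_left:
  assumes i: "inverse_objects U V" and X: "X \<in> Obj C" and g: "hom g W (U \<boxtimes> X)"
  obtains w W' g' where "isom w (U \<boxtimes> W') W" "hom g' W' X" "g \<bullet> w = ide U \<star> g'" "W' = V \<boxtimes> W"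
proof -
  have W: "W \<in> Obj C" using g hom_objs by blast
  obtain w where w: "isom w (U \<boxtimes> (V \<boxtimes> W)) W" using inverse_surj[OF i W] by blast
  have V: "V \<boxtimes> W \<in> Obj C" using i W tensor_closed unfolding inverse_objects_def by blast
  show ?thesis
    using that[OF w] inverse_full[OF i V X hom_cmp[OF isom_hom[OF w] g]] by blast
qed

lemma inverse_lift_right:
  assumes i: "inverse_objects U V" and X: "X \<in> Obj C" and g: "hom g (U \<boxtimes> X) W"
  obtains w W' g' where "isom w W (U \<boxtimes> W')" "hom g' X W'" "w \<bullet> g = ide U \<star> g'"
proof -
  have W: "W \<in> Obj C" using g hom_objs by blast
  obtain w where w: "isom w W (U \<boxtimes> (V \<boxtimes> W))" using inverse_surj[OF i W] isomE by metis
  have V: "V \<boxtimes> W \<in> Obj C" using i W tensor_closed unfolding inverse_objects_def by blast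
  show ?thesis
    using that[OF w] inverse_full[OF i X V hom_cmp[OF g isom_hom[OF w]]] by blast
qed

text \<open>Every test arrow into \<open>U \<boxtimes> N\<close> is, up to an isomorphism of its
  source, of the form \<open>ide U \<star> g'\<close>.\<close>

lemma inverse_monic:
  assumes i: "inverse_objects U V" and k: "hom k N X" "monic k" shows "monic (ide U \<star> k)"
proof -
  have o: "U \<in> Obj C" "N \<in> Obj C" "X \<in> Obj C" using i k hom_objs unfolding inverse_objects_def by auto
  have uk: "hom (ide U \<star> k) (U \<boxtimes> N) (U \<boxtimes> X)" using k o by blast
  show ?thesis
  proof (rule monicI_hom[OF uk])
    fix W g h assume g: "hom g W (U \<boxtimes> N)" "hom h W (U \<boxtimes> N)" "(ide U \<star> k) \<bullet> g = (ide U \<star> k) \<bullet> h"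
    have W: "W \<in> Obj C" using g hom_objs by blast
    have V: "V \<boxtimes> W \<in> Obj C" using i W tensor_closed unfolding inverse_objects_def by blast
    obtain w where w: "isom w (U \<boxtimes> (V \<boxtimes> W)) W" using inverse_surj[OF i W] by blast
    obtain g' h' where g': "hom g' (V \<boxtimes> W) N" "g \<bullet> w = ide U \<star> g'" "hom h' (V \<boxtimes> W) N" "h \<bullet> w = ide U \<star> h'"
      using inverse_full[OF i V o(2) hom_cmp[OF isom_hom[OF w] g(1)]]
        inverse_full[OF i V o(2) hom_cmp[OF isom_hom[OF w] g(2)]] by blast
    have "ide U \<star> (k \<bullet> g') = ((ide U \<star> k) \<bullet> g) \<bullet> w"
      using ide_ten_cmp[OF o(1) g'(1) k(1)] g' by (simp add: cmp_assoc)
    also have "\<dots> = ide U \<star> (k \<bullet> h')"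
      using ide_ten_cmp[OF o(1) g'(3) k(1)] g' g(3) by (simp add: cmp_assoc)
    finally have "k \<bullet> g' = k \<bullet> h'" using inverse_faithful[OF i] g' k hom_cmp by metis
    then have "g' = h'" using monicD k g' by metis
    then show "g = h" using g' epicD[OF isom_epic[OF w] isom_hom[OF w] g(1)] by simp
  qed
qed

lemma inverse_epic:
  assumes i: "inverse_objects U V" and k: "hom k X N" "epic k" shows "epic (ide U \<star> k)"
proof -
  have o: "U \<in> Obj C" "N \<in> Obj C" "X \<in> Obj C" using i k hom_objs unfolding inverse_objects_def by auto
  have uk: "hom (ide U \<star> k) (U \<boxtimes> X) (U \<boxtimes> N)" using k o by blast
  show ?thesis
  proof (rule epicI_hom[OF uk])
    fix W g h assume g: "hom g (U \<boxtimes> N) W" "hom h (U \<boxtimes> N) W" "g \<bullet> (ide U \<star> k) = h \<bullet> (ide U \<star> k)"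
    have W: "W \<in> Obj C" using g hom_objs by blast
    have V: "V \<boxtimes> W \<in> Obj C" using i W tensor_closed unfolding inverse_objects_def by blast
    obtain w where w: "isom w W (U \<boxtimes> (V \<boxtimes> W))" using inverse_surj[OF i W] isomE by metis
    obtain g' h' where g': "hom g' N (V \<boxtimes> W)" "w \<bullet> g = ide U \<star> g'" "hom h' N (V \<boxtimes> W)" "w \<bullet> h = ide U \<star> h'"
      using inverse_full[OF i o(2) V hom_cmp[OF g(1) isom_hom[OF w]]]
        inverse_full[OF i o(2) V hom_cmp[OF g(2) isom_hom[OF w]]] by blast
    have "ide U \<star> (g' \<bullet> k) = w \<bullet> (g \<bullet> (ide U \<star> k))"
      using ide_ten_cmp[OF o(1) k(1) g'(1)] g' by (simp flip: cmp_assoc)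
    also have "\<dots> = ide U \<star> (h' \<bullet> k)"
      using ide_ten_cmp[OF o(1) k(1) g'(3)] g' g(3) by (simp flip: cmp_assoc)
    finally have "g' \<bullet> k = h' \<bullet> k" using inverse_faithful[OF i] g' k hom_cmp by metis
    then have "g' = h'" using epicD k g' by metis
    then show "g = h" using g' monicD[OF isom_monic[OF w] isom_hom[OF w] g(1)] by simp
  qed
qed

lemma inverse_zro:
  assumes i: "inverse_objects U V" and f: "hom f X Y" "zro (ide U \<star> f)" shows "zro f"
proof -
  have o: "U \<in> Obj C" "X \<in> Obj C" "Y \<in> Obj C" using i f hom_objs unfolding inverse_objects_def by auto
  have "zro (ide U \<star> zer X Y)" using ten_zro_right[OF hom_ide[OF o(1)] hom_zer[OF o(2,3)]] zro_zer o by blast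
  then have "ide U \<star> f = ide U \<star> zer X Y" using zro_parallel f(2) hom_ten[OF hom_ide[OF o(1)] f(1)] hom_ten[OF hom_ide[OF o(1)] hom_zer[OF o(2,3)]] by blast
  then have "f = zer X Y" using inverse_faithful[OF i f(1) hom_zer[OF o(2,3)]] by blast
  then show ?thesis using zroI f by blast
qed

lemma inverse_kern:
  assumes i: "inverse_objects U V" and f: "hom f X Y" and k: "kern f k"
  shows "kern (ide U \<star> f) (ide U \<star> k)"
  unfolding kern_def
proof (intro conjI allI impI)
  obtain N where N: "hom k N X" "monic k" "zro (f \<bullet> k)" using kernD[OF k f] by blast
  have o: "U \<in> Obj C" "N \<in> Obj C" "X \<in> Obj C" using i N hom_objs unfolding inverse_objects_def by auto
  show "monic (ide U \<star> k)" using inverse_monic[OF i N(1,2)] .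
  show "zro ((ide U \<star> f) \<bullet> (ide U \<star> k))"
    using ide_ten_cmp[OF o(1) N(1) f] ten_zro_right[OF hom_ide[OF o(1)] hom_cmp[OF N(1) f] N(3)] by simp
  have uf: "hom (ide U \<star> f) (U \<boxtimes> X) (U \<boxtimes> Y)" using f o by blast
  fix g assume g: "zro ((ide U \<star> f) \<bullet> g)"
  obtain W where W: "hom g W (U \<boxtimes> X)" using zro_cmp_dom[OF g uf] .
  obtain w W' g' where w: "isom w (U \<boxtimes> W') W" "hom g' W' X" "g \<bullet> w = ide U \<star> g'"
    using inverse_lift_left[OF i o(3) W] .
  have "zro (((ide U \<star> f) \<bullet> g) \<bullet> w)" using zro_cmp_hom[OF isom_hom[OF w(1)] hom_cmp[OF W uf]] g by blast
  then have "zro (ide U \<star> (f \<bullet> g'))" using ide_ten_cmp[OF o(1) w(2) f] w(3) by (simp add: cmp_assoc)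
  then have "zro (f \<bullet> g')" using inverse_zro[OF i hom_cmp[OF w(2) f]] by blast
  then obtain v where v: "g' = k \<bullet> v" using k kern_def by blast
  have vh: "hom v W' N" using v w N hom_cmpE hom_unique by metis
  obtain w' where w': "w \<bullet> w' = ide W" using isomE[OF w(1)] by metis
  have "g = (g \<bullet> w) \<bullet> w'" using w' ide_right[OF W] by (simp add: cmp_assoc)
  also have "\<dots> = (ide U \<star> k) \<bullet> ((ide U \<star> v) \<bullet> w')"
    using w(3) v ide_ten_cmp[OF o(1) vh N(1)] by (simp add: cmp_assoc)
  finally show "\<exists>u. g = (ide U \<star> k) \<bullet> u" by blast
qed

lemma inverse_coker:
  assumes i: "inverse_objects U V" and f: "hom f X Y" and q: "coker f q"
  shows "coker (ide U \<star> f) (ide U \<star> q)"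
  unfolding coker_def
proof (intro conjI allI impI)
  obtain N where N: "hom q Y N" "epic q" "zro (q \<bullet> f)" using cokerD[OF q f] by blast
  have o: "U \<in> Obj C" "N \<in> Obj C" "Y \<in> Obj C" using i N hom_objs unfolding inverse_objects_def by auto
  show "epic (ide U \<star> q)" using inverse_epic[OF i N(1,2)] .
  show "zro ((ide U \<star> q) \<bullet> (ide U \<star> f))"
    using ide_ten_cmp[OF o(1) f N(1)] ten_zro_right[OF hom_ide[OF o(1)] hom_cmp[OF f N(1)] N(3)] by simp
  have uf: "hom (ide U \<star> f) (U \<boxtimes> X) (U \<boxtimes> Y)" using f o by blast
  fix g assume g: "zro (g \<bullet> (ide U \<star> f))"
  obtain W where W: "hom g (U \<boxtimes> Y) W" using zro_cmp_cod[OF g uf] .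
  obtain w W' g' where w: "isom w W (U \<boxtimes> W')" "hom g' Y W'" "w \<bullet> g = ide U \<star> g'"
    using inverse_lift_right[OF i o(3) W] .
  have "zro (w \<bullet> (g \<bullet> (ide U \<star> f)))" using zro_cmp_hom[OF hom_cmp[OF uf W] isom_hom[OF w(1)]] g by blast
  then have "zro (ide U \<star> (g' \<bullet> f))" using ide_ten_cmp[OF o(1) f w(2)] w(3) by (simp flip: cmp_assoc)
  then have "zro (g' \<bullet> f)" using inverse_zro[OF i hom_cmp[OF f w(2)]] by blast
  then obtain v where v: "g' = v \<bullet> q" using q coker_def by blast
  have vh: "hom v N W'" using v w N hom_cmpE hom_unique by metis
  obtain w' where w': "w' \<bullet> w = ide W" using isomE[OF w(1)] by metis
  have "g = w' \<bullet> (w \<bullet> g)" using cmp_rewrite[OF w'] ide_left[OF W] by simp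
  also have "\<dots> = (w' \<bullet> (ide U \<star> v)) \<bullet> (ide U \<star> q)"
    using w(3) v ide_ten_cmp[OF o(1) N(1) vh] by (simp add: cmp_assoc)
  finally show "\<exists>u. g = u \<bullet> (ide U \<star> q)" by blast
qed

lemma inverse_zob: assumes i: "inverse_objects U V" and X: "X \<in> Obj C" shows "zob (U \<boxtimes> X) \<longleftrightarrow> zob X"
proof -
  have o: "U \<in> Obj C" using i unfolding inverse_objects_def by auto
  have "ide (U \<boxtimes> X) = ide U \<star> ide X" using ten_ide o X by simp
  then show ?thesis
    using inverse_zro[OF i hom_ide[OF X]] ten_zro_right[OF hom_ide[OF o] hom_ide[OF X]] zob_iff tensor_closed o X by metis
qed

text \<open>Up to an isomorphism of its source, a subobject of \<open>U \<boxtimes> T\<close> is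
  \<open>U\<close> tensored with a subobject of \<open>T\<close>.\<close>

lemma inverse_simple:
  assumes i: "inverse_objects U V" and T: "simple T" shows "simple (U \<boxtimes> T)"
  unfolding simple_def
proof (intro conjI allI impI)
  have o: "U \<in> Obj C" "V \<in> Obj C" "T \<in> Obj C" using i T simple_obj unfolding inverse_objects_def by auto
  show UT: "U \<boxtimes> T \<in> Obj C" using o tensor_closed by blast
  show "\<not> zob (U \<boxtimes> T)" using inverse_zob[OF i o(3)] T simple_def by blast
  fix s S assume s: "hom s S (U \<boxtimes> T)" "monic s"
  obtain w W' s' where w: "isom w (U \<boxtimes> W') S" "hom s' W' T" "s \<bullet> w = ide U \<star> s'"
    using inverse_lift_left[OF i o(3) s(1)] .
  have W': "W' \<in> Obj C" using w hom_objs by blast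
  have m: "monic (ide U \<star> s')" using w monic_cmp[OF isom_monic[OF w(1)] s(2)] hom_cmp[OF isom_hom[OF w(1)] s(1)] hom_not_None by metis
  have "monic s'"
  proof (rule monicI_hom[OF w(2)])
    fix X g h assume g: "hom g X W'" "hom h X W'" "s' \<bullet> g = s' \<bullet> h"
    then have "(ide U \<star> s') \<bullet> (ide U \<star> g) = (ide U \<star> s') \<bullet> (ide U \<star> h)"
      using ide_ten_cmp[OF o(1) _ w(2)] by metis
    then have "ide U \<star> g = ide U \<star> h"
      using monicD[OF m hom_ten[OF hom_ide[OF o(1)] w(2)] hom_ten[OF hom_ide[OF o(1)] g(1)]] by blast
    then show "g = h" using inverse_faithful[OF i g(1,2)] by blast
  qed
  then consider "zro s'" | "isom s' W' T" using T w simple_def by blast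
  then show "zro s \<or> isom s S (U \<boxtimes> T)"
  proof cases
    case 1
    then have "zro (s \<bullet> w)" using ten_zro_right[OF hom_ide[OF o(1)] w(2)] w(3) by simp
    then show ?thesis using epic_zro isom_epic w(1) by blast
  next
    case 2
    then have "isom (s \<bullet> w) (U \<boxtimes> W') (U \<boxtimes> T)" using ten_isom[OF isom_ide[OF o(1)] 2] w(3) by simp
    then show ?thesis using isom_cancel_right[OF w(1) s(1)] by blast
  qed
qed

text \<open>The braiding exchanges the tensor factors, which reduces the claim to
  \<open>inverse_epic\<close>.\<close>

lemma inverse_epic_right:
  assumes i: "inverse_objects U V" and f: "hom f X Y" "epic f" shows "epic (f \<star> ide U)"
proof -
  have o: "U \<in> Obj C" "X \<in> Obj C" "Y \<in> Obj C" using i f hom_objs unfolding inverse_objects_def by auto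
  have "brd Y U \<bullet> (f \<star> ide U) = (ide U \<star> f) \<bullet> brd X U" using brd_natural[OF f(1) hom_ide[OF o(1)]] .
  moreover have "epic ((ide U \<star> f) \<bullet> brd X U)"
    using epic_cmp[OF isom_epic[OF brd_isom[OF o(2,1)]] inverse_epic[OF i f]]
      hom_cmp[OF brd_hom[OF o(2,1)] hom_ten[OF hom_ide[OF o(1)] f(1)]] hom_not_None by blast
  ultimately have e: "epic (brd Y U \<bullet> (f \<star> ide U))" by simp
  obtain b where b: "isom b (U \<boxtimes> Y) (Y \<boxtimes> U)" "b \<bullet> brd Y U = ide (Y \<boxtimes> U)" using isomE[OF brd_isom[OF o(3,1)]] by metis
  have h: "hom (f \<star> ide U) (X \<boxtimes> U) (Y \<boxtimes> U)" using f o by blast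
  have "b \<bullet> (brd Y U \<bullet> (f \<star> ide U)) = f \<star> ide U" using cmp_rewrite[OF b(2)] ide_left[OF h] by simp
  moreover have "epic (b \<bullet> (brd Y U \<bullet> (f \<star> ide U)))"
    using epic_cmp[OF e isom_epic[OF b(1)]] calculation h hom_not_None by metis
  ultimately show ?thesis by simp
qed

text \<open>Fullness lifts an isomorphism and its inverse, and faithfulness shows that the lifts are
  inverse to each other.\<close>

lemma inverse_cancel:
  assumes i: "inverse_objects U V" and X: "X \<in> Obj C" "Y \<in> Obj C" and e: "isomorphic C (U \<boxtimes> X) (U \<boxtimes> Y)"
  shows "isomorphic C X Y"
proof -
  have o: "U \<in> Obj C" using i unfolding inverse_objects_def by auto
  obtain a where a: "isom a (U \<boxtimes> X) (U \<boxtimes> Y)" using e isomorphic_iff tensor_closed o X by blast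
  obtain b where b: "hom b (U \<boxtimes> Y) (U \<boxtimes> X)" "b \<bullet> a = ide (U \<boxtimes> X)" "a \<bullet> b = ide (U \<boxtimes> Y)" using isomE[OF a] by metis
  obtain f where f: "hom f X Y" "a = ide U \<star> f" using inverse_full[OF i X isom_hom[OF a]] by blast
  obtain g where g: "hom g Y X" "b = ide U \<star> g" using inverse_full[OF i X(2,1) b(1)] by blast
  have "ide U \<star> (g \<bullet> f) = ide U \<star> ide X" using ide_ten_cmp[OF o f(1) g(1)] f g b ten_ide[OF o X(1)] by simp
  then have 1: "g \<bullet> f = ide X" using inverse_faithful[OF i hom_cmp[OF f(1) g(1)]] X by blast
  have "ide U \<star> (f \<bullet> g) = ide U \<star> ide Y" using ide_ten_cmp[OF o g(1) f(1)] f g b ten_ide[OF o X(2)] by simp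
  then have 2: "f \<bullet> g = ide Y" using inverse_faithful[OF i hom_cmp[OF g(1) f(1)]] X by blast
  show ?thesis using isomI[OF f(1) g(1) 1 2] isomorphic_iff X by blast
qed

end

section \<open>Modules over a commutative algebra\<close>

text \<open>Module homomorphisms are the equaliser of two linear maps on a morphism space of
  \<open>C\<close>; this is how the morphism sets of \<open>Rep\<close> become vector
  spaces.\<close>

lemma submodule_equalizer:
  assumes T: "mod_hom R V W T" and S: "mod_hom R V W S"
  shows "submodule R {f \<in> carrier V. T f = S f} V"
proof -
  interpret T: mod_hom R V W T by (rule T)
  interpret S: mod_hom R V W S by (rule S)
  show ?thesis
    by (unfold_locales) (auto simp: T.f0_is_0 S.f0_is_0)
qed

lemma mod_hom_comp:
  assumes T: "mod_hom R V W T" and S: "mod_hom R W U S"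
  shows "mod_hom R V U (\<lambda>x. S (T x))"
proof -
  interpret T: mod_hom R V W T by (rule T)
  interpret S: mod_hom R W U S by (rule S)
  show ?thesis
    by unfold_locales (auto simp: module_hom_def)
qed

locale comm_algebra = braided_locally_finite_category K C
  for K :: "('k, 'x) ring_scheme" and C :: "('o, 'm, 'k, 'z) br_cat_scheme" (structure) +
  fixes A :: 'o and \<mu> \<iota> :: 'm
  assumes commutative_algebra: "is_commutative_algebra C A \<mu> \<iota>"
begin

abbreviation RepA :: "('o \<times> 'm, 'm, 'k) lin_cat"
  where "RepA \<equiv> Rep C A \<mu> \<iota>"

section \<open>Modules over the algebra as a linear category\<close>

definition mu :: "('o, 'm) arrow" where "mu = ar (A \<boxtimes> A) \<mu> A"

definition io :: "('o, 'm) arrow" where "io = ar \<U> \<iota> A"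

lemma A_obj: "A \<in> Obj C" and mu_hom: "hom mu (A \<boxtimes> A) A" and io_hom: "hom io \<U> A"
  using commutative_algebra tensor_closed unit_closed
  unfolding is_commutative_algebra_def is_algebra_def mu_def io_def by (auto simp: hom_ar)

definition act :: "'o \<times> 'm \<Rightarrow> ('o, 'm) arrow"
  where "act X = ar (A \<boxtimes> fst X) (snd X) (fst X)"

text \<open>The unit law has \<open>lun\<close> on the right instead of its inverse on the left;
  \<open>act_unit_iff\<close> shows that the two forms are equivalent.\<close>

definition is_mod :: "'o \<times> 'm \<Rightarrow> bool"
  where "is_mod X \<longleftrightarrow> hom (act X) (A \<boxtimes> fst X) (fst X) \<and>
    act X \<bullet> ((mu \<star> ide (fst X)) \<bullet> asc A A (fst X)) = act X \<bullet> (ide A \<star> act X) \<and>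
    act X \<bullet> (io \<star> ide (fst X)) = lun (fst X)"

text \<open>Kept as a property of arrows of \<open>C\<close>, so that computations stay in
  \<open>C\<close> and are lifted to modules only at the end by \<open>und_lift\<close>.\<close>

definition equi :: "'o \<times> 'm \<Rightarrow> 'o \<times> 'm \<Rightarrow> ('o, 'm) arrow \<Rightarrow> bool"
  where "equi X Y f \<longleftrightarrow> hom f (fst X) (fst Y) \<and> f \<bullet> act X = act Y \<bullet> (ide A \<star> f)"

lemma is_modD:
  assumes "is_mod X"
  shows "hom (act X) (A \<boxtimes> fst X) (fst X)" "fst X \<in> Obj C"
    "act X \<bullet> ((mu \<star> ide (fst X)) \<bullet> asc A A (fst X)) = act X \<bullet> (ide A \<star> act X)"
    "act X \<bullet> (io \<star> ide (fst X)) = lun (fst X)"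
  using assms hom_objs unfolding is_mod_def by auto

lemma act_assoc_iff:
  assumes M: "M \<in> Obj C" and n: "\<nu> \<in> mor C (A \<boxtimes> M) M"
  shows "\<nu> \<cdot> (\<mu> \<boxdot> \<I> M) \<cdot> Assoc C A A M = \<nu> \<cdot> (\<I> A \<boxdot> \<nu>) \<longleftrightarrow>
    act (M, \<nu>) \<bullet> ((mu \<star> ide M) \<bullet> asc A A M) = act (M, \<nu>) \<bullet> (ide A \<star> act (M, \<nu>))"
proof -
  have h: "hom (ar (A \<boxtimes> M) \<nu> M) (A \<boxtimes> M) M" using M n A_obj tensor_closed hom_ar by blast
  have iA: "hom (ar A (\<I> A) A) A A" "hom (ar M (\<I> M) M) M M" using hom_ide[OF A_obj] hom_ide[OF M] unfolding ide_def by auto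
  have e1: "mu \<star> ide M = ar ((A \<boxtimes> A) \<boxtimes> M) (\<mu> \<boxdot> \<I> M) (A \<boxtimes> M)"
    "ide A \<star> act (M, \<nu>) = ar (A \<boxtimes> (A \<boxtimes> M)) (\<I> A \<boxdot> \<nu>) (A \<boxtimes> M)"
    unfolding mu_def ide_def act_def using ten_ar[OF mu_hom[unfolded mu_def] iA(2)] ten_ar[OF iA(1) h] by auto
  have h1: "hom (ar ((A \<boxtimes> A) \<boxtimes> M) (\<mu> \<boxdot> \<I> M) (A \<boxtimes> M)) ((A \<boxtimes> A) \<boxtimes> M) (A \<boxtimes> M)"
    "hom (ar (A \<boxtimes> (A \<boxtimes> M)) (\<I> A \<boxdot> \<nu>) (A \<boxtimes> M)) (A \<boxtimes> (A \<boxtimes> M)) (A \<boxtimes> M)"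
    "hom (ar (A \<boxtimes> (A \<boxtimes> M)) (Assoc C A A M) ((A \<boxtimes> A) \<boxtimes> M)) (A \<boxtimes> (A \<boxtimes> M)) ((A \<boxtimes> A) \<boxtimes> M)"
    using hom_ten[OF mu_hom hom_ide[OF M]] hom_ten[OF hom_ide[OF A_obj] h] asc_hom[OF A_obj A_obj M] e1
    unfolding asc_def act_def by auto
  have h2: "hom (ar (A \<boxtimes> (A \<boxtimes> M)) ((\<mu> \<boxdot> \<I> M) \<cdot> Assoc C A A M) (A \<boxtimes> M)) (A \<boxtimes> (A \<boxtimes> M)) (A \<boxtimes> M)"
    using hom_cmp[OF h1(3,1)] cmp_ar[OF h1(3,1)] by simp
  have l: "act (M, \<nu>) \<bullet> ((mu \<star> ide M) \<bullet> asc A A M) = ar (A \<boxtimes> (A \<boxtimes> M)) (\<nu> \<cdot> ((\<mu> \<boxdot> \<I> M) \<cdot> Assoc C A A M)) M"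
    unfolding e1 using cmp_ar[OF h1(3,1)] cmp_ar[OF h2 h] by (simp add: asc_def act_def)
  have r: "act (M, \<nu>) \<bullet> (ide A \<star> act (M, \<nu>)) = ar (A \<boxtimes> (A \<boxtimes> M)) (\<nu> \<cdot> (\<I> A \<boxdot> \<nu>)) M"
    unfolding e1 using cmp_ar[OF h1(2) h] by (simp add: act_def)
  have "hom (ar (A \<boxtimes> (A \<boxtimes> M)) (\<nu> \<cdot> (\<I> A \<boxdot> \<nu>)) M) (A \<boxtimes> (A \<boxtimes> M)) M"
    using hom_cmp[OF h1(2) h] cmp_ar[OF h1(2) h] by simp
  then show ?thesis unfolding l r using ar_inject by metis
qed

lemma act_unit_iff:
  assumes M: "M \<in> Obj C" and n: "\<nu> \<in> mor C (A \<boxtimes> M) M"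
  shows "\<nu> \<cdot> (\<iota> \<boxdot> \<I> M) \<cdot> inv_mor C (\<U> \<boxtimes> M) M (Lunit C M) = \<I> M \<longleftrightarrow>
    act (M, \<nu>) \<bullet> (io \<star> ide M) = lun M"
proof -
  let ?l = "inv_mor C (\<U> \<boxtimes> M) M (Lunit C M)"
  note L = inv_arrow[OF lun_isom[OF M]]
  have h: "hom (ar (A \<boxtimes> M) \<nu> M) (A \<boxtimes> M) M" using M n A_obj tensor_closed hom_ar by blast
  have iM: "hom (ar M (\<I> M) M) M M" using hom_ide[OF M] unfolding ide_def by auto
  have e1: "io \<star> ide M = ar (\<U> \<boxtimes> M) (\<iota> \<boxdot> \<I> M) (A \<boxtimes> M)"
    unfolding io_def ide_def using ten_ar[OF io_hom[unfolded io_def] iM] .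
  have e2: "inv_arrow (lun M) = ar M ?l (\<U> \<boxtimes> M)"
    using ar_inv_mor[OF lun_isom[OF M, unfolded lun_def]] unfolding lun_def by simp
  have h0: "hom (io \<star> ide M) (\<U> \<boxtimes> M) (A \<boxtimes> M)" using hom_ten[OF io_hom hom_ide[OF M]] .
  note h1 = h0[unfolded e1] and h2 = L(2)[unfolded e2]
  have h3: "hom (ar M ((\<iota> \<boxdot> \<I> M) \<cdot> ?l) (A \<boxtimes> M)) M (A \<boxtimes> M)"
    using hom_cmp[OF h2 h1] cmp_ar[OF h2 h1] by simp
  have l: "act (M, \<nu>) \<bullet> ((io \<star> ide M) \<bullet> inv_arrow (lun M)) = ar M (\<nu> \<cdot> ((\<iota> \<boxdot> \<I> M) \<cdot> ?l)) M"
    unfolding e1 e2 using cmp_ar[OF h2 h1] cmp_ar[OF h3 h] by (simp add: act_def)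
  have hl: "hom (ar M (\<nu> \<cdot> ((\<iota> \<boxdot> \<I> M) \<cdot> ?l)) M) M M" using hom_cmp[OF h3 h] cmp_ar[OF h3 h] by simp
  have ha: "hom (act (M, \<nu>) \<bullet> (io \<star> ide M)) (\<U> \<boxtimes> M) M" using hom_cmp[OF h0 h] by (simp add: act_def)
  have "\<nu> \<cdot> ((\<iota> \<boxdot> \<I> M) \<cdot> ?l) = \<I> M \<longleftrightarrow> (act (M, \<nu>) \<bullet> (io \<star> ide M)) \<bullet> inv_arrow (lun M) = ide M"
    using l ar_inject[OF hl] unfolding ide_def by (metis cmp_assoc)
  also have "\<dots> \<longleftrightarrow> act (M, \<nu>) \<bullet> (io \<star> ide M) = lun M"
  proof
    assume "(act (M, \<nu>) \<bullet> (io \<star> ide M)) \<bullet> inv_arrow (lun M) = ide M"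
    then show "act (M, \<nu>) \<bullet> (io \<star> ide M) = lun M"
      using L(4) epicD[OF isom_epic[OF L(1)] L(2) ha] by metis
  next
    assume "act (M, \<nu>) \<bullet> (io \<star> ide M) = lun M"
    then show "(act (M, \<nu>) \<bullet> (io \<star> ide M)) \<bullet> inv_arrow (lun M) = ide M" using L by simp
  qed
  finally show ?thesis .
qed

lemma Rep_obj: "X \<in> Obj RepA \<longleftrightarrow> is_mod X"
proof -
  obtain M \<nu> where X: "X = (M, \<nu>)" by (cases X)
  show ?thesis
  proof (cases "M \<in> Obj C \<and> \<nu> \<in> mor C (A \<boxtimes> M) M")
    case True
    then have "hom (act X) (A \<boxtimes> M) M" using A_obj tensor_closed hom_ar unfolding X act_def by simp
    then show ?thesis
      using act_assoc_iff[of M \<nu>] act_unit_iff[of M \<nu>] True unfolding X Rep_def is_mod_def by simp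
  next
    case False
    then show ?thesis unfolding X Rep_def is_mod_def act_def by (auto simp: hom_ar)
  qed
qed

lemma Rep_Comp: "Comp RepA = Comp C"
  by (simp add: Rep_def)

lemma Rep_Idm: "Idm RepA X = Idm C (fst X)"
  by (simp add: Rep_def split: prod.splits)

lemma Rep_Hom: "Hom RepA X Y = (Hom C (fst X) (fst Y))
    \<lparr>carrier := {f \<in> mor C (fst X) (fst Y). f \<cdot> snd X = snd Y \<cdot> (\<I> A \<boxdot> f)}\<rparr>"
  by (simp add: Rep_def split: prod.splits)

lemma Rep_mor:
  assumes X: "is_mod X" and Y: "is_mod Y"
  shows "f \<in> mor RepA X Y \<longleftrightarrow> equi X Y (ar (fst X) f (fst Y))"
proof (cases "f \<in> mor C (fst X) (fst Y)")
  case True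
  have o: "fst X \<in> Obj C" "fst Y \<in> Obj C" using is_modD X Y by auto
  have h: "hom (ar (fst X) f (fst Y)) (fst X) (fst Y)" using True o hom_ar by blast
  have t: "ide A \<star> ar (fst X) f (fst Y) = ar (A \<boxtimes> fst X) (\<I> A \<boxdot> f) (A \<boxtimes> fst Y)"
    using ten_ar[OF hom_ide[OF A_obj, unfolded ide_def] h] unfolding ide_def .
  have ht: "hom (ar (A \<boxtimes> fst X) (\<I> A \<boxdot> f) (A \<boxtimes> fst Y)) (A \<boxtimes> fst X) (A \<boxtimes> fst Y)"
    using hom_ten[OF hom_ide[OF A_obj] h] t by simp
  note hX = is_modD(1)[OF X, unfolded act_def] and hY = is_modD(1)[OF Y, unfolded act_def]
  have "f \<cdot> snd X = snd Y \<cdot> (\<I> A \<boxdot> f) \<longleftrightarrow> ar (fst X) f (fst Y) \<bullet> act X = act Y \<bullet> (ide A \<star> ar (fst X) f (fst Y))"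
    unfolding act_def t using cmp_ar[OF hX h] cmp_ar[OF ht hY] ar_inject hom_cmp[OF hX h] by metis
  then show ?thesis unfolding equi_def Rep_Hom using True h by simp
next
  case False
  then show ?thesis unfolding equi_def Rep_Hom by (auto simp: hom_ar)
qed

lemma equi_ide: "is_mod X \<Longrightarrow> equi X X (ide (fst X))"
  using is_modD[of X] ten_ide[OF A_obj] ide_left ide_right A_obj by (auto simp: equi_def)

lemma equi_cmp: assumes "equi X Y f" "equi Y Z g" shows "equi X Z (g \<bullet> f)"
proof -
  have h: "hom f (fst X) (fst Y)" "hom g (fst Y) (fst Z)" using assms equi_def by auto
  have "(g \<bullet> f) \<bullet> act X = g \<bullet> (act Y \<bullet> (ide A \<star> f))" using assms equi_def by (simp add: cmp_assoc)
  also have "\<dots> = act Z \<bullet> ((ide A \<star> g) \<bullet> (ide A \<star> f))"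
    using assms(2) cmp_rewrite2 unfolding equi_def by blast
  also have "\<dots> = act Z \<bullet> (ide A \<star> (g \<bullet> f))" using ide_ten_cmp[OF A_obj h] by simp
  finally show ?thesis using h unfolding equi_def by blast
qed

lemma Rep_category: "category RepA"
proof (rule category.intro)
  fix X assume "X \<in> Obj RepA"
  then have X: "is_mod X" using Rep_obj by blast
  have "Idm RepA X \<in> mor RepA X X"
    unfolding Rep_Idm Rep_mor[OF X X] using equi_ide[OF X] unfolding ide_def .
  then show "Idm RepA X \<in> mor RepA X X" .
next
  fix X Y Z f g assume a: "X \<in> Obj RepA" "Y \<in> Obj RepA" "Z \<in> Obj RepA" "f \<in> mor RepA X Y" "g \<in> mor RepA Y Z"
  then have m: "is_mod X" "is_mod Y" "is_mod Z" using Rep_obj by auto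
  have e: "equi X Y (ar (fst X) f (fst Y))" "equi Y Z (ar (fst Y) g (fst Z))" using a m Rep_mor by auto
  then have "ar (fst Y) g (fst Z) \<bullet> ar (fst X) f (fst Y) = ar (fst X) (g \<cdot> f) (fst Z)"
    using cmp_ar unfolding equi_def by blast
  then show "Comp RepA g f \<in> mor RepA X Z" using equi_cmp[OF e] Rep_mor[OF m(1,3)] unfolding Rep_Comp by simp
next
  fix W X Y Z f g h assume a: "W \<in> Obj RepA" "X \<in> Obj RepA" "Y \<in> Obj RepA" "Z \<in> Obj RepA"
    "f \<in> mor RepA W X" "g \<in> mor RepA X Y" "h \<in> mor RepA Y Z"
  then have "fst W \<in> Obj C" "fst X \<in> Obj C" "fst Y \<in> Obj C" "fst Z \<in> Obj C" using Rep_obj is_modD by auto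
  then show "Comp RepA (Comp RepA h g) f = Comp RepA h (Comp RepA g f)"
    using a comp_assoc unfolding Rep_Comp Rep_Hom by auto
next
  fix X Y f assume a: "X \<in> Obj RepA" "Y \<in> Obj RepA" "f \<in> mor RepA X Y"
  then have o: "fst X \<in> Obj C" "fst Y \<in> Obj C" using Rep_obj is_modD by auto
  show "Comp RepA (Idm RepA Y) f = f" "Comp RepA f (Idm RepA X) = f"
    using a o id_left id_right unfolding Rep_Comp Rep_Idm Rep_Hom by auto
qed

lemma Rep_hom_space:
  assumes X: "is_mod X" and Y: "is_mod Y" shows "vectorspace K (Hom RepA X Y)"
proof -
  have o: "fst X \<in> Obj C" "fst Y \<in> Obj C" "A \<boxtimes> fst X \<in> Obj C" "A \<boxtimes> fst Y \<in> Obj C"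
    using is_modD X Y A_obj tensor_closed by auto
  interpret V: vectorspace K "Hom C (fst X) (fst Y)" using hom_space o by blast
  have s: "snd X \<in> mor C (A \<boxtimes> fst X) (fst X)" "snd Y \<in> mor C (A \<boxtimes> fst Y) (fst Y)"
    using is_modD(1)[OF X] is_modD(1)[OF Y] unfolding act_def hom_ar by auto
  have T: "mod_hom K (Hom C (fst X) (fst Y)) (Hom C (A \<boxtimes> fst X) (fst Y)) (\<lambda>f. f \<cdot> snd X)"
    using comp_linear_left[OF o(3,1,2) s(1)] by (simp add: linear_map_def)
  have "\<I> A \<in> mor C A A" using id_closed A_obj by blast
  then have S1: "mod_hom K (Hom C (fst X) (fst Y)) (Hom C (A \<boxtimes> fst X) (A \<boxtimes> fst Y)) (\<lambda>f. \<I> A \<boxdot> f)"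
    using tensor_linear_right[OF A_obj A_obj o(1,2)] by (simp add: linear_map_def)
  have S2: "mod_hom K (Hom C (A \<boxtimes> fst X) (A \<boxtimes> fst Y)) (Hom C (A \<boxtimes> fst X) (fst Y)) (\<lambda>f. snd Y \<cdot> f)"
    using comp_linear_right[OF o(3,4,2) s(2)] by (simp add: linear_map_def)
  have "submodule K {f \<in> mor C (fst X) (fst Y). f \<cdot> snd X = snd Y \<cdot> (\<I> A \<boxdot> f)} (Hom C (fst X) (fst Y))"
    using submodule_equalizer[OF T mod_hom_comp[OF S1 S2]] .
  then have "subspace K {f \<in> mor C (fst X) (fst Y). f \<cdot> snd X = snd Y \<cdot> (\<I> A \<boxdot> f)} (Hom C (fst X) (fst Y))"
    using V.vectorspace_axioms by (simp add: subspace_def)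
  then show ?thesis unfolding Rep_Hom by (rule V.subspace_is_vs)
qed

lemma linear_map_restrict:
  assumes l: "linear_map K V W T" and V: "vectorspace K (V\<lparr>carrier := V'\<rparr>)" and W: "vectorspace K (W\<lparr>carrier := W'\<rparr>)"
    and sub: "V' \<subseteq> carrier V" and T: "\<And>x. x \<in> V' \<Longrightarrow> T x \<in> W'"
  shows "linear_map K (V\<lparr>carrier := V'\<rparr>) (W\<lparr>carrier := W'\<rparr>) T"
proof -
  have "T \<in> module_hom K V W" using l by (simp add: linear_map_def mod_hom_def mod_hom_axioms_def)
  then have "T \<in> module_hom K (V\<lparr>carrier := V'\<rparr>) (W\<lparr>carrier := W'\<rparr>)"
    using sub T unfolding module_hom_def by (auto simp: subset_iff)
  then show ?thesis
    using V W by (simp add: linear_map_def mod_hom_def mod_hom_axioms_def vectorspace_def)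
qed

lemma Rep_linear_category: "linear_category K RepA"
proof (intro linear_category.intro linear_category_axioms.intro)
  show "category RepA" by (rule Rep_category)
  show "field K" using K.field_axioms .
  show "vectorspace K (Hom RepA X Y)" if "X \<in> Obj RepA" "Y \<in> Obj RepA" for X Y
    using that Rep_hom_space Rep_obj by blast
next
  fix X Y Z g assume a: "X \<in> Obj RepA" "Y \<in> Obj RepA" "Z \<in> Obj RepA" "g \<in> mor RepA Y Z"
  then have m: "is_mod X" "is_mod Y" "is_mod Z" using Rep_obj by auto
  have o: "fst X \<in> Obj C" "fst Y \<in> Obj C" "fst Z \<in> Obj C" using m is_modD by auto
  have g: "g \<in> mor C (fst Y) (fst Z)" using a(4) unfolding Rep_Hom by simp
  have cl: "\<And>f. f \<in> mor RepA X Y \<Longrightarrow> g \<cdot> f \<in> mor RepA X Z"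
    using category.comp_closed[OF Rep_category a(1-3) _ a(4)] unfolding Rep_Comp .
  show "linear_map K (Hom RepA X Y) (Hom RepA X Z) (\<lambda>f. Comp RepA g f)"
    unfolding Rep_Comp Rep_Hom
    by (rule linear_map_restrict[OF comp_linear_right[OF o g] Rep_hom_space[OF m(1,2), unfolded Rep_Hom]
        Rep_hom_space[OF m(1,3), unfolded Rep_Hom]]) (use cl[unfolded Rep_Hom] in auto)
next
  fix X Y Z f assume a: "X \<in> Obj RepA" "Y \<in> Obj RepA" "Z \<in> Obj RepA" "f \<in> mor RepA X Y"
  then have m: "is_mod X" "is_mod Y" "is_mod Z" using Rep_obj by auto
  have o: "fst X \<in> Obj C" "fst Y \<in> Obj C" "fst Z \<in> Obj C" using m is_modD by auto
  have f: "f \<in> mor C (fst X) (fst Y)" using a(4) unfolding Rep_Hom by simp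
  have cl: "\<And>g. g \<in> mor RepA Y Z \<Longrightarrow> g \<cdot> f \<in> mor RepA X Z"
    using category.comp_closed[OF Rep_category a(1-3) a(4)] unfolding Rep_Comp .
  show "linear_map K (Hom RepA Y Z) (Hom RepA X Z) (\<lambda>g. Comp RepA g f)"
    unfolding Rep_Comp Rep_Hom
    by (rule linear_map_restrict[OF comp_linear_left[OF o f] Rep_hom_space[OF m(2,3), unfolded Rep_Hom]
        Rep_hom_space[OF m(1,3), unfolded Rep_Hom]]) (use cl[unfolded Rep_Hom] in auto)
qed

end

sublocale comm_algebra \<subseteq> R: linear_category K "Rep C A \<mu> \<iota>"
  by (rule Rep_linear_category)

context comm_algebra
begin

no_notation R.cmp (infixr \<open>\<bullet>\<close> 75)

section \<open>Forgetting the action: module arrows compared with arrows of \<open>C\<close>\<close>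

definition und :: "('o \<times> 'm, 'm) arrow \<Rightarrow> ('o, 'm) arrow"
  where "und a = map_option (\<lambda>(X, f, Y). (fst X, f, fst Y)) a"

lemma R_homD:
  assumes "R.hom a X Y" shows "is_mod X" "is_mod Y" "equi X Y (und a)" "hom (und a) (fst X) (fst Y)"
proof -
  obtain f where f: "a = Some (X, f, Y)" "X \<in> Obj RepA" "Y \<in> Obj RepA" "f \<in> mor RepA X Y"
    using assms R.hom_def by blast
  then show m: "is_mod X" "is_mod Y" using Rep_obj by auto
  have e: "equi X Y (ar (fst X) f (fst Y))" using f m Rep_mor by blast
  moreover have "und a = ar (fst X) f (fst Y)"
  proof -
    have "hom (ar (fst X) f (fst Y)) (fst X) (fst Y)" using e equi_def by blast
    then show ?thesis using f(1) unfolding hom_ar by (simp add: und_def ar_def)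
  qed
  ultimately show "equi X Y (und a)" "hom (und a) (fst X) (fst Y)" unfolding equi_def by auto
qed

lemma und_ar: "R.hom (R.ar X f Y) X Y \<Longrightarrow> und (R.ar X f Y) = ar (fst X) f (fst Y)"
proof -
  assume h: "R.hom (R.ar X f Y) X Y"
  then have "hom (und (R.ar X f Y)) (fst X) (fst Y)" using R_homD by blast
  moreover have "R.ar X f Y = Some (X, f, Y)" using h unfolding R.hom_ar by (simp add: R.ar_def)
  ultimately show ?thesis unfolding und_def hom_def ar_def by auto
qed

lemma und_inject: "R.hom a X Y \<Longrightarrow> R.hom b X Y \<Longrightarrow> und a = und b \<Longrightarrow> a = b"
  by (auto simp: R.hom_def und_def)

lemma und_lift:
  assumes "is_mod X" "is_mod Y" "equi X Y f"
  obtains a where "R.hom a X Y" "und a = f"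
proof -
  obtain g where g: "f = ar (fst X) g (fst Y)" using assms(3) hom_arE unfolding equi_def by blast
  then have "g \<in> mor RepA X Y" using Rep_mor assms by blast
  then have h: "R.hom (R.ar X g Y) X Y" using assms Rep_obj R.hom_ar by blast
  then show ?thesis using that und_ar g by blast
qed

lemma und_cmp: assumes "R.hom a X Y" "R.hom b Y Z" shows "und (R.cmp b a) = und b \<bullet> und a"
proof -
  obtain f g where e: "a = R.ar X f Y" "b = R.ar Y g Z" using assms R.hom_arE by metis
  have "R.cmp b a = R.ar X (g \<cdot> f) Z" using R.cmp_ar assms e unfolding Rep_Comp by metis
  then have "und (R.cmp b a) = ar (fst X) (g \<cdot> f) (fst Z)" using und_ar R.hom_cmp[OF assms] by simp
  also have "\<dots> = und b \<bullet> und a"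
    using cmp_ar R_homD(4)[OF assms(1)] R_homD(4)[OF assms(2)] und_ar assms unfolding e by metis
  finally show ?thesis .
qed

lemma und_ide: "is_mod X \<Longrightarrow> und (R.ide X) = ide (fst X)"
  using und_ar R.hom_ide[of X] Rep_obj unfolding R.ide_def ide_def Rep_Idm by blast

lemma R_zro_iff: assumes "R.hom a X Y" shows "R.zro a \<longleftrightarrow> zro (und a)"
proof -
  have o: "X \<in> Obj RepA" "Y \<in> Obj RepA" using assms R.hom_objs by auto
  have z: "und (R.zer X Y) = zer (fst X) (fst Y)"
    using und_ar R.hom_zer[OF o] unfolding R.zer_def zer_def Rep_Hom by simp
  show ?thesis
    using R.zro_hom[OF _ assms] R.zroI[OF assms] zro_hom[OF _ R_homD(4)[OF assms]] zroI[OF R_homD(4)[OF assms]]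
      und_inject[OF assms R.hom_zer[OF o]] z by metis
qed

lemma R_zob_iff: "is_mod X \<Longrightarrow> R.zob X \<longleftrightarrow> zob (fst X)"
  using R.zob_iff R_zro_iff[OF R.hom_ide] und_ide zob_iff is_modD(2) Rep_obj by metis

lemma equi_inverse:
  assumes "equi X Y f" "is_mod X" "hom g (fst Y) (fst X)" "g \<bullet> f = ide (fst X)" "f \<bullet> g = ide (fst Y)"
    "is_mod Y"
  shows "equi Y X g"
proof -
  have f: "hom f (fst X) (fst Y)" "f \<bullet> act X = act Y \<bullet> (ide A \<star> f)" using assms equi_def by auto
  have o: "fst X \<in> Obj C" "fst Y \<in> Obj C" using f hom_objs by auto
  have Ag: "hom (ide A \<star> g) (A \<boxtimes> fst Y) (A \<boxtimes> fst X)" using assms A_obj by blast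
  have "(ide A \<star> f) \<bullet> (ide A \<star> g) = ide (A \<boxtimes> fst Y)"
    using ide_ten_cmp[OF A_obj assms(3) f(1)] assms(5) ten_ide[OF A_obj o(2)] by simp
  then have "act Y = (act Y \<bullet> (ide A \<star> f)) \<bullet> (ide A \<star> g)"
    using ide_right is_modD(1)[OF assms(6)] by (simp add: cmp_assoc)
  then have "act Y = f \<bullet> (act X \<bullet> (ide A \<star> g))" using f by (metis cmp_assoc)
  then have "g \<bullet> act Y = act X \<bullet> (ide A \<star> g)"
    using cmp_rewrite[OF assms(4)] ide_left hom_cmp[OF Ag is_modD(1)[OF assms(2)]] by metis
  then show ?thesis using assms(3) equi_def by blast
qed

lemma R_isom_iff: assumes a: "R.hom a X Y" shows "R.isom a X Y \<longleftrightarrow> isom (und a) (fst X) (fst Y)"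
proof
  assume "R.isom a X Y"
  then obtain b where b: "R.hom b Y X" "R.cmp b a = R.ide X" "R.cmp a b = R.ide Y" using R.isomE by metis
  show "isom (und a) (fst X) (fst Y)"
    by (rule isomI[OF R_homD(4)[OF a] R_homD(4)[OF b(1)]])
      (use und_cmp[OF a b(1)] und_cmp[OF b(1) a] b und_ide R_homD[OF a] in auto)
next
  assume "isom (und a) (fst X) (fst Y)"
  then obtain g where g: "hom g (fst Y) (fst X)" "g \<bullet> und a = ide (fst X)" "und a \<bullet> g = ide (fst Y)" using isomE by metis
  have m: "is_mod X" "is_mod Y" "equi X Y (und a)" using R_homD a by auto
  obtain b where b: "R.hom b Y X" "und b = g" using und_lift[OF m(2,1) equi_inverse[OF m(3,1) g m(2)]] .
  have o: "X \<in> Obj RepA" "Y \<in> Obj RepA" using m Rep_obj by auto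
  have "R.cmp b a = R.ide X"
    by (rule und_inject[OF R.hom_cmp[OF a b(1)] R.hom_ide[OF o(1)]]) (use und_cmp[OF a b(1)] b g und_ide m in simp)
  moreover have "R.cmp a b = R.ide Y"
    by (rule und_inject[OF R.hom_cmp[OF b(1) a] R.hom_ide[OF o(2)]]) (use und_cmp[OF b(1) a] b g und_ide m in simp)
  ultimately show "R.isom a X Y" using R.isomI a b by blast
qed

lemma R_monicI: assumes a: "R.hom a X Y" and m: "monic (und a)" shows "R.monic a"
proof (rule R.monicI[OF a])
  fix W w assume w: "R.hom w W X" "R.zro (R.cmp a w)"
  then have "zro (und a \<bullet> und w)" using R_zro_iff[OF R.hom_cmp[OF w(1) a]] und_cmp[OF w(1) a] by simp
  then show "R.zro w" using monic_zro[OF m] R_zro_iff w by blast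
qed

lemma R_epicI: assumes a: "R.hom a X Y" and m: "epic (und a)" shows "R.epic a"
proof (rule R.epicI[OF a])
  fix W w assume w: "R.hom w Y W" "R.zro (R.cmp w a)"
  then have "zro (und w \<bullet> und a)" using R_zro_iff[OF R.hom_cmp[OF a w(1)]] und_cmp[OF a w(1)] by simp
  then show "R.zro w" using epic_zro[OF m] R_zro_iff w by blast
qed

text \<open>The factorisation found in \<open>C\<close> is automatically a module homomorphism: both
  sides of its equation agree after composition with the monic \<open>und k\<close>.\<close>

lemma R_kernI:
  assumes f: "R.hom f X Y" and k: "R.hom k N X" and kern: "kern (und f) (und k)"
  shows "R.kern f k"
  unfolding R.kern_def
proof (intro conjI allI impI)
  have m: "monic (und k)" "zro (und f \<bullet> und k)" using kern kern_def by auto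
  show "R.monic k" using R_monicI[OF k m(1)] .
  show "R.zro (R.cmp f k)" using R_zro_iff[OF R.hom_cmp[OF k f]] und_cmp[OF k f] m by simp
  fix w assume w: "R.zro (R.cmp f w)"
  obtain W where W: "R.hom w W X" using R.zro_cmp_dom[OF w f] .
  have "zro (und f \<bullet> und w)" using w R_zro_iff[OF R.hom_cmp[OF W f]] und_cmp[OF W f] by simp
  then obtain u where u: "und w = und k \<bullet> u" using kern kern_def by blast
  note hk = R_homD[OF k] and hw = R_homD[OF W]
  have uh: "hom u (fst W) (fst N)" using u hw(4) hk(4) hom_cmpE hom_unique by metis
  have Au: "hom (ide A \<star> u) (A \<boxtimes> fst W) (A \<boxtimes> fst N)" using uh A_obj by blast
  have "und k \<bullet> (u \<bullet> act W) = act X \<bullet> (ide A \<star> und w)"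
    using hw(3) u unfolding equi_def by (simp flip: cmp_assoc)
  also have "\<dots> = (act X \<bullet> (ide A \<star> und k)) \<bullet> (ide A \<star> u)"
    using ide_ten_cmp[OF A_obj uh hk(4)] u by (simp add: cmp_assoc)
  also have "\<dots> = und k \<bullet> (act N \<bullet> (ide A \<star> u))" using hk(3) unfolding equi_def by (simp flip: cmp_assoc)
  finally have "u \<bullet> act W = act N \<bullet> (ide A \<star> u)"
    using monicD[OF m(1) hk(4) hom_cmp[OF is_modD(1)[OF hw(1)] uh]] by blast
  then have "equi W N u" using uh equi_def by blast
  then obtain v where v: "R.hom v W N" "und v = u" using und_lift hw hk by blast
  have "w = R.cmp k v"
    by (rule und_inject[OF W R.hom_cmp[OF v(1) k]]) (use und_cmp[OF v(1) k] u v in simp)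
  then show "\<exists>u. w = R.cmp k u" by blast
qed

text \<open>The action restricts to the kernel because \<open>und f\<close> kills
  \<open>act X \<bullet> (ide A \<star> k)\<close>. The module laws for the restricted action hold
  after composition with the monic \<open>k\<close>, hence hold.\<close>

lemma kernel_module:
  assumes f: "R.hom f X Y" and k: "hom k N (fst X)" "kern (und f) k"
  obtains a Z where "R.hom a Z X" "und a = k" "fst Z = N"
proof -
  note hf = R_homD[OF f]
  have X: "hom (act X) (A \<boxtimes> fst X) (fst X)" "fst X \<in> Obj C" using is_modD hf by auto
  have N: "N \<in> Obj C" "monic k" "zro (und f \<bullet> k)" using k hom_objs unfolding kern_def by auto
  have AN: "A \<boxtimes> N \<in> Obj C" using N A_obj tensor_closed by blast
  have Ak: "hom (ide A \<star> k) (A \<boxtimes> N) (A \<boxtimes> fst X)" using k A_obj by blast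
  have "und f \<bullet> (act X \<bullet> (ide A \<star> k)) = act Y \<bullet> (ide A \<star> (und f \<bullet> k))"
    using hf(3) ide_ten_cmp[OF A_obj k(1) hf(4)] cmp_rewrite2 unfolding equi_def by metis
  moreover have "zro (act Y \<bullet> (ide A \<star> (und f \<bullet> k)))"
    using zro_cmp_hom[OF hom_ten[OF hom_ide[OF A_obj] hom_cmp[OF k(1) hf(4)]] is_modD(1)[OF hf(2)]]
      ten_zro_right[OF hom_ide[OF A_obj] hom_cmp[OF k(1) hf(4)] N(3)] by blast
  ultimately obtain n where n: "act X \<bullet> (ide A \<star> k) = k \<bullet> n" using k(2) kern_def by metis
  have nh: "hom n (A \<boxtimes> N) N" using n hom_cmp[OF Ak X(1)] k(1) hom_cmpE hom_unique by metis
  obtain \<nu> where \<nu>: "n = ar (A \<boxtimes> N) \<nu> N" using nh hom_arE by blast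
  have actN: "act (N, \<nu>) = n" using \<nu> unfolding act_def by simp
  have i: "hom (ide A) A A" "hom (ide N) N N" "hom (ide (fst X)) (fst X) (fst X)" using A_obj N X by auto
  have h1: "hom ((mu \<star> ide N) \<bullet> asc A A N) (A \<boxtimes> (A \<boxtimes> N)) (A \<boxtimes> N)"
    using hom_cmp[OF asc_hom[OF A_obj A_obj N(1)] hom_ten[OF mu_hom i(2)]] .
  have h2: "hom (ide A \<star> n) (A \<boxtimes> (A \<boxtimes> N)) (A \<boxtimes> N)" using nh i by blast
  have e1: "(ide A \<star> k) \<bullet> (mu \<star> ide N) = (mu \<star> ide (fst X)) \<bullet> (ide (A \<boxtimes> A) \<star> k)"
    using ten_split1[OF mu_hom k(1)] ten_split2[OF mu_hom k(1)] by simp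
  have e2: "(ide (A \<boxtimes> A) \<star> k) \<bullet> asc A A N = asc A A (fst X) \<bullet> (ide A \<star> (ide A \<star> k))"
    using asc_natural[OF i(1,1) k(1)] ten_ide[OF A_obj A_obj] by simp
  have "k \<bullet> (n \<bullet> ((mu \<star> ide N) \<bullet> asc A A N)) = act X \<bullet> ((ide A \<star> k) \<bullet> ((mu \<star> ide N) \<bullet> asc A A N))"
    using cmp_rewrite2[OF n[symmetric]] by simp
  also have "\<dots> = act X \<bullet> ((mu \<star> ide (fst X)) \<bullet> (asc A A (fst X) \<bullet> (ide A \<star> (ide A \<star> k))))"
    using cmp_rewrite2[OF e1] e2 by simp
  also have "\<dots> = act X \<bullet> ((ide A \<star> act X) \<bullet> (ide A \<star> (ide A \<star> k)))"
    using cmp_rewrite2[of "act X" "(mu \<star> ide (fst X)) \<bullet> asc A A (fst X)" "act X" "ide A \<star> act X"] is_modD(3)[OF hf(1)]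
    by (simp add: cmp_assoc)
  also have "\<dots> = act X \<bullet> (ide A \<star> (k \<bullet> n))" using ide_ten_cmp[OF A_obj Ak X(1)] n by simp
  also have "\<dots> = k \<bullet> (n \<bullet> (ide A \<star> n))" using ide_ten_cmp[OF A_obj nh k(1)] cmp_rewrite2[OF n] by simp
  finally have assoc: "n \<bullet> ((mu \<star> ide N) \<bullet> asc A A N) = n \<bullet> (ide A \<star> n)"
    using monicD[OF N(2) k(1) hom_cmp[OF h1 nh]] by blast
  have h3: "hom (io \<star> ide N) (\<U> \<boxtimes> N) (A \<boxtimes> N)" using io_hom i by blast
  have e3: "(ide A \<star> k) \<bullet> (io \<star> ide N) = (io \<star> ide (fst X)) \<bullet> (ide \<U> \<star> k)"
    using ten_split1[OF io_hom k(1)] ten_split2[OF io_hom k(1)] by simp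
  have "k \<bullet> (n \<bullet> (io \<star> ide N)) = act X \<bullet> ((io \<star> ide (fst X)) \<bullet> (ide \<U> \<star> k))"
    using cmp_rewrite2[OF n[symmetric]] e3 by simp
  also have "\<dots> = lun (fst X) \<bullet> (ide \<U> \<star> k)" using cmp_rewrite[OF is_modD(4)[OF hf(1)]] by simp
  also have "\<dots> = k \<bullet> lun N" using lun_natural[OF k(1)] .
  finally have unit: "n \<bullet> (io \<star> ide N) = lun N" using monicD[OF N(2) k(1) hom_cmp[OF h3 nh]] by blast
  have "is_mod (N, \<nu>)" unfolding is_mod_def actN using nh assoc unit by simp
  moreover have "equi (N, \<nu>) X k" unfolding equi_def actN using k n by simp
  ultimately show ?thesis using that und_lift hf by (metis fst_conv)
qed

lemma R_ex_kern: assumes f: "R.hom f X Y" obtains a Z where "R.hom a Z X" "kern (und f) (und a)" "R.kern f a"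
proof -
  note hf = R_homD[OF f]
  obtain k where k: "kern (und f) k" using ex_kern hf by blast
  obtain N where N: "hom k N (fst X)" using kernD(2)[OF k hf(4)] by blast
  obtain a Z where a: "R.hom a Z X" "und a = k" using kernel_module[OF f N k] .
  then show ?thesis using that R_kernI[OF f a(1)] k by simp
qed

text \<open>The kernel taken in \<open>C\<close> is a module, so a monomorphism of modules kills it
  and it vanishes already in \<open>C\<close>.\<close>

lemma R_monic_iff: assumes f: "R.hom f X Y" shows "R.monic f \<longleftrightarrow> monic (und f)"
proof
  assume m: "R.monic f"
  obtain a Z where a: "R.hom a Z X" "kern (und f) (und a)" "R.kern f a" using R_ex_kern[OF f] .
  have "R.zro (R.cmp f a)" using a R.kern_def by blast
  then have "R.zro a" using R.monic_zro m by blast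
  then have "zro (und a)" using R_zro_iff a by blast
  then show "monic (und f)" using monic_of_zro_kern a R_homD(4)[OF f] by blast
qed (rule R_monicI[OF f])

end

lemma (in category) epic_cancel_isom:
  assumes "isom b Y Z" "hom a X Y" "epic (b \<bullet> a)" shows "epic a"
proof -
  obtain c where c: "isom c Z Y" "c \<bullet> b = ide Y" using isomE[OF assms(1)] by metis
  have "c \<bullet> (b \<bullet> a) = a" using cmp_rewrite[OF c(2)] ide_left[OF assms(2)] by simp
  then show ?thesis using epic_cmp[OF assms(3) isom_epic[OF c(1)]] assms(2) hom_not_None by metis
qed

text \<open>Dualising \<open>kernel_module\<close> requires \<open>ide A \<star> q\<close> to be a
  cokernel. Exactness of tensoring with \<open>A\<close> is therefore assumed here and proved later
  for simple current algebras.\<close>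

locale exact_algebra = comm_algebra +
  assumes A_kern: "hom f X Y \<Longrightarrow> kern f k \<Longrightarrow> kern (ide A \<star> f) (ide A \<star> k)"
    and A_coker: "hom f X Y \<Longrightarrow> coker f q \<Longrightarrow> coker (ide A \<star> f) (ide A \<star> q)"
begin

lemma A_epic: assumes "hom q X Y" "epic q" shows "epic (ide A \<star> q)"
proof -
  obtain k where k: "kern q k" using ex_kern assms by blast
  obtain N where "hom k N X" using kernD(2)[OF k assms(1)] by blast
  then show ?thesis using A_coker coker_of_kern[OF assms(2,1) k] coker_def by blast
qed

text \<open>The action descends because \<open>f\<close> respects it and
  \<open>ide A \<star> q\<close> is the cokernel of \<open>ide A \<star> und f\<close>.
  Associativity is checked after \<open>ide A \<star> (ide A \<star> q)\<close> and the unit law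
  after \<open>ide \<U> \<star> q\<close>, both of which are epic.\<close>

lemma cokernel_module:
  assumes f: "R.hom f X Y" and q: "hom q (fst Y) Q" "coker (und f) q"
  obtains a Z where "R.hom a Y Z" "und a = q" "fst Z = Q"
proof -
  note hf = R_homD[OF f]
  have Y: "hom (act Y) (A \<boxtimes> fst Y) (fst Y)" "fst Y \<in> Obj C" using is_modD hf by auto
  have Q: "Q \<in> Obj C" "epic q" "zro (q \<bullet> und f)" using q hom_objs unfolding coker_def by auto
  have Aq: "hom (ide A \<star> q) (A \<boxtimes> fst Y) (A \<boxtimes> Q)" using q A_obj by blast
  have Af: "hom (ide A \<star> und f) (A \<boxtimes> fst X) (A \<boxtimes> fst Y)" using hf A_obj by blast
  have ce: "coker (ide A \<star> und f) (ide A \<star> q)" using A_coker hf q by blast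
  then have Aqe: "epic (ide A \<star> q)" using coker_def by blast
  have "(q \<bullet> act Y) \<bullet> (ide A \<star> und f) = (q \<bullet> und f) \<bullet> act X"
    using hf(3) unfolding equi_def by (simp add: cmp_assoc)
  moreover have "zro ((q \<bullet> und f) \<bullet> act X)"
    using zro_cmp_hom[OF is_modD(1)[OF hf(1)] hom_cmp[OF hf(4) q(1)]] Q(3) by blast
  ultimately obtain n where n: "q \<bullet> act Y = n \<bullet> (ide A \<star> q)" using ce coker_def by metis
  have nh: "hom n (A \<boxtimes> Q) Q" using n hom_cmp[OF Y(1) q(1)] Aq hom_cmpE hom_unique by metis
  obtain \<nu> where \<nu>: "n = ar (A \<boxtimes> Q) \<nu> Q" using nh hom_arE by blast
  have actQ: "act (Q, \<nu>) = n" using \<nu> unfolding act_def by simp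
  have i: "hom (ide A) A A" "hom (ide Q) Q Q" "hom (ide (fst Y)) (fst Y) (fst Y)" using A_obj Q Y by auto
  have AAq: "hom (ide A \<star> (ide A \<star> q)) (A \<boxtimes> (A \<boxtimes> fst Y)) (A \<boxtimes> (A \<boxtimes> Q))" "epic (ide A \<star> (ide A \<star> q))"
    using i Aq A_epic[OF Aq Aqe] by auto
  have h1: "hom ((mu \<star> ide Q) \<bullet> asc A A Q) (A \<boxtimes> (A \<boxtimes> Q)) (A \<boxtimes> Q)"
    using hom_cmp[OF asc_hom[OF A_obj A_obj Q(1)] hom_ten[OF mu_hom i(2)]] .
  have e1: "(mu \<star> ide Q) \<bullet> (ide (A \<boxtimes> A) \<star> q) = (ide A \<star> q) \<bullet> (mu \<star> ide (fst Y))"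
    using ten_split1[OF mu_hom q(1)] ten_split2[OF mu_hom q(1)] by simp
  have e2: "asc A A Q \<bullet> (ide A \<star> (ide A \<star> q)) = (ide (A \<boxtimes> A) \<star> q) \<bullet> asc A A (fst Y)"
    using asc_natural[OF i(1,1) q(1)] ten_ide[OF A_obj A_obj] by simp
  have "(n \<bullet> ((mu \<star> ide Q) \<bullet> asc A A Q)) \<bullet> (ide A \<star> (ide A \<star> q))
      = n \<bullet> ((ide A \<star> q) \<bullet> ((mu \<star> ide (fst Y)) \<bullet> asc A A (fst Y)))"
    using cmp_rewrite2[OF e1] e2 by (simp add: cmp_assoc)
  also have "\<dots> = q \<bullet> (act Y \<bullet> (ide A \<star> act Y))"
    using cmp_rewrite2[OF n[symmetric]] is_modD(3)[OF hf(2)] by simp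
  also have "\<dots> = n \<bullet> (ide A \<star> (q \<bullet> act Y))"
    using cmp_rewrite2[OF n] ide_ten_cmp[OF A_obj Y(1) q(1)] by simp
  also have "\<dots> = (n \<bullet> (ide A \<star> n)) \<bullet> (ide A \<star> (ide A \<star> q))"
    using n ide_ten_cmp[OF A_obj Aq nh] by (simp add: cmp_assoc)
  finally have assoc: "n \<bullet> ((mu \<star> ide Q) \<bullet> asc A A Q) = n \<bullet> (ide A \<star> n)"
    using epicD[OF AAq(2,1) hom_cmp[OF h1 nh]] by blast
  have h3: "hom (io \<star> ide Q) (\<U> \<boxtimes> Q) (A \<boxtimes> Q)" using io_hom i by blast
  have e3: "(io \<star> ide Q) \<bullet> (ide \<U> \<star> q) = (ide A \<star> q) \<bullet> (io \<star> ide (fst Y))"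
    using ten_split1[OF io_hom q(1)] ten_split2[OF io_hom q(1)] by simp
  have Uq: "hom (ide \<U> \<star> q) (\<U> \<boxtimes> fst Y) (\<U> \<boxtimes> Q)" using q unit_closed by blast
  have "epic (q \<bullet> lun (fst Y))"
    using epic_cmp[OF isom_epic[OF lun_isom[OF Y(2)]] Q(2)] hom_cmp[OF lun_hom[OF Y(2)] q(1)] hom_not_None by blast
  then have Uqe: "epic (ide \<U> \<star> q)" using epic_cancel_isom[OF lun_isom[OF Q(1)] Uq] lun_natural[OF q(1)] by simp
  have "(n \<bullet> (io \<star> ide Q)) \<bullet> (ide \<U> \<star> q) = n \<bullet> ((ide A \<star> q) \<bullet> (io \<star> ide (fst Y)))"
    using e3 by (simp add: cmp_assoc)
  also have "\<dots> = q \<bullet> lun (fst Y)" using cmp_rewrite2[OF n[symmetric]] is_modD(4)[OF hf(2)] by simp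
  also have "\<dots> = lun Q \<bullet> (ide \<U> \<star> q)" using lun_natural[OF q(1)] by simp
  finally have unit: "n \<bullet> (io \<star> ide Q) = lun Q" using epicD[OF Uqe Uq hom_cmp[OF h3 nh]] by blast
  have "is_mod (Q, \<nu>)" unfolding is_mod_def actQ using nh assoc unit by simp
  moreover have "equi Y (Q, \<nu>) q" unfolding equi_def actQ using q n by simp
  ultimately show ?thesis using that und_lift hf by (metis fst_conv)
qed

lemma R_cokerI:
  assumes f: "R.hom f X Y" and q: "R.hom q Y Q" and coker: "coker (und f) (und q)"
  shows "R.coker f q"
  unfolding R.coker_def
proof (intro conjI allI impI)
  have m: "epic (und q)" "zro (und q \<bullet> und f)" using coker coker_def by auto
  show "R.epic q" using R_epicI[OF q m(1)] .
  show "R.zro (R.cmp q f)" using R_zro_iff[OF R.hom_cmp[OF f q]] und_cmp[OF f q] m by simp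
  fix w assume w: "R.zro (R.cmp w f)"
  obtain W where W: "R.hom w Y W" using R.zro_cmp_cod[OF w f] .
  have "zro (und w \<bullet> und f)" using w R_zro_iff[OF R.hom_cmp[OF f W]] und_cmp[OF f W] by simp
  then obtain u where u: "und w = u \<bullet> und q" using coker coker_def by blast
  note hq = R_homD[OF q] and hw = R_homD[OF W]
  have uh: "hom u (fst Q) (fst W)" using u hw(4) hq(4) hom_cmpE hom_unique by metis
  have Au: "hom (ide A \<star> u) (A \<boxtimes> fst Q) (A \<boxtimes> fst W)" "hom (ide A \<star> und q) (A \<boxtimes> fst Y) (A \<boxtimes> fst Q)"
    using uh hq A_obj by auto
  have "(u \<bullet> act Q) \<bullet> (ide A \<star> und q) = u \<bullet> (und q \<bullet> act Y)"
    using hq(3) unfolding equi_def by (simp add: cmp_assoc)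
  also have "\<dots> = und w \<bullet> act Y" using u by (simp add: cmp_assoc)
  also have "\<dots> = act W \<bullet> (ide A \<star> und w)" using hw(3) equi_def by blast
  also have "\<dots> = (act W \<bullet> (ide A \<star> u)) \<bullet> (ide A \<star> und q)"
    using ide_ten_cmp[OF A_obj hq(4) uh] u by (simp add: cmp_assoc)
  finally have "u \<bullet> act Q = act W \<bullet> (ide A \<star> u)"
    using epicD[OF A_epic[OF hq(4) m(1)] Au(2) hom_cmp[OF is_modD(1)[OF hq(2)] uh]] by blast
  then have "equi Q W u" using uh equi_def by blast
  then obtain v where v: "R.hom v Q W" "und v = u" using und_lift hw hq by blast
  have "w = R.cmp v q"
    by (rule und_inject[OF W R.hom_cmp[OF q v(1)]]) (use und_cmp[OF q v(1)] u v in simp)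
  then show "\<exists>u. w = R.cmp u q" by blast
qed

lemma R_ex_coker: assumes f: "R.hom f X Y" obtains a Z where "R.hom a Y Z" "coker (und f) (und a)" "R.coker f a"
proof -
  note hf = R_homD[OF f]
  obtain k where k: "coker (und f) k" using ex_coker hf by blast
  obtain N where N: "hom k (fst Y) N" using cokerD(2)[OF k hf(4)] by blast
  obtain a Z where a: "R.hom a Y Z" "und a = k" using cokernel_module[OF f N k] .
  then show ?thesis using that R_cokerI[OF f a(1)] k by simp
qed

lemma R_epic_iff: assumes f: "R.hom f X Y" shows "R.epic f \<longleftrightarrow> epic (und f)"
proof
  assume m: "R.epic f"
  obtain a Z where a: "R.hom a Y Z" "coker (und f) (und a)" "R.coker f a" using R_ex_coker[OF f] .
  have "R.zro (R.cmp a f)" using a R.coker_def by blast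
  then have "R.zro a" using R.epic_zro m by blast
  then have "zro (und a)" using R_zro_iff a by blast
  then show "epic (und f)" using epic_of_zro_coker a R_homD(4)[OF f] by blast
qed (rule R_epicI[OF f])

text \<open>Kernels and cokernels are computed in \<open>C\<close>, so normality of monomorphisms
  and epimorphisms is inherited from there.\<close>

lemma Rep_normal_category: "normal_category K RepA"
proof
  fix f X Y assume f: "R.hom f X Y"
  show "\<exists>k. R.kern f k" using R_ex_kern[OF f] by metis
  show "\<exists>q. R.coker f q" using R_ex_coker[OF f] by metis
  note hf = R_homD[OF f]
  show "\<exists>g. R.kern g f" if "R.monic f"
  proof -
    have m: "monic (und f)" using that R_monic_iff f by blast
    obtain a Z where a: "R.hom a Y Z" "coker (und f) (und a)" using R_ex_coker[OF f] .
    then show ?thesis using R_kernI[OF a(1) f] kern_of_coker[OF m hf(4)] by blast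
  qed
  show "\<exists>g. R.coker g f" if "R.epic f"
  proof -
    have m: "epic (und f)" using that R_epic_iff f by blast
    obtain a Z where a: "R.hom a Z X" "kern (und f) (und a)" using R_ex_kern[OF f] .
    then show ?thesis using R_cokerI[OF a(1) f] coker_of_kern[OF m hf(4)] by blast
  qed
qed

end

sublocale exact_algebra \<subseteq> R: normal_category K "Rep C A \<mu> \<iota>"
  by (rule Rep_normal_category)

section \<open>The induction functor\<close>

context comm_algebra
begin

abbreviation Ind :: "('o, 'm, 'o \<times> 'm, 'm) fnctr" where "Ind \<equiv> induction_functor C A \<mu>"

definition fre :: "'o \<Rightarrow> 'o \<times> 'm" where "fre M = omap Ind M"

lemma fst_fre [simp]: "fst (fre M) = A \<boxtimes> M"
  by (simp add: fre_def induction_functor_def)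

lemma act_fre: assumes M: "M \<in> Obj C" shows "act (fre M) = (mu \<star> ide M) \<bullet> asc A A M"
proof -
  have e1: "mu \<star> ide M = ar ((A \<boxtimes> A) \<boxtimes> M) (\<mu> \<boxdot> \<I> M) (A \<boxtimes> M)"
    unfolding mu_def ide_def using ten_ar[OF mu_hom[unfolded mu_def] hom_ide[OF M, unfolded ide_def]] .
  have h: "hom (ar ((A \<boxtimes> A) \<boxtimes> M) (\<mu> \<boxdot> \<I> M) (A \<boxtimes> M)) ((A \<boxtimes> A) \<boxtimes> M) (A \<boxtimes> M)"
    using hom_ten[OF mu_hom hom_ide[OF M]] e1 by simp
  show ?thesis
    unfolding e1 unfolding asc_def act_def fst_fre
    using cmp_ar[OF asc_hom[OF A_obj A_obj M, unfolded asc_def] h] by (simp add: fre_def induction_functor_def)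
qed

lemma act_A: "act (A, \<mu>) = mu"
  by (simp add: act_def mu_def)

lemma is_mod_A: "is_mod (A, \<mu>)"
proof -
  have m: "\<mu> \<in> mor C (A \<boxtimes> A) A" using mu_hom hom_ar mu_def by simp
  show ?thesis
    using act_assoc_iff[OF A_obj m] act_unit_iff[OF A_obj m] commutative_algebra mu_hom
    unfolding is_mod_def act_A is_commutative_algebra_def is_algebra_def by simp
qed

lemma mu_assoc: "mu \<bullet> ((mu \<star> ide A) \<bullet> asc A A A) = mu \<bullet> (ide A \<star> mu)"
  and mu_unit_left: "mu \<bullet> (io \<star> ide A) = lun A"
  using is_modD[OF is_mod_A] by (auto simp: act_A)

lemma mu_brd: "mu \<bullet> brd A A = mu"
proof -
  have "\<mu> \<cdot> Braid C A A = \<mu>" using commutative_algebra is_commutative_algebra_def by metis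
  then show ?thesis
    using cmp_ar[OF brd_hom[OF A_obj A_obj, unfolded brd_def] mu_hom[unfolded mu_def]] unfolding brd_def mu_def by simp
qed

text \<open>Only a left unit law is part of the definition of an algebra; commutativity and
  \<open>lun_brd_unit\<close> supply the other side.\<close>

lemma mu_unit_right: "mu \<bullet> (ide A \<star> io) = run A"
proof -
  have "mu \<bullet> (ide A \<star> io) = mu \<bullet> (brd A A \<bullet> (ide A \<star> io))" using mu_brd cmp_rewrite by metis
  also have "\<dots> = mu \<bullet> ((io \<star> ide A) \<bullet> brd A \<U>)" using brd_natural[OF hom_ide[OF A_obj] io_hom] by simp
  also have "\<dots> = lun A \<bullet> brd A \<U>" using cmp_rewrite[OF mu_unit_left] by simp
  also have "\<dots> = run A" using lun_brd_unit[OF A_obj] .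
  finally show ?thesis .
qed

text \<open>Associativity of the action is associativity of \<open>mu\<close> tensored with
  \<open>M\<close> and rebracketed by the pentagon; the unit law uses
  \<open>lun_ten\<close>.\<close>

lemma is_mod_fre: assumes M: "M \<in> Obj C" shows "is_mod (fre M)"
proof -
  have t: "A \<boxtimes> A \<in> Obj C" "A \<boxtimes> M \<in> Obj C" "A \<boxtimes> (A \<boxtimes> M) \<in> Obj C" using A_obj M tensor_closed by auto
  have i: "hom (ide A) A A" "hom (ide M) M M" using A_obj M by auto
  have muM: "hom (mu \<star> ide M) ((A \<boxtimes> A) \<boxtimes> M) (A \<boxtimes> M)" using mu_hom i by blast
  have h: "hom ((mu \<star> ide M) \<bullet> asc A A M) (A \<boxtimes> (A \<boxtimes> M)) (A \<boxtimes> M)"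
    using hom_cmp[OF asc_hom[OF A_obj A_obj M] muM] .
  have muA: "hom (mu \<star> ide A) ((A \<boxtimes> A) \<boxtimes> A) (A \<boxtimes> A)" "hom (ide A \<star> mu) (A \<boxtimes> (A \<boxtimes> A)) (A \<boxtimes> A)" using mu_hom i by auto
  have aA: "hom (asc A A A) (A \<boxtimes> (A \<boxtimes> A)) ((A \<boxtimes> A) \<boxtimes> A)" using A_obj by blast
  have n1: "asc A A M \<bullet> (mu \<star> ide (A \<boxtimes> M)) = ((mu \<star> ide A) \<star> ide M) \<bullet> asc (A \<boxtimes> A) A M"
    using asc_natural[OF mu_hom i] ten_ide[OF A_obj M] by simp
  have n2: "asc A A M \<bullet> (ide A \<star> (mu \<star> ide M)) = ((ide A \<star> mu) \<star> ide M) \<bullet> asc A (A \<boxtimes> A) M"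
    using asc_natural[OF i(1) mu_hom i(2)] .
  have m: "(mu \<star> ide M) \<bullet> (((mu \<star> ide A) \<star> ide M) \<bullet> (asc A A A \<star> ide M)) = (mu \<star> ide M) \<bullet> ((ide A \<star> mu) \<star> ide M)"
    using mu_assoc ten_ide_cmp[OF M aA muA(1)] ten_ide_cmp[OF M hom_cmp[OF aA muA(1)] mu_hom] ten_ide_cmp[OF M muA(2) mu_hom] by simp
  have "((mu \<star> ide M) \<bullet> asc A A M) \<bullet> ((mu \<star> ide (A \<boxtimes> M)) \<bullet> asc A A (A \<boxtimes> M))
      = (mu \<star> ide M) \<bullet> (((mu \<star> ide A) \<star> ide M) \<bullet> (asc (A \<boxtimes> A) A M \<bullet> asc A A (A \<boxtimes> M)))"
    using cmp_rewrite2[OF n1] by (simp add: cmp_assoc)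
  also have "\<dots> = (mu \<star> ide M) \<bullet> (((mu \<star> ide A) \<star> ide M) \<bullet> ((asc A A A \<star> ide M) \<bullet> (asc A (A \<boxtimes> A) M \<bullet> (ide A \<star> asc A A M))))"
    using pentagon_arrow[OF A_obj A_obj A_obj M] by simp
  also have "\<dots> = ((mu \<star> ide M) \<bullet> (((mu \<star> ide A) \<star> ide M) \<bullet> (asc A A A \<star> ide M))) \<bullet> (asc A (A \<boxtimes> A) M \<bullet> (ide A \<star> asc A A M))"
    by (simp add: cmp_assoc)
  also have "\<dots> = (mu \<star> ide M) \<bullet> (((ide A \<star> mu) \<star> ide M) \<bullet> (asc A (A \<boxtimes> A) M \<bullet> (ide A \<star> asc A A M)))"
    unfolding m by (simp add: cmp_assoc)
  also have "\<dots> = (mu \<star> ide M) \<bullet> (asc A A M \<bullet> ((ide A \<star> (mu \<star> ide M)) \<bullet> (ide A \<star> asc A A M)))"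
    using cmp_rewrite2[OF n2] by simp
  also have "\<dots> = ((mu \<star> ide M) \<bullet> asc A A M) \<bullet> (ide A \<star> ((mu \<star> ide M) \<bullet> asc A A M))"
    using ide_ten_cmp[OF A_obj asc_hom[OF A_obj A_obj M] muM] by (simp add: cmp_assoc)
  finally have assoc: "((mu \<star> ide M) \<bullet> asc A A M) \<bullet> ((mu \<star> ide (A \<boxtimes> M)) \<bullet> asc A A (A \<boxtimes> M))
      = ((mu \<star> ide M) \<bullet> asc A A M) \<bullet> (ide A \<star> ((mu \<star> ide M) \<bullet> asc A A M))" .
  have n3: "asc A A M \<bullet> (io \<star> ide (A \<boxtimes> M)) = ((io \<star> ide A) \<star> ide M) \<bullet> asc \<U> A M"
    using asc_natural[OF io_hom i] ten_ide[OF A_obj M] by simp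
  have m2: "(mu \<star> ide M) \<bullet> ((io \<star> ide A) \<star> ide M) = lun A \<star> ide M"
    using mu_unit_left ten_ide_cmp[OF M hom_ten[OF io_hom i(1)] mu_hom] by simp
  have "((mu \<star> ide M) \<bullet> asc A A M) \<bullet> (io \<star> ide (A \<boxtimes> M)) = (lun A \<star> ide M) \<bullet> asc \<U> A M"
    using n3 cmp_rewrite[OF m2] by (simp add: cmp_assoc)
  also have "\<dots> = lun (A \<boxtimes> M)" using lun_ten[OF A_obj M] .
  finally have unit: "((mu \<star> ide M) \<bullet> asc A A M) \<bullet> (io \<star> ide (A \<boxtimes> M)) = lun (A \<boxtimes> M)" .
  show ?thesis unfolding is_mod_def act_fre[OF M] fst_fre using h assoc unit by blast
qed

text \<open>Frobenius reciprocity: \<open>ext X x\<close> is the unique module homomorphism \<open>fre N \<rightarrow> X\<close> whose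
  composite with the unit \<open>un N : N \<rightarrow> A \<boxtimes> N\<close> is \<open>x\<close>.\<close>

definition ext :: "'o \<times> 'm \<Rightarrow> ('o, 'm) arrow \<Rightarrow> ('o, 'm) arrow"
  where "ext X x = act X \<bullet> (ide A \<star> x)"

definition un :: "'o \<Rightarrow> ('o, 'm) arrow"
  where "un N = (io \<star> ide N) \<bullet> inv_arrow (lun N)"

lemma un_hom [intro]: "N \<in> Obj C \<Longrightarrow> hom (un N) N (A \<boxtimes> N)"
  unfolding un_def using inv_arrow(2)[OF lun_isom] io_hom by blast

lemma ext_equi:
  assumes X: "is_mod X" and x: "hom x N (fst X)" shows "equi (fre N) X (ext X x)"
proof -
  have N: "N \<in> Obj C" using x hom_objs by blast
  note hX = is_modD[OF X]
  have i: "hom (ide A) A A" "hom (ide N) N N" "hom (ide (fst X)) (fst X) (fst X)" using A_obj N hX by auto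
  have Ax: "hom (ide A \<star> x) (A \<boxtimes> N) (A \<boxtimes> fst X)" using x i by blast
  have e1: "(ide A \<star> x) \<bullet> (mu \<star> ide N) = (mu \<star> ide (fst X)) \<bullet> (ide (A \<boxtimes> A) \<star> x)"
    using ten_split1[OF mu_hom x] ten_split2[OF mu_hom x] by simp
  have e2: "(ide (A \<boxtimes> A) \<star> x) \<bullet> asc A A N = asc A A (fst X) \<bullet> (ide A \<star> (ide A \<star> x))"
    using asc_natural[OF i(1,1) x] ten_ide[OF A_obj A_obj] by simp
  have "ext X x \<bullet> act (fre N) = act X \<bullet> ((mu \<star> ide (fst X)) \<bullet> (asc A A (fst X) \<bullet> (ide A \<star> (ide A \<star> x))))"
    unfolding ext_def act_fre[OF N] using cmp_rewrite2[OF e1] e2 by (simp add: cmp_assoc)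
  also have "\<dots> = (act X \<bullet> ((mu \<star> ide (fst X)) \<bullet> asc A A (fst X))) \<bullet> (ide A \<star> (ide A \<star> x))"
    by (simp add: cmp_assoc)
  also have "\<dots> = act X \<bullet> (ide A \<star> ext X x)"
    unfolding ext_def using hX(3) ide_ten_cmp[OF A_obj Ax hX(1)] by (simp add: cmp_assoc)
  finally show ?thesis
    unfolding equi_def using hom_cmp[OF Ax hX(1)] unfolding ext_def by simp
qed

lemma ext_un:
  assumes X: "is_mod X" and x: "hom x N (fst X)" shows "ext X x \<bullet> un N = x"
proof -
  have N: "N \<in> Obj C" using x hom_objs by blast
  note hX = is_modD[OF X]
  have e: "(ide A \<star> x) \<bullet> (io \<star> ide N) = (io \<star> ide (fst X)) \<bullet> (ide \<U> \<star> x)"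
    using ten_split1[OF io_hom x] ten_split2[OF io_hom x] by simp
  have "ext X x \<bullet> un N = act X \<bullet> ((io \<star> ide (fst X)) \<bullet> ((ide \<U> \<star> x) \<bullet> inv_arrow (lun N)))"
    unfolding ext_def un_def using cmp_rewrite2[OF e] by (simp add: cmp_assoc)
  also have "\<dots> = lun (fst X) \<bullet> ((ide \<U> \<star> x) \<bullet> inv_arrow (lun N))" using cmp_rewrite[OF hX(4)] by simp
  also have "\<dots> = x \<bullet> (lun N \<bullet> inv_arrow (lun N))" using cmp_rewrite2[OF lun_natural[OF x]] by simp
  also have "\<dots> = x" using inv_arrow(4)[OF lun_isom[OF N]] ide_right[OF x] by simp
  finally show ?thesis .
qed

text \<open>The triangle identity of the adjunction, and the place where the right unit law of
  \<open>mu\<close> enters. It gives the uniqueness half of Frobenius reciprocity.\<close>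

lemma act_fre_un:
  assumes N: "N \<in> Obj C" shows "act (fre N) \<bullet> (ide A \<star> un N) = ide (A \<boxtimes> N)"
proof -
  note L = inv_arrow[OF lun_isom[OF N]]
  have i: "hom (ide A) A A" "hom (ide N) N N" using A_obj N by auto
  have io: "hom (io \<star> ide N) (\<U> \<boxtimes> N) (A \<boxtimes> N)" using io_hom i by blast
  have e: "asc A A N \<bullet> (ide A \<star> (io \<star> ide N)) = ((ide A \<star> io) \<star> ide N) \<bullet> asc A \<U> N"
    using asc_natural[OF i(1) io_hom i(2)] .
  have m: "(mu \<star> ide N) \<bullet> ((ide A \<star> io) \<star> ide N) = run A \<star> ide N"
    using mu_unit_right ten_ide_cmp[OF N hom_ten[OF i(1) io_hom] mu_hom] by simp
  have "act (fre N) \<bullet> (ide A \<star> un N) = (mu \<star> ide N) \<bullet> (asc A A N \<bullet> ((ide A \<star> (io \<star> ide N)) \<bullet> (ide A \<star> inv_arrow (lun N))))"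
    unfolding act_fre[OF N] un_def using ide_ten_cmp[OF A_obj L(2) io] by (simp add: cmp_assoc)
  also have "\<dots> = (run A \<star> ide N) \<bullet> (asc A \<U> N \<bullet> (ide A \<star> inv_arrow (lun N)))"
    using cmp_rewrite2[OF e] cmp_rewrite[OF m] by simp
  also have "\<dots> = (ide A \<star> lun N) \<bullet> (ide A \<star> inv_arrow (lun N))"
    using cmp_rewrite[OF triangle_arrow[OF A_obj N]] by simp
  also have "\<dots> = ide A \<star> ide N" using ide_ten_cmp[OF A_obj L(2) lun_hom[OF N]] L(4) by simp
  also have "\<dots> = ide (A \<boxtimes> N)" using ten_ide[OF A_obj N] .
  finally show ?thesis .
qed

lemma equi_fre_eq_ext:
  assumes X: "is_mod X" and N: "N \<in> Obj C" and g: "equi (fre N) X g" shows "g = ext X (g \<bullet> un N)"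
proof -
  have gh: "hom g (A \<boxtimes> N) (fst X)" using g equi_def by simp
  have "ext X (g \<bullet> un N) = act X \<bullet> ((ide A \<star> g) \<bullet> (ide A \<star> un N))"
    unfolding ext_def using ide_ten_cmp[OF A_obj un_hom[OF N] gh] by simp
  also have "\<dots> = g \<bullet> (act (fre N) \<bullet> (ide A \<star> un N))" using g cmp_rewrite2 unfolding equi_def by metis
  also have "\<dots> = g" using act_fre_un[OF N] ide_right[OF gh] by simp
  finally show ?thesis by simp
qed

lemma un_natural: assumes f: "hom f X Y" shows "un Y \<bullet> f = (ide A \<star> f) \<bullet> un X"
proof -
  have o: "X \<in> Obj C" "Y \<in> Obj C" using f hom_objs by auto
  note LX = inv_arrow[OF lun_isom[OF o(1)]] and LY = inv_arrow[OF lun_isom[OF o(2)]]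
  have Uf: "hom (ide \<U> \<star> f) (\<U> \<boxtimes> X) (\<U> \<boxtimes> Y)" using f unit_closed by blast
  have "inv_arrow (lun Y) \<bullet> f = inv_arrow (lun Y) \<bullet> ((f \<bullet> lun X) \<bullet> inv_arrow (lun X))"
    using LX(4) ide_right[OF f] by (simp add: cmp_assoc)
  also have "\<dots> = inv_arrow (lun Y) \<bullet> ((lun Y \<bullet> (ide \<U> \<star> f)) \<bullet> inv_arrow (lun X))" using lun_natural[OF f] by simp
  also have "\<dots> = (ide \<U> \<star> f) \<bullet> inv_arrow (lun X)"
    using cmp_rewrite[OF LY(3)] ide_left[OF hom_cmp[OF LX(2) Uf]] by (simp add: cmp_assoc)
  finally have "inv_arrow (lun Y) \<bullet> f = (ide \<U> \<star> f) \<bullet> inv_arrow (lun X)" .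
  moreover have "(io \<star> ide Y) \<bullet> (ide \<U> \<star> f) = (ide A \<star> f) \<bullet> (io \<star> ide X)"
    using ten_split1[OF io_hom f] ten_split2[OF io_hom f] by simp
  ultimately show ?thesis unfolding un_def using cmp_rewrite2 by (metis cmp_assoc)
qed

text \<open>Instead of a direct computation, \<open>ide A \<star> f\<close> is recognised as the
  extension of \<open>un Y \<bullet> f\<close>.\<close>

lemma equi_fre: assumes f: "hom f X Y" shows "equi (fre X) (fre Y) (ide A \<star> f)"
proof -
  have o: "X \<in> Obj C" "Y \<in> Obj C" using f hom_objs by auto
  have h: "hom (un Y \<bullet> f) X (fst (fre Y))" using f un_hom[OF o(2)] by auto
  have "ext (fre Y) (un Y \<bullet> f) = act (fre Y) \<bullet> ((ide A \<star> un Y) \<bullet> (ide A \<star> f))"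
    unfolding ext_def using ide_ten_cmp[OF A_obj f un_hom[OF o(2)]] by simp
  also have "\<dots> = ide A \<star> f" using cmp_rewrite[OF act_fre_un[OF o(2)]] ide_left[OF hom_ten[OF hom_ide[OF A_obj] f]] by simp
  finally show ?thesis using ext_equi[OF is_mod_fre[OF o(2)] h] by simp
qed

lemma Ind_functor: "is_functor C RepA Ind"
proof (intro is_functor.intro is_functor_axioms.intro)
  show "category C" by (rule category_axioms)
  show "category RepA" by (rule Rep_category)
  show "omap Ind X \<in> Obj RepA" if "X \<in> Obj C" for X using is_mod_fre[OF that] Rep_obj unfolding fre_def by blast
  have mm: "\<And>f. mmap Ind f = \<I> A \<boxdot> f" by (simp add: induction_functor_def)
  show "mmap Ind f \<in> mor RepA (omap Ind X) (omap Ind Y)" if a: "X \<in> Obj C" "Y \<in> Obj C" "f \<in> mor C X Y" for X Y f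
  proof -
    have h: "hom (ar X f Y) X Y" using a hom_ar by blast
    have "ide A \<star> ar X f Y = ar (A \<boxtimes> X) (\<I> A \<boxdot> f) (A \<boxtimes> Y)"
      using ten_ar[OF hom_ide[OF A_obj, unfolded ide_def] h] unfolding ide_def .
    then have "equi (fre X) (fre Y) (ar (fst (fre X)) (\<I> A \<boxdot> f) (fst (fre Y)))" using equi_fre[OF h] by simp
    then show ?thesis using Rep_mor is_mod_fre a unfolding mm fre_def by metis
  qed
  show "mmap Ind (Idm C X) = Idm RepA (omap Ind X)" if "X \<in> Obj C" for X
    unfolding mm Rep_Idm using tensor_id[OF A_obj that] fst_fre[of X] unfolding fre_def by simp
  show "mmap Ind (Comp C g f) = Comp RepA (mmap Ind g) (mmap Ind f)"
    if a: "X \<in> Obj C" "Y \<in> Obj C" "Z \<in> Obj C" "f \<in> mor C X Y" "g \<in> mor C Y Z" for X Y Z f g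
  proof -
    have i: "\<I> A \<in> mor C A A" using id_closed A_obj by blast
    show ?thesis
      unfolding mm Rep_Comp
      using tensor_comp[OF A_obj A_obj A_obj a(1-3) i i a(4,5)] id_left[OF A_obj A_obj i] by simp
  qed
qed

end

sublocale comm_algebra \<subseteq> F: is_functor C "Rep C A \<mu> \<iota>" "induction_functor C A \<mu>"
  by (rule Ind_functor)

context comm_algebra
begin

lemma R_hom_fa: "hom f X Y \<Longrightarrow> R.hom (F.fa f) (fre X) (fre Y)"
  unfolding fre_def by (rule F.hom_fa)

lemma und_fa: assumes f: "hom f X Y" shows "und (F.fa f) = ide A \<star> f"
proof -
  obtain g where g: "f = ar X g Y" using f hom_arE by blast
  have "F.fa f = R.ar (fre X) (\<I> A \<boxdot> g) (fre Y)"
    using F.fa_ar f unfolding g fre_def by (simp add: induction_functor_def)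
  then have "und (F.fa f) = ar (A \<boxtimes> X) (\<I> A \<boxdot> g) (A \<boxtimes> Y)" using und_ar R_hom_fa[OF f] by (metis fst_fre)
  then show ?thesis using ten_ar[OF hom_ide[OF A_obj, unfolded ide_def] f[unfolded g]] g unfolding ide_def by simp
qed

lemma R_ext:
  assumes "is_mod X" "hom x N (fst X)"
  obtains a where "R.hom a (fre N) X" "und a = ext X x" "und a \<bullet> un N = x"
proof -
  have "N \<in> Obj C" using assms hom_objs by blast
  then show ?thesis using that und_lift[OF is_mod_fre assms(1) ext_equi[OF assms]] ext_un[OF assms] by metis
qed

lemma R_fre_inject:
  assumes a: "R.hom a (fre N) X" "R.hom b (fre N) X" "N \<in> Obj C" "und a \<bullet> un N = und b \<bullet> un N" shows "a = b"
  using und_inject[OF a(1,2)] equi_fre_eq_ext[OF _ a(3)] R_homD[OF a(1)] R_homD[OF a(2)] a(4) by metis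

lemma ext_zro: assumes "is_mod X" "hom x N (fst X)" "zro x" shows "zro (ext X x)"
  using zro_cmp_hom[OF hom_ten[OF hom_ide[OF A_obj] assms(2)] is_modD(1)[OF assms(1)]]
    ten_zro_right[OF hom_ide[OF A_obj] assms(2,3)] unfolding ext_def by blast

text \<open>A homomorphism out of an induced module is the extension of its restriction along
  \<open>un N\<close>, and extending a zero arrow gives zero.\<close>

lemma R_fre_zro:
  assumes a: "R.hom a (fre N) X" "N \<in> Obj C" "zro (und a \<bullet> un N)" shows "R.zro a"
proof -
  have h: "hom (und a \<bullet> un N) N (fst X)" using R_homD(4)[OF a(1)] un_hom[OF a(2)] by auto
  show ?thesis
    using R_zro_iff[OF a(1)] equi_fre_eq_ext[OF _ a(2)] R_homD[OF a(1)] ext_zro[OF _ h a(3)] by metis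
qed

text \<open>Induction is a left adjoint and so preserves coproducts: existence and uniqueness of the
  mediating homomorphism are both decided by restriction along \<open>un\<close>.\<close>

lemma fa_dsum:
  assumes S: "dsum J U S e"
  shows "R.dsum J (\<lambda>i. fre (U i)) (fre S) (\<lambda>i. F.fa (e i))"
  unfolding R.dsum_def
proof (intro conjI allI impI ballI)
  have So: "S \<in> Obj C" and e: "\<And>i. i \<in> J \<Longrightarrow> hom (e i) (U i) S" using dsumD S by auto
  show "fre S \<in> Obj RepA" using is_mod_fre[OF So] Rep_obj by blast
  show fe: "R.hom (F.fa (e i)) (fre (U i)) (fre S)" if "i \<in> J" for i using R_hom_fa e that by blast
  fix X f assume X: "X \<in> Obj RepA" and f: "\<forall>i\<in>J. R.hom (f i) (fre (U i)) X"
  have m: "is_mod X" using X Rep_obj by blast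
  have fh: "hom (und (f i) \<bullet> un (U i)) (U i) (fst X)" if "i \<in> J" for i
    using R_homD(4) f that un_hom hom_objs(1)[OF e[OF that]] by (metis fst_fre hom_cmp)
  obtain h where h: "hom h S (fst X)" "\<And>i. i \<in> J \<Longrightarrow> h \<bullet> e i = und (f i) \<bullet> un (U i)"
    using dsum_ex[OF S is_modD(2)[OF m], of "\<lambda>i. und (f i) \<bullet> un (U i)"] fh by blast
  obtain a where a: "R.hom a (fre S) X" "und a \<bullet> un S = h" using R_ext[OF m h(1)] by metis
  have "R.cmp a (F.fa (e i)) = f i" if i: "i \<in> J" for i
  proof (rule R_fre_inject[OF R.hom_cmp[OF fe[OF i] a(1)]])
    show "R.hom (f i) (fre (U i)) X" using f i by blast
    show "U i \<in> Obj C" using e[OF i] hom_objs by blast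
    have "und (R.cmp a (F.fa (e i))) \<bullet> un (U i) = (und a \<bullet> un S) \<bullet> e i"
      using und_cmp[OF fe[OF i] a(1)] und_fa[OF e[OF i]] un_natural[OF e[OF i]] by (simp add: cmp_assoc)
    then show "und (R.cmp a (F.fa (e i))) \<bullet> un (U i) = und (f i) \<bullet> un (U i)" using a h(2)[OF i] by simp
  qed
  then show "\<exists>h. R.hom h (fre S) X \<and> (\<forall>i\<in>J. R.cmp h (F.fa (e i)) = f i)" using a by blast
next
  have So: "S \<in> Obj C" and e: "\<And>i. i \<in> J \<Longrightarrow> hom (e i) (U i) S" using dsumD S by auto
  fix X g h assume gh: "R.hom g (fre S) X" "R.hom h (fre S) X" "\<forall>i\<in>J. R.cmp g (F.fa (e i)) = R.cmp h (F.fa (e i))"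
  have hs: "hom (und g \<bullet> un S) S (fst X)" "hom (und h \<bullet> un S) S (fst X)"
    using R_homD(4)[OF gh(1)] R_homD(4)[OF gh(2)] un_hom[OF So] by auto
  have "und g \<bullet> un S = und h \<bullet> un S"
  proof (rule dsumD(4)[OF S hs])
    fix i assume i: "i \<in> J"
    have fe: "R.hom (F.fa (e i)) (fre (U i)) (fre S)" using R_hom_fa e i by blast
    have "und g \<bullet> (ide A \<star> e i) = und h \<bullet> (ide A \<star> e i)"
      using gh(3) i und_cmp[OF fe gh(1)] und_cmp[OF fe gh(2)] und_fa[OF e[OF i]] by metis
    then show "(und g \<bullet> un S) \<bullet> e i = (und h \<bullet> un S) \<bullet> e i"
      using un_natural[OF e[OF i]] by (metis cmp_assoc)
  qed
  then show "g = h" using R_fre_inject gh So by blast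
qed

end

section \<open>Simple current algebras\<close>

text \<open>The common kernels of finitely many projections shrink as more projections are imposed.
  The descending chain condition gives a smallest one, yet imposing the projection at a new index
  excludes the nonzero summand there.\<close>

lemma (in locally_finite_category) finite_dsum:
  assumes A: "dsum I U A e" and nz: "\<And>i. i \<in> I \<Longrightarrow> \<not> zob (U i)"
  shows "finite I"
proof (rule ccontr)
  assume inf: "infinite I"
  note e = dsumD(2)[OF A] and oA = dsumD(1)[OF A]
  obtain p where p: "\<And>i. i \<in> I \<Longrightarrow> hom (p i) A (U i)" "\<And>i. i \<in> I \<Longrightarrow> p i \<bullet> e i = ide (U i)"
    "\<And>i j. i \<in> I \<Longrightarrow> j \<in> I \<Longrightarrow> i \<noteq> j \<Longrightarrow> p i \<bullet> e j = zer (U j) (U i)"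
    using dsum_projections[OF A] by blast
  \<comment> \<open>The common kernel of the projections in \<open>F\<close> is described by the
    arrows that factor through it.\<close>
  define Q where "Q F s \<longleftrightarrow> monic s \<and> (\<exists>S. hom s S A) \<and>
    (\<forall>w W. hom w W A \<longrightarrow> ((\<forall>i\<in>F. zro (p i \<bullet> w)) \<longleftrightarrow> (\<exists>u. w = s \<bullet> u)))" for F s
  have ex: "\<exists>s. Q F s" if "finite F" "F \<subseteq> I" for F
    using that
  proof (induction F)
    case empty
    have "Q {} (ide A)" unfolding Q_def using monic_ide[OF oA] hom_ide[OF oA] ide_left by (metis empty_iff)
    then show ?case by blast
  next
    case (insert j F)
    then obtain s where s: "Q F s" by auto
    obtain S where S: "hom s S A" "monic s" using s Q_def by blast
    have j: "j \<in> I" using insert by simp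
    have pj: "hom (p j \<bullet> s) S (U j)" using S p(1)[OF j] by blast
    obtain k where k: "kern (p j \<bullet> s) k" using ex_kern pj by blast
    obtain N where N: "hom k N S" "monic k" using kernD[OF k pj] by blast
    have "Q (insert j F) (s \<bullet> k)"
      unfolding Q_def
    proof (intro conjI allI impI)
      show "\<exists>S. hom (s \<bullet> k) S A" using S N by blast
      then show "monic (s \<bullet> k)" using monic_cmp S N hom_not_None by blast
      fix w W assume w: "hom w W A"
      show "(\<forall>i\<in>insert j F. zro (p i \<bullet> w)) \<longleftrightarrow> (\<exists>u. w = (s \<bullet> k) \<bullet> u)"
      proof
        assume a: "\<forall>i\<in>insert j F. zro (p i \<bullet> w)"
        then have "\<forall>i\<in>F. zro (p i \<bullet> w)" by simp
        then obtain u where u: "w = s \<bullet> u" using s w unfolding Q_def by blast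
        have "zro ((p j \<bullet> s) \<bullet> u)" using a u by (simp add: cmp_assoc)
        then obtain v where "u = k \<bullet> v" using k kern_def by blast
        then show "\<exists>u. w = (s \<bullet> k) \<bullet> u" using u by (auto simp: cmp_assoc)
      next
        assume "\<exists>u. w = (s \<bullet> k) \<bullet> u"
        then obtain u where u: "w = s \<bullet> (k \<bullet> u)" by (auto simp: cmp_assoc)
        then have "\<forall>i\<in>F. zro (p i \<bullet> w)" using s w unfolding Q_def by blast
        moreover have "zro (p j \<bullet> w)"
        proof -
          have "hom (k \<bullet> u) W S" using u w S hom_cmpE hom_unique by metis
          then have "zro ((p j \<bullet> s) \<bullet> (k \<bullet> u))" using zro_if_factors[OF k pj refl] hom_not_None by blast
          then show ?thesis using u by (simp add: cmp_assoc)
        qed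
        ultimately show "\<forall>i\<in>insert j F. zro (p i \<bullet> w)" by simp
      qed
    qed
    then show ?case by blast
  qed
  let ?P = "\<lambda>s. \<exists>F. finite F \<and> F \<subseteq> I \<and> Q F s"
  obtain s0 where "Q {} s0" using ex[of "{}"] by auto
  then have "?P s0" by blast
  moreover have "monic s \<and> (\<exists>S. hom s S A)" if "?P s" for s using that unfolding Q_def by blast
  ultimately obtain s where s: "?P s" "\<And>t. ?P t \<Longrightarrow> \<exists>h. t = s \<bullet> h \<Longrightarrow> \<exists>h. s = t \<bullet> h"
    using minimal_sub_ex[OF oA, of ?P s0] by blast
  obtain F where F: "finite F" "F \<subseteq> I" "Q F s" using s by blast
  obtain i where i: "i \<in> I" "i \<notin> F" using inf F by (metis finite_subset subsetI)
  obtain t where t: "Q (insert i F) t" using ex[of "insert i F"] F i by auto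
  obtain T where T: "hom t T A" using t Q_def by blast
  have "\<forall>j\<in>insert i F. zro (p j \<bullet> t)" using t T ide_right unfolding Q_def by metis
  then have "\<exists>h. t = s \<bullet> h" using F(3) T unfolding Q_def by blast
  moreover have "?P t" using t F i by (intro exI[of _ "insert i F"]) simp
  ultimately obtain h where h: "s = t \<bullet> h" using s(2) by blast
  have "\<forall>j\<in>F. zro (p j \<bullet> e i)"
    using p(3) i F(2) zro_zer dsumD(3)[OF A] by (metis subsetD)
  then obtain u where "e i = s \<bullet> u" using F(3) e[OF i(1)] unfolding Q_def by blast
  then have "e i = t \<bullet> (h \<bullet> u)" using h by (simp add: cmp_assoc)
  then have "zro (p i \<bullet> e i)" using t e[OF i(1)] unfolding Q_def by blast
  then show False using p(2)[OF i(1)] nz[OF i(1)] zob_iff dsumD(3)[OF A i(1)] by simp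
qed

locale simple_current = comm_algebra K C A \<mu> \<iota>
  for K :: "('k, 'x) ring_scheme" and C :: "('o, 'm, 'k, 'z) br_cat_scheme" (structure)
    and A :: 'o and \<mu> \<iota> :: 'm +
  fixes I :: "'i set" and U :: "'i \<Rightarrow> 'o"
  assumes simple_current_algebra: "is_simple_current_algebra C I U A \<mu> \<iota>"
    and no_fixed: "no_fixed_points C I U"
    and simple_algebra: "is_simple (Rep C A \<mu> \<iota>) (A, \<mu>)"
begin

section \<open>Decomposition of the algebra into invertible summands, and exactness\<close>

lemma R_simple_A: "R.simple (A, \<mu>)"
  using simple_algebra R.is_simple_iff by blast

lemma A_nonzero: "\<not> zob A"
  using R_simple_A R_zob_iff[OF is_mod_A] unfolding R.simple_def by simp

lemma U_inverse: "i \<in> I \<Longrightarrow> \<exists>V. inverse_objects (U i) V"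
  using simple_current_algebra is_invertible_inverse unfolding is_simple_current_algebra_def by blast

lemma U_obj: "i \<in> I \<Longrightarrow> U i \<in> Obj C"
  using U_inverse inverse_objects_def by blast

lemma unit_nonzero: "\<not> zob \<U>"
proof
  assume "zob \<U>"
  then have "zro (ide \<U>)" using zob_iff unit_closed by blast
  then have "zro (ide \<U> \<star> ide A)" using ten_zro_left hom_ide unit_closed A_obj by blast
  then have "zob (\<U> \<boxtimes> A)" using ten_ide[OF unit_closed A_obj] zob_iff tensor_closed[OF unit_closed A_obj] by simp
  then show False using zob_isom[OF lun_isom[OF A_obj]] A_nonzero by blast
qed

lemma U_nonzero: assumes i: "i \<in> I" shows "\<not> zob (U i)"
proof
  assume z: "zob (U i)"
  obtain V where V: "inverse_objects (U i) V" using U_inverse[OF i] by blast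
  then have o: "V \<in> Obj C" "U i \<in> Obj C" "V \<boxtimes> U i \<in> Obj C" using tensor_closed unfolding inverse_objects_def by auto
  have "zob (V \<boxtimes> U i)" using inverse_zob[OF inverse_objects_sym[OF V] o(2)] z by blast
  moreover obtain f where "isom f (V \<boxtimes> U i) \<U>" using V isomorphic_iff[OF o(3) unit_closed] unfolding inverse_objects_def by blast
  ultimately show False using zob_isom unit_nonzero by blast
qed

lemma ex_dsum: "\<exists>e. dsum I U A e"
  using simple_current_algebra is_direct_sum_iff unfolding is_simple_current_algebra_def by blast

text \<open>The direct sum is only known to exist; the injections are chosen once so that they can
  be named throughout the locale.\<close>

definition inc :: "'i \<Rightarrow> ('o, 'm) arrow" where "inc = (SOME e. dsum I U A e)"

lemma dsum_inc: "dsum I U A inc"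
  unfolding inc_def using ex_dsum by (rule someI_ex)

lemma inc_hom: "i \<in> I \<Longrightarrow> hom (inc i) (U i) A"
  using dsumD(2)[OF dsum_inc] .

lemma finite_I: "finite I"
  using finite_dsum[OF dsum_inc] U_nonzero by blast

definition prj :: "'i \<Rightarrow> ('o, 'm) arrow"
  where "prj = (SOME p. (\<forall>i\<in>I. hom (p i) A (U i)) \<and> (\<forall>i\<in>I. p i \<bullet> inc i = ide (U i)) \<and>
    (\<forall>i\<in>I. \<forall>j\<in>I. i \<noteq> j \<longrightarrow> p i \<bullet> inc j = zer (U j) (U i)))"

lemma prj: "i \<in> I \<Longrightarrow> hom (prj i) A (U i)" "i \<in> I \<Longrightarrow> prj i \<bullet> inc i = ide (U i)"
  "i \<in> I \<Longrightarrow> j \<in> I \<Longrightarrow> i \<noteq> j \<Longrightarrow> prj i \<bullet> inc j = zer (U j) (U i)"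
proof -
  obtain p where p: "\<And>i. i \<in> I \<Longrightarrow> hom (p i) A (U i)" "\<And>i. i \<in> I \<Longrightarrow> p i \<bullet> inc i = ide (U i)"
    "\<And>i j. i \<in> I \<Longrightarrow> j \<in> I \<Longrightarrow> i \<noteq> j \<Longrightarrow> p i \<bullet> inc j = zer (U j) (U i)"
    using dsum_projections[OF dsum_inc] by blast
  have "(\<forall>i\<in>I. hom (prj i) A (U i)) \<and> (\<forall>i\<in>I. prj i \<bullet> inc i = ide (U i)) \<and>
    (\<forall>i\<in>I. \<forall>j\<in>I. i \<noteq> j \<longrightarrow> prj i \<bullet> inc j = zer (U j) (U i))"
    unfolding prj_def by (rule someI[of _ p]) (use p in simp)
  then show "i \<in> I \<Longrightarrow> hom (prj i) A (U i)" "i \<in> I \<Longrightarrow> prj i \<bullet> inc i = ide (U i)"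
    "i \<in> I \<Longrightarrow> j \<in> I \<Longrightarrow> i \<noteq> j \<Longrightarrow> prj i \<bullet> inc j = zer (U j) (U i)" by auto
qed

lemma A_induct:
  assumes "P (zer A A)" "\<And>i. i \<in> I \<Longrightarrow> P (inc i \<bullet> prj i)"
    "\<And>f g. hom f A A \<Longrightarrow> hom g A A \<Longrightarrow> P f \<Longrightarrow> P g \<Longrightarrow> P (pls f g)"
  shows "P (ide A)"
  by (rule dsum_ide_induct[OF dsum_inc finite_I prj assms])

lemma pls_zro: "hom f X Y \<Longrightarrow> hom g X Y \<Longrightarrow> zro f \<Longrightarrow> zro g \<Longrightarrow> zro (pls f g)"
  using zro_hom pls_zer by metis

text \<open>The arrow \<open>b \<bullet> ((g \<star> ide X) \<bullet> a)\<close> is additive in the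
  endomorphism \<open>g\<close> of \<open>A\<close>, so it suffices to treat the idempotents whose
  sum is the identity. This takes the place of a direct sum decomposition of
  \<open>A \<boxtimes> X\<close>.\<close>

lemma A_induct_zro:
  assumes X: "X \<in> Obj C" and a: "hom a W (A \<boxtimes> X)" and b: "hom b (A \<boxtimes> X) Y"
    and i: "\<And>i. i \<in> I \<Longrightarrow> zro (b \<bullet> (((inc i \<bullet> prj i) \<star> ide X) \<bullet> a))"
  shows "zro (b \<bullet> a)"
proof -
  have iX: "hom (ide X) X X" using X by blast
  have AX: "A \<boxtimes> X \<in> Obj C" using A_obj X tensor_closed by blast
  have "zro (b \<bullet> ((ide A \<star> ide X) \<bullet> a))"
  proof (rule A_induct[where P = "\<lambda>g. zro (b \<bullet> ((g \<star> ide X) \<bullet> a))"])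
    have "zro (zer A A \<star> ide X)" using ten_zro_left[OF hom_zer[OF A_obj A_obj] iX] zro_zer A_obj by blast
    moreover have h: "hom (zer A A \<star> ide X) (A \<boxtimes> X) (A \<boxtimes> X)" using hom_zer A_obj iX by blast
    ultimately have "zro ((zer A A \<star> ide X) \<bullet> a)" using zro_cmp_hom[OF a h] by blast
    then show "zro (b \<bullet> ((zer A A \<star> ide X) \<bullet> a))" using zro_cmp_hom[OF hom_cmp[OF a h] b] by blast
    show "zro (b \<bullet> (((inc i \<bullet> prj i) \<star> ide X) \<bullet> a))" if "i \<in> I" for i using i[OF that] .
    fix f g assume h: "hom f A A" "hom g A A"
      and z: "zro (b \<bullet> ((f \<star> ide X) \<bullet> a))" "zro (b \<bullet> ((g \<star> ide X) \<bullet> a))"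
    have hX: "hom (f \<star> ide X) (A \<boxtimes> X) (A \<boxtimes> X)" "hom (g \<star> ide X) (A \<boxtimes> X) (A \<boxtimes> X)" using h iX by auto
    have "b \<bullet> ((pls f g \<star> ide X) \<bullet> a) = pls (b \<bullet> ((f \<star> ide X) \<bullet> a)) (b \<bullet> ((g \<star> ide X) \<bullet> a))"
      using pls_ten[OF h iX] pls_cmp[OF a hX] cmp_pls[OF hom_cmp[OF a hX(1)] hom_cmp[OF a hX(2)] b] by simp
    then show "zro (b \<bullet> ((pls f g \<star> ide X) \<bullet> a))"
      using pls_zro[OF hom_cmp[OF hom_cmp[OF a hX(1)] b] hom_cmp[OF hom_cmp[OF a hX(2)] b] z] by simp
  qed
  then show ?thesis using ten_ide[OF A_obj X] ide_left[OF a] by simp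
qed

lemma inc_prj_ten:
  assumes "i \<in> I" "X \<in> Obj C" shows "(inc i \<bullet> prj i) \<star> ide X = (inc i \<star> ide X) \<bullet> (prj i \<star> ide X)"
  using ten_ide_cmp[OF assms(2) prj(1)[OF assms(1)] inc_hom[OF assms(1)]] .

text \<open>The case of \<open>A_induct_zro\<close> with \<open>b\<close> the identity: the
  projections still detect zero after tensoring with \<open>X\<close>.\<close>

lemma prj_zro:
  assumes X: "X \<in> Obj C" and a: "hom a W (A \<boxtimes> X)" and z: "\<And>i. i \<in> I \<Longrightarrow> zro ((prj i \<star> ide X) \<bullet> a)"
  shows "zro a"
proof -
  have AX: "A \<boxtimes> X \<in> Obj C" using A_obj X tensor_closed by blast
  have "zro (ide (A \<boxtimes> X) \<bullet> a)"
  proof (rule A_induct_zro[OF X a hom_ide[OF AX]])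
    fix i assume i: "i \<in> I"
    have hp: "hom (prj i \<star> ide X) (A \<boxtimes> X) (U i \<boxtimes> X)" "hom (inc i \<star> ide X) (U i \<boxtimes> X) (A \<boxtimes> X)"
      using prj(1)[OF i] inc_hom[OF i] X by auto
    have "zro ((inc i \<star> ide X) \<bullet> ((prj i \<star> ide X) \<bullet> a))" using zro_cmp_hom[OF hom_cmp[OF a hp(1)] hp(2)] z[OF i] by blast
    then have z': "zro (((inc i \<bullet> prj i) \<star> ide X) \<bullet> a)" using inc_prj_ten[OF i X] by (simp add: cmp_assoc)
    have "hom (((inc i \<bullet> prj i) \<star> ide X) \<bullet> a) W (A \<boxtimes> X)" using inc_prj_ten[OF i X] a hp by auto
    then show "zro (ide (A \<boxtimes> X) \<bullet> (((inc i \<bullet> prj i) \<star> ide X) \<bullet> a))" using z' ide_left by simp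
  qed
  then show ?thesis using ide_left[OF a] by simp
qed

lemma inc_zro:
  assumes X: "X \<in> Obj C" and a: "hom a (A \<boxtimes> X) W" and z: "\<And>i. i \<in> I \<Longrightarrow> zro (a \<bullet> (inc i \<star> ide X))"
  shows "zro a"
proof -
  have AX: "A \<boxtimes> X \<in> Obj C" using A_obj X tensor_closed by blast
  have "zro (a \<bullet> ide (A \<boxtimes> X))"
  proof (rule A_induct_zro[OF X hom_ide[OF AX] a])
    fix i assume i: "i \<in> I"
    have hp: "hom (prj i \<star> ide X) (A \<boxtimes> X) (U i \<boxtimes> X)" "hom (inc i \<star> ide X) (U i \<boxtimes> X) (A \<boxtimes> X)"
      using prj(1)[OF i] inc_hom[OF i] X by auto
    have "zro ((a \<bullet> (inc i \<star> ide X)) \<bullet> (prj i \<star> ide X))" using zro_cmp_hom[OF hp(1) hom_cmp[OF hp(2) a]] z[OF i] by blast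
    then have z': "zro (a \<bullet> ((inc i \<bullet> prj i) \<star> ide X))" using inc_prj_ten[OF i X] by (simp add: cmp_assoc)
    have "hom ((inc i \<bullet> prj i) \<star> ide X) (A \<boxtimes> X) (A \<boxtimes> X)" using inc_prj_ten[OF i X] hp by auto
    then show "zro (a \<bullet> (((inc i \<bullet> prj i) \<star> ide X) \<bullet> ide (A \<boxtimes> X)))" using z' ide_right by simp
  qed
  then show ?thesis using ide_right[OF a] by simp
qed

lemma prj_natural: "i \<in> I \<Longrightarrow> hom f X Y \<Longrightarrow> (prj i \<star> ide Y) \<bullet> (ide A \<star> f) = (ide (U i) \<star> f) \<bullet> (prj i \<star> ide X)"
  using ten_split1[OF prj(1)] ten_split2[OF prj(1)] by metis

lemma inc_natural: "i \<in> I \<Longrightarrow> hom f X Y \<Longrightarrow> (inc i \<star> ide Y) \<bullet> (ide (U i) \<star> f) = (ide A \<star> f) \<bullet> (inc i \<star> ide X)"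
  using ten_split1[OF inc_hom] ten_split2[OF inc_hom] by metis

lemma A_monic: assumes f: "hom f X Y" "monic f" shows "monic (ide A \<star> f)"
proof -
  have o: "X \<in> Obj C" "Y \<in> Obj C" using f hom_objs by auto
  have Af: "hom (ide A \<star> f) (A \<boxtimes> X) (A \<boxtimes> Y)" using f A_obj by blast
  show ?thesis
  proof (rule monicI[OF Af])
    fix W w assume w: "hom w W (A \<boxtimes> X)" "zro ((ide A \<star> f) \<bullet> w)"
    show "zro w"
    proof (rule prj_zro[OF o(1) w(1)])
      fix i assume i: "i \<in> I"
      obtain V where V: "inverse_objects (U i) V" using U_inverse[OF i] by blast
      have hp: "hom (prj i \<star> ide Y) (A \<boxtimes> Y) (U i \<boxtimes> Y)" using prj(1)[OF i] o by auto
      have "zro ((prj i \<star> ide Y) \<bullet> ((ide A \<star> f) \<bullet> w))" using zro_cmp_hom[OF hom_cmp[OF w(1) Af] hp] w(2) by blast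
      then have "zro ((ide (U i) \<star> f) \<bullet> ((prj i \<star> ide X) \<bullet> w))" using cmp_rewrite2[OF prj_natural[OF i f(1)]] by simp
      then show "zro ((prj i \<star> ide X) \<bullet> w)" using monic_zro inverse_monic[OF V f] by blast
    qed
  qed
qed

lemma A_epic': assumes f: "hom f X Y" "epic f" shows "epic (ide A \<star> f)"
proof -
  have o: "X \<in> Obj C" "Y \<in> Obj C" using f hom_objs by auto
  have Af: "hom (ide A \<star> f) (A \<boxtimes> X) (A \<boxtimes> Y)" using f A_obj by blast
  show ?thesis
  proof (rule epicI[OF Af])
    fix W w assume w: "hom w (A \<boxtimes> Y) W" "zro (w \<bullet> (ide A \<star> f))"
    show "zro w"
    proof (rule inc_zro[OF o(2) w(1)])
      fix i assume i: "i \<in> I"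
      obtain V where V: "inverse_objects (U i) V" using U_inverse[OF i] by blast
      have hp: "hom (inc i \<star> ide X) (U i \<boxtimes> X) (A \<boxtimes> X)" using inc_hom[OF i] o by auto
      have "zro ((w \<bullet> (ide A \<star> f)) \<bullet> (inc i \<star> ide X))" using zro_cmp_hom[OF hp hom_cmp[OF Af w(1)]] w(2) by blast
      then have "zro ((w \<bullet> (inc i \<star> ide Y)) \<bullet> (ide (U i) \<star> f))" using inc_natural[OF i f(1)] by (simp add: cmp_assoc)
      then show "zro (w \<bullet> (inc i \<star> ide Y))" using epic_zro inverse_epic[OF V f] by blast
    qed
  qed
qed

text \<open>That \<open>w\<close> factors through \<open>ide A \<star> k\<close> means that the
  cokernel \<open>c\<close> of the latter kills \<open>w\<close>. In this form the claim is additive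
  and can be checked on each summand, where tensoring with \<open>U i\<close> preserves the
  kernel.\<close>

lemma A_kern':
  assumes f: "hom f X Y" and k: "kern f k" shows "kern (ide A \<star> f) (ide A \<star> k)"
proof -
  obtain N where N: "hom k N X" "monic k" "zro (f \<bullet> k)" using kernD[OF k f] by blast
  have o: "X \<in> Obj C" "Y \<in> Obj C" "N \<in> Obj C" using f N hom_objs by auto
  have Ak: "hom (ide A \<star> k) (A \<boxtimes> N) (A \<boxtimes> X)" "monic (ide A \<star> k)" using N A_obj A_monic by auto
  have Af: "hom (ide A \<star> f) (A \<boxtimes> X) (A \<boxtimes> Y)" using f A_obj by blast
  obtain c where c: "coker (ide A \<star> k) c" using ex_coker Ak by blast
  obtain Q where Q: "hom c (A \<boxtimes> X) Q" "zro (c \<bullet> (ide A \<star> k))" using cokerD[OF c Ak(1)] by blast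
  show ?thesis
    unfolding kern_def
  proof (intro conjI allI impI)
    show "monic (ide A \<star> k)" using Ak by blast
    show "zro ((ide A \<star> f) \<bullet> (ide A \<star> k))"
      using ide_ten_cmp[OF A_obj N(1) f] ten_zro_right[OF hom_ide[OF A_obj] hom_cmp[OF N(1) f] N(3)] by simp
    fix w assume z: "zro ((ide A \<star> f) \<bullet> w)"
    obtain W where w: "hom w W (A \<boxtimes> X)" using zro_cmp_dom[OF z Af] .
    have "zro (c \<bullet> w)"
    proof (rule A_induct_zro[OF o(1) w Q(1)])
      fix i assume i: "i \<in> I"
      obtain V where V: "inverse_objects (U i) V" using U_inverse[OF i] by blast
      have hp: "hom (prj i \<star> ide Y) (A \<boxtimes> Y) (U i \<boxtimes> Y)" "hom (prj i \<star> ide X) (A \<boxtimes> X) (U i \<boxtimes> X)"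
        "hom (inc i \<star> ide N) (U i \<boxtimes> N) (A \<boxtimes> N)"
        using prj(1)[OF i] inc_hom[OF i] o by auto
      have "zro ((prj i \<star> ide Y) \<bullet> ((ide A \<star> f) \<bullet> w))" using zro_cmp_hom[OF hom_cmp[OF w Af] hp(1)] z by blast
      then have "zro ((ide (U i) \<star> f) \<bullet> ((prj i \<star> ide X) \<bullet> w))" using cmp_rewrite2[OF prj_natural[OF i f]] by simp
      then obtain v where v: "(prj i \<star> ide X) \<bullet> w = (ide (U i) \<star> k) \<bullet> v"
        using inverse_kern[OF V f k] kern_def by blast
      have vh: "hom v W (U i \<boxtimes> N)"
        using v hom_cmp[OF w hp(2)] hom_ten[OF hom_ide[OF U_obj[OF i]] N(1)] hom_cmpE hom_unique by metis
      have "c \<bullet> (((inc i \<bullet> prj i) \<star> ide X) \<bullet> w) = c \<bullet> ((inc i \<star> ide X) \<bullet> ((ide (U i) \<star> k) \<bullet> v))"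
        using inc_prj_ten[OF i o(1)] v by (simp add: cmp_assoc)
      also have "\<dots> = (c \<bullet> (ide A \<star> k)) \<bullet> ((inc i \<star> ide N) \<bullet> v)"
        using cmp_rewrite2[OF inc_natural[OF i N(1)]] by (simp add: cmp_assoc)
      finally show "zro (c \<bullet> (((inc i \<bullet> prj i) \<star> ide X) \<bullet> w))"
        using zro_cmp_hom[OF hom_cmp[OF vh hp(3)] hom_cmp[OF Ak(1) Q(1)]] Q(2) by simp
    qed
    then show "\<exists>u. w = (ide A \<star> k) \<bullet> u" using kern_of_coker[OF Ak(2,1) c] kern_def by blast
  qed
qed

lemma A_coker':
  assumes f: "hom f X Y" and q: "coker f q" shows "coker (ide A \<star> f) (ide A \<star> q)"
proof -
  obtain N where N: "hom q Y N" "epic q" "zro (q \<bullet> f)" using cokerD[OF q f] by blast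
  have o: "X \<in> Obj C" "Y \<in> Obj C" "N \<in> Obj C" using f N hom_objs by auto
  have Aq: "hom (ide A \<star> q) (A \<boxtimes> Y) (A \<boxtimes> N)" "epic (ide A \<star> q)" using N A_obj A_epic' by auto
  have Af: "hom (ide A \<star> f) (A \<boxtimes> X) (A \<boxtimes> Y)" using f A_obj by blast
  obtain c where c: "kern (ide A \<star> q) c" using ex_kern Aq by blast
  obtain Q where Q: "hom c Q (A \<boxtimes> Y)" "zro ((ide A \<star> q) \<bullet> c)" using kernD[OF c Aq(1)] by blast
  show ?thesis
    unfolding coker_def
  proof (intro conjI allI impI)
    show "epic (ide A \<star> q)" using Aq by blast
    show "zro ((ide A \<star> q) \<bullet> (ide A \<star> f))"
      using ide_ten_cmp[OF A_obj f N(1)] ten_zro_right[OF hom_ide[OF A_obj] hom_cmp[OF f N(1)] N(3)] by simp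
    fix w assume z: "zro (w \<bullet> (ide A \<star> f))"
    obtain W where w: "hom w (A \<boxtimes> Y) W" using zro_cmp_cod[OF z Af] .
    have "zro (w \<bullet> c)"
    proof (rule A_induct_zro[OF o(2) Q(1) w])
      fix i assume i: "i \<in> I"
      obtain V where V: "inverse_objects (U i) V" using U_inverse[OF i] by blast
      have hp: "hom (inc i \<star> ide X) (U i \<boxtimes> X) (A \<boxtimes> X)" "hom (inc i \<star> ide Y) (U i \<boxtimes> Y) (A \<boxtimes> Y)"
        "hom (prj i \<star> ide N) (A \<boxtimes> N) (U i \<boxtimes> N)"
        using prj(1)[OF i] inc_hom[OF i] o by auto
      have "zro ((w \<bullet> (ide A \<star> f)) \<bullet> (inc i \<star> ide X))" using zro_cmp_hom[OF hp(1) hom_cmp[OF Af w]] z by blast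
      then have "zro ((w \<bullet> (inc i \<star> ide Y)) \<bullet> (ide (U i) \<star> f))" using inc_natural[OF i f] by (simp add: cmp_assoc)
      then obtain v where v: "w \<bullet> (inc i \<star> ide Y) = v \<bullet> (ide (U i) \<star> q)"
        using inverse_coker[OF V f q] coker_def by blast
      have vh: "hom v (U i \<boxtimes> N) W"
        using v hom_cmp[OF hp(2) w] hom_ten[OF hom_ide[OF U_obj[OF i]] N(1)] hom_cmpE hom_unique by metis
      have "w \<bullet> (((inc i \<bullet> prj i) \<star> ide Y) \<bullet> c) = (w \<bullet> (inc i \<star> ide Y)) \<bullet> ((prj i \<star> ide Y) \<bullet> c)"
        using inc_prj_ten[OF i o(2)] by (simp add: cmp_assoc)
      also have "\<dots> = v \<bullet> ((prj i \<star> ide N) \<bullet> ((ide A \<star> q) \<bullet> c))"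
        using v cmp_rewrite2[OF prj_natural[OF i N(1), symmetric]] by (simp add: cmp_assoc)
      also have "\<dots> = (v \<bullet> (prj i \<star> ide N)) \<bullet> ((ide A \<star> q) \<bullet> c)" by (simp add: cmp_assoc)
      finally show "zro (w \<bullet> (((inc i \<bullet> prj i) \<star> ide Y) \<bullet> c))"
        using zro_cmp_hom[OF hom_cmp[OF Q(1) Aq(1)] hom_cmp[OF hp(3) vh]] Q(2) by simp
    qed
    then show "\<exists>u. w = u \<bullet> (ide A \<star> q)" using coker_of_kern[OF Aq(2,1) c] coker_def by blast
  qed
qed

end

sublocale simple_current \<subseteq> exact_algebra K C A \<mu> \<iota>
  by unfold_locales (rule A_kern', assumption+, rule A_coker', assumption+)

section \<open>Simplicity of induced modules and the induction functor\<close>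

context simple_current
begin

text \<open>\<open>u\<close> comes from the isomorphism of \<open>U i0\<close> with the monoidal
  unit and is not identified with the algebra unit \<open>io\<close>; this is why
  \<open>ext_unit_isom\<close> treats arbitrary nonzero arrows.\<close>

lemma unit_summand:
  obtains i0 u r where "i0 \<in> I" "hom u \<U> A" "hom r A \<U>" "r \<bullet> u = ide \<U>" "u \<bullet> r = inc i0 \<bullet> prj i0"
    "\<And>i. i \<in> I \<Longrightarrow> i \<noteq> i0 \<Longrightarrow> \<not> has_fixed_point C (U i)"
proof -
  obtain i0 where i0: "i0 \<in> I" "isomorphic C (U i0) \<U>" "\<And>i. i \<in> I \<Longrightarrow> i \<noteq> i0 \<Longrightarrow> \<not> has_fixed_point C (U i)"
    using no_fixed unfolding no_fixed_points_def by blast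
  obtain f where f: "isom f (U i0) \<U>" using i0(2) isomorphic_iff[OF U_obj[OF i0(1)] unit_closed] by blast
  obtain g where g: "hom g \<U> (U i0)" "g \<bullet> f = ide (U i0)" "f \<bullet> g = ide \<U>" using isomE[OF f] by metis
  have fh: "hom f (U i0) \<U>" using f isom_hom by blast
  show ?thesis
  proof (rule that[OF i0(1), of "inc i0 \<bullet> g" "f \<bullet> prj i0"])
    show "hom (inc i0 \<bullet> g) \<U> A" "hom (f \<bullet> prj i0) A \<U>" using g fh inc_hom[OF i0(1)] prj(1)[OF i0(1)] by auto
    show "(f \<bullet> prj i0) \<bullet> (inc i0 \<bullet> g) = ide \<U>"
      using cmp_rewrite[OF prj(2)[OF i0(1)]] ide_left[OF g(1)] g by (simp add: cmp_assoc)
    show "(inc i0 \<bullet> g) \<bullet> (f \<bullet> prj i0) = inc i0 \<bullet> prj i0"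
      using cmp_rewrite[OF g(2)] ide_left[OF prj(1)[OF i0(1)]] by (simp add: cmp_assoc)
  qed (use i0 in blast)
qed

text \<open>A nonzero \<open>f\<close> would be an isomorphism by Schur's lemma, since
  \<open>U i \<boxtimes> S\<close> is again simple, and would make \<open>S\<close> a fixed point of
  \<open>U i\<close>.\<close>

lemma simple_fixed_zro:
  assumes S: "simple S" and i: "i \<in> I" "\<not> has_fixed_point C (U i)" and f: "hom f S (U i \<boxtimes> S)"
  shows "zro f"
proof (rule ccontr)
  assume "\<not> zro f"
  obtain V where V: "inverse_objects (U i) V" using U_inverse[OF i(1)] by blast
  have "isom f S (U i \<boxtimes> S)" using simple_isom_of_nonzero[OF S inverse_simple[OF V S] f] \<open>\<not> zro f\<close> by blast
  then have "isomorphic C (U i \<boxtimes> S) S" using isomE isomorphic_iff f hom_objs by metis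
  then show False using i(2) S simple_def unfolding has_fixed_point_def zob_def by blast
qed

text \<open>The family is finite, so the powers of \<open>U i\<close> recur and one of them is an inverse of \<open>U i\<close>.
  This avoids comparing the inverse with the chosen dual.\<close>

lemma inverse_index: assumes i: "i \<in> I" shows "\<exists>s\<in>I. isomorphic C (U s \<boxtimes> U i) \<U>"
proof -
  obtain i0 where i0: "i0 \<in> I" "isomorphic C (U i0) \<U>" using no_fixed unfolding no_fixed_points_def by blast
  have "\<forall>j\<in>I. \<exists>k. k \<in> I \<and> isomorphic C (U i \<boxtimes> U j) (U k)"
    using simple_current_algebra i unfolding is_simple_current_algebra_def closed_family_def by blast
  from bchoice[OF this] obtain f where f: "\<And>j. j \<in> I \<Longrightarrow> f j \<in> I \<and> isomorphic C (U i \<boxtimes> U j) (U (f j))" by blast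
  \<comment> \<open>\<open>f\<close> is multiplication by \<open>U i\<close> on indices, so
    \<open>g m\<close> is an index of its \<open>m\<close>-th power, starting from the unit at
    \<open>i0\<close>.\<close>
  define g where "g m = (f ^^ m) i0" for m
  have g: "g m \<in> I" for m by (induction m) (use i0 f in \<open>auto simp: g_def\<close>)
  have gS: "isomorphic C (U i \<boxtimes> U (g m)) (U (g (Suc m)))" for m using f[OF g[of m]] by (simp add: g_def)
  have o: "U (g m) \<in> Obj C" "U i \<boxtimes> U (g m) \<in> Obj C" for m using U_obj g i tensor_closed by auto
  obtain V where V: "inverse_objects (U i) V" using U_inverse[OF i] by blast
  \<comment> \<open>A recurrence among the powers is shifted down to the start by cancelling
    \<open>U i\<close>.\<close>
  have cancel: "isomorphic C (U (g k)) (U (g 0))" if "isomorphic C (U (g (m + k))) (U (g m))" for m k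
    using that
  proof (induction m)
    case 0 then show ?case by simp
  next
    case (Suc m)
    have "isomorphic C (U i \<boxtimes> U (g (m + k))) (U (g (Suc m)))"
      using isomorphic_trans[OF o(2) o(1) o(1) gS] Suc.prems by simp
    then have "isomorphic C (U i \<boxtimes> U (g (m + k))) (U i \<boxtimes> U (g m))"
      using isomorphic_trans[OF o(2) o(1) o(2)] isomorphic_sym[OF o(2) o(1) gS] by blast
    then show ?case using Suc.IH inverse_cancel[OF V o(1) o(1)] by blast
  qed
  have "\<not> inj g" using finite_I g by (metis finite_subset image_subsetI infinite_UNIV_nat finite_imageD)
  then obtain m n where mn: "g m = g n" "m < n" unfolding inj_def by (metis nat_neq_iff)
  then obtain k where k: "n = m + Suc k" using less_iff_Suc_add by auto
  \<comment> \<open>The gap between the repeated powers is positive, hence of the form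
    \<open>Suc k\<close>. That power is isomorphic to the unit, so the power \<open>k\<close> is
    inverse to \<open>U i\<close>.\<close>
  have "isomorphic C (U (g (Suc k))) (U (g 0))" using cancel[of m "Suc k"] mn k isomorphic_refl[OF o(1)] by simp
  then have "isomorphic C (U (g (Suc k))) \<U>"
    using isomorphic_trans[OF o(1) o(1) unit_closed] i0(2) by (metis funpow_0 g_def)
  then have 1: "isomorphic C (U i \<boxtimes> U (g k)) \<U>" using isomorphic_trans[OF o(2) o(1) unit_closed gS] by blast
  have o': "U (g k) \<boxtimes> U i \<in> Obj C" using o U_obj[OF i] tensor_closed by blast
  have "isomorphic C (U (g k) \<boxtimes> U i) (U i \<boxtimes> U (g k))"
    using brd_isom[OF o(1) U_obj[OF i]] isomorphic_iff[OF o' o(2)] by blast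
  then show ?thesis using isomorphic_trans[OF o' o(2) unit_closed] 1 g by blast
qed

text \<open>The action on an induced module touches only the factor \<open>A\<close>. Up to an
  associator, the extension of \<open>g \<star> ide S\<close> is therefore the extension of
  \<open>g\<close> into \<open>A\<close>, tensored with \<open>S\<close>; invertibility need only be
  proved over \<open>A\<close>.\<close>

lemma ext_fre_ten:
  assumes g: "hom g Y A" and S: "S \<in> Obj C"
  shows "ext (fre S) (g \<star> ide S) = (ext (A, \<mu>) g \<star> ide S) \<bullet> asc A Y S"
proof -
  have e: "asc A A S \<bullet> (ide A \<star> (g \<star> ide S)) = ((ide A \<star> g) \<star> ide S) \<bullet> asc A Y S"
    using asc_natural[OF hom_ide[OF A_obj] g hom_ide[OF S]] .
  have "(mu \<star> ide S) \<bullet> ((ide A \<star> g) \<star> ide S) = ext (A, \<mu>) g \<star> ide S"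
    unfolding ext_def act_A using ten_ide_cmp[OF S hom_ten[OF hom_ide[OF A_obj] g] mu_hom] by simp
  then show ?thesis
    unfolding ext_def[of "fre S"] act_fre[OF S] using e by (simp add: cmp_assoc cmp_rewrite)
qed

lemma ext_fre_isom:
  assumes g: "hom g Y A" and S: "S \<in> Obj C" and i: "isom (ext (A, \<mu>) g) (A \<boxtimes> Y) A"
  shows "isom (ext (fre S) (g \<star> ide S)) (A \<boxtimes> (Y \<boxtimes> S)) (A \<boxtimes> S)"
  unfolding ext_fre_ten[OF g S]
  using isom_cmp[OF asc_isom[OF A_obj hom_objs(1)[OF g] S] ten_isom[OF i isom_ide[OF S]]] .

text \<open>The right unit law identifies the module induced from the unit with
  \<open>A\<close>.\<close>

lemma R_simple_fre_unit: "R.simple (fre \<U>)"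
proof -
  have x: "hom io \<U> (fst (A, \<mu>))" using io_hom by simp
  obtain a where a: "R.hom a (fre \<U>) (A, \<mu>)" "und a = ext (A, \<mu>) io" using R_ext[OF is_mod_A x] .
  have "ext (A, \<mu>) io = run A" unfolding ext_def act_A using mu_unit_right .
  then have "R.isom a (fre \<U>) (A, \<mu>)" using R_isom_iff[OF a(1)] a(2) run_isom[OF A_obj] by simp
  then show ?thesis using R.simple_isom[OF R_simple_A] R.isomE by metis
qed

lemma ext_A_epic:
  assumes g: "hom g Y A" "\<not> zro g"
  obtains a where "R.hom a (fre Y) (A, \<mu>)" "und a = ext (A, \<mu>) g" "R.epic a" "epic (und a)"
proof -
  have Y: "Y \<in> Obj C" using g hom_objs by blast
  have x: "hom g Y (fst (A, \<mu>))" using g by simp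
  obtain a where a: "R.hom a (fre Y) (A, \<mu>)" "und a = ext (A, \<mu>) g" "und a \<bullet> un Y = g" using R_ext[OF is_mod_A x] .
  have "\<not> zro (und a)"
    using g a zro_cmp_left hom_not_None by metis
  then have "\<not> R.zro a" using R_zro_iff a by blast
  then have "R.epic a" using R.simple_epic[OF R_simple_A a(1)] by blast
  then show ?thesis using that a R_epic_iff by blast
qed

text \<open>The map \<open>a\<close> from \<open>fre (U i)\<close> to \<open>A\<close> is epic by
  simplicity. Tensoring the epimorphism from \<open>A \<boxtimes> U s\<close> to \<open>A\<close>,
  for an inverse index \<open>s\<close>, with \<open>U i\<close> presents \<open>fre (U i)\<close>
  as an epic image of the simple \<open>fre \<U>\<close>. The composite onto the nonzero
  \<open>A\<close> is then invertible, and so are both factors.\<close>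

lemma ext_inc_isom: assumes i: "i \<in> I" shows "isom (ext (A, \<mu>) (inc i)) (A \<boxtimes> U i) A"
proof -
  obtain s where s: "s \<in> I" "isomorphic C (U s \<boxtimes> U i) \<U>" using inverse_index[OF i] by blast
  obtain V where V: "inverse_objects (U i) V" using U_inverse[OF i] by blast
  have o: "U s \<in> Obj C" "U i \<in> Obj C" "U s \<boxtimes> U i \<in> Obj C" using U_obj s i tensor_closed by auto
  have nz: "\<not> zro (inc j)" if "j \<in> I" for j
  proof
    assume "zro (inc j)"
    then have "zro (prj j \<bullet> inc j)" using zro_cmp_hom[OF inc_hom[OF that] prj(1)[OF that]] by blast
    then show False using prj(2)[OF that] U_nonzero[OF that] zob_iff[OF U_obj[OF that]] by simp
  qed
  obtain a where a: "R.hom a (fre (U i)) (A, \<mu>)" "und a = ext (A, \<mu>) (inc i)" "R.epic a" "epic (und a)"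
    using ext_A_epic[OF inc_hom[OF i] nz[OF i]] .
  obtain as where as: "R.hom as (fre (U s)) (A, \<mu>)" "und as = ext (A, \<mu>) (inc s)" "R.epic as" "epic (und as)"
    using ext_A_epic[OF inc_hom[OF s(1)] nz[OF s(1)]] .
  have ash: "hom (und as) (A \<boxtimes> U s) A" using R_homD(4)[OF as(1)] by simp
  have x: "hom (inc s \<star> ide (U i)) (U s \<boxtimes> U i) (fst (fre (U i)))" using inc_hom[OF s(1)] o by auto
  obtain b where b: "R.hom b (fre (U s \<boxtimes> U i)) (fre (U i))" "und b = ext (fre (U i)) (inc s \<star> ide (U i))"
    using R_ext[OF is_mod_fre[OF o(2)] x] .
  have be: "und b = (und as \<star> ide (U i)) \<bullet> asc A (U s) (U i)"
    using b(2) ext_fre_ten[OF inc_hom[OF s(1)] o(2)] as(2) by simp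
  have "epic (und as \<star> ide (U i))" using inverse_epic_right[OF V ash as(4)] .
  then have bepic: "epic (und b)"
    using be epic_cmp[OF isom_epic[OF asc_isom[OF A_obj o(1,2)]]] R_homD(4)[OF b(1)] hom_not_None by metis
  obtain p where p: "isom p \<U> (U s \<boxtimes> U i)" using s(2) isomorphic_iff[OF o(3) unit_closed] isomE by metis
  have fp: "R.isom (F.fa p) (fre \<U>) (fre (U s \<boxtimes> U i))" using F.fa_isom[OF p] unfolding fre_def .
  let ?b = "R.cmp b (F.fa p)"
  have bh: "R.hom ?b (fre \<U>) (fre (U i))" using R.isom_hom[OF fp] b(1) by blast
  have be': "R.epic ?b"
    using R.epic_cmp[OF R.isom_epic[OF fp]] R_epic_iff[OF b(1)] bepic bh R.hom_not_None by blast
  have ch: "R.hom (R.cmp a ?b) (fre \<U>) (A, \<mu>)" using bh a by blast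
  have ce: "R.epic (R.cmp a ?b)" using R.epic_cmp[OF be' a(3)] ch R.hom_not_None by blast
  have "\<not> R.zob (A, \<mu>)" using R_simple_A R.simple_def by blast
  then have ci: "R.isom (R.cmp a ?b) (fre \<U>) (A, \<mu>)" using R.isom_of_epic_to_simple[OF R_simple_fre_unit _ ch ce] by blast
  then have "R.monic ?b" using R.monic_cancel R.isom_monic by blast
  then have "R.isom ?b (fre \<U>) (fre (U i))" using R.monic_epic_isom be' bh by blast
  then have "R.isom a (fre (U i)) (A, \<mu>)" using R.isom_cancel_right[OF _ a(1) ci] by blast
  then show ?thesis using R_isom_iff[OF a(1)] a(2) by simp
qed

lemma ext_unit_isom: assumes u: "hom u \<U> A" "\<not> zro u" shows "isom (ext (A, \<mu>) u) (A \<boxtimes> \<U>) A"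
proof -
  obtain a where a: "R.hom a (fre \<U>) (A, \<mu>)" "und a = ext (A, \<mu>) u" "R.epic a" using ext_A_epic[OF u] .
  have "\<not> R.zob (A, \<mu>)" using R_simple_A R.simple_def by blast
  then have "R.isom a (fre \<U>) (A, \<mu>)" using R.isom_of_epic_to_simple[OF R_simple_fre_unit _ a(1,3)] by blast
  then show ?thesis using R_isom_iff[OF a(1)] a(2) by simp
qed

text \<open>The arrows \<open>u\<close> and \<open>r\<close> make \<open>\<U> \<boxtimes> X\<close>
  a retract of \<open>A \<boxtimes> X\<close>, and the former is isomorphic to
  \<open>X\<close>.\<close>

lemma zob_ten_A: assumes X: "X \<in> Obj C" and z: "zob (A \<boxtimes> X)" shows "zob X"
proof -
  obtain i0 u r where u: "hom u \<U> A" "hom r A \<U>" "r \<bullet> u = ide \<U>" using unit_summand by metis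
  have h: "hom (u \<star> ide X) (\<U> \<boxtimes> X) (A \<boxtimes> X)" "hom (r \<star> ide X) (A \<boxtimes> X) (\<U> \<boxtimes> X)" using u X by auto
  have "zro (u \<star> ide X)" using to_zob[OF z h(1)] .
  then have "zro ((r \<star> ide X) \<bullet> (u \<star> ide X))" using zro_cmp_hom[OF h] by blast
  then have "zro (ide \<U> \<star> ide X)" using ten_ide_cmp[OF X u(1,2)] u(3) by simp
  then have "zob (\<U> \<boxtimes> X)" using ten_ide[OF unit_closed X] zob_iff[OF tensor_closed[OF unit_closed X]] by simp
  then show ?thesis using zob_isom[OF lun_isom[OF X]] by blast
qed

text \<open>A nonzero submodule \<open>N\<close> of \<open>fre S\<close> contains some \<open>U i \<boxtimes> S\<close>, which generates a quotient of
  \<open>fre (U i \<boxtimes> S)\<close>, an isomorphic copy of \<open>fre S\<close>. The resulting endomorphism of \<open>fre S\<close> with image in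
  \<open>N\<close> is nonzero, and it is invertible because \<open>S\<close> maps to no \<open>U j \<boxtimes> S\<close> other than \<open>S\<close> itself.\<close>

lemma fre_simple: assumes S: "simple S" shows "R.simple (fre S)"
  unfolding R.simple_def
proof (intro conjI allI impI)
  have So: "S \<in> Obj C" using S simple_obj by blast
  note m = is_mod_fre[OF So]
  show "fre S \<in> Obj RepA" using m Rep_obj by blast
  show "\<not> R.zob (fre S)" using R_zob_iff[OF m] zob_ten_A[OF So] S unfolding simple_def by auto
  fix n N assume n: "R.hom n N (fre S)" "R.monic n"
  show "R.zro n \<or> R.isom n N (fre S)"
  proof (rule disjCI)
    assume "\<not> R.isom n N (fre S)"
    show "R.zro n"
    proof (rule ccontr)
      assume nz: "\<not> R.zro n"
      note hn = R_homD[OF n(1)]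
      have nm: "monic (und n)" using R_monic_iff n by blast
      have N: "fst N \<in> Obj C" "\<not> zob (fst N)"
        using is_modD(2)[OF hn(1)] from_zob hn(4) nz R_zro_iff[OF n(1)] by auto
      \<comment> \<open>The simple subobject is taken in \<open>C\<close>, where every object has
        finite length.\<close>
      obtain t T where t: "hom t T (fst N)" "monic t" "simple T" using ex_simple_sub[OF N] .
      have nt: "hom (und n \<bullet> t) T (A \<boxtimes> S)" using t hn by auto
      have "\<not> zro (und n \<bullet> t)"
        using monic_zro[OF nm] zob_monic[OF t(2,1)] t(3) simple_def by blast
      then obtain i where i: "i \<in> I" "\<not> zro ((prj i \<star> ide S) \<bullet> (und n \<bullet> t))" using prj_zro[OF So nt] by blast
      obtain V where V: "inverse_objects (U i) V" using U_inverse[OF i(1)] by blast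
      have pS: "hom (prj i \<star> ide S) (A \<boxtimes> S) (U i \<boxtimes> S)" using prj(1)[OF i(1)] So by blast
      have "isom ((prj i \<star> ide S) \<bullet> (und n \<bullet> t)) T (U i \<boxtimes> S)"
        using simple_isom_of_nonzero[OF t(3) inverse_simple[OF V S] hom_cmp[OF nt pS] i(2)] .
      \<comment> \<open>A nonzero component identifies \<open>T\<close> with
        \<open>U i \<boxtimes> S\<close>. From here on \<open>t\<close> is replaced by its composite
        with this identification.\<close>
      then obtain v where v: "isom v (U i \<boxtimes> S) T" using isomE by metis
      let ?t = "t \<bullet> v"
      have th: "hom ?t (U i \<boxtimes> S) (fst N)" using t isom_hom[OF v] by blast
      have tnz: "\<not> zro (und n \<bullet> ?t)"
      proof
        assume "zro (und n \<bullet> ?t)"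
        then have "zro ((und n \<bullet> t) \<bullet> v)" by (simp add: cmp_assoc)
        then show False using epic_zro isom_epic[OF v] \<open>\<not> zro (und n \<bullet> t)\<close> by blast
      qed
      have US: "U i \<boxtimes> S \<in> Obj C" using th hom_objs by blast
      obtain a where a: "R.hom a (fre (U i \<boxtimes> S)) N" "und a \<bullet> un (U i \<boxtimes> S) = ?t"
        using R_ext[OF hn(1) th] by metis
      have x: "hom (inc i \<star> ide S) (U i \<boxtimes> S) (fst (fre S))" using inc_hom[OF i(1)] So by auto
      obtain b where b: "R.hom b (fre (U i \<boxtimes> S)) (fre S)" "und b = ext (fre S) (inc i \<star> ide S)" using R_ext[OF m x] .
      have "R.isom b (fre (U i \<boxtimes> S)) (fre S)"
        using R_isom_iff[OF b(1)] b(2) ext_fre_isom[OF inc_hom[OF i(1)] So ext_inc_isom[OF i(1)]] by simp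
      then obtain b' where b': "R.isom b' (fre S) (fre (U i \<boxtimes> S))" using R.isomE by metis
      \<comment> \<open>As \<open>b\<close> is an isomorphism from
        \<open>fre (U i \<boxtimes> S)\<close> to \<open>fre S\<close>, this is an endomorphism of
        \<open>fre S\<close> that factors through \<open>n\<close>.\<close>
      let ?e = "R.cmp n (R.cmp a b')"
      have eh: "R.hom ?e (fre S) (fre S)" using R.isom_hom[OF b'] a n by blast
      let ?x = "und ?e \<bullet> un S"
      have xh: "hom ?x S (A \<boxtimes> S)" using R_homD(4)[OF eh] un_hom[OF So] by auto
      have xnz: "\<not> zro ?x"
      proof
        assume "zro ?x"
        then have "R.zro (R.cmp (R.cmp n a) b')" using R_fre_zro[OF eh So] by (simp add: R.cmp_assoc)
        then have "R.zro (R.cmp n a)" using R.epic_zro R.isom_epic[OF b'] by blast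
        then have "zro (und n \<bullet> und a)" using R_zro_iff[OF R.hom_cmp[OF a(1) n(1)]] und_cmp[OF a(1) n(1)] by simp
        then have "zro ((und n \<bullet> und a) \<bullet> un (U i \<boxtimes> S))"
          using zro_cmp_hom[OF _ hom_cmp[OF R_homD(4)[OF a(1)] R_homD(4)[OF n(1)]]] un_hom[OF US] by simp
        then show False using tnz a(2) by (simp add: cmp_assoc)
      qed
      obtain i0 u r where u: "i0 \<in> I" "hom u \<U> A" "hom r A \<U>" "r \<bullet> u = ide \<U>" "u \<bullet> r = inc i0 \<bullet> prj i0"
        and nofix: "\<And>i. i \<in> I \<Longrightarrow> i \<noteq> i0 \<Longrightarrow> \<not> has_fixed_point C (U i)"
        by (rule unit_summand) iprover
      have uS: "hom (u \<star> ide S) (\<U> \<boxtimes> S) (A \<boxtimes> S)" "hom (r \<star> ide S) (A \<boxtimes> S) (\<U> \<boxtimes> S)" using u So by auto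
      have z: "zro ((prj j \<star> ide S) \<bullet> ?x)" if j: "j \<in> I" "j \<noteq> i0" for j
        using simple_fixed_zro[OF S j(1) nofix[OF j] hom_cmp[OF xh hom_ten[OF prj(1)[OF j(1)] hom_ide[OF So]]]] .
      let ?y = "(r \<star> ide S) \<bullet> ?x"
      have yh: "hom ?y S (\<U> \<boxtimes> S)" using xh uS by blast
      \<comment> \<open>All components of \<open>?x\<close> away from \<open>i0\<close> vanish, so
        \<open>?x\<close> should equal its part in the unit summand. The difference \<open>d\<close>
        of the two sides is shown to have only zero components.\<close>
      have xy: "?x = (u \<star> ide S) \<bullet> ?y"
      proof -
        obtain d where d: "hom d S (A \<boxtimes> S)" "pls d ((u \<star> ide S) \<bullet> ?y) = ?x"
          using difference_arrow[OF xh hom_cmp[OF yh uS(1)]] .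
        have e: "(u \<star> ide S) \<bullet> ?y = (inc i0 \<star> ide S) \<bullet> ((prj i0 \<star> ide S) \<bullet> ?x)"
          using ten_ide_cmp[OF So u(3,2)] u(5) inc_prj_ten[OF u(1) So] by (metis cmp_assoc)
        have "zro d"
        proof (rule prj_zro[OF So d(1)])
          fix j assume j: "j \<in> I"
          have pj: "hom (prj j \<star> ide S) (A \<boxtimes> S) (U j \<boxtimes> S)" using prj(1)[OF j] So by blast
          have 1: "(prj j \<star> ide S) \<bullet> ?x = pls ((prj j \<star> ide S) \<bullet> d) ((prj j \<star> ide S) \<bullet> ((u \<star> ide S) \<bullet> ?y))"
            using cmp_pls[OF d(1) hom_cmp[OF yh uS(1)] pj] d(2) by simp
          have 2: "(prj j \<star> ide S) \<bullet> (inc i0 \<star> ide S) = (prj j \<bullet> inc i0) \<star> ide S"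
            using ten_ide_cmp[OF So inc_hom[OF u(1)] prj(1)[OF j]] by simp
          have 3: "(prj j \<star> ide S) \<bullet> ((u \<star> ide S) \<bullet> ?y) = (prj j \<star> ide S) \<bullet> ?x"
          proof (cases "j = i0")
            case True
            have "ide (U i0) \<star> ide S = ide (U i0 \<boxtimes> S)" using ten_ide[OF U_obj[OF u(1)] So] .
            then show ?thesis
              unfolding e using cmp_rewrite[OF 2] prj(2)[OF u(1)] True ide_left[OF hom_cmp[OF xh pj]] by simp
          next
            case False
            have pi: "hom (prj i0 \<star> ide S) (A \<boxtimes> S) (U i0 \<boxtimes> S)" using prj(1)[OF u(1)] So by blast
            have hz: "hom (prj j \<bullet> inc i0) (U i0) (U j)" "zro (prj j \<bullet> inc i0)"
              using hom_cmp[OF inc_hom[OF u(1)] prj(1)[OF j]] prj(3)[OF j u(1) False] zro_zer U_obj j u(1) by auto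
            have "zro ((prj j \<bullet> inc i0) \<star> ide S)" using ten_zro_left[OF hz(1) hom_ide[OF So] hz(2)] .
            then have "zro ((prj j \<star> ide S) \<bullet> ((u \<star> ide S) \<bullet> ?y))"
              unfolding e cmp_rewrite[OF 2] using zro_cmp_hom[OF hom_cmp[OF xh pi] hom_ten[OF hz(1) hom_ide[OF So]]] by blast
            then show ?thesis
              using zro_parallel[OF _ z[OF j False] hom_cmp[OF hom_cmp[OF yh uS(1)] pj] hom_cmp[OF xh pj]] by blast
          qed
          have "pls ((prj j \<star> ide S) \<bullet> d) ((prj j \<star> ide S) \<bullet> ?x) = (prj j \<star> ide S) \<bullet> ?x" using 1 3 by simp
          then have "(prj j \<star> ide S) \<bullet> d = zer S (U j \<boxtimes> S)"
            using pls_cancel[OF hom_cmp[OF d(1) pj] hom_cmp[OF xh pj]] by blast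
          then show "zro ((prj j \<star> ide S) \<bullet> d)" using zroI[OF hom_cmp[OF d(1) pj]] by blast
        qed
        then show ?thesis using d zro_hom pls_zer(2)[OF hom_cmp[OF yh uS(1)]] by metis
      qed
      have ynz: "\<not> zro ?y" using xnz xy zro_cmp_hom[OF yh uS(1)] by metis
      have "\<not> zro (lun S \<bullet> ?y)" using ynz monic_zro isom_monic[OF lun_isom[OF So]] by blast
      then have "isom (lun S \<bullet> ?y) S S" using simple_isom_of_nonzero[OF S S hom_cmp[OF yh lun_hom[OF So]]] by blast
      then have yi: "isom ?y S (\<U> \<boxtimes> S)" using isom_cancel_left[OF lun_isom[OF So] yh] by blast
      have unz: "\<not> zro u"
      proof
        assume "zro u"
        then have "zro (r \<bullet> u)" using zro_cmp_hom[OF u(2,3)] by blast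
        then show False using u(4) zob_iff[OF unit_closed] unit_nonzero by simp
      qed
      \<comment> \<open>By \<open>xy\<close>, the endomorphism is the extension of
        \<open>u \<star> ide S\<close> after \<open>ide A \<star> ?y\<close>, and both are
        invertible. An isomorphism that factors through the monic \<open>n\<close> makes
        \<open>n\<close> invertible, against the assumption.\<close>
      have "und ?e = ext (fre S) ?x" using equi_fre_eq_ext[OF m So] R_homD(3)[OF eh] by blast
      also have "\<dots> = ext (fre S) (u \<star> ide S) \<bullet> (ide A \<star> ?y)"
        unfolding ext_def using arg_cong[OF xy, of "\<lambda>x. ide A \<star> x"] ide_ten_cmp[OF A_obj yh uS(1)] by (simp add: cmp_assoc)
      finally have "isom (und ?e) (A \<boxtimes> S) (A \<boxtimes> S)"
        using isom_cmp[OF ten_isom[OF isom_ide[OF A_obj] yi] ext_fre_isom[OF u(2) So ext_unit_isom[OF u(2) unz]]] by simp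
      then have "R.isom ?e (fre S) (fre S)" using R_isom_iff[OF eh] by simp
      then have "R.isom n N (fre S)" using R.monic_isom_cancel[OF n(2,1)] by blast
      then show False using \<open>\<not> R.isom n N (fre S)\<close> by blast
    qed
  qed
qed

lemma simple_module_image: assumes N: "R.simple N" shows "\<exists>T f. simple T \<and> R.isom f (fre T) N"
proof -
  have m: "is_mod N" using N R.simple_obj Rep_obj by blast
  have nz: "\<not> zob (fst N)" using N R_zob_iff[OF m] R.simple_def by blast
  obtain t T where t: "hom t T (fst N)" "monic t" "simple T" using ex_simple_sub[OF is_modD(2)[OF m] nz] .
  have tz: "\<not> zro t" using zob_monic[OF t(2,1)] t(3) simple_def by blast
  obtain a where a: "R.hom a (fre T) N" "und a \<bullet> un T = t" using R_ext[OF m t(1)] by metis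
  have "\<not> zro (und a)" using tz a zro_cmp_left t hom_not_None by metis
  then have "\<not> R.zro a" using R_zro_iff a by blast
  then have "R.isom a (fre T) N" using R.simple_isom_of_nonzero[OF fre_simple[OF t(3)] N a(1)] by blast
  then show ?thesis using t by blast
qed

text \<open>A component of \<open>d\<close> on generators is an arrow from \<open>T\<close> to
  \<open>U i \<boxtimes> X\<close>. Up to an isomorphism of its source it is
  \<open>ide (U i) \<star> g\<close>, with \<open>g\<close> from the simple object
  \<open>V \<boxtimes> T\<close> to \<open>X\<close>, so \<open>kill\<close> applies to
  \<open>g\<close>.\<close>

lemma fa_socle_zro':
  assumes T: "simple T" and q: "hom q X Y" and kill: "\<And>t T'. simple T' \<Longrightarrow> hom t T' X \<Longrightarrow> zro (q \<bullet> t)"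
    and d: "R.hom d (fre T) (fre X)"
  shows "R.zro (R.cmp (F.fa q) d)"
proof -
  have o: "T \<in> Obj C" "X \<in> Obj C" "Y \<in> Obj C" using T q simple_obj hom_objs by auto
  let ?x = "und d \<bullet> un T"
  have x: "hom ?x T (A \<boxtimes> X)" using R_homD(4)[OF d] un_hom[OF o(1)] by auto
  have Aq: "hom (ide A \<star> q) (A \<boxtimes> X) (A \<boxtimes> Y)" using q A_obj by blast
  have "zro ((ide A \<star> q) \<bullet> ?x)"
  proof (rule prj_zro[OF o(3) hom_cmp[OF x Aq]])
    fix i assume i: "i \<in> I"
    obtain V where V: "inverse_objects (U i) V" using U_inverse[OF i] by blast
    let ?w = "(prj i \<star> ide X) \<bullet> ?x"
    have w: "hom ?w T (U i \<boxtimes> X)" using x prj(1)[OF i] o by blast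
    obtain w0 W' g where g: "isom w0 (U i \<boxtimes> W') T" "hom g W' X" "?w \<bullet> w0 = ide (U i) \<star> g" "W' = V \<boxtimes> T"
      using inverse_lift_left[OF V o(2) w] .
    have "zro (q \<bullet> g)" using kill g inverse_simple[OF inverse_objects_sym[OF V] T] by blast
    then have "zro (ide (U i) \<star> (q \<bullet> g))" using ten_zro_right[OF hom_ide[OF U_obj[OF i]] hom_cmp[OF g(2) q]] by blast
    then have "zro (((ide (U i) \<star> q) \<bullet> ?w) \<bullet> w0)" using ide_ten_cmp[OF U_obj[OF i] g(2) q] g(3) by (simp add: cmp_assoc)
    then have "zro ((ide (U i) \<star> q) \<bullet> ?w)" using epic_zro isom_epic[OF g(1)] by blast
    then show "zro ((prj i \<star> ide Y) \<bullet> ((ide A \<star> q) \<bullet> ?x))" using cmp_rewrite2[OF prj_natural[OF i q]] by simp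
  qed
  then have "zro (und (R.cmp (F.fa q) d) \<bullet> un T)"
    using und_cmp[OF d R_hom_fa[OF q]] und_fa[OF q] by (simp add: cmp_assoc)
  then show ?thesis using R_fre_zro[OF R.hom_cmp[OF d R_hom_fa[OF q]] o(1)] by blast
qed

text \<open>The components of \<open>d\<close> on generators are arrows from \<open>X\<close> to
  \<open>U i \<boxtimes> T\<close>, which is again simple, so \<open>kill\<close> applies to them
  directly.\<close>

lemma fa_radical_zro':
  assumes T: "simple T" and k: "hom k W X" and kill: "\<And>t T'. simple T' \<Longrightarrow> hom t X T' \<Longrightarrow> zro (t \<bullet> k)"
    and d: "R.hom d (fre X) (fre T)"
  shows "R.zro (R.cmp d (F.fa k))"
proof -
  have o: "T \<in> Obj C" "X \<in> Obj C" "W \<in> Obj C" using T k simple_obj hom_objs by auto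
  let ?x = "und d \<bullet> un X"
  have x: "hom ?x X (A \<boxtimes> T)" using R_homD(4)[OF d] un_hom[OF o(2)] by auto
  have "zro (?x \<bullet> k)"
  proof (rule prj_zro[OF o(1) hom_cmp[OF k x]])
    fix i assume i: "i \<in> I"
    obtain V where V: "inverse_objects (U i) V" using U_inverse[OF i] by blast
    have w: "hom ((prj i \<star> ide T) \<bullet> ?x) X (U i \<boxtimes> T)" using x prj(1)[OF i] o by blast
    have "zro (((prj i \<star> ide T) \<bullet> ?x) \<bullet> k)" using kill[OF inverse_simple[OF V T] w] .
    then show "zro ((prj i \<star> ide T) \<bullet> (?x \<bullet> k))" by (simp add: cmp_assoc)
  qed
  moreover have "und (R.cmp d (F.fa k)) \<bullet> un W = ?x \<bullet> k"
    using und_cmp[OF R_hom_fa[OF k] d] und_fa[OF k] un_natural[OF k] by (simp add: cmp_assoc)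
  ultimately show ?thesis using R_fre_zro[OF R.hom_cmp[OF R_hom_fa[OF k] d] o(3)] by simp
qed

text \<open>The section is the unit component of \<open>h\<close>: enter
  \<open>A \<boxtimes> T\<close> by \<open>u\<close>, apply \<open>h\<close>, and leave
  \<open>A \<boxtimes> Z\<close> by \<open>r\<close>. Since \<open>r\<close> acts on the first
  tensor factor it commutes with \<open>g\<close>, and \<open>r \<bullet> u\<close> is the
  identity.\<close>

lemma fa_section':
  assumes g: "hom g Z T" and h: "R.hom h (fre T) (fre Z)" and e: "R.cmp (F.fa g) h = R.ide (fre T)"
  shows "\<exists>s. g \<bullet> s = ide T"
proof -
  have o: "T \<in> Obj C" "Z \<in> Obj C" using g hom_objs by auto
  obtain i0 u r where u: "hom u \<U> A" "hom r A \<U>" "r \<bullet> u = ide \<U>" using unit_summand by metis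
  note L = inv_arrow[OF lun_isom[OF o(1)]]
  have uT: "hom (u \<star> ide T) (\<U> \<boxtimes> T) (A \<boxtimes> T)" using u o by auto
  have gh: "(ide A \<star> g) \<bullet> und h = ide (A \<boxtimes> T)"
    using und_cmp[OF h R_hom_fa[OF g]] und_fa[OF g] e und_ide[OF is_mod_fre[OF o(1)]] by simp
  have 1: "(ide \<U> \<star> g) \<bullet> (r \<star> ide Z) = (r \<star> ide T) \<bullet> (ide A \<star> g)"
    using ten_split1[OF u(2) g] ten_split2[OF u(2) g] by simp
  have 2: "(r \<star> ide T) \<bullet> (u \<star> ide T) = ide (\<U> \<boxtimes> T)"
    using ten_ide_cmp[OF o(1) u(1,2)] u(3) ten_ide[OF unit_closed o(1)] by simp
  let ?s = "lun Z \<bullet> ((r \<star> ide Z) \<bullet> (und h \<bullet> ((u \<star> ide T) \<bullet> inv_arrow (lun T))))"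
  have "g \<bullet> ?s = lun T \<bullet> ((ide \<U> \<star> g) \<bullet> ((r \<star> ide Z) \<bullet> (und h \<bullet> ((u \<star> ide T) \<bullet> inv_arrow (lun T)))))"
    using cmp_rewrite2[OF lun_natural[OF g, symmetric]] by simp
  also have "\<dots> = lun T \<bullet> ((r \<star> ide T) \<bullet> ((ide A \<star> g) \<bullet> (und h \<bullet> ((u \<star> ide T) \<bullet> inv_arrow (lun T)))))"
    using cmp_rewrite2[OF 1] by simp
  also have "\<dots> = lun T \<bullet> ((r \<star> ide T) \<bullet> ((u \<star> ide T) \<bullet> inv_arrow (lun T)))"
    using cmp_rewrite[OF gh] ide_left[OF hom_cmp[OF L(2) uT]] by simp
  also have "\<dots> = ide T" using cmp_rewrite[OF 2] ide_left[OF L(2)] L(4) by simp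
  finally show ?thesis by blast
qed

lemma Ind_loewy_functor: "loewy_functor K C K RepA Ind"
proof (intro loewy_functor.intro loewy_functor_axioms.intro)
  show "locally_finite_category K C" by (rule locally_finite_category_axioms)
  show "normal_category K RepA" by (rule Rep_normal_category)
  show "is_functor C RepA Ind" by (rule Ind_functor)
  show "R.kern (F.fa f) (F.fa k)" if f: "hom f X Y" "kern f k" for f k X Y
  proof -
    obtain N where N: "hom k N X" using kernD(2)[OF f(2,1)] by blast
    show ?thesis using R_kernI[OF R_hom_fa[OF f(1)] R_hom_fa[OF N]] A_kern[OF f] und_fa[OF f(1)] und_fa[OF N] by simp
  qed
  show "R.coker (F.fa f) (F.fa q)" if f: "hom f X Y" "coker f q" for f q X Y
  proof -
    obtain N where N: "hom q Y N" using cokerD(2)[OF f(2,1)] by blast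
    show ?thesis using R_cokerI[OF R_hom_fa[OF f(1)] R_hom_fa[OF N]] A_coker[OF f] und_fa[OF f(1)] und_fa[OF N] by simp
  qed
  show "R.dsum J (\<lambda>i. omap Ind (U' i)) (omap Ind S) (\<lambda>i. F.fa (e i))" if "dsum J U' S e" for J :: "nat set" and U' S e
    using fa_dsum[OF that] unfolding fre_def .
  show "R.simple (omap Ind T)" if "simple T" for T using fre_simple[OF that] unfolding fre_def .
  show "\<exists>T f. simple T \<and> R.isom f (omap Ind T) N" if "R.simple N" for N
    using simple_module_image[OF that] unfolding fre_def .
  show "R.zro (R.cmp (F.fa q) d)" if "simple T" "hom q X Y" "\<And>t T'. simple T' \<Longrightarrow> hom t T' X \<Longrightarrow> zro (q \<bullet> t)"
    "R.hom d (omap Ind T) (omap Ind X)" for T q X Y d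
    using fa_socle_zro'[OF that(1,2)] that(3,4) unfolding fre_def by blast
  show "R.zro (R.cmp d (F.fa k))" if "simple T" "hom k W X" "\<And>t T'. simple T' \<Longrightarrow> hom t X T' \<Longrightarrow> zro (t \<bullet> k)"
    "R.hom d (omap Ind X) (omap Ind T)" for T k W X d
    using fa_radical_zro'[OF that(1,2)] that(3,4) unfolding fre_def by blast
  show "zob X" if X: "X \<in> Obj C" "R.zob (omap Ind X)" for X
    using zob_ten_A[OF X(1)] R_zob_iff[OF is_mod_fre[OF X(1)]] X(2) fst_fre[of X] unfolding fre_def by simp
  show "\<exists>s. g \<bullet> s = ide T" if "hom g Z T" "R.hom h (omap Ind T) (omap Ind Z)" "R.cmp (F.fa g) h = R.ide (omap Ind T)"
    for g Z T h
    using fa_section'[OF that(1)] that(2,3) unfolding fre_def by blast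
qed

end

theorem theorem1p3:
  fixes K :: "('k, 'x) ring_scheme"
    and C :: "('o, 'm, 'k, 'z) br_cat_scheme"
    and I :: "'i set" and U :: "'i \<Rightarrow> 'o"
    and A :: 'o and \<mu> \<iota> :: 'm
  assumes "braided_locally_finite_category K C"
    and "is_simple_current_algebra C I U A \<mu> \<iota>"
    and "no_fixed_points C I U"
    and "is_simple (Rep C A \<mu> \<iota>) (A, \<mu>)"
  shows "preserves_socle_loewy_diagrams C (Rep C A \<mu> \<iota>) (induction_functor C A \<mu>) \<and>
         preserves_radical_loewy_diagrams C (Rep C A \<mu> \<iota>) (induction_functor C A \<mu>)"
proof -
  interpret S: simple_current K C A \<mu> \<iota> I U
    using assms unfolding simple_current_def comm_algebra_def comm_algebra_axioms_def simple_current_axioms_def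
      is_simple_current_algebra_def by blast
  show ?thesis
    using loewy_functor.preserves_socle[OF S.Ind_loewy_functor]
      loewy_functor.preserves_radical[OF S.Ind_loewy_functor] by blast
qed

end
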